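(* Let $m\ge 1$ be an integer. Let $\hat u$ be the solution of the homogenized Schrödinger problem $$-\mathrm{i}\,\partial_t\hat u=\gamma\Delta\hat u+\tilde\psi\,\hat u+\tilde f\ \text{ in }\widetilde\Omega\times J,\qquad \hat u(\cdot,\cdot,t_0)=\hat\varphi\ \text{ on }\widetilde\Omega,\qquad \hat u=0\ \text{ on }\partial\widetilde\Omega\times J,$$ where $\widetilde\Omega=(-1,1)^2$, $J=(t_0,T)$, and the data $\gamma,\tilde f,\hat\varphi$ are as described in the context. Let $\hat u_N:\bar J\to V_N^2$ be the solution of the semidiscrete Legendre–Galerkin scheme $$-\mathrm{i}(\partial_t\hat u_N,v)+\gamma(\nabla\hat u_N,\nabla v)-(\tilde\psi\,\hat u_N,v)-(\tilde f,v)=0,\qquad (\hat u_N(\cdot,\cdot,t_0)-\hat\varphi,v)=0,\qquad \forall\,v\in V_N^2 .$$ Assume that $\tilde\psi$ is a real-valued function with $\tilde\psi\in L^\infty(\widetilde\Omega)$, and that $\hat u,\ \partial_t\hat u\in L^\infty\big(J;H^m(\widetilde\Omega)\cap H^1_0(\widetilde\Omega)\big)$. Then $$\|\hat u_N(t)-\hat u(t)\|\le C N^{-m}\Big(\|\hat u\|_{L^\infty(J;H^m(\widetilde\Omega))}+\|\partial_t\hat u\|_{L^\infty(J;H^m(\widetilde\Omega))}\Big)\qquad\text{for } t\in J,$$ where $C$ is a constant independent of $N$.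
   Context: All functions are complex-valued unless stated otherwise, $\mathrm{i}=\sqrt{-1}$, $t_0<T$ are real numbers, $J=(t_0,T)$, $\bar J=[t_0,T]$, and $\widetilde\Omega=(-1,1)\times(-1,1)$ with coordinates $(\tilde x,\tilde y)$. Inner product and norms: $(u,v)=\int_{\widetilde\Omega}u\,\bar v\,d\tilde x\,d\tilde y$ (also used componentwise for gradients), $\|u\|=(u,u)^{1/2}$ is the $L^2(\widetilde\Omega)$ norm, $\|u\|_m=\big(\sum_{|k|=0}^m\|D^ku\|^2\big)^{1/2}$ is the $H^m(\widetilde\Omega)$ norm, $H^1_0(\widetilde\Omega)=\{v\in H^1(\widetilde\Omega): v=0 \text{ on }\partial\widetilde\Omega\}$, and $\|v\|_{L^\infty(J;X)}=\operatorname{ess\,sup}_{t\in J}\|v(t)\|_X$. Discrete spaces: $L_n$ is the Legendre polynomial of degree $n$, $P_N=\mathrm{span}\{L_0,\dots,L_N\}$ (polynomials of degree at most $N$ in one variable, with complex coefficients), $V_N=\{v\in P_N: v(\pm1)=0\}$ with $N\ge 2$. $V_N^2$ denotes the tensor-product space $V_N\otimes V_N$, i.e. the span of the products $p(\tilde x)q(\tilde y)$ with $p,q\in V_N$. Origin of the data. For real numbers $c<d$ put $\gamma=\big(\tfrac{2}{d-c}\big)^2>0$. The problem comes from the Schrödinger equation with nonhomogeneous Dirichlet data, rescaled from $(c,d)^2$ to $\widetilde\Omega$: $$-\mathrm{i}\,\partial_t\tilde u=\gamma\Delta\tilde u+\tilde\psi(\tilde x,\tilde y)\tilde u \text{ in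 }\widetilde\Omega\times J,\quad \tilde u(\cdot,\cdot,t_0)=\tilde\varphi,$$ $$\tilde u(-1,\tilde y,t)=\tilde g_1(\tilde y,t),\ \tilde u(1,\tilde y,t)=\tilde g_2(\tilde y,t),\ \tilde u(\tilde x,-1,t)=\tilde g_3(\tilde x,t),\ \tilde u(\tilde x,1,t)=\tilde g_4(\tilde x,t),$$ with $\tilde\varphi,\tilde g_1,\dots,\tilde g_4$ given smooth complex functions. Boundary data are removed by setting $$\tilde u_1=\tfrac{\tilde g_4(\tilde x,t)-\tilde g_3(\tilde x,t)}{2}\tilde y+\tfrac{\tilde g_4(\tilde x,t)+\tilde g_3(\tilde x,t)}{2},\quad \hat g_1(\tilde y,t)=\tilde g_1(\tilde y,t)-\tilde u_1(-1,\tilde y,t),\quad \hat g_2(\tilde y,t)=\tilde g_2(\tilde y,t)-\tilde u_1(1,\tilde y,t),$$ $$\tilde u_2=\tfrac{\hat g_2(\tilde y,t)-\hat g_1(\tilde y,t)}{2}\tilde x+\tfrac{\hat g_2(\tilde y,t)+\hat g_1(\tilde y,t)}{2},\qquad \hat u=\tilde u-\tilde u_1-\tilde u_2,$$ $$\tilde f=\mathrm{i}(\partial_t\tilde u_1+\partial_t\tilde u_2)+\gamma(\Delta\tilde u_1+\Delta\tilde u_2)+\tilde\psi(\tilde u_1+\tilde u_2),\qquad \hat\varphi=\tilde\varphi-\tilde u_1(\cdot,\cdot,t_0)-\tilde u_2(\cdot,\cdot,t_0).$$ When $m=1$ the differential equation for $\hat u$ is understood in the weak sense: $-\mathrm{i}(\partial_t\hat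 u,v)+\gamma(\nabla\hat u,\nabla v)-(\tilde\psi\hat u,v)-(\tilde f,v)=0$ for all $v\in H^1_0(\widetilde\Omega)$. *)

theory Defs
  imports
    "HOL-Analysis.Analysis"
    "HOL-Probability.Essential_Supremum"
    "HOL-Computational_Algebra.Polynomial"
begin

section \<open>The square, smooth functions and the \<open>L\<^sup>2\<close> inner product\<close>

type_synonym sfun = "real \<times> real \<Rightarrow> complex"

definition Sq :: "(real \<times> real) set" where
  "Sq = {-1<..<1} \<times> {-1<..<1}"

definition cSq :: "(real \<times> real) set" where
  "cSq = {-1..1} \<times> {-1..1}"

text \<open>The sets \<open>S\<close> used below are the whole plane and closed nondegenerate rectangles. On the latter
  derivatives on the boundary are the one-sided ones, so \<open>smooth_on\<close> is smoothness up to
  the boundary.\<close>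

primrec Ck_on :: "nat \<Rightarrow> (real \<times> real) set \<Rightarrow> sfun \<Rightarrow> bool" where
  "Ck_on 0 S f \<longleftrightarrow> continuous_on S f"
| "Ck_on (Suc k) S f \<longleftrightarrow>
     (\<exists>fx fy. (\<forall>z\<in>S. (f has_derivative (\<lambda>h. fst h *\<^sub>R fx z + snd h *\<^sub>R fy z)) (at z within S))
              \<and> Ck_on k S fx \<and> Ck_on k S fy)"

definition smooth_on :: "(real \<times> real) set \<Rightarrow> sfun \<Rightarrow> bool" where
  "smooth_on S f \<longleftrightarrow> (\<forall>k. Ck_on k S f)"

definition L2 :: "sfun set" where
  "L2 = {u \<in> borel_measurable (lebesgue_on Sq). integrable (lebesgue_on Sq) (\<lambda>z. (cmod (u z))\<^sup>2)}"

definition l2_inner :: "sfun \<Rightarrow> sfun \<Rightarrow> complex" where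
  "l2_inner u v = (LINT z|lebesgue_on Sq. u z * cnj (v z))"

definition l2_norm :: "sfun \<Rightarrow> real" where
  "l2_norm u = sqrt (Re (l2_inner u u))"

section \<open>Sobolev spaces\<close>

definition pd_x :: "sfun \<Rightarrow> sfun" where
  "pd_x f = (\<lambda>(x, y). vector_derivative (\<lambda>s. f (s, y)) (at x))"

definition pd_y :: "sfun \<Rightarrow> sfun" where
  "pd_y f = (\<lambda>(x, y). vector_derivative (\<lambda>s. f (x, s)) (at y))"

definition test_functions :: "sfun set" where
  "test_functions = {\<phi>. smooth_on UNIV \<phi> \<and> closure {z. \<phi> z \<noteq> 0} \<subseteq> Sq}"

definition has_weak_deriv :: "nat \<Rightarrow> nat \<Rightarrow> sfun \<Rightarrow> sfun \<Rightarrow> bool" where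
  "has_weak_deriv a b u w \<longleftrightarrow> w \<in> L2 \<and>
     (\<forall>\<phi>\<in>test_functions.
        (LINT z|lebesgue_on Sq. u z * (pd_x ^^ a) ((pd_y ^^ b) \<phi>) z) =
        (-1) ^ (a + b) * (LINT z|lebesgue_on Sq. w z * \<phi> z))"

text \<open>Weak derivatives are unique almost everywhere on the square; \<open>weak_deriv\<close> picks a representative.\<close>

definition weak_deriv :: "nat \<Rightarrow> nat \<Rightarrow> sfun \<Rightarrow> sfun" where
  "weak_deriv a b u = (SOME w. has_weak_deriv a b u w)"

definition Hm :: "nat \<Rightarrow> sfun set" where
  "Hm m = {u \<in> L2. \<forall>a b. a + b \<le> m \<longrightarrow> (\<exists>w. has_weak_deriv a b u w)}"

definition Hm_norm :: "nat \<Rightarrow> sfun \<Rightarrow> real" where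
  "Hm_norm m u = sqrt (\<Sum>k\<le>m. \<Sum>a\<le>k. (l2_norm (weak_deriv a (k - a) u))\<^sup>2)"

definition bdry_norm :: "sfun \<Rightarrow> real" where
  "bdry_norm w = sqrt (LINT s|lebesgue_on {-1..1}.
     (cmod (w (-1, s)))\<^sup>2 + (cmod (w (1, s)))\<^sup>2 + (cmod (w (s, -1)))\<^sup>2 + (cmod (w (s, 1)))\<^sup>2)"

text \<open>The trace of \<open>v \<in> H\<^sup>1\<close> is the \<open>L\<^sup>2\<close>-limit on the boundary of \<open>w\<^sub>n\<close> for any functions \<open>w\<^sub>n\<close>, smooth up
  to the boundary, that converge to \<open>v\<close> in \<open>H\<^sup>1\<close>. So \<open>v = 0\<close> on the boundary
  means that some such sequence has boundary values tending to \<open>0\<close>.\<close>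

definition zero_trace :: "sfun \<Rightarrow> bool" where
  "zero_trace v \<longleftrightarrow>
     (\<exists>w. (\<forall>n::nat. smooth_on cSq (w n)) \<and>
          (\<lambda>n. Hm_norm 1 (\<lambda>z. w n z - v z)) \<longlonglongrightarrow> 0 \<and>
          (\<lambda>n. bdry_norm (w n)) \<longlonglongrightarrow> 0)"

definition H10 :: "sfun set" where
  "H10 = {v \<in> Hm 1. zero_trace v}"

definition grad_inner :: "sfun \<Rightarrow> sfun \<Rightarrow> complex" where
  "grad_inner u v = l2_inner (weak_deriv 1 0 u) (weak_deriv 1 0 v)
                  + l2_inner (weak_deriv 0 1 u) (weak_deriv 0 1 v)"

section \<open>Functions of time with values in a function space\<close>

text \<open>Bochner's strong measurability: almost everywhere limit of \<open>X\<close>-valued simple functions.\<close>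

definition strongly_measurable :: "real set \<Rightarrow> sfun set \<Rightarrow> (sfun \<Rightarrow> real) \<Rightarrow> (real \<Rightarrow> sfun) \<Rightarrow> bool" where
  "strongly_measurable I X nrm u \<longleftrightarrow>
     (\<exists>s :: nat \<Rightarrow> real \<Rightarrow> sfun.
        (\<forall>n. simple_function (lebesgue_on I) (s n) \<and> s n ` I \<subseteq> X) \<and>
        (AE t in lebesgue_on I. (\<lambda>n. nrm (\<lambda>z. s n t z - u t z)) \<longlonglongrightarrow> 0))"

definition Linf_esssup :: "real set \<Rightarrow> (sfun \<Rightarrow> real) \<Rightarrow> (real \<Rightarrow> sfun) \<Rightarrow> ereal" where
  "Linf_esssup I nrm u = esssup (lebesgue_on I) (\<lambda>t. ereal (nrm (u t)))"

definition Linf :: "real set \<Rightarrow> sfun set \<Rightarrow> (sfun \<Rightarrow> real) \<Rightarrow> (real \<Rightarrow> sfun) set" where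
  "Linf I X nrm = {u. (AE t in lebesgue_on I. u t \<in> X) \<and> strongly_measurable I X nrm u
                      \<and> Linf_esssup I nrm u < \<infinity>}"

definition Linf_norm :: "real set \<Rightarrow> (sfun \<Rightarrow> real) \<Rightarrow> (real \<Rightarrow> sfun) \<Rightarrow> real" where
  "Linf_norm I nrm u = real_of_ereal (Linf_esssup I nrm u)"

definition continuous_L2 :: "real set \<Rightarrow> (real \<Rightarrow> sfun) \<Rightarrow> bool" where
  "continuous_L2 I u \<longleftrightarrow> (\<forall>t\<in>I. u t \<in> L2) \<and>
     (\<forall>t\<in>I. ((\<lambda>s. l2_norm (\<lambda>z. u s z - u t z)) \<longlongrightarrow> 0) (at t within I))"

text \<open>Distributional time derivative of an \<open>L\<^sup>2\<close>-valued function on the open interval \<open>I\<close>. The identity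
  between Bochner integrals that defines it is expressed by pairing with all \<open>v \<in> L\<^sup>2\<close>.\<close>

definition time_test_functions :: "real set \<Rightarrow> (real \<Rightarrow> real) set" where
  "time_test_functions I = {\<eta>. (\<forall>k t. (deriv ^^ k) \<eta> differentiable (at t))
                              \<and> compact (closure {t. \<eta> t \<noteq> 0}) \<and> closure {t. \<eta> t \<noteq> 0} \<subseteq> I}"

definition has_time_deriv :: "real set \<Rightarrow> (real \<Rightarrow> sfun) \<Rightarrow> (real \<Rightarrow> sfun) \<Rightarrow> bool" where
  "has_time_deriv I u u' \<longleftrightarrow>
     (\<forall>v\<in>L2. \<forall>\<eta>\<in>time_test_functions I.
        (LINT t|lebesgue_on I. of_real (deriv \<eta> t) * l2_inner (u t) v) =
        - (LINT t|lebesgue_on I. of_real (\<eta> t) * l2_inner (u' t) v))"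

section \<open>Discrete spaces\<close>

fun legendre :: "nat \<Rightarrow> complex poly" where
  "legendre 0 = 1"
| "legendre (Suc 0) = [:0, 1:]"
| "legendre (Suc (Suc n)) = smult (1 / of_nat (n + 2))
     (smult (of_nat (2 * n + 3)) ([:0, 1:] * legendre (Suc n)) - smult (of_nat (n + 1)) (legendre n))"

definition PN :: "nat \<Rightarrow> complex poly set" where
  "PN N = {p. \<exists>c. p = (\<Sum>k\<le>N. smult (c k) (legendre k))}"

definition VN :: "nat \<Rightarrow> complex poly set" where
  "VN N = {p \<in> PN N. poly p 1 = 0 \<and> poly p (-1) = 0}"

definition VN2 :: "nat \<Rightarrow> sfun set" where
  "VN2 N = {v. \<exists>(n::nat) p q. (\<forall>k<n. p k \<in> VN N \<and> q k \<in> VN N) \<and>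
                 v = (\<lambda>(x, y). \<Sum>k<n. poly (p k) (of_real x) * poly (q k) (of_real y))}"

lemma degree_legendre: "degree (legendre n) = n"
proof (induction n rule: legendre.induct)
  case (3 n)
  have nz: "legendre (Suc n) \<noteq> 0" using 3 by auto
  have c: "(of_nat (2 * n + 3) :: complex) \<noteq> 0" "(of_nat (n + 2) :: complex) \<noteq> 0"
    by (simp_all only: of_nat_eq_0_iff)
  have d1: "degree (smult (of_nat (2 * n + 3)) ([:0, 1:] * legendre (Suc n))) = Suc (Suc n)"
    using c nz 3 by (simp add: degree_mult_eq del: of_nat_add of_nat_mult)
  have d2: "degree (smult (of_nat (n + 1)) (legendre n)) < Suc (Suc n)"
    by (rule le_less_trans[OF degree_smult_le]) (simp add: 3)
  have "degree (smult (of_nat (2 * n + 3)) ([:0, 1:] * legendre (Suc n))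
      - smult (of_nat (n + 1)) (legendre n)) = Suc (Suc n)"
    using degree_add_eq_left[of "- smult (of_nat (n + 1)) (legendre n)"] d1 d2
    by (metis degree_minus diff_conv_add_uminus)
  then show ?case using c by (simp del: of_nat_add of_nat_mult)
qed simp_all

lemma PN_iff_degree: "p \<in> PN N \<longleftrightarrow> degree p \<le> N"
proof
  assume "p \<in> PN N"
  then obtain c where p: "p = (\<Sum>k\<le>N. smult (c k) (legendre k))" by (auto simp: PN_def)
  show "degree p \<le> N" unfolding p
    by (rule degree_sum_le) (auto intro: order_trans[OF degree_smult_le] simp: degree_legendre)
next
  show "degree p \<le> N \<Longrightarrow> p \<in> PN N"
  proof (induction N arbitrary: p)
    case 0
    then obtain a where "p = [:a:]" by (auto elim: degree_eq_zeroE)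
    then show ?case by (auto simp: PN_def intro!: exI[of _ "\<lambda>_. a"])
  next
    case (Suc N)
    define a where "a = coeff p (Suc N) / coeff (legendre (Suc N)) (Suc N)"
    have nz: "coeff (legendre (Suc N)) (Suc N) \<noteq> 0"
      by (metis degree_legendre leading_coeff_0_iff degree_0 nat.distinct(1))
    define q where "q = p - smult a (legendre (Suc N))"
    have "degree q \<le> N"
    proof (rule degree_le, intro allI impI)
      fix i assume i: "N < i"
      show "coeff q i = 0"
      proof (cases "i = Suc N")
        case True then show ?thesis using nz by (simp add: q_def a_def)
      next
        case False
        then have "i > Suc N" using i by simp
        then show ?thesis using Suc.prems
          by (simp add: q_def coeff_eq_0 degree_legendre)
      qed
    qed
    then obtain c where c: "q = (\<Sum>k\<le>N. smult (c k) (legendre k))"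
      using Suc.IH by (auto simp: PN_def)
    have "p = (\<Sum>k\<le>Suc N. smult ((c(Suc N := a)) k) (legendre k))"
    proof -
      have "p = q + smult a (legendre (Suc N))" by (simp add: q_def)
      also have "q = (\<Sum>k\<le>N. smult ((c(Suc N := a)) k) (legendre k))"
        unfolding c by (rule sum.cong) auto
      finally show ?thesis by simp
    qed
    then show ?case unfolding PN_def by blast
  qed
qed

section \<open>Data of the homogenized problem\<close>

definition d_t :: "(real \<Rightarrow> sfun) \<Rightarrow> real \<Rightarrow> sfun" where
  "d_t w t = (\<lambda>z. vector_derivative (\<lambda>s. w s z) (at t))"

definition lap :: "sfun \<Rightarrow> sfun" where
  "lap w = (\<lambda>z. pd_x (pd_x w) z + pd_y (pd_y w) z)"

text \<open>The boundary data are passed as functions of the pair (space variable, time).\<close>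

definition lift1 :: "sfun \<Rightarrow> sfun \<Rightarrow> real \<Rightarrow> sfun" where
  "lift1 g3 g4 t = (\<lambda>(x, y). (g4 (x, t) - g3 (x, t)) / 2 * of_real y + (g4 (x, t) + g3 (x, t)) / 2)"

definition ghat1 :: "sfun \<Rightarrow> sfun \<Rightarrow> sfun \<Rightarrow> sfun" where
  "ghat1 g1 g3 g4 = (\<lambda>(y, t). g1 (y, t) - lift1 g3 g4 t (-1, y))"

definition ghat2 :: "sfun \<Rightarrow> sfun \<Rightarrow> sfun \<Rightarrow> sfun" where
  "ghat2 g2 g3 g4 = (\<lambda>(y, t). g2 (y, t) - lift1 g3 g4 t (1, y))"

definition lift2 :: "sfun \<Rightarrow> sfun \<Rightarrow> sfun \<Rightarrow> sfun \<Rightarrow> real \<Rightarrow> sfun" where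
  "lift2 g1 g2 g3 g4 t = (\<lambda>(x, y).
     (ghat2 g2 g3 g4 (y, t) - ghat1 g1 g3 g4 (y, t)) / 2 * of_real x
     + (ghat2 g2 g3 g4 (y, t) + ghat1 g1 g3 g4 (y, t)) / 2)"

definition source :: "real \<Rightarrow> (real \<times> real \<Rightarrow> real) \<Rightarrow> (real \<Rightarrow> sfun) \<Rightarrow> (real \<Rightarrow> sfun) \<Rightarrow> real \<Rightarrow> sfun" where
  "source \<gamma> \<psi> u1 u2 t = (\<lambda>z. \<i> * (d_t u1 t z + d_t u2 t z)
     + of_real \<gamma> * (lap (u1 t) z + lap (u2 t) z) + of_real (\<psi> z) * (u1 t z + u2 t z))"

definition initial_datum :: "sfun \<Rightarrow> real \<Rightarrow> (real \<Rightarrow> sfun) \<Rightarrow> (real \<Rightarrow> sfun) \<Rightarrow> sfun" where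
  "initial_datum \<phi> t0 u1 u2 = (\<lambda>z. \<phi> z - u1 t0 z - u2 t0 z)"

definition Linf_Sq :: "(real \<times> real \<Rightarrow> real) set" where
  "Linf_Sq = {\<psi> \<in> borel_measurable (lebesgue_on Sq). esssup (lebesgue_on Sq) (\<lambda>z. ereal \<bar>\<psi> z\<bar>) < \<infinity>}"

section \<open>Exact and semidiscrete solutions\<close>

definition weak_eq :: "real \<Rightarrow> (real \<times> real \<Rightarrow> real) \<Rightarrow> sfun \<Rightarrow> sfun \<Rightarrow> sfun \<Rightarrow> sfun \<Rightarrow> bool" where
  "weak_eq \<gamma> \<psi> f u u' v \<longleftrightarrow>
     - \<i> * l2_inner u' v + of_real \<gamma> * grad_inner u v
     - l2_inner (\<lambda>z. of_real (\<psi> z) * u z) v - l2_inner f v = 0"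

definition strong_eq :: "real \<Rightarrow> (real \<times> real \<Rightarrow> real) \<Rightarrow> sfun \<Rightarrow> sfun \<Rightarrow> sfun \<Rightarrow> bool" where
  "strong_eq \<gamma> \<psi> f u u' \<longleftrightarrow>
     (AE z in lebesgue_on Sq. - \<i> * u' z
        = of_real \<gamma> * (weak_deriv 2 0 u z + weak_deriv 0 2 u z) + of_real (\<psi> z) * u z + f z)"

text \<open>\<open>u'\<close> is the time derivative of \<open>u\<close>. Since \<open>u\<close> and \<open>u'\<close> are essentially bounded in time, \<open>u\<close> has a
  unique representative that is continuous on the closed time interval with values in \<open>L\<^sup>2\<close>; this is
  the one taken, so that its values at the initial time and at individual times are meaningful.
  The boundary condition is membership in \<open>H\<^sup>1\<^sub>0\<close>.\<close>

definition homogenized_solution ::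
  "nat \<Rightarrow> real \<Rightarrow> real \<Rightarrow> real \<Rightarrow> (real \<times> real \<Rightarrow> real) \<Rightarrow> (real \<Rightarrow> sfun) \<Rightarrow> sfun
     \<Rightarrow> (real \<Rightarrow> sfun) \<Rightarrow> (real \<Rightarrow> sfun) \<Rightarrow> bool" where
  "homogenized_solution m t0 T \<gamma> \<psi> f \<phi> u u' \<longleftrightarrow>
     continuous_L2 {t0..T} u \<and>
     has_time_deriv {t0<..<T} u u' \<and>
     (AE t in lebesgue_on {t0<..<T}. u t \<in> H10) \<and>
     (if m = 1 then AE t in lebesgue_on {t0<..<T}. \<forall>v\<in>H10. weak_eq \<gamma> \<psi> (f t) (u t) (u' t) v
      else AE t in lebesgue_on {t0<..<T}. strong_eq \<gamma> \<psi> (f t) (u t) (u' t)) \<and>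
     (AE z in lebesgue_on Sq. u t0 z = \<phi> z)"

definition semidiscrete_solution ::
  "nat \<Rightarrow> real \<Rightarrow> real \<Rightarrow> real \<Rightarrow> (real \<times> real \<Rightarrow> real) \<Rightarrow> (real \<Rightarrow> sfun) \<Rightarrow> sfun
     \<Rightarrow> (real \<Rightarrow> sfun) \<Rightarrow> bool" where
  "semidiscrete_solution N t0 T \<gamma> \<psi> f \<phi> uN \<longleftrightarrow>
     (\<forall>t\<in>{t0..T}. uN t \<in> VN2 N) \<and>
     (\<forall>z. continuous_on {t0..T} (\<lambda>t. uN t z)) \<and>
     (\<forall>t\<in>{t0<..<T}. \<forall>z. (\<lambda>s. uN s z) differentiable (at t)) \<and>
     (\<forall>t\<in>{t0<..<T}. \<forall>v\<in>VN2 N. weak_eq \<gamma> \<psi> (f t) (uN t) (d_t uN t) v) \<and>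
     (\<forall>v\<in>VN2 N. l2_inner (\<lambda>z. uN t0 z - \<phi> z) v = 0)"

end

theory Submission imports Defs begin

text \<open>The elliptic projection \<open>P\<close> onto the discrete space is extended to all square integrable functions
  by moving both derivatives onto an orthonormal basis \<open>e\<^sub>k\<close> for the gradient inner product,
  \<open>P g = - \<Sum>\<^sub>k (g, \<Delta> e\<^sub>k) e\<^sub>k\<close>. It then commutes with the time derivative, and the difference of \<open>u\<^sub>N\<close> and
  \<open>P u\<close> satisfies a perturbed Schroedinger equation. Since the potential is real, testing this
  equation with the difference itself leaves only the projection errors of \<open>u\<close> and \<open>\<partial>\<^sub>t u\<close> on the right-hand side.

  The projection error is bounded by duality. Laplacians of polynomials \<open>w\<close> that vanish on the boundary are
  dense, since their closure contains the products of sines, and the second derivatives of \<open>w\<close> are controlled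
  by \<open>\<parallel>\<Delta> w\<parallel>\<close>. Galerkin orthogonality gives \<open>(u - P u, \<Delta> w) = - (\<nabla> (u - v), \<nabla> (w - P w))\<close> for every discrete
  \<open>v\<close>; take for \<open>v\<close> the function whose mixed derivative is the truncated Legendre expansion of \<open>\<partial>\<^sub>x \<partial>\<^sub>y u\<close>. Only
  Legendre frequencies of at least \<open>N\<close> remain, and each further derivative of \<open>u\<close> contributes a factor of
  order \<open>1/N\<close>, because the derivative of \<open>(1 - x\<^sup>2)\<^sup>s\<^sup>+\<^sup>1 L\<^sub>n\<^sup>(\<^sup>s\<^sup>+\<^sup>1\<^sup>)\<close> is
  \<open>- (n (n + 1) - s (s + 1)) (1 - x\<^sup>2)\<^sup>s L\<^sub>n\<^sup>(\<^sup>s\<^sup>)\<close>. The factor \<open>\<parallel>\<nabla> (w - P w)\<parallel>\<close> is of order \<open>\<parallel>\<Delta> w\<parallel>/N\<close> by the same argument.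

  As the time derivative exists only weakly, all energy arguments are carried out with difference
  quotients, and the regularity of \<open>u\<close> in time enters through its continuity with values in \<open>L\<^sup>2\<close>.\<close>

section \<open>The space of square integrable functions on the square\<close>

text \<open>Three obstacles shape the details. The boundary condition gives a trace of
  \<open>u\<close> only, while approximating the gradient through the mixed derivative needs a trace
  of the x-derivative on the horizontal sides; \<open>mixed_derivative\<close> recovers it. In the
  duality argument no dual problem is solved: the error is paired with Laplacians of polynomials,
  for which the dual solution is the polynomial itself, and density turns the pairing into a norm.
  Weak derivatives must reach Legendre coefficients, so they are tested against polynomials instead
  of compactly supported functions, after a limit in the cutoff. The decay of Legendre coefficients
  at order \<open>m\<close> requires \<open>N\<close> to be at least \<open>2 m\<close>. For smaller
  \<open>N\<close> the factor \<open>(2 m / N)^(m-1)\<close> is at least 1 and a first-order bound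
  suffices; this is the second summand of the constant. Bounds that depend on \<open>N\<close> in an
  uncontrolled way, such as the inverse inequality, are harmless in the energy argument: they
  multiply squares of time steps only. The final constant does not contain \<gamma>, since the
  projection removes the elliptic term from the consistency error and the remaining quadratic form
  is real.\<close>

abbreviation MS :: "(real \<times> real) measure" where "MS \<equiv> lebesgue_on Sq"

lemma Sq_sets [simp, measurable]: "Sq \<in> sets lebesgue"
proof -
  have "open Sq" unfolding Sq_def by (intro open_Times) auto
  then show ?thesis by (simp add: borel_open)
qed

lemma Sq_eq_box: "Sq = box (-1, -1) (1, 1)"
  by (auto simp: Sq_def box_def Basis_prod_def)

lemma cSq_eq_cbox: "cSq = cbox (-1, -1) (1, 1)"
  by (auto simp: cSq_def cbox_def Basis_prod_def)

lemma compact_cSq: "compact cSq"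
  by (simp add: cSq_eq_cbox)

lemma Sq_subset_cSq: "Sq \<subseteq> cSq"
  by (auto simp: Sq_def cSq_def)

lemma finite_measure_MS: "finite_measure MS"
proof
  have "emeasure MS (space MS) = emeasure lborel (box (-1 :: real, -1 :: real) (1, 1))"
    by (simp add: emeasure_restrict_space Sq_eq_box)
  then show "emeasure MS (space MS) \<noteq> \<infinity>"
    by (metis emeasure_lborel_box_finite infinity_ennreal_def less_irrefl)
qed

interpretation MS: finite_measure MS by (rule finite_measure_MS)

lemma L2_measurable: "u \<in> L2 \<Longrightarrow> u \<in> borel_measurable MS"
  by (simp add: L2_def)

lemma L2_integrable_sq: "u \<in> L2 \<Longrightarrow> integrable MS (\<lambda>z. (cmod (u z))\<^sup>2)"
  by (simp add: L2_def)

lemma L2_mult_integrable: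
  assumes "u \<in> L2" "v \<in> L2"
  shows "integrable MS (\<lambda>z. u z * cnj (v z))"
proof (rule Bochner_Integration.integrable_bound)
  show "integrable MS (\<lambda>z. (cmod (u z))\<^sup>2 + (cmod (v z))\<^sup>2)"
    using assms by (intro Bochner_Integration.integrable_add L2_integrable_sq)
  show "(\<lambda>z. u z * cnj (v z)) \<in> borel_measurable MS"
  proof -
    have "(\<lambda>z. cnj (v z)) \<in> borel_measurable MS"
      by (rule measurable_compose[OF L2_measurable[OF assms(2)]])
         (intro borel_measurable_continuous_onI continuous_intros)
    then show ?thesis using L2_measurable[OF assms(1)] by measurable
  qed
  show "AE z in MS. norm (u z * cnj (v z)) \<le> norm ((cmod (u z))\<^sup>2 + (cmod (v z))\<^sup>2)"
  proof (rule AE_I2)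
    fix z
    have "0 \<le> (cmod (u z) - cmod (v z))\<^sup>2" by simp
    moreover have "0 \<le> cmod (u z) * cmod (v z)" by simp
    ultimately show "norm (u z * cnj (v z)) \<le> norm ((cmod (u z))\<^sup>2 + (cmod (v z))\<^sup>2)"
      unfolding power2_diff norm_mult complex_mod_cnj real_norm_def by linarith
  qed
qed

lemma L2_add [intro]:
  assumes "u \<in> L2" "v \<in> L2"
  shows "(\<lambda>z. u z + v z) \<in> L2"
proof -
  note [measurable] = L2_measurable[OF assms(1)] L2_measurable[OF assms(2)]
  have "integrable MS (\<lambda>z. (cmod (u z + v z))\<^sup>2)"
  proof (rule Bochner_Integration.integrable_bound)
    show "integrable MS (\<lambda>z. 2 * (cmod (u z))\<^sup>2 + 2 * (cmod (v z))\<^sup>2)"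
      using assms
      by (intro Bochner_Integration.integrable_add integrable_mult_right) (auto simp: L2_integrable_sq)
    show "AE z in MS. norm ((cmod (u z + v z))\<^sup>2) \<le> norm (2 * (cmod (u z))\<^sup>2 + 2 * (cmod (v z))\<^sup>2)"
    proof (rule AE_I2)
      fix z
      have "(cmod (u z + v z))\<^sup>2 \<le> (cmod (u z) + cmod (v z))\<^sup>2"
        by (intro power_mono norm_triangle_ineq) auto
      also have "\<dots> \<le> 2 * (cmod (u z))\<^sup>2 + 2 * (cmod (v z))\<^sup>2"
        using sum_squares_bound[of "cmod (u z)" "cmod (v z)"] by (simp add: power2_sum)
      finally show "norm ((cmod (u z + v z))\<^sup>2) \<le> norm (2 * (cmod (u z))\<^sup>2 + 2 * (cmod (v z))\<^sup>2)"
        by simp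
    qed
  qed simp
  then show ?thesis by (simp add: L2_def)
qed

lemma L2_scale [intro]: "u \<in> L2 \<Longrightarrow> (\<lambda>z. c * u z) \<in> L2"
  by (auto simp: L2_def norm_mult power_mult_distrib)

lemma L2_zero [simp]: "(\<lambda>z. 0) \<in> L2"
  by (simp add: L2_def)

lemma L2_diff [intro]: "u \<in> L2 \<Longrightarrow> v \<in> L2 \<Longrightarrow> (\<lambda>z. u z - v z) \<in> L2"
  using L2_add[of u "\<lambda>z. (-1) * v z"] L2_scale[of v "-1"] by simp

lemma L2_sum [intro]: "(\<And>i. i \<in> I \<Longrightarrow> u i \<in> L2) \<Longrightarrow> (\<lambda>z. \<Sum>i\<in>I. u i z) \<in> L2"
proof (induction I rule: infinite_finite_induct)
  case (insert x F)
  then have "(\<lambda>z. u x z + (\<Sum>i\<in>F. u i z)) \<in> L2" by (intro L2_add) auto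
  then show ?case using insert by simp
qed auto

text \<open>Lebesgue measure is complete, so agreement almost everywhere transfers measurability.
  Extension by zero moves the argument from the square to the plane, where
  \<open>borel_measurable_AE\<close> applies.\<close>

lemma L2_AE_cong:
  assumes "v \<in> L2" "AE z in MS. u z = v z"
  shows "u \<in> L2"
proof -
  have u [measurable]: "u \<in> borel_measurable MS"
  proof -
    have v: "(\<lambda>z. if z \<in> Sq then v z else 0) \<in> borel_measurable lebesgue"
      using L2_measurable[OF assms(1)] by (simp add: borel_measurable_if)
    have "AE z in lebesgue. z \<in> Sq \<longrightarrow> u z = v z"
      using assms(2) by (simp add: AE_restrict_space_iff)
    then have "AE z in lebesgue. (if z \<in> Sq then v z else 0) = (if z \<in> Sq then u z else 0)"
      by eventually_elim simp
    from borel_measurable_AE[OF v this] show ?thesis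
      by (simp add: borel_measurable_if)
  qed
  note [measurable] = L2_measurable[OF assms(1)]
  have "integrable MS (\<lambda>z. (cmod (u z))\<^sup>2) \<longleftrightarrow> integrable MS (\<lambda>z. (cmod (v z))\<^sup>2)"
    by (rule integrable_cong_AE) (use assms(2) in auto)
  then show ?thesis using assms(1) u by (simp add: L2_def)
qed

lemma L2_bounded:
  assumes "u \<in> borel_measurable MS" "\<And>z. z \<in> Sq \<Longrightarrow> cmod (u z) \<le> B"
  shows "u \<in> L2"
proof -
  have "integrable MS (\<lambda>z. (cmod (u z))\<^sup>2)"
  proof (rule MS.integrable_const_bound[where B = "B\<^sup>2"])
    show "AE z in MS. norm ((cmod (u z))\<^sup>2) \<le> B\<^sup>2"
    proof (rule AE_I2)
      fix z assume "z \<in> space MS"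
      then show "norm ((cmod (u z))\<^sup>2) \<le> B\<^sup>2"
        using power_mono[OF assms(2)[of z], of 2] by simp
    qed
  qed (use assms(1) in simp)
  then show ?thesis using assms(1) by (simp add: L2_def)
qed

lemma L2_continuous:
  assumes "continuous_on cSq u"
  shows "u \<in> L2"
proof -
  obtain B where B: "\<And>z. z \<in> cSq \<Longrightarrow> cmod (u z) \<le> B"
    using compact_imp_bounded[OF compact_continuous_image[OF assms compact_cSq]]
    unfolding bounded_iff by blast
  have "u \<in> borel_measurable MS"
    using assms Sq_subset_cSq
    by (intro continuous_imp_measurable_on_sets_lebesgue) (auto intro: continuous_on_subset)
  then show ?thesis
    by (rule L2_bounded[where B = B]) (use B Sq_subset_cSq in auto)
qed

lemma l2_inner_add_left:
  "u \<in> L2 \<Longrightarrow> v \<in> L2 \<Longrightarrow> w \<in> L2 \<Longrightarrow> l2_inner (\<lambda>z. u z + v z) w = l2_inner u w + l2_inner v w"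
  by (simp add: l2_inner_def distrib_right L2_mult_integrable)

lemma l2_inner_diff_left:
  "u \<in> L2 \<Longrightarrow> v \<in> L2 \<Longrightarrow> w \<in> L2 \<Longrightarrow> l2_inner (\<lambda>z. u z - v z) w = l2_inner u w - l2_inner v w"
  by (simp add: l2_inner_def left_diff_distrib L2_mult_integrable)

lemma l2_inner_scale_left: "l2_inner (\<lambda>z. c * u z) w = c * l2_inner u w"
  by (simp add: l2_inner_def mult.assoc)

lemma l2_inner_commute: "l2_inner v u = cnj (l2_inner u v)"
proof -
  have "l2_inner v u = (LINT z|MS. cnj (u z * cnj (v z)))"
    by (simp add: l2_inner_def mult.commute)
  also have "\<dots> = cnj (l2_inner u v)" unfolding l2_inner_def by (rule Bochner_Integration.integral_cnj)
  finally show ?thesis .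
qed

lemma l2_inner_add_right:
  "u \<in> L2 \<Longrightarrow> v \<in> L2 \<Longrightarrow> w \<in> L2 \<Longrightarrow> l2_inner w (\<lambda>z. u z + v z) = l2_inner w u + l2_inner w v"
  using l2_inner_commute[of w "\<lambda>z. u z + v z"] l2_inner_commute[of w u] l2_inner_commute[of w v]
  by (simp add: l2_inner_add_left)

lemma l2_inner_diff_right:
  "u \<in> L2 \<Longrightarrow> v \<in> L2 \<Longrightarrow> w \<in> L2 \<Longrightarrow> l2_inner w (\<lambda>z. u z - v z) = l2_inner w u - l2_inner w v"
  using l2_inner_commute[of w "\<lambda>z. u z - v z"] l2_inner_commute[of w u] l2_inner_commute[of w v]
  by (simp add: l2_inner_diff_left)

lemma l2_inner_scale_right: "l2_inner w (\<lambda>z. c * u z) = cnj c * l2_inner w u"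
  using l2_inner_commute[of w "\<lambda>z. c * u z"] l2_inner_commute[of w u]
  by (simp add: l2_inner_scale_left)

lemma l2_inner_zero_left [simp]: "l2_inner (\<lambda>z. 0) w = 0"
  by (simp add: l2_inner_def)

lemma l2_inner_zero_right [simp]: "l2_inner w (\<lambda>z. 0) = 0"
  by (simp add: l2_inner_def)

lemma l2_inner_sum_left:
  assumes "\<And>i. i \<in> I \<Longrightarrow> u i \<in> L2" "w \<in> L2"
  shows "l2_inner (\<lambda>z. \<Sum>i\<in>I. u i z) w = (\<Sum>i\<in>I. l2_inner (u i) w)"
  using assms(1)
proof (induction I rule: infinite_finite_induct)
  case (insert x F)
  have "l2_inner (\<lambda>z. u x z + (\<Sum>i\<in>F. u i z)) w = l2_inner (u x) w + l2_inner (\<lambda>z. \<Sum>i\<in>F. u i z) w"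
    by (rule l2_inner_add_left) (use insert assms(2) in auto)
  then show ?case using insert by simp
qed auto

lemma l2_inner_sum_right:
  assumes "\<And>i. i \<in> I \<Longrightarrow> u i \<in> L2" "w \<in> L2"
  shows "l2_inner w (\<lambda>z. \<Sum>i\<in>I. u i z) = (\<Sum>i\<in>I. l2_inner w (u i))"
proof -
  have "l2_inner w (\<lambda>z. \<Sum>i\<in>I. u i z) = cnj (\<Sum>i\<in>I. l2_inner (u i) w)"
    using l2_inner_commute[of w "\<lambda>z. \<Sum>i\<in>I. u i z"] l2_inner_sum_left[of I u w, OF assms] by simp
  also have "\<dots> = (\<Sum>i\<in>I. l2_inner w (u i))"
    unfolding cnj_sum by (intro sum.cong refl) (rule l2_inner_commute[symmetric])
  finally show ?thesis .
qed

lemma l2_inner_cong_AE: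
  assumes "AE z in MS. u z = u' z" "AE z in MS. v z = v' z" "u' \<in> L2" "v' \<in> L2"
  shows "l2_inner u v = l2_inner u' v'"
  unfolding l2_inner_def
proof (rule integral_cong_AE)
  show "(\<lambda>z. u z * cnj (v z)) \<in> borel_measurable MS"
    using L2_mult_integrable[OF L2_AE_cong[OF assms(3,1)] L2_AE_cong[OF assms(4,2)]] by auto
  show "(\<lambda>z. u' z * cnj (v' z)) \<in> borel_measurable MS"
    using L2_mult_integrable[OF assms(3,4)] by auto
  show "AE z in MS. u z * cnj (v z) = u' z * cnj (v' z)"
    using assms(1,2) by eventually_elim simp
qed

lemma l2_inner_self: "l2_inner u u = of_real (LINT z|MS. (cmod (u z))\<^sup>2)"
  by (simp add: l2_inner_def complex_norm_square[symmetric] flip: of_real_power integral_of_real)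

lemma l2_norm_sq: "(l2_norm u)\<^sup>2 = (LINT z|MS. (cmod (u z))\<^sup>2)"
  by (simp add: l2_norm_def l2_inner_self)

lemma l2_norm_sq_complex: "l2_inner u u = of_real ((l2_norm u)\<^sup>2)"
  by (simp add: l2_norm_sq l2_inner_self)

lemma l2_norm_nonneg [simp]: "0 \<le> l2_norm u"
  by (simp add: l2_norm_def l2_inner_self)

lemma l2_norm_zero [simp]: "l2_norm (\<lambda>z. 0) = 0"
  by (simp add: l2_norm_def)

lemma l2_norm_scale: "l2_norm (\<lambda>z. c * u z) = cmod c * l2_norm u"
proof -
  have "(l2_norm (\<lambda>z. c * u z))\<^sup>2 = (cmod c * l2_norm u)\<^sup>2"
    by (simp add: l2_norm_sq norm_mult power_mult_distrib)
  then show ?thesis by (simp add: power2_eq_iff_nonneg)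
qed

lemma l2_norm_cong_AE:
  assumes "AE z in MS. u z = u' z" "u' \<in> L2"
  shows "l2_norm u = l2_norm u'"
  unfolding l2_norm_def by (subst l2_inner_cong_AE[OF assms(1,1,2,2)]) simp

lemma l2_norm_eq_0_iff:
  assumes "u \<in> L2"
  shows "l2_norm u = 0 \<longleftrightarrow> (AE z in MS. u z = 0)"
proof -
  have "l2_norm u = 0 \<longleftrightarrow> (LINT z|MS. (cmod (u z))\<^sup>2) = 0"
    by (metis l2_norm_sq zero_eq_power2)
  also have "\<dots> \<longleftrightarrow> (AE z in MS. (cmod (u z))\<^sup>2 = 0)"
    by (rule integral_nonneg_eq_0_iff_AE) (use assms in \<open>auto simp: L2_integrable_sq\<close>)
  finally show ?thesis by simp
qed

lemma l2_cauchy_schwarz: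
  assumes "u \<in> L2" "v \<in> L2"
  shows "cmod (l2_inner u v) \<le> l2_norm u * l2_norm v"
proof (cases "l2_norm v = 0")
  case True
  then have "AE z in MS. v z = 0" using l2_norm_eq_0_iff[OF assms(2)] by simp
  then have "l2_inner u v = l2_inner u (\<lambda>z. 0)"
    using assms by (intro l2_inner_cong_AE) auto
  then show ?thesis by simp
next
  case False
  define b where "b = (l2_norm v)\<^sup>2"
  have b: "b > 0" using False by (simp add: b_def)
  define a where "a = l2_inner u v"
  have vu: "l2_inner v u = cnj a" by (subst l2_inner_commute) (simp add: a_def)
  have vv: "l2_inner v v = of_real b" by (simp add: l2_norm_sq_complex b_def)
  have uu: "l2_inner u u = of_real ((l2_norm u)\<^sup>2)" by (rule l2_norm_sq_complex)
  \<comment> \<open>This is \<open>b\<close> times the component of \<open>u\<close> orthogonal to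
    \<open>v\<close>, scaled to avoid a division. That its squared norm is nonnegative is the
    inequality.\<close>
  let ?w = "\<lambda>z. of_real b * u z - a * v z"
  have w: "?w \<in> L2" using assms by auto
  have "l2_inner ?w ?w = of_real b * (of_real b * l2_inner u u - cnj a * l2_inner u v)
         - a * (of_real b * l2_inner v u - cnj a * l2_inner v v)"
    using assms w
    by (simp add: l2_inner_diff_left l2_inner_diff_right l2_inner_scale_left l2_inner_scale_right L2_scale)
  also have "\<dots> = of_real b * (of_real b * of_real ((l2_norm u)\<^sup>2) - cnj a * a)"
    by (simp add: vu vv uu a_def[symmetric] algebra_simps)
  also have "cnj a * a = of_real ((cmod a)\<^sup>2)" by (metis complex_norm_square mult.commute of_real_power)
  finally have "l2_inner ?w ?w = of_real (b * (b * (l2_norm u)\<^sup>2 - (cmod a)\<^sup>2))" by simp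
  then have "(l2_norm ?w)\<^sup>2 = b * (b * (l2_norm u)\<^sup>2 - (cmod a)\<^sup>2)"
    by (metis l2_norm_sq_complex of_real_eq_iff)
  then have "0 \<le> b * (b * (l2_norm u)\<^sup>2 - (cmod a)\<^sup>2)" by (metis zero_le_power2)
  then have "(cmod a)\<^sup>2 \<le> b * (l2_norm u)\<^sup>2"
    using b by (simp add: zero_le_mult_iff)
  also have "\<dots> = (l2_norm u * l2_norm v)\<^sup>2" by (simp add: b_def power_mult_distrib)
  finally show ?thesis unfolding a_def by (rule power2_le_imp_le) simp
qed

lemma l2_norm_triangle:
  assumes "u \<in> L2" "v \<in> L2"
  shows "l2_norm (\<lambda>z. u z + v z) \<le> l2_norm u + l2_norm v"
proof (rule power2_le_imp_le)
  have "(l2_norm (\<lambda>z. u z + v z))\<^sup>2 = Re (l2_inner (\<lambda>z. u z + v z) (\<lambda>z. u z + v z))"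
    by (simp add: l2_norm_sq_complex)
  also have "\<dots> = (l2_norm u)\<^sup>2 + (l2_norm v)\<^sup>2 + 2 * Re (l2_inner u v)"
    using assms l2_inner_commute[of v u] l2_norm_sq_complex[of u] l2_norm_sq_complex[of v]
    by (simp add: l2_inner_add_left l2_inner_add_right L2_add del: of_real_power)
  also have "Re (l2_inner u v) \<le> l2_norm u * l2_norm v"
    using l2_cauchy_schwarz[OF assms] complex_Re_le_cmod order_trans by blast
  finally show "(l2_norm (\<lambda>z. u z + v z))\<^sup>2 \<le> (l2_norm u + l2_norm v)\<^sup>2"
    by (simp add: power2_sum)
qed simp

lemma l2_norm_triangle_diff:
  assumes "u \<in> L2" "v \<in> L2"
  shows "l2_norm (\<lambda>z. u z - v z) \<le> l2_norm u + l2_norm v"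
  using l2_norm_triangle[OF assms(1) L2_scale[OF assms(2), of "-1"]] l2_norm_scale[of "-1" v] by simp

lemma l2_norm_triangle_sub:
  assumes "u \<in> L2" "v \<in> L2"
  shows "l2_norm u \<le> l2_norm v + l2_norm (\<lambda>z. u z - v z)"
  using l2_norm_triangle[OF assms(2) L2_diff[OF assms(1,2)]] by simp

lemma l2_norm_minus_commute: "l2_norm (\<lambda>z. u z - v z) = l2_norm (\<lambda>z. v z - u z)"
  using l2_norm_scale[of "-1" "\<lambda>z. u z - v z"] by simp

lemma l2_inner_tendsto:
  assumes "(\<lambda>n. l2_norm (\<lambda>z. u n z - v z)) \<longlonglongrightarrow> 0" "\<And>n. u n \<in> L2" "v \<in> L2" "w \<in> L2"
  shows "(\<lambda>n. l2_inner (u n) w) \<longlonglongrightarrow> l2_inner v w"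
proof (rule Lim_transform_bound[THEN LIM_zero_cancel])
  show "\<forall>\<^sub>F n in sequentially. norm (l2_inner (u n) w - l2_inner v w)
           \<le> norm (l2_norm (\<lambda>z. u n z - v z) * l2_norm w)"
    using l2_cauchy_schwarz[OF L2_diff[OF assms(2,3)] assms(4)] assms
    by (intro always_eventually) (simp add: l2_inner_diff_left)
  show "(\<lambda>n. l2_norm (\<lambda>z. u n z - v z) * l2_norm w) \<longlonglongrightarrow> 0"
    using tendsto_mult_right[OF assms(1), of "l2_norm w"] by simp
qed

lemma l2_inner_tendsto_right:
  assumes "(\<lambda>n. l2_norm (\<lambda>z. u n z - v z)) \<longlonglongrightarrow> 0" "\<And>n. u n \<in> L2" "v \<in> L2" "w \<in> L2"
  shows "(\<lambda>n. l2_inner w (u n)) \<longlonglongrightarrow> l2_inner w v"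
  using tendsto_cnj[OF l2_inner_tendsto[OF assms]]
  unfolding l2_inner_commute[of w v] l2_inner_commute[of w "u _"] .

text \<open>The majorant of \<open>|u n - v|^2\<close> is \<open>2 |w|^2 + 2 |v|^2\<close>, so one
  square integrable bound on the sequence suffices. Most limits below, in Taylor polynomials,
  cutoffs and truncations, pass through this lemma.\<close>

lemma l2_dominated_convergence:
  assumes "\<And>n. u n \<in> L2" "v \<in> L2" "w \<in> L2"
    and "AE z in MS. (\<lambda>n. u n z) \<longlonglongrightarrow> v z"
    and "\<And>n. AE z in MS. cmod (u n z) \<le> cmod (w z)"
  shows "(\<lambda>n. l2_norm (\<lambda>z. u n z - v z)) \<longlonglongrightarrow> 0"
proof -
  note [measurable] = L2_measurable[OF assms(1)] L2_measurable[OF assms(2)]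
  have "(\<lambda>n. LINT z|MS. (cmod (u n z - v z))\<^sup>2) \<longlonglongrightarrow> (LINT z|MS. 0)"
  proof (rule integral_dominated_convergence[where w = "\<lambda>z. 2 * (cmod (w z))\<^sup>2 + 2 * (cmod (v z))\<^sup>2"])
    show "integrable MS (\<lambda>z. 2 * (cmod (w z))\<^sup>2 + 2 * (cmod (v z))\<^sup>2)"
      using assms(2,3)
      by (intro Bochner_Integration.integrable_add integrable_mult_right) (auto simp: L2_integrable_sq)
    show "AE z in MS. (\<lambda>n. (cmod (u n z - v z))\<^sup>2) \<longlonglongrightarrow> 0"
      using assms(4)
    proof eventually_elim
      case (elim z)
      have "(\<lambda>n. (cmod (u n z - v z))\<^sup>2) \<longlonglongrightarrow> (cmod (v z - v z))\<^sup>2"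
        by (intro tendsto_intros elim)
      then show ?case by simp
    qed
    show "AE z in MS. norm ((cmod (u n z - v z))\<^sup>2) \<le> 2 * (cmod (w z))\<^sup>2 + 2 * (cmod (v z))\<^sup>2" for n
      using assms(5)[of n]
    proof eventually_elim
      case (elim z)
      have "(cmod (u n z - v z))\<^sup>2 \<le> (cmod (w z) + cmod (v z))\<^sup>2"
        using elim norm_triangle_ineq4[of "u n z" "v z"] by (intro power_mono) auto
      also have "\<dots> \<le> 2 * (cmod (w z))\<^sup>2 + 2 * (cmod (v z))\<^sup>2"
        using sum_squares_bound[of "cmod (w z)" "cmod (v z)"] by (simp add: power2_sum)
      finally show ?case by simp
    qed
  qed simp_all
  then have "(\<lambda>n. sqrt ((l2_norm (\<lambda>z. u n z - v z))\<^sup>2)) \<longlonglongrightarrow> sqrt 0"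
    by (intro tendsto_real_sqrt) (simp add: l2_norm_sq)
  then show ?thesis by simp
qed

lemma l2_norm_le_sup:
  assumes "u \<in> borel_measurable MS" "\<And>z. z \<in> Sq \<Longrightarrow> cmod (u z) \<le> B" "0 \<le> B"
  shows "l2_norm u \<le> sqrt (measure MS Sq) * B"
proof (rule power2_le_imp_le)
  have "(l2_norm u)\<^sup>2 = (LINT z|MS. (cmod (u z))\<^sup>2)" by (rule l2_norm_sq)
  also have "\<dots> \<le> (LINT z|MS. B\<^sup>2)"
  proof (rule integral_mono_AE)
    show "integrable MS (\<lambda>z. (cmod (u z))\<^sup>2)"
      using L2_bounded[OF assms(1,2)] by (rule L2_integrable_sq)
    show "AE z in MS. (cmod (u z))\<^sup>2 \<le> B\<^sup>2"
      by (rule AE_I2) (auto intro!: power_mono assms(2))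
  qed simp
  also have "\<dots> = (sqrt (measure MS Sq) * B)\<^sup>2" by (simp add: power_mult_distrib)
  finally show "(l2_norm u)\<^sup>2 \<le> (sqrt (measure MS Sq) * B)\<^sup>2" .
qed (use assms in simp)

section \<open>Exchange of the coordinates\<close>

lemma distr_swap_lborel:
  "distr lborel lborel (prod.swap :: real \<times> real \<Rightarrow> real \<times> real) = lborel"
  using lborel_pair.distr_pair_swap[where ?'a = real and ?'b = real] unfolding lborel_prod
  by (simp add: prod.swap_def[abs_def] case_prod_unfold)

lemma distr_swap_lebesgue:
  "distr lebesgue lebesgue (prod.swap :: real \<times> real \<Rightarrow> real \<times> real) = lebesgue"
proof -
  have sw: "(prod.swap :: real \<times> real \<Rightarrow> _) \<in> borel_measurable borel"
    by (intro borel_measurable_continuous_onI) (auto simp: prod.swap_def intro!: continuous_intros)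
  have d: "distr lebesgue lborel (prod.swap :: real \<times> real \<Rightarrow> real \<times> real) = lborel"
    using distr_completion[of prod.swap "lborel :: (real \<times> real) measure" lborel]
      distr_swap_lborel sw by simp
  have sw': "(prod.swap :: real \<times> real \<Rightarrow> _) \<in> lebesgue \<rightarrow>\<^sub>M lborel"
    using sw by (simp add: measurable_completion)
  show ?thesis
    using completion.completion_distr_eq[OF sw'] d by simp
qed

lemma swap_measurable_lebesgue: "(prod.swap :: real \<times> real \<Rightarrow> _) \<in> lebesgue \<rightarrow>\<^sub>M lebesgue"
proof -
  have sw: "(prod.swap :: real \<times> real \<Rightarrow> _) \<in> borel_measurable borel"
    by (intro borel_measurable_continuous_onI) (auto simp: prod.swap_def intro!: continuous_intros)
  have d: "distr lebesgue lborel (prod.swap :: real \<times> real \<Rightarrow> real \<times> real) = lborel"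
    using distr_completion[of prod.swap "lborel :: (real \<times> real) measure" lborel]
      distr_swap_lborel sw by simp
  have sw': "(prod.swap :: real \<times> real \<Rightarrow> _) \<in> lebesgue \<rightarrow>\<^sub>M lborel"
    using sw by (simp add: measurable_completion)
  show ?thesis
    using completion.measurable_completion2[OF sw'] d by simp
qed

text \<open>Exchanging the coordinates exchanges the roles of x- and y-derivatives, so estimates are
  proved in one direction and transported to the other by this isometry.\<close>

definition swp :: "sfun \<Rightarrow> sfun" where "swp u = (\<lambda>z. u (prod.swap z))"

lemma swp_swp [simp]: "swp (swp u) = u"
  by (simp add: swp_def)

lemma swap_in_Sq [simp]: "prod.swap z \<in> Sq \<longleftrightarrow> z \<in> Sq"
  by (cases z) (auto simp: Sq_def)

lemma integral_swap_Sq: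
  fixes f :: "real \<times> real \<Rightarrow> 'b::euclidean_space"
  assumes "f \<in> borel_measurable MS"
  shows "(LINT z|MS. f (prod.swap z)) = (LINT z|MS. f z)"
proof -
  have m: "(\<lambda>z. indicat_real Sq z *\<^sub>R f z) \<in> borel_measurable lebesgue"
    using assms by (simp add: borel_measurable_restrict_space_iff mult.commute)
  have i: "indicat_real Sq (prod.swap z) = indicat_real Sq z" for z
    by (simp add: indicator_def)
  have "(LINT z|MS. f z) = (LINT z|lebesgue. indicat_real Sq z *\<^sub>R f z)"
    by (simp add: integral_restrict_space)
  also have "\<dots> = (LINT z|distr lebesgue lebesgue prod.swap. indicat_real Sq z *\<^sub>R f z)"
    by (simp add: distr_swap_lebesgue)
  also have "\<dots> = (LINT z|lebesgue. indicat_real Sq (prod.swap z) *\<^sub>R f (prod.swap z))"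
    by (rule integral_distr[OF swap_measurable_lebesgue m])
  also have "\<dots> = (LINT z|MS. f (prod.swap z))"
    by (simp add: integral_restrict_space i)
  finally show ?thesis by simp
qed

lemma swap_measurable_MS:
  fixes f :: "real \<times> real \<Rightarrow> 'b::euclidean_space"
  assumes "f \<in> borel_measurable MS"
  shows "(\<lambda>z. f (prod.swap z)) \<in> borel_measurable MS"
proof -
  have "(\<lambda>z. indicat_real Sq z *\<^sub>R f z) \<in> borel_measurable lebesgue"
    using assms by (simp add: borel_measurable_restrict_space_iff mult.commute)
  from measurable_compose[OF swap_measurable_lebesgue this]
  have "(\<lambda>z. indicat_real Sq z *\<^sub>R f (prod.swap z)) \<in> borel_measurable lebesgue"
    by (simp add: indicator_def)
  then show ?thesis by (simp add: borel_measurable_restrict_space_iff mult.commute)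
qed

lemma integrable_swap_Sq:
  fixes f :: "real \<times> real \<Rightarrow> real"
  assumes "integrable MS f"
  shows "integrable MS (\<lambda>z. f (prod.swap z))"
proof -
  have "integrable (distr lebesgue lebesgue prod.swap) (\<lambda>z. indicat_real Sq z *\<^sub>R f z)"
    using assms by (simp add: distr_swap_lebesgue integrable_restrict_space)
  from integrable_distr[OF swap_measurable_lebesgue this]
  have "integrable lebesgue (\<lambda>z. indicat_real Sq z *\<^sub>R f (prod.swap z))"
    by (simp add: indicator_def)
  then show ?thesis by (simp add: integrable_restrict_space)
qed

lemma swp_L2 [intro]: "u \<in> L2 \<Longrightarrow> swp u \<in> L2"
  using swap_measurable_MS[of u] integrable_swap_Sq[of "\<lambda>z. (cmod (u z))\<^sup>2"]
  by (simp add: L2_def swp_def)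

lemma swp_L2_iff [simp]: "swp u \<in> L2 \<longleftrightarrow> u \<in> L2"
  by (metis swp_L2 swp_swp)

lemma l2_inner_swp:
  assumes "u \<in> L2" "v \<in> L2"
  shows "l2_inner (swp u) (swp v) = l2_inner u v"
  unfolding l2_inner_def swp_def
  by (rule integral_swap_Sq[of "\<lambda>z. u z * cnj (v z)"]) (use L2_mult_integrable[OF assms] in auto)

lemma l2_norm_swp: "u \<in> L2 \<Longrightarrow> l2_norm (swp u) = l2_norm u"
  by (simp add: l2_norm_def l2_inner_swp)

section \<open>Iterated integration\<close>

lemma integral_MS_eq_cSq:
  fixes f :: sfun
  assumes "continuous_on cSq f"
  shows "(LINT z|MS. f z) = integral cSq f"
proof -
  have "integrable MS f"
  proof -
    have "f absolutely_integrable_on cSq"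
      unfolding cSq_eq_cbox by (rule absolutely_integrable_continuous) (use assms in \<open>simp add: cSq_eq_cbox\<close>)
    then have "f absolutely_integrable_on Sq"
      by (rule set_integrable_subset) (use Sq_subset_cSq in auto)
    then show ?thesis by (simp add: integrable_restrict_space set_integrable_def)
  qed
  then have "(LINT z|MS. f z) = integral Sq f"
    by (simp add: lebesgue_integral_eq_integral)
  also have "\<dots> = integral cSq f"
    unfolding Sq_eq_box cSq_eq_cbox by (rule integral_open_interval)
  finally show ?thesis .
qed

lemma integral_MS_iterated:
  fixes f :: sfun
  assumes "continuous_on cSq f"
  shows "(LINT z|MS. f z) = integral {-1..1} (\<lambda>x. integral {-1..1} (\<lambda>y. f (x, y)))"
    and "(LINT z|MS. f z) = integral {-1..1} (\<lambda>y. integral {-1..1} (\<lambda>x. f (x, y)))"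
proof -
  have c: "continuous_on (cbox (-1, -1) (1, 1)) f" using assms by (simp add: cSq_eq_cbox)
  show 1: "(LINT z|MS. f z) = integral {-1..1} (\<lambda>x. integral {-1..1} (\<lambda>y. f (x, y)))"
    using integral_integrable_2dim[OF c] integral_prod_continuous[OF c] integral_MS_eq_cSq[OF assms]
    by (simp add: cSq_eq_cbox)
  show "(LINT z|MS. f z) = integral {-1..1} (\<lambda>y. integral {-1..1} (\<lambda>x. f (x, y)))"
    unfolding 1 using integral_swap_continuous[of "-1" "-1" 1 1 "\<lambda>x y. f (x, y)"] c
    by (simp add: case_prod_unfold)
qed

section \<open>Legendre polynomials\<close>

lemma smult_of_nat_eq: "smult (of_nat k) p = of_nat k * (p :: complex poly)"
  by (simp add: of_nat_poly)

lemma legendre_rec: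
  "of_nat (n + 2) * legendre (n + 2) = of_nat (2 * n + 3) * ([:0, 1:] * legendre (n + 1)) - of_nat (n + 1) * legendre n"
proof -
  have c: "(of_nat (n + 2) :: complex) \<noteq> 0" by (simp only: of_nat_eq_0_iff)
  have "smult (of_nat (n + 2)) (legendre (Suc (Suc n)))
     = smult (of_nat (2 * n + 3)) ([:0, 1:] * legendre (Suc n)) - smult (of_nat (n + 1)) (legendre n)"
    using c by (simp del: of_nat_add of_nat_mult of_nat_Suc mult_pCons_left)
  then show ?thesis unfolding smult_of_nat_eq by (simp del: of_nat_add of_nat_mult of_nat_Suc mult_pCons_left)
qed

abbreviation X :: "complex poly" where "X \<equiv> [:0, 1:]"

lemma pderiv_X: "pderiv X = 1"
  by (simp add: pderiv_pCons one_pCons)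

lemma pderiv_of_nat: "pderiv (of_nat k :: complex poly) = 0"
  by (simp add: of_nat_poly pderiv_pCons)

text \<open>Both identities are carried through one induction. The first at the next index comes
  from differentiating the three-term recurrence and inserting the second at the current index; the
  second then follows from the new first one and the recurrence.\<close>

lemma legendre_deriv_rec:
  "pderiv (legendre (Suc n)) = X * pderiv (legendre n) + of_nat (n + 1) * legendre n \<and>
   X * pderiv (legendre (Suc n)) - pderiv (legendre n) = of_nat (n + 1) * legendre (Suc n)"
proof (induction n)
  case 0
  then show ?case by (simp add: pderiv_pCons one_pCons)
next
  case (Suc n)
  define x where "x = X"
  define A where "A = pderiv (legendre n)"
  define B where "B = pderiv (legendre (Suc n))"
  define C where "C = pderiv (legendre (Suc (Suc n)))"
  define k where "k = (of_nat n :: complex poly)"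
  note d = x_def[symmetric] A_def[symmetric] B_def[symmetric] C_def[symmetric]
  have a: "B = x * A + (k + 1) * legendre n" and b: "x * B - A = (k + 1) * legendre (Suc n)"
  proof -
    have k1: "of_nat (n + 1) = k + 1" by (simp add: k_def)
    show "B = x * A + (k + 1) * legendre n" "x * B - A = (k + 1) * legendre (Suc n)"
      using Suc unfolding d k1 by blast+
  qed
  have r: "(k + 2) * legendre (Suc (Suc n)) = (2 * k + 3) * (x * legendre (Suc n)) - (k + 1) * legendre n"
    using legendre_rec[of n] unfolding d by (simp add: k_def add.commute del: legendre.simps)
  have "pderiv ((k + 2) * legendre (Suc (Suc n))) = pderiv ((2 * k + 3) * (x * legendre (Suc n)) - (k + 1) * legendre n)"
    unfolding r ..
  then have r': "(k + 2) * C = (2 * k + 3) * (legendre (Suc n) + x * B) - (k + 1) * A"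
    unfolding k_def
    using pderiv_of_nat[of "n + 2"] pderiv_of_nat[of "2 * n + 3"] pderiv_of_nat[of "n + 1"] pderiv_X
    unfolding pderiv_mult pderiv_diff d
    by (simp add: C_def B_def A_def pderiv_mult add.commute x_def mult.commute del: legendre.simps mult_pCons_right mult_pCons_left)
  have "(k + 2) * C = (k + 2) * (x * B + (k + 2) * legendre (Suc n))"
    using r' b by algebra
  moreover have k2: "k + 2 \<noteq> 0"
  proof -
    have "k + 2 = of_nat (n + 2)" by (simp add: k_def)
    then show ?thesis by (metis of_nat_eq_0_iff add_2_eq_Suc' nat.distinct(1))
  qed
  ultimately have c1: "C = x * B + (k + 2) * legendre (Suc n)" by simp
  have c2: "x * C - B = (k + 2) * legendre (Suc (Suc n))"
    using c1 r a b by algebra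
  show ?case unfolding d using c1 c2 by (simp add: k_def add.commute del: legendre.simps)
qed

section \<open>The differential equations of Legendre polynomials and of their derivatives\<close>

definition om :: "complex poly" where "om = 1 - X\<^sup>2"

lemma poly_om [simp]: "poly om x = 1 - x\<^sup>2"
  by (simp add: om_def)

lemma pderiv_om: "pderiv om = - 2 * X"
  unfolding om_def power2_eq_square pderiv_diff pderiv_mult pderiv_X pderiv_1 by algebra

text \<open>The eigenvalue belonging to the \<open>s\<close>-th derivative of the
  \<open>n\<close>-th Legendre polynomial, a multiple of a Gegenbauer polynomial.\<close>

definition kap :: "nat \<Rightarrow> nat \<Rightarrow> real" where
  "kap n s = real n * (real n + 1) - real s * (real s + 1)"

text \<open>Combining the two derivative recurrences gives
  \<open>(1 - x^2) L_n' = n (L_(n-1) - x L_n)\<close>; one more differentiation and the second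
  recurrence yield Legendre's equation.\<close>

lemma legendre_ode_0: "om * pderiv (pderiv (legendre n)) - 2 * X * pderiv (legendre n) + of_nat (n * (n + 1)) * legendre n = 0"
proof (cases n)
  case 0
  then show ?thesis by simp
next
  case (Suc m)
  have a: "pderiv (legendre n) = X * pderiv (legendre m) + of_nat (m + 1) * legendre m"
    and b: "X * pderiv (legendre n) - pderiv (legendre m) = of_nat (m + 1) * legendre n"
    using legendre_deriv_rec[of m] Suc by auto
  have "om * pderiv (legendre n) = of_nat (m + 1) * legendre m - of_nat (m + 1) * (X * legendre n)"
    unfolding om_def using a b by algebra
  from arg_cong[OF this, of pderiv]
  have "om * pderiv (pderiv (legendre n)) - 2 * X * pderiv (legendre n)
      = of_nat (m + 1) * pderiv (legendre m) - of_nat (m + 1) * (legendre n + X * pderiv (legendre n))"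
    unfolding pderiv_mult pderiv_diff pderiv_om pderiv_of_nat pderiv_X by algebra
  moreover have "of_nat (n * (n + 1)) = (of_nat (m + 1) * (of_nat (m + 1) + 1) :: complex poly)"
    unfolding Suc by (simp add: algebra_simps)
  ultimately show ?thesis using b by algebra
qed

text \<open>Differentiating the equation for \<open>s\<close> gives that for \<open>s + 1\<close>:
  since \<open>om\<close> has derivative \<open>-2 x\<close>, the coefficient of the first-order
  term grows by 2, and the eigenvalue drops by \<open>2 (s + 1)\<close>.\<close>

lemma legendre_ode:
  "om * (pderiv ^^ (s + 2)) (legendre n) - of_nat (2 * (s + 1)) * X * (pderiv ^^ (s + 1)) (legendre n)
     + smult (of_real (kap n s)) ((pderiv ^^ s) (legendre n)) = 0"
proof (induction s)
  case 0
  have "smult (of_real (kap n 0)) (legendre n) = of_nat (n * (n + 1)) * legendre n"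
    unfolding smult_of_nat_eq[symmetric] by (simp add: kap_def algebra_simps)
  then show ?case using legendre_ode_0[of n] by (simp del: mult_pCons_right mult_pCons_left)
next
  case (Suc s)
  define D where "D = (pderiv ^^ s) (legendre n)"
  define c where "c = [:complex_of_real (kap n s):]"
  have sm: "smult (of_real (kap n s)) p = c * p" for p by (simp add: c_def)
  define k where "k = (of_nat (2 * (s + 1)) :: complex poly)"
  have e: "om * pderiv (pderiv D) - k * X * pderiv D + c * D = 0"
  proof -
    have "(pderiv ^^ (s + 2)) (legendre n) = pderiv (pderiv D)" "(pderiv ^^ (s + 1)) (legendre n) = pderiv D"
      by (simp_all add: D_def)
    then show ?thesis using Suc unfolding sm k_def D_def[symmetric] by simp
  qed
  from arg_cong[OF this, of pderiv]
  have "pderiv om * pderiv (pderiv D) + om * pderiv (pderiv (pderiv D)) - k * (pderiv X * pderiv D + X * pderiv (pderiv D)) + c * pderiv D = 0"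
    by (simp add: pderiv_add pderiv_diff pderiv_mult k_def pderiv_of_nat c_def pderiv_pCons algebra_simps
        del: mult_pCons_right mult_pCons_left of_nat_mult of_nat_add)
  then have "om * pderiv (pderiv (pderiv D)) - (k + 2) * X * pderiv (pderiv D) + (c - k) * pderiv D = 0"
    unfolding pderiv_om pderiv_X by algebra
  moreover have "(c - k) * p = smult (of_real (kap n (Suc s))) p" for p
  proof -
    have "c - k = [:of_real (kap n (Suc s)):]"
      unfolding c_def k_def of_nat_poly by (simp add: kap_def algebra_simps)
    then show ?thesis by simp
  qed
  moreover have "k + 2 = of_nat (2 * (Suc s + 1))" by (simp add: k_def)
  ultimately show ?case by (simp add: D_def del: mult_pCons_right mult_pCons_left of_nat_mult of_nat_add)
qed

text \<open>The weighted partner of the \<open>s\<close>-th derivative. For positive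
  \<open>s\<close> it vanishes at both ends, so it is admissible as a test polynomial for
  derivatives of functions without boundary condition.\<close>

definition J :: "nat \<Rightarrow> nat \<Rightarrow> complex poly" where
  "J s n = om ^ s * (pderiv ^^ s) (legendre n)"

text \<open>This is \<open>legendre_ode\<close> in divergence form, with integrating factor
  \<open>om ^ s\<close>.\<close>

lemma pderiv_J: "pderiv (J (Suc s) n) = smult (- of_real (kap n s)) (J s n)"
proof -
  define D where "D = (pderiv ^^ s) (legendre n)"
  define c where "c = [:complex_of_real (kap n s):]"
  have e: "om * pderiv (pderiv D) - of_nat (2 * (s + 1)) * X * pderiv D + c * D = 0"
  proof -
    have "(pderiv ^^ (s + 2)) (legendre n) = pderiv (pderiv D)" "(pderiv ^^ (s + 1)) (legendre n) = pderiv D"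
      by (simp_all add: D_def)
    moreover have "smult (of_real (kap n s)) D = c * D" by (simp add: c_def)
    ultimately show ?thesis using legendre_ode[of s n] unfolding D_def[symmetric] by simp
  qed
  have p: "pderiv (om ^ Suc s) = of_nat (s + 1) * om ^ s * pderiv om"
    unfolding pderiv_power_Suc smult_of_nat_eq by simp
  have "pderiv (J (Suc s) n) = om ^ s * (om * pderiv (pderiv D) - of_nat (2 * (s + 1)) * X * pderiv D)"
    unfolding J_def pderiv_mult p pderiv_om by (simp add: D_def algebra_simps del: mult_pCons_right mult_pCons_left)
  also have "om * pderiv (pderiv D) - of_nat (2 * (s + 1)) * X * pderiv D = - (c * D)"
    using e by (simp add: add_eq_0_iff2)
  finally show ?thesis by (simp add: J_def D_def c_def)
qed

lemma J_boundary: "s > 0 \<Longrightarrow> poly (J s n) 1 = 0" "s > 0 \<Longrightarrow> poly (J s n) (-1) = 0"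
  by (simp_all add: J_def)

subsection \<open>Integration of polynomials\<close>

definition pint :: "complex poly \<Rightarrow> complex" where
  "pint p = integral {-1..1} (\<lambda>x. poly p (of_real x))"

lemma pint_has_integral: "((\<lambda>x. poly p (complex_of_real x)) has_integral pint p) {-1..1}"
  unfolding pint_def by (intro integrable_integral integrable_continuous_interval continuous_intros)

lemma pint_add: "pint (p + q) = pint p + pint q"
  unfolding pint_def poly_add
  by (intro integral_add integrable_continuous_interval continuous_intros)

lemma pint_smult: "pint (smult c p) = c * pint p"
  unfolding pint_def by simp

lemma pint_pderiv: "pint (pderiv p) = poly p 1 - poly p (-1)"
proof -
  have "((\<lambda>x. poly (pderiv p) (complex_of_real x)) has_integral (poly p (of_real 1) - poly p (of_real (-1)))) {-1..1}"
  proof (rule fundamental_theorem_of_calculus)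
    fix x :: real assume "x \<in> {-1..1}"
    have "(poly p has_field_derivative poly (pderiv p) (of_real x)) (at (of_real x))"
      by (rule poly_DERIV)
    then show "((\<lambda>x. poly p (complex_of_real x)) has_vector_derivative poly (pderiv p) (of_real x)) (at x within {-1..1})"
      by (intro has_vector_derivative_real_field) (rule has_field_derivative_at_within)
  qed simp
  from has_integral_unique[OF pint_has_integral this] show ?thesis by simp
qed

lemma pint_by_parts:
  assumes "poly (p * q) 1 = 0" "poly (p * q) (-1) = 0"
  shows "pint (pderiv p * q) = - pint (p * pderiv q)"
proof -
  have "pint (p * pderiv q) + pint (q * pderiv p) = poly (p * q) 1 - poly (p * q) (-1)"
    using pint_pderiv[of "p * q"] unfolding pderiv_mult pint_add .
  then have "pint (q * pderiv p) + pint (p * pderiv q) = 0"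
    unfolding assms by (simp add: add.commute)
  then show ?thesis unfolding mult.commute[of "pderiv p"] by (simp only: eq_neg_iff_add_eq_0)
qed

abbreviation cnjp :: "complex poly \<Rightarrow> complex poly" where "cnjp \<equiv> map_poly cnj"

lemma poly_cnjp: "poly (cnjp p) (of_real x) = cnj (poly p (of_real x))"
  by (induction p) (simp_all add: map_poly_pCons)

lemma cnjp_smult: "cnjp (smult c p) = smult (cnj c) (cnjp p)"
  by (rule poly_eqI) (simp add: coeff_map_poly)

lemma cnjp_diff: "cnjp (p - q) = cnjp p - cnjp q"
  by (rule poly_eqI) (simp add: coeff_map_poly)

lemma cnjp_mult: "cnjp (p * q) = cnjp p * cnjp q"
  by (rule poly_eqI) (simp add: coeff_map_poly coeff_mult)

lemma cnjp_pderiv: "cnjp (pderiv p) = pderiv (cnjp p)"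
  by (rule poly_eqI) (simp add: coeff_map_poly coeff_pderiv)

lemma cnjp_legendre [simp]: "cnjp (legendre n) = legendre n"
proof (induction n rule: legendre.induct)
  case (3 n)
  have X: "cnjp X = X" by (simp add: map_poly_pCons)
  have c: "cnj (1 / of_nat k) = 1 / of_nat k" "cnj (of_nat k) = of_nat k" for k by simp_all
  show ?case unfolding legendre.simps cnjp_smult cnjp_diff cnjp_mult X 3 c ..
qed (simp_all add: map_poly_pCons)

lemma cnjp_pderivs_legendre [simp]: "cnjp ((pderiv ^^ s) (legendre n)) = (pderiv ^^ s) (legendre n)"
  by (induction s) (simp_all add: cnjp_pderiv)

lemma poly_cnjp_pm1: "poly (cnjp p) 1 = cnj (poly p 1)" "poly (cnjp p) (-1) = cnj (poly p (-1))"
  using poly_cnjp[of p 1] poly_cnjp[of p "-1"] by simp_all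

text \<open>The squared norm of the \<open>n\<close>-th Legendre polynomial on the interval, equal
  to \<open>2 / (2 n + 1)\<close>.\<close>

definition hh :: "nat \<Rightarrow> real" where "hh n = Re (pint (legendre n * legendre n))"

text \<open>The product of the eigenvalues collected by \<open>s\<close> successive integrations by
  parts.\<close>

definition cc :: "nat \<Rightarrow> nat \<Rightarrow> real" where "cc n s = (\<Prod>i<s. kap n i)"

lemma pint_J_Suc:
  "pint (J (Suc s) n * (pderiv ^^ Suc s) (legendre k)) = of_real (kap n s) * pint (J s n * (pderiv ^^ s) (legendre k))"
proof -
  have "pint (J (Suc s) n * pderiv ((pderiv ^^ s) (legendre k))) = - pint (pderiv (J (Suc s) n) * (pderiv ^^ s) (legendre k))"
    by (subst pint_by_parts) (simp_all add: J_boundary)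
  then show ?thesis by (simp add: pderiv_J pint_smult del: smult_minus_left)
qed

text \<open>Eigenfunctions of a symmetric operator with different eigenvalues are orthogonal:
  \<open>(1 - x^2) L_n' L_k'\<close> is symmetric in \<open>n\<close> and \<open>k\<close>, and its
  integral equals the scalar product multiplied by either eigenvalue.\<close>

lemma pint_legendre_orth:
  assumes "n \<noteq> k"
  shows "pint (legendre n * legendre k) = 0"
proof -
  have s: "J 1 n * pderiv (legendre k) = J 1 k * pderiv (legendre n)"
    by (simp add: J_def)
  have "of_real (kap n 0) * pint (legendre n * legendre k) = of_real (kap k 0) * pint (legendre n * legendre k)"
  proof -
    have "of_real (kap n 0) * pint (legendre n * legendre k) = pint (J 1 n * pderiv (legendre k))"
      using pint_J_Suc[of 0 n k] by (simp add: J_def)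
    also have "\<dots> = of_real (kap k 0) * pint (legendre k * legendre n)"
      unfolding s using pint_J_Suc[of 0 k n] by (simp add: J_def)
    finally show ?thesis by (simp only: mult.commute[of "legendre k"])
  qed
  moreover have "kap n 0 \<noteq> kap k 0"
  proof
    assume "kap n 0 = kap k 0"
    then have "(real n - real k) * (real n + real k + 1) = 0" by (simp add: kap_def algebra_simps)
    then show False using assms by (simp add: add_eq_0_iff_both_eq_0)
  qed
  ultimately show ?thesis by (metis mult_cancel_right of_real_eq_iff)
qed

lemma pint_norm:
  "pint (p * cnjp p) = of_real (integral {-1..1} (\<lambda>x. (cmod (poly p (of_real x)))\<^sup>2))"
proof -
  have "((\<lambda>x. (cmod (poly p (complex_of_real x)))\<^sup>2) has_integral integral {-1..1} (\<lambda>x. (cmod (poly p (of_real x)))\<^sup>2)) {-1..1}"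
    by (intro integrable_integral integrable_continuous_interval continuous_intros)
  from has_integral_linear[OF this bounded_linear_of_real[where ?'a = complex]]
  have "((\<lambda>x. poly (p * cnjp p) (of_real x)) has_integral of_real (integral {-1..1} (\<lambda>x. (cmod (poly p (of_real x)))\<^sup>2))) {-1..1}"
    by (simp add: poly_cnjp o_def flip: complex_norm_square)
  then show ?thesis using pint_has_integral has_integral_unique by blast
qed

lemma pint_norm_pos:
  assumes "p \<noteq> 0"
  shows "integral {-1..1} (\<lambda>x. (cmod (poly p (of_real x)))\<^sup>2) > 0"
proof -
  let ?f = "\<lambda>x. (cmod (poly p (complex_of_real x)))\<^sup>2"
  have c: "continuous_on {-1..1} ?f" by (intro continuous_intros)
  have ge: "integral {-1..1} ?f \<ge> 0" by (intro integral_nonneg integrable_continuous_interval c) auto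
  have "integral {-1..1} ?f \<noteq> 0"
  proof
    assume "integral {-1..1} ?f = 0"
    then have "\<forall>x\<in>{-1..1}. ?f x = 0"
      using integral_eq_0_iff[OF c] by auto
    then have "of_real ` {-1..1::real} \<subseteq> {x. poly p x = 0}" by auto
    moreover have "infinite (complex_of_real ` {-1..1::real})"
      by (subst finite_image_iff) (auto simp: inj_on_def infinite_Icc)
    ultimately show False using poly_roots_finite[OF assms] finite_subset by blast
  qed
  then show ?thesis using ge by simp
qed

lemma hh_pos: "hh n > 0"
proof -
  have "legendre n \<noteq> 0"
    using degree_legendre[of n] by (cases n) auto
  then show ?thesis
    unfolding hh_def using pint_norm[of "legendre n"] pint_norm_pos[of "legendre n"] by simp
qed

lemma pint_J_legendre:
  "pint (J s n * (pderiv ^^ s) (legendre k)) = (if n = k then of_real (cc n s * hh n) else 0)"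
proof (induction s)
  case 0
  have "pint (legendre n * legendre n) = of_real (hh n)"
    unfolding hh_def using pint_norm[of "legendre n"] by simp
  then show ?case using pint_legendre_orth[of n k] by (cases "n = k") (simp_all add: J_def cc_def)
next
  case (Suc s)
  then show ?case unfolding pint_J_Suc by (simp add: cc_def)
qed

lemma pint_legendre: "pint (legendre n * legendre k) = (if n = k then of_real (hh n) else 0)"
  using pint_J_legendre[of 0 n k] by (simp add: J_def cc_def)

text \<open>For \<open>2 i \<le> n\<close> one has \<open>i^2 + i \<le> n^2/4 + n/2\<close>, hence
  \<open>kap n i \<ge> n^2/4\<close>. With \<open>s \<le> 1\<close> only \<open>i = 0\<close>
  occurs, which explains the alternative in the hypothesis.\<close>

lemma cc_lower:
  assumes "n \<ge> N" "s \<le> 1 \<or> N \<ge> 2 * s"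
  shows "cc n s \<ge> (real N / 2) ^ (2 * s)"
proof -
  have "kap n i \<ge> (real N / 2)\<^sup>2" if "i < s" for i
  proof -
    have "2 * i \<le> n" using that assms by (cases "s \<le> 1") auto
    then have i: "2 * real i \<le> real n" by linarith
    have nn: "real N \<le> real n" using assms by simp
    have "(real N / 2)\<^sup>2 \<le> (real n / 2)\<^sup>2" using nn by (intro power_mono) auto
    moreover have "(real i)\<^sup>2 \<le> (real n / 2)\<^sup>2" using i by (intro power_mono) auto
    moreover have "kap n i = (real n)\<^sup>2 + real n - (real i)\<^sup>2 - real i"
      by (simp add: kap_def power2_eq_square algebra_simps)
    moreover have "(real n / 2)\<^sup>2 = (real n)\<^sup>2 / 4" by (simp add: power_divide)
    moreover have "0 \<le> (real n)\<^sup>2" by simp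
    ultimately show ?thesis using i by linarith
  qed
  then have "(\<Prod>i<s. (real N / 2)\<^sup>2) \<le> cc n s"
    unfolding cc_def by (intro prod_mono) auto
  then show ?thesis by (simp add: power_mult)
qed

section \<open>Polynomial antiderivatives vanishing at the left end\<close>

lemma antiderivative_poly:
  fixes p :: "complex poly"
  shows "\<exists>P. pderiv P = p \<and> poly P (-1) = 0 \<and> degree P \<le> Suc (degree p)"
proof -
  define Q where "Q = (\<Sum>i\<le>degree p. monom (coeff p i / of_nat (Suc i)) (Suc i))"
  have c: "coeff Q (Suc n) = coeff p n / of_nat (Suc n)" for n
    by (simp add: Q_def coeff_sum coeff_eq_0 if_distrib cong: if_cong)
  have "pderiv Q = p"
    by (rule poly_eqI) (simp add: coeff_pderiv c del: of_nat_Suc)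
  moreover have "degree Q \<le> Suc (degree p)"
    unfolding Q_def by (rule degree_sum_le) (auto intro: order_trans[OF degree_monom_le])
  ultimately have "pderiv (Q - [:poly Q (-1):]) = p \<and> poly (Q - [:poly Q (-1):]) (-1) = 0
      \<and> degree (Q - [:poly Q (-1):]) \<le> Suc (degree p)"
    by (auto simp: pderiv_diff pderiv_pCons intro!: degree_diff_le)
  then show ?thesis by blast
qed

definition ap :: "complex poly \<Rightarrow> complex poly" where
  "ap p = (SOME P. pderiv P = p \<and> poly P (-1) = 0 \<and> degree P \<le> Suc (degree p))"

lemma pderiv_ap [simp]: "pderiv (ap p) = p"
  and poly_ap_m1 [simp]: "poly (ap p) (-1) = 0"
  and degree_ap: "degree (ap p) \<le> Suc (degree p)"
  using someI_ex[OF antiderivative_poly[of p]] unfolding ap_def by auto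

lemma poly_ap_1: "poly (ap p) 1 = pint p"
  using pint_pderiv[of "ap p"] by simp

text \<open>Orthogonality to the constant \<open>L_0\<close> makes the antiderivative vanish at the
  right end too, so it satisfies both boundary conditions.\<close>

lemma poly_ap_legendre [simp]: "n > 0 \<Longrightarrow> poly (ap (legendre n)) 1 = 0"
  unfolding poly_ap_1 using pint_legendre[of n 0] by simp

lemma legendre_expansion:
  "degree p \<le> M \<Longrightarrow> \<exists>c. p = (\<Sum>k\<le>M. smult (c k) (legendre k))"
  using PN_iff_degree[of p M] by (auto simp: PN_def)

section \<open>Polynomials in two variables\<close>

definition tp :: "complex poly \<Rightarrow> complex poly \<Rightarrow> sfun" where
  "tp p q = (\<lambda>(x, y). poly p (of_real x) * poly q (of_real y))"

lemma tp_apply [simp]: "tp p q (x, y) = poly p (of_real x) * poly q (of_real y)"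
  by (simp add: tp_def)

lemma tp_eq: "tp p q z = poly p (of_real (fst z)) * poly q (of_real (snd z))"
  by (cases z) simp

lemma tp_continuous [continuous_intros]: "continuous_on S (tp p q)"
  unfolding tp_def case_prod_unfold by (intro continuous_intros)

lemma tp_L2 [simp]: "tp p q \<in> L2"
  by (intro L2_continuous tp_continuous)

lemma swp_tp [simp]: "swp (tp p q) = tp q p"
  by (auto simp: swp_def tp_eq)

lemma tp_smult_left: "tp (smult c p) q = (\<lambda>z. c * tp p q z)"
  by (auto simp: tp_eq)

lemma tp_smult_right: "tp p (smult c q) = (\<lambda>z. c * tp p q z)"
  by (auto simp: tp_eq)

lemma tp_zero [simp]: "tp 0 q = (\<lambda>z. 0)" "tp p 0 = (\<lambda>z. 0)"
  by (auto simp: tp_eq)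

lemma l2_inner_tp: "l2_inner (tp p q) (tp r s) = pint (p * cnjp r) * pint (q * cnjp s)"
proof -
  have "l2_inner (tp p q) (tp r s) = (LINT z|MS. tp p q z * cnj (tp r s z))"
    by (simp add: l2_inner_def)
  also have "\<dots> = integral {-1..1} (\<lambda>x. integral {-1..1} (\<lambda>y. tp p q (x, y) * cnj (tp r s (x, y))))"
    by (rule integral_MS_iterated) (intro continuous_intros)
  also have "\<dots> = integral {-1..1} (\<lambda>x. integral {-1..1} (\<lambda>y. poly (p * cnjp r) (of_real x) * poly (q * cnjp s) (of_real y)))"
    by (simp add: poly_cnjp mult_ac)
  also have "\<dots> = pint (p * cnjp r) * pint (q * cnjp s)"
    by (simp add: pint_def)
  finally show ?thesis .
qed

lemma l2_inner_lin_left: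
  assumes "\<And>i. i \<in> I \<Longrightarrow> f i \<in> L2" "w \<in> L2"
  shows "l2_inner (\<lambda>z. \<Sum>i\<in>I. a i * f i z) w = (\<Sum>i\<in>I. a i * l2_inner (f i) w)"
  by (subst l2_inner_sum_left) (use assms in \<open>auto simp: l2_inner_scale_left\<close>)

lemma l2_inner_lin_right:
  assumes "\<And>i. i \<in> I \<Longrightarrow> f i \<in> L2" "w \<in> L2"
  shows "l2_inner w (\<lambda>z. \<Sum>i\<in>I. a i * f i z) = (\<Sum>i\<in>I. cnj (a i) * l2_inner w (f i))"
  by (subst l2_inner_sum_right) (use assms in \<open>auto simp: l2_inner_scale_right\<close>)

text \<open>Two families are allowed because the weighted polynomials \<open>J\<close> pair
  diagonally with the unweighted derivatives, whereas neither family need be orthogonal in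
  itself.\<close>

lemma l2_inner_biorthogonal:
  assumes "finite I" "\<And>i. i \<in> I \<Longrightarrow> f i \<in> L2" "\<And>i. i \<in> I \<Longrightarrow> g i \<in> L2"
    and "\<And>i j. i \<in> I \<Longrightarrow> j \<in> I \<Longrightarrow> l2_inner (f i) (g j) = (if i = j then d i else 0)"
  shows "l2_inner (\<lambda>z. \<Sum>i\<in>I. a i * f i z) (\<lambda>z. \<Sum>i\<in>I. b i * g i z) = (\<Sum>i\<in>I. a i * cnj (b i) * d i)"
proof -
  have "l2_inner (\<lambda>z. \<Sum>i\<in>I. a i * f i z) (\<lambda>z. \<Sum>i\<in>I. b i * g i z)
      = (\<Sum>i\<in>I. a i * (\<Sum>j\<in>I. cnj (b j) * l2_inner (f i) (g j)))"
    using assms by (subst l2_inner_lin_left) (auto simp: l2_inner_lin_right intro!: L2_sum)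
  also have "\<dots> = (\<Sum>i\<in>I. a i * (\<Sum>j\<in>I. if i = j then cnj (b i) * d i else 0))"
    using assms(4) by (intro sum.cong refl arg_cong2[where f = "(*)"]) auto
  also have "\<dots> = (\<Sum>i\<in>I. a i * cnj (b i) * d i)"
    using assms(1) by (intro sum.cong) auto
  finally show ?thesis .
qed

text \<open>\<open>pd_x\<close> and \<open>pd_y\<close> are total and have an unspecified value
  where no derivative exists. On this class they are genuine derivatives, linear, and map the class
  into itself.\<close>

definition Pol :: "sfun set" where
  "Pol = {f. \<exists>(n::nat) p q. f = (\<lambda>z. \<Sum>k<n. tp (p k) (q k) z)}"

lemma Pol_induct [consumes 1, case_names zero add]:
  assumes "f \<in> Pol" "P (\<lambda>z. 0)" "\<And>f p q. f \<in> Pol \<Longrightarrow> P f \<Longrightarrow> P (\<lambda>z. f z + tp p q z)"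
  shows "P f"
proof -
  have "P (\<lambda>z. \<Sum>k<n. tp (p k) (q k) z)" for n :: nat and p q
  proof (induction n)
    case (Suc n)
    have "(\<lambda>z. \<Sum>k<n. tp (p k) (q k) z) \<in> Pol" by (auto simp: Pol_def)
    from assms(3)[OF this Suc] show ?case by simp
  qed (simp add: assms(2))
  then show ?thesis using assms(1) by (auto simp: Pol_def)
qed

lemma Pol_zero [simp]: "(\<lambda>z. 0) \<in> Pol"
  unfolding Pol_def by (intro CollectI exI[of _ 0]) auto

lemma Pol_add_tp: "f \<in> Pol \<Longrightarrow> (\<lambda>z. f z + tp p q z) \<in> Pol"
proof -
  assume "f \<in> Pol"
  then obtain n :: nat and a b where f: "f = (\<lambda>z. \<Sum>k<n. tp (a k) (b k) z)" by (auto simp: Pol_def)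
  show ?thesis unfolding Pol_def f
    by (intro CollectI exI[of _ "Suc n"] exI[of _ "a(n := p)"] exI[of _ "b(n := q)"]) (auto simp: fun_eq_iff)
qed

lemma Pol_tp [simp]: "tp p q \<in> Pol"
  using Pol_add_tp[OF Pol_zero, of p q] by simp

lemma Pol_add:
  assumes "f \<in> Pol" "g \<in> Pol"
  shows "(\<lambda>z. f z + g z) \<in> Pol"
  using assms(2)
proof (induction g rule: Pol_induct)
  case (add g p q)
  then show ?case using Pol_add_tp[of "\<lambda>z. f z + g z" p q] by (simp add: add.assoc)
qed (use assms in auto)

lemma Pol_scale: "f \<in> Pol \<Longrightarrow> (\<lambda>z. c * f z) \<in> Pol"
proof (induction f rule: Pol_induct)
  case (add f p q)
  then show ?case using Pol_add_tp[of "\<lambda>z. c * f z" "smult c p" q] by (simp add: distrib_left tp_smult_left)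
qed auto

lemma Pol_sum: "(\<And>i. i \<in> I \<Longrightarrow> f i \<in> Pol) \<Longrightarrow> (\<lambda>z. \<Sum>i\<in>I. f i z) \<in> Pol"
  by (induction I rule: infinite_finite_induct) (auto simp: Pol_add)

lemma Pol_lin: "(\<And>i. i \<in> I \<Longrightarrow> f i \<in> Pol) \<Longrightarrow> (\<lambda>z. \<Sum>i\<in>I. a i * f i z) \<in> Pol"
  by (intro Pol_sum Pol_scale)

lemma Pol_continuous: "f \<in> Pol \<Longrightarrow> continuous_on S f"
  by (induction f rule: Pol_induct) (auto intro!: continuous_intros)

lemma Pol_L2 [simp]: "f \<in> Pol \<Longrightarrow> f \<in> L2"
  by (intro L2_continuous Pol_continuous)

section \<open>Classical derivatives of polynomials in two variables\<close>

lemma tp_has_vector_derivative_x: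
  "((\<lambda>s. tp p q (s, y)) has_vector_derivative tp (pderiv p) q (x, y)) (at x within S)"
proof -
  have "((\<lambda>s. poly p (of_real s)) has_vector_derivative poly (pderiv p) (of_real x)) (at x within S)"
    by (intro has_vector_derivative_real_field) (rule has_field_derivative_at_within, rule poly_DERIV)
  then show ?thesis
    using has_vector_derivative_mult_left[of "\<lambda>s. poly p (of_real s)"] by simp
qed

lemma tp_has_vector_derivative_y:
  "((\<lambda>s. tp p q (x, s)) has_vector_derivative tp p (pderiv q) (x, y)) (at y within S)"
proof -
  have "((\<lambda>s. poly q (of_real s)) has_vector_derivative poly (pderiv q) (of_real y)) (at y within S)"
    by (intro has_vector_derivative_real_field) (rule has_field_derivative_at_within, rule poly_DERIV)
  then show ?thesis
    using has_vector_derivative_mult_right[of "\<lambda>s. poly q (of_real s)"] by simp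
qed

lemma Pol_has_vector_derivative:
  assumes "f \<in> Pol"
  shows "pd_x f \<in> Pol" "pd_y f \<in> Pol"
    and "((\<lambda>s. f (s, y)) has_vector_derivative pd_x f (x, y)) (at x within S)"
    and "((\<lambda>s. f (x, s)) has_vector_derivative pd_y f (x, y)) (at y within S)"
proof -
  obtain n :: nat and p q where f: "f = (\<lambda>z. \<Sum>k<n. tp (p k) (q k) z)"
    using assms by (auto simp: Pol_def)
  have dx: "((\<lambda>s. f (s, y)) has_vector_derivative (\<Sum>k<n. tp (pderiv (p k)) (q k) (x, y))) (at x within S)" for x y S
    unfolding f by (intro has_vector_derivative_sum tp_has_vector_derivative_x)
  have dy: "((\<lambda>s. f (x, s)) has_vector_derivative (\<Sum>k<n. tp (p k) (pderiv (q k)) (x, y))) (at y within S)" for x y S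
    unfolding f by (intro has_vector_derivative_sum tp_has_vector_derivative_y)
  have x: "pd_x f = (\<lambda>z. \<Sum>k<n. tp (pderiv (p k)) (q k) z)"
    using vector_derivative_at[OF dx] by (auto simp: pd_x_def fun_eq_iff)
  have y: "pd_y f = (\<lambda>z. \<Sum>k<n. tp (p k) (pderiv (q k)) z)"
    using vector_derivative_at[OF dy] by (auto simp: pd_y_def fun_eq_iff)
  show "pd_x f \<in> Pol" "pd_y f \<in> Pol" unfolding x y by (auto intro!: Pol_sum)
  show "((\<lambda>s. f (s, y)) has_vector_derivative pd_x f (x, y)) (at x within S)"
    unfolding x by (rule dx)
  show "((\<lambda>s. f (x, s)) has_vector_derivative pd_y f (x, y)) (at y within S)"
    unfolding y by (rule dy)
qed

lemma pd_tp: "pd_x (tp p q) = tp (pderiv p) q" "pd_y (tp p q) = tp p (pderiv q)"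
  using vector_derivative_at[OF tp_has_vector_derivative_x[of p q _ _ UNIV]]
    vector_derivative_at[OF tp_has_vector_derivative_y[of p q _ _ UNIV]]
  by (auto simp: pd_x_def pd_y_def fun_eq_iff)

lemma pd_add:
  assumes "f \<in> Pol" "g \<in> Pol"
  shows "pd_x (\<lambda>z. f z + g z) = (\<lambda>z. pd_x f z + pd_x g z)"
    and "pd_y (\<lambda>z. f z + g z) = (\<lambda>z. pd_y f z + pd_y g z)"
  using vector_derivative_at[OF has_vector_derivative_add[OF Pol_has_vector_derivative(3)[OF assms(1)] Pol_has_vector_derivative(3)[OF assms(2)]]]
    vector_derivative_at[OF has_vector_derivative_add[OF Pol_has_vector_derivative(4)[OF assms(1)] Pol_has_vector_derivative(4)[OF assms(2)]]]
  by (auto simp: pd_x_def pd_y_def fun_eq_iff)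

lemma pd_scale:
  assumes "f \<in> Pol"
  shows "pd_x (\<lambda>z. c * f z) = (\<lambda>z. c * pd_x f z)" and "pd_y (\<lambda>z. c * f z) = (\<lambda>z. c * pd_y f z)"
  using vector_derivative_at[OF has_vector_derivative_mult_right[OF Pol_has_vector_derivative(3)[OF assms(1)]]]
    vector_derivative_at[OF has_vector_derivative_mult_right[OF Pol_has_vector_derivative(4)[OF assms(1)]]]
  by (auto simp: pd_x_def pd_y_def fun_eq_iff)

lemma pd_zero [simp]: "pd_x (\<lambda>z. 0) = (\<lambda>z. 0)" "pd_y (\<lambda>z. 0) = (\<lambda>z. 0)"
  by (auto simp: pd_x_def pd_y_def)

lemma lap_Pol: "f \<in> Pol \<Longrightarrow> lap f \<in> Pol"
  unfolding lap_def by (intro Pol_add Pol_has_vector_derivative)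

lemma lap_add: "f \<in> Pol \<Longrightarrow> g \<in> Pol \<Longrightarrow> lap (\<lambda>z. f z + g z) = (\<lambda>z. lap f z + lap g z)"
  unfolding lap_def by (simp add: pd_add Pol_has_vector_derivative add_ac)

lemma lap_scale: "f \<in> Pol \<Longrightarrow> lap (\<lambda>z. c * f z) = (\<lambda>z. c * lap f z)"
  unfolding lap_def by (simp add: pd_scale Pol_has_vector_derivative distrib_left)

lemma lap_zero [simp]: "lap (\<lambda>z. 0) = (\<lambda>z. 0)"
  unfolding lap_def by simp

lemma lap_tp: "lap (tp p q) = (\<lambda>z. tp (pderiv (pderiv p)) q z + tp p (pderiv (pderiv q)) z)"
  unfolding lap_def by (simp add: pd_tp)

lemma lin_Pol:
  assumes "\<And>i. i \<in> I \<Longrightarrow> f i \<in> Pol"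
  shows "pd_x (\<lambda>z. \<Sum>i\<in>I. a i * f i z) = (\<lambda>z. \<Sum>i\<in>I. a i * pd_x (f i) z)"
    and "pd_y (\<lambda>z. \<Sum>i\<in>I. a i * f i z) = (\<lambda>z. \<Sum>i\<in>I. a i * pd_y (f i) z)"
    and "lap (\<lambda>z. \<Sum>i\<in>I. a i * f i z) = (\<lambda>z. \<Sum>i\<in>I. a i * lap (f i) z)"
  using assms
  by (induction I rule: infinite_finite_induct)
     (simp_all add: pd_add pd_scale lap_add lap_scale Pol_scale Pol_lin)

lemma diff_Pol:
  assumes "f \<in> Pol" "g \<in> Pol"
  shows "pd_x (\<lambda>z. f z - g z) = (\<lambda>z. pd_x f z - pd_x g z)"
    and "pd_y (\<lambda>z. f z - g z) = (\<lambda>z. pd_y f z - pd_y g z)"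
    and "lap (\<lambda>z. f z - g z) = (\<lambda>z. lap f z - lap g z)"
  using pd_add[of f "\<lambda>z. (-1) * g z"] lap_add[of f "\<lambda>z. (-1) * g z"] pd_scale[of g "-1"] lap_scale[of g "-1"] assms
    Pol_scale[of g "-1"] by simp_all

section \<open>The discrete spaces\<close>

lemma VN_iff: "p \<in> VN N \<longleftrightarrow> degree p \<le> N \<and> poly p 1 = 0 \<and> poly p (-1) = 0"
  by (auto simp: VN_def PN_iff_degree)

lemma VN2_alt: "VN2 N = {f. \<exists>(n::nat) p q. (\<forall>k<n. p k \<in> VN N \<and> q k \<in> VN N) \<and> f = (\<lambda>z. \<Sum>k<n. tp (p k) (q k) z)}"
  unfolding VN2_def by (simp add: case_prod_unfold tp_eq)

lemma VN2_Pol: "f \<in> VN2 N \<Longrightarrow> f \<in> Pol"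
  unfolding VN2_alt Pol_def by blast

lemma VN2_induct [consumes 1, case_names zero add]:
  assumes "f \<in> VN2 N" "P (\<lambda>z. 0)"
    and "\<And>f p q. f \<in> VN2 N \<Longrightarrow> p \<in> VN N \<Longrightarrow> q \<in> VN N \<Longrightarrow> P f \<Longrightarrow> P (\<lambda>z. f z + tp p q z)"
  shows "P f"
proof -
  have "(\<forall>k<n. p k \<in> VN N \<and> q k \<in> VN N) \<Longrightarrow> P (\<lambda>z. \<Sum>k<n. tp (p k) (q k) z)" for n :: nat and p q
  proof (induction n)
    case (Suc n)
    have "(\<lambda>z. \<Sum>k<n. tp (p k) (q k) z) \<in> VN2 N" using Suc.prems unfolding VN2_alt
      by (intro CollectI exI[of _ n] exI[of _ p] exI[of _ q]) auto
    from assms(3)[OF this, of "p n" "q n"] Suc show ?case by simp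
  qed (simp add: assms(2))
  then show ?thesis using assms(1) unfolding VN2_alt by blast
qed

lemma VN2_zero [simp]: "(\<lambda>z. 0) \<in> VN2 N"
  unfolding VN2_alt by (intro CollectI exI[of _ 0]) auto

lemma VN2_add_tp: "f \<in> VN2 N \<Longrightarrow> p \<in> VN N \<Longrightarrow> q \<in> VN N \<Longrightarrow> (\<lambda>z. f z + tp p q z) \<in> VN2 N"
proof -
  assume "f \<in> VN2 N" and pq: "p \<in> VN N" "q \<in> VN N"
  then obtain n :: nat and a b where n: "\<forall>k<n. a k \<in> VN N \<and> b k \<in> VN N"
    and f: "f = (\<lambda>z. \<Sum>k<n. tp (a k) (b k) z)" unfolding VN2_alt by blast
  show ?thesis unfolding VN2_alt f using n pq
    by (intro CollectI exI[of _ "Suc n"] exI[of _ "a(n := p)"] exI[of _ "b(n := q)"])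
       (auto simp: fun_eq_iff less_Suc_eq)
qed

lemma VN2_tp: "p \<in> VN N \<Longrightarrow> q \<in> VN N \<Longrightarrow> tp p q \<in> VN2 N"
  using VN2_add_tp[OF VN2_zero, of p N q] by simp

lemma VN2_add:
  assumes "f \<in> VN2 N" "g \<in> VN2 N"
  shows "(\<lambda>z. f z + g z) \<in> VN2 N"
  using assms(2)
proof (induction g rule: VN2_induct)
  case (add g p q)
  then show ?case using VN2_add_tp[of "\<lambda>z. f z + g z" N p q] by (simp add: add.assoc)
qed (use assms in auto)

lemma VN_smult: "p \<in> VN N \<Longrightarrow> smult c p \<in> VN N"
  by (auto simp: VN_iff intro: order_trans[OF degree_smult_le])

lemma VN2_scale: "f \<in> VN2 N \<Longrightarrow> (\<lambda>z. c * f z) \<in> VN2 N"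
proof (induction f rule: VN2_induct)
  case (add f p q)
  then show ?case using VN2_add_tp[of "\<lambda>z. c * f z" N "smult c p" q] VN_smult
    by (simp add: distrib_left tp_smult_left)
qed auto

lemma VN2_sum: "(\<And>i. i \<in> I \<Longrightarrow> f i \<in> VN2 N) \<Longrightarrow> (\<lambda>z. \<Sum>i\<in>I. f i z) \<in> VN2 N"
  by (induction I rule: infinite_finite_induct) (auto simp: VN2_add)

lemma VN2_lin: "(\<And>i. i \<in> I \<Longrightarrow> f i \<in> VN2 N) \<Longrightarrow> (\<lambda>z. \<Sum>i\<in>I. a i * f i z) \<in> VN2 N"
  by (intro VN2_sum VN2_scale)

lemma VN2_diff: "f \<in> VN2 N \<Longrightarrow> g \<in> VN2 N \<Longrightarrow> (\<lambda>z. f z - g z) \<in> VN2 N"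
  using VN2_add[of f N "\<lambda>z. (-1) * g z"] VN2_scale[of g N "-1"] by simp

lemma VN2_mono: "f \<in> VN2 N \<Longrightarrow> N \<le> M \<Longrightarrow> f \<in> VN2 M"
proof (induction f rule: VN2_induct)
  case (add f p q)
  then show ?case by (intro VN2_add_tp) (auto simp: VN_iff)
qed auto

section \<open>Weak derivatives tested against polynomials\<close>

text \<open>The boundary terms vanish because of the test polynomial in \<open>XD\<close>, and because of the trace of \<open>u\<close> in \<open>XD0\<close>.\<close>

definition XD :: "sfun \<Rightarrow> sfun \<Rightarrow> bool" where
  "XD u w \<longleftrightarrow> (\<forall>p q. poly p 1 = 0 \<longrightarrow> poly p (-1) = 0 \<longrightarrow> l2_inner u (tp (pderiv p) q) = - l2_inner w (tp p q))"

definition XD0 :: "sfun \<Rightarrow> sfun \<Rightarrow> bool" where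
  "XD0 u w \<longleftrightarrow> (\<forall>p q. l2_inner u (tp (pderiv p) q) = - l2_inner w (tp p q))"

definition YD :: "sfun \<Rightarrow> sfun \<Rightarrow> bool" where
  "YD u w \<longleftrightarrow> (\<forall>p q. poly q 1 = 0 \<longrightarrow> poly q (-1) = 0 \<longrightarrow> l2_inner u (tp p (pderiv q)) = - l2_inner w (tp p q))"

definition YD0 :: "sfun \<Rightarrow> sfun \<Rightarrow> bool" where
  "YD0 u w \<longleftrightarrow> (\<forall>p q. l2_inner u (tp p (pderiv q)) = - l2_inner w (tp p q))"

lemma l2_inner_swp_tp: "u \<in> L2 \<Longrightarrow> l2_inner (swp u) (tp p q) = l2_inner u (tp q p)"
  using l2_inner_swp[of u "tp q p"] by simp

lemma swp_derivs:
  assumes "u \<in> L2" "w \<in> L2"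
  shows "XD (swp u) (swp w) \<longleftrightarrow> YD u w" "YD (swp u) (swp w) \<longleftrightarrow> XD u w"
    "XD0 (swp u) (swp w) \<longleftrightarrow> YD0 u w" "YD0 (swp u) (swp w) \<longleftrightarrow> XD0 u w"
  unfolding XD_def YD_def XD0_def YD0_def l2_inner_swp_tp[OF assms(1)] l2_inner_swp_tp[OF assms(2)]
  by blast+

lemma XD0_Pol:
  assumes "XD0 u w" "u \<in> L2" "w \<in> L2" "f \<in> Pol"
  shows "l2_inner u (pd_x f) = - l2_inner w f"
  using assms(4)
proof (induction f rule: Pol_induct)
  case (add f p q)
  then show ?case using assms
    by (simp add: pd_add pd_tp l2_inner_add_right Pol_has_vector_derivative XD0_def)
qed simp

lemma YD0_Pol:
  assumes "YD0 u w" "u \<in> L2" "w \<in> L2" "f \<in> Pol"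
  shows "l2_inner u (pd_y f) = - l2_inner w f"
  using assms(4)
proof (induction f rule: Pol_induct)
  case (add f p q)
  then show ?case using assms
    by (simp add: pd_add pd_tp l2_inner_add_right Pol_has_vector_derivative YD0_def)
qed simp

lemma XD_VN2:
  assumes "XD u w" "u \<in> L2" "w \<in> L2" "f \<in> VN2 N"
  shows "l2_inner u (pd_x f) = - l2_inner w f"
  using assms(4)
proof (induction f rule: VN2_induct)
  case (add f p q)
  then show ?case using assms VN2_Pol[OF add(1)]
    by (simp add: pd_add pd_tp l2_inner_add_right Pol_has_vector_derivative XD_def VN_iff)
qed simp

lemma YD_VN2:
  assumes "YD u w" "u \<in> L2" "w \<in> L2" "f \<in> VN2 N"
  shows "l2_inner u (pd_y f) = - l2_inner w f"
  using assms(4)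
proof (induction f rule: VN2_induct)
  case (add f p q)
  then show ?case using assms VN2_Pol[OF add(1)]
    by (simp add: pd_add pd_tp l2_inner_add_right Pol_has_vector_derivative YD_def VN_iff)
qed simp

lemma l2_inner_tp_parts:
  "poly (p * cnjp r) 1 = 0 \<Longrightarrow> poly (p * cnjp r) (-1) = 0 \<Longrightarrow>
     l2_inner (tp p q) (tp (pderiv r) s) = - l2_inner (tp (pderiv p) q) (tp r s)"
  "poly (q * cnjp s) 1 = 0 \<Longrightarrow> poly (q * cnjp s) (-1) = 0 \<Longrightarrow>
     l2_inner (tp p q) (tp r (pderiv s)) = - l2_inner (tp p (pderiv q)) (tp r s)"
  by (simp_all add: l2_inner_tp cnjp_pderiv pint_by_parts)

lemma VN2_XD0:
  assumes "f \<in> VN2 N"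
  shows "XD0 f (pd_x f)" "YD0 f (pd_y f)"
proof -
  have "XD0 f (pd_x f) \<and> YD0 f (pd_y f)"
    using assms
  proof (induction f rule: VN2_induct)
    case (add f p q)
    have "l2_inner (tp p q) (tp (pderiv r) s) = - l2_inner (tp (pderiv p) q) (tp r s)"
      "l2_inner (tp p q) (tp r (pderiv s)) = - l2_inner (tp p (pderiv q)) (tp r s)" for r s
      using add(2,3) by (auto intro!: l2_inner_tp_parts simp: VN_iff)
    then show ?case using add VN2_Pol[OF add(1)]
      by (simp add: XD0_def YD0_def pd_add pd_tp l2_inner_add_left Pol_has_vector_derivative)
  qed (simp_all add: XD0_def YD0_def)
  then show "XD0 f (pd_x f)" "YD0 f (pd_y f)" by auto
qed

lemma Pol_XD:
  assumes "f \<in> Pol"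
  shows "XD f (pd_x f)" "YD f (pd_y f)"
proof -
  have "XD f (pd_x f) \<and> YD f (pd_y f)"
    using assms
  proof (induction f rule: Pol_induct)
    case (add f p q)
    have "poly r 1 = 0 \<Longrightarrow> poly r (-1) = 0 \<Longrightarrow> l2_inner (tp p q) (tp (pderiv r) s) = - l2_inner (tp (pderiv p) q) (tp r s)"
      "poly s 1 = 0 \<Longrightarrow> poly s (-1) = 0 \<Longrightarrow> l2_inner (tp p q) (tp r (pderiv s)) = - l2_inner (tp p (pderiv q)) (tp r s)" for r s
      by (auto intro!: l2_inner_tp_parts simp: poly_cnjp_pm1)
    then show ?case using add
      by (simp add: XD_def YD_def pd_add pd_tp l2_inner_add_left Pol_has_vector_derivative)
  qed (simp_all add: XD_def YD_def)
  then show "XD f (pd_x f)" "YD f (pd_y f)" by auto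
qed

section \<open>Approximation by Legendre expansions\<close>

definition LL :: "nat \<times> nat \<Rightarrow> sfun" where
  "LL i = tp (legendre (fst i)) (legendre (snd i))"

text \<open>The index set is a parameter so that a polynomial can be split by frequency; by
  orthogonality each part has a norm no larger than the whole.\<close>

definition PS :: "(nat \<times> nat) set \<Rightarrow> (nat \<times> nat \<Rightarrow> complex) \<Rightarrow> sfun" where
  "PS I G = (\<lambda>z. \<Sum>i\<in>I. G i * LL i z)"

definition hw :: "nat \<times> nat \<Rightarrow> real" where "hw i = hh (fst i) * hh (snd i)"

lemma hw_pos: "hw i > 0"
  by (simp add: hw_def hh_pos)

lemma LL_Pol [simp]: "LL i \<in> Pol"
  by (simp add: LL_def)

lemma LL_L2 [simp]: "LL i \<in> L2"
  by simp

lemma PS_Pol [simp]: "PS I G \<in> Pol"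
  unfolding PS_def by (intro Pol_lin) simp

lemma PS_L2 [simp]: "PS I G \<in> L2"
  by simp

lemma swp_LL: "swp (LL i) = LL (prod.swap i)"
  by (simp add: LL_def)

lemma swp_PS: "swp (PS I G) = PS (prod.swap ` I) (G \<circ> prod.swap)"
proof -
  have "swp (PS I G) = (\<lambda>z. \<Sum>i\<in>I. G i * swp (LL i) z)"
    by (simp add: swp_def PS_def)
  also have "\<dots> = (\<lambda>z. \<Sum>i\<in>prod.swap ` I. G (prod.swap i) * LL i z)"
    by (subst sum.reindex) (auto simp: inj_on_def swp_LL)
  finally show ?thesis by (simp add: PS_def)
qed

lemma l2_inner_LL: "l2_inner (LL i) (LL j) = (if i = j then of_real (hw i) else 0)"
  by (simp add: LL_def l2_inner_tp pint_legendre hw_def prod_eq_iff)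

lemma l2_inner_PS_left: "w \<in> L2 \<Longrightarrow> l2_inner (PS I G) w = (\<Sum>i\<in>I. G i * l2_inner (LL i) w)"
  unfolding PS_def by (intro l2_inner_lin_left) auto

lemma l2_inner_PS_right: "w \<in> L2 \<Longrightarrow> l2_inner w (PS I G) = (\<Sum>i\<in>I. cnj (G i) * l2_inner w (LL i))"
  unfolding PS_def by (intro l2_inner_lin_right) auto

lemma l2_norm_PS:
  assumes "finite I"
  shows "(l2_norm (PS I G))\<^sup>2 = (\<Sum>i\<in>I. (cmod (G i))\<^sup>2 * hw i)"
proof -
  have "l2_inner (PS I G) (PS I G) = (\<Sum>i\<in>I. G i * cnj (G i) * of_real (hw i))"
    unfolding PS_def using assms by (intro l2_inner_biorthogonal) (auto simp: l2_inner_LL)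
  also have "\<dots> = of_real (\<Sum>i\<in>I. (cmod (G i))\<^sup>2 * hw i)"
    by (simp add: complex_norm_square del: of_real_power)
  finally show ?thesis unfolding l2_norm_sq_complex of_real_eq_iff .
qed

lemma l2_norm_PS_mono:
  assumes "finite I" "I' \<subseteq> I"
  shows "l2_norm (PS I' G) \<le> l2_norm (PS I G)"
proof (rule power2_le_imp_le)
  show "(l2_norm (PS I' G))\<^sup>2 \<le> (l2_norm (PS I G))\<^sup>2"
    using assms finite_subset[OF assms(2,1)] hw_pos
    by (simp add: l2_norm_PS) (intro sum_mono2, auto simp: less_imp_le)
qed simp

lemma PS_split:
  assumes "finite I"
  shows "PS I G = (\<lambda>z. PS {i\<in>I. P i} G z + PS {i\<in>I. \<not> P i} G z)"
proof
  fix z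
  have "(\<Sum>i\<in>I. G i * LL i z) = (\<Sum>i\<in>{i\<in>I. P i} \<union> {i\<in>I. \<not> P i}. G i * LL i z)"
    by (rule sum.cong) auto
  also have "\<dots> = PS {i\<in>I. P i} G z + PS {i\<in>I. \<not> P i} G z"
    unfolding PS_def using assms by (intro sum.union_disjoint) auto
  finally show "PS I G z = PS {i\<in>I. P i} G z + PS {i\<in>I. \<not> P i} G z"
    by (simp add: PS_def)
qed

lemma PS_extend:
  assumes "finite I'" "I \<subseteq> I'"
  shows "PS I G = PS I' (\<lambda>i. if i \<in> I then G i else 0)"
  unfolding PS_def
proof
  fix z show "(\<Sum>i\<in>I. G i * LL i z) = (\<Sum>i\<in>I'. (if i \<in> I then G i else 0) * LL i z)"
    using assms by (intro sum.mono_neutral_cong_left) auto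
qed

lemma PS_add: "PS I G z + PS I G' z = PS I (\<lambda>i. G i + G' i) z"
  by (simp add: PS_def distrib_right sum.distrib)

lemma tp_PS: "\<exists>G. tp p q = PS ({..degree p} \<times> {..degree q}) G"
proof -
  obtain a where a: "p = (\<Sum>k\<le>degree p. smult (a k) (legendre k))" using legendre_expansion by blast
  obtain b where b: "q = (\<Sum>k\<le>degree q. smult (b k) (legendre k))" using legendre_expansion by blast
  have "tp p q = PS ({..degree p} \<times> {..degree q}) (\<lambda>i. a (fst i) * b (snd i))"
  proof
    fix z
    have "tp p q z = poly (\<Sum>k\<le>degree p. smult (a k) (legendre k)) (of_real (fst z))
        * poly (\<Sum>k\<le>degree q. smult (b k) (legendre k)) (of_real (snd z))"
      unfolding a[symmetric] b[symmetric] by (rule tp_eq)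
    also have "\<dots> = PS ({..degree p} \<times> {..degree q}) (\<lambda>i. a (fst i) * b (snd i)) z"
      unfolding PS_def poly_sum sum_product sum.cartesian_product
      by (intro sum.cong) (auto simp: LL_def tp_eq)
    finally show "tp p q z = PS ({..degree p} \<times> {..degree q}) (\<lambda>i. a (fst i) * b (snd i)) z" .
  qed
  then show ?thesis by blast
qed

lemma lin_tp_PS:
  assumes "finite A" "\<And>a. a \<in> A \<Longrightarrow> degree (p a) \<le> m" "\<And>a. a \<in> A \<Longrightarrow> degree (q a) \<le> n"
  shows "\<exists>G. (\<lambda>z. \<Sum>a\<in>A. c a * tp (p a) (q a) z) = PS ({..m} \<times> {..n}) G"
  using assms
proof (induction A rule: finite_induct)
  case empty
  have "(\<lambda>z. 0) = PS ({..m} \<times> {..n}) (\<lambda>i. 0)" by (simp add: PS_def)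
  then show ?case by auto
next
  case (insert a A)
  then obtain G where G: "(\<lambda>z. \<Sum>a\<in>A. c a * tp (p a) (q a) z) = PS ({..m} \<times> {..n}) G" by auto
  obtain H where H: "tp (smult (c a) (p a)) (q a) = PS ({..degree (smult (c a) (p a))} \<times> {..degree (q a)}) H"
    using tp_PS by blast
  have "degree (smult (c a) (p a)) \<le> m" "degree (q a) \<le> n"
    using insert.prems order_trans[OF degree_smult_le] by auto
  then have "{..degree (smult (c a) (p a))} \<times> {..degree (q a)} \<subseteq> {..m} \<times> {..n}" by auto
  from H[unfolded PS_extend[OF _ this, of H, OF finite_cartesian_product[OF finite_atMost finite_atMost]]]
  obtain H' where H': "(\<lambda>z. c a * tp (p a) (q a) z) = PS ({..m} \<times> {..n}) H'"
    unfolding tp_smult_left by blast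
  have "(\<lambda>z. \<Sum>a\<in>insert a A. c a * tp (p a) (q a) z)
     = (\<lambda>z. (\<lambda>z. c a * tp (p a) (q a) z) z + (\<lambda>z. \<Sum>a\<in>A. c a * tp (p a) (q a) z) z)"
    using insert by simp
  also have "\<dots> = PS ({..m} \<times> {..n}) (\<lambda>i. H' i + G i)"
    using fun_cong[OF G] fun_cong[OF H'] by (simp add: fun_eq_iff flip: PS_add)
  finally show ?case by blast
qed

lemma Pol_PS:
  assumes "f \<in> Pol"
  shows "\<exists>M G. f = PS ({..M} \<times> {..M}) G"
proof -
  obtain n :: nat and p q where f: "f = (\<lambda>z. \<Sum>k<n. 1 * tp (p k) (q k) z)"
    using assms by (auto simp: Pol_def)
  \<comment> \<open>The sum of all degrees is a crude common bound, convenient because every single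
    degree is one of its summands.\<close>
  define M where "M = (\<Sum>k<n. degree (p k) + degree (q k))"
  have "degree (p k) + degree (q k) \<le> M" if "k < n" for k
    unfolding M_def using that by (intro member_le_sum) auto
  then have "degree (p k) \<le> M" "degree (q k) \<le> M" if "k \<in> {..<n}" for k
    using that by (fastforce)+
  then have "\<exists>G. (\<lambda>z. \<Sum>k<n. 1 * tp (p k) (q k) z) = PS ({..M} \<times> {..M}) G"
    by (intro lin_tp_PS) auto
  then show ?thesis unfolding f by blast
qed

text \<open>Applying \<open>pderiv_J\<close> \<open>s\<close> times moves the \<open>s\<close> derivatives of \<open>g\<close> onto the Legendre coefficients; the
  weighted derivatives of the Legendre polynomials remain orthogonal, so the coefficients decay like \<open>N\<^sup>-\<^sup>s\<close>.\<close>

lemma high_frequency_y: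
  assumes g: "\<And>i. i \<le> s \<Longrightarrow> g i \<in> L2" "\<And>i. i < s \<Longrightarrow> YD (g i) (g (Suc i))"
    and I: "finite I" "\<And>i. i \<in> I \<Longrightarrow> snd i \<ge> N" and N: "N \<ge> 1" "s \<le> 1 \<or> N \<ge> 2 * s"
  shows "cmod (l2_inner (g 0) (PS I G)) \<le> (2 / real N) ^ s * l2_norm (g s) * l2_norm (PS I G)"
proof -
  define w where "w i = cc (snd i) s" for i :: "nat \<times> nat"
  have wlow: "w i \<ge> (real N / 2) ^ (2 * s)" if "i \<in> I" for i
    unfolding w_def using I(2)[OF that] N by (intro cc_lower) auto
  have wpos: "w i > 0" if "i \<in> I" for i
    using wlow[OF that] N by (meson divide_pos_pos less_le_trans of_nat_0_less_iff zero_less_numeral zero_less_power le_numeral_extra(4) zero_less_one)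
  have chain: "of_real (cc n r) * l2_inner (g 0) (tp p (legendre n)) = l2_inner (g r) (tp p (J r n))"
    if "r \<le> s" for r n p
    using that
  proof (induction r)
    case 0
    then show ?case by (simp add: cc_def J_def)
  next
    case (Suc r)
    have "l2_inner (g r) (tp p (pderiv (J (Suc r) n))) = - l2_inner (g (Suc r)) (tp p (J (Suc r) n))"
      using g(2)[of r] Suc.prems J_boundary[of "Suc r" n] unfolding YD_def by auto
    then have "of_real (kap n r) * l2_inner (g r) (tp p (J r n)) = l2_inner (g (Suc r)) (tp p (J (Suc r) n))"
      unfolding pderiv_J tp_smult_right l2_inner_scale_right by simp
    then show ?case using Suc by (simp add: cc_def mult_ac)
  qed
  define F where "F i = tp (legendre (fst i)) (J s (snd i))" for i :: "nat \<times> nat"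
  define D where "D i = tp (legendre (fst i)) ((pderiv ^^ s) (legendre (snd i)))" for i :: "nat \<times> nat"
  \<comment> \<open>The coefficients are divided by the eigenvalue products, so that pairing
    \<open>g s\<close> with \<open>W\<close> reproduces the pairing of \<open>g 0\<close> with the
    original sum. It remains to show that this division makes the norm small.\<close>
  define W where "W = (\<lambda>z. \<Sum>i\<in>I. (G i / of_real (w i)) * F i z)"
  define X1 where "X1 = (\<lambda>z. \<Sum>i\<in>I. (G i / of_real (w i)) * D i z)"
  have FD: "F i \<in> L2" "D i \<in> L2" for i by (simp_all add: F_def D_def)
  have WX: "W \<in> L2" "X1 \<in> L2" "W \<in> Pol" "X1 \<in> Pol"
  proof -
    show 1: "W \<in> Pol" "X1 \<in> Pol"
      unfolding W_def X1_def by (rule Pol_lin, simp add: F_def D_def)+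
    then show "W \<in> L2" "X1 \<in> L2" by simp_all
  qed
  have "l2_inner (g 0) (PS I G) = (\<Sum>i\<in>I. cnj (G i) * l2_inner (g 0) (LL i))"
    using g(1)[of 0] by (simp add: l2_inner_PS_right)
  also have "\<dots> = (\<Sum>i\<in>I. cnj (G i / of_real (w i)) * l2_inner (g s) (F i))"
  proof (rule sum.cong)
    fix i assume i: "i \<in> I"
    have "of_real (w i) * l2_inner (g 0) (LL i) = l2_inner (g s) (F i)"
      using chain[of s "snd i" "legendre (fst i)"] by (simp add: w_def LL_def F_def)
    then show "cnj (G i) * l2_inner (g 0) (LL i) = cnj (G i / of_real (w i)) * l2_inner (g s) (F i)"
      using wpos[OF i] by (auto simp: field_simps)
  qed simp
  also have "\<dots> = l2_inner (g s) W"
    unfolding W_def using g(1)[of s] FD by (subst l2_inner_lin_right) auto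
  finally have 1: "cmod (l2_inner (g 0) (PS I G)) \<le> l2_norm (g s) * l2_norm W"
    using l2_cauchy_schwarz[OF g(1)[of s] WX(1)] by simp
  have WXz: "W z = of_real ((1 - (snd z)\<^sup>2) ^ s) * X1 z" for z
    unfolding W_def X1_def sum_distrib_left
    by (intro sum.cong) (auto simp: F_def D_def tp_eq J_def)
  \<comment> \<open>The weight \<open>a\<close> lies between 0 and 1, hence
    \<open>a^2 \<le> a\<close>. This replaces the norm of \<open>W\<close>, whose terms need not be
    orthogonal, by the diagonal pairing of \<open>W\<close> with \<open>X1\<close>.\<close>
  have pt: "(cmod (W z))\<^sup>2 \<le> Re (W z * cnj (X1 z))" if "z \<in> Sq" for z
  proof -
    define a where "a = (1 - (snd z)\<^sup>2) ^ s"
    have "0 \<le> 1 - (snd z)\<^sup>2" "1 - (snd z)\<^sup>2 \<le> 1"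
      using that by (auto simp: Sq_def abs_square_le_1)
    then have a: "0 \<le> a" "a \<le> 1" unfolding a_def by (auto intro: power_le_one)
    have "(cmod (W z))\<^sup>2 = a * (a * (cmod (X1 z))\<^sup>2)"
      unfolding WXz a_def[symmetric] by (simp add: norm_mult power_mult_distrib power2_eq_square)
    also have "\<dots> \<le> 1 * (a * (cmod (X1 z))\<^sup>2)"
      using a by (intro mult_right_mono) auto
    also have "\<dots> = Re (W z * cnj (X1 z))"
      unfolding WXz a_def[symmetric] by (simp add: mult.assoc complex_mult_cnj cmod_power2)
    finally show ?thesis .
  qed
  have "(l2_norm W)\<^sup>2 \<le> Re (l2_inner W X1)"
  proof -
    have i: "integrable MS (\<lambda>z. W z * cnj (X1 z))" using WX by (intro L2_mult_integrable)
    have "(l2_norm W)\<^sup>2 \<le> (LINT z|MS. Re (W z * cnj (X1 z)))"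
      unfolding l2_norm_sq
    proof (rule integral_mono_AE)
      show "integrable MS (\<lambda>z. Re (W z * cnj (X1 z)))" using i by (rule integrable_Re)
      show "AE z in MS. (cmod (W z))\<^sup>2 \<le> Re (W z * cnj (X1 z))" by (rule AE_I2) (use pt in simp)
    qed (intro L2_integrable_sq WX)
    also have "\<dots> = Re (l2_inner W X1)" unfolding l2_inner_def using i by (rule integral_Re)
    finally show ?thesis .
  qed
  also have "l2_inner W X1 = (\<Sum>i\<in>I. (G i / of_real (w i)) * cnj (G i / of_real (w i)) * of_real (w i * hw i))"
    unfolding W_def X1_def
  proof (rule l2_inner_biorthogonal)
    fix i j
    show "l2_inner (F i) (D j) = (if i = j then of_real (w i * hw i) else 0)"
      by (auto simp: F_def D_def l2_inner_tp pint_J_legendre pint_legendre hw_def w_def prod_eq_iff)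
  qed (use I FD in auto)
  also have "\<dots> = of_real (\<Sum>i\<in>I. (cmod (G i))\<^sup>2 * hw i / w i)"
    unfolding of_real_sum
  proof (rule sum.cong)
    fix i assume i: "i \<in> I"
    have "G i / of_real (w i) * cnj (G i / of_real (w i)) = of_real ((cmod (G i) / w i)\<^sup>2)"
    proof -
      have "cmod (G i / of_real (w i)) = cmod (G i) / w i"
        using wpos[OF i] by (simp add: norm_divide)
      then show ?thesis by (metis complex_norm_square)
    qed
    then show "G i / of_real (w i) * cnj (G i / of_real (w i)) * of_real (w i * hw i) = of_real ((cmod (G i))\<^sup>2 * hw i / w i)"
      using wpos[OF i] by (simp only: of_real_mult[symmetric]) (simp add: power2_eq_square)
  qed simp
  also have "Re \<dots> = (\<Sum>i\<in>I. (cmod (G i))\<^sup>2 * hw i / w i)" by simp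
  also have "\<dots> \<le> (\<Sum>i\<in>I. (2 / real N) ^ (2 * s) * ((cmod (G i))\<^sup>2 * hw i))"
  proof (rule sum_mono)
    fix i assume i: "i \<in> I"
    have p: "(real N / 2) ^ (2 * s) > 0" using N by simp
    have "inverse (w i) \<le> inverse ((real N / 2) ^ (2 * s))"
      using wlow[OF i] p by (intro le_imp_inverse_le) auto
    then have "1 / w i \<le> (2 / real N) ^ (2 * s)"
      by (simp add: power_divide inverse_eq_divide)
    then have "(1 / w i) * ((cmod (G i))\<^sup>2 * hw i) \<le> (2 / real N) ^ (2 * s) * ((cmod (G i))\<^sup>2 * hw i)"
      using hw_pos[of i] by (intro mult_right_mono) auto
    then show "(cmod (G i))\<^sup>2 * hw i / w i \<le> (2 / real N) ^ (2 * s) * ((cmod (G i))\<^sup>2 * hw i)" by simp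
  qed
  also have "\<dots> = ((2 / real N) ^ s * l2_norm (PS I G))\<^sup>2"
    using I by (simp add: l2_norm_PS power_mult_distrib power_mult sum_distrib_left flip: power_mult)
       (simp add: mult.commute)
  finally have "l2_norm W \<le> (2 / real N) ^ s * l2_norm (PS I G)"
    by (rule power2_le_imp_le) simp
  then have "l2_norm (g s) * l2_norm W \<le> l2_norm (g s) * ((2 / real N) ^ s * l2_norm (PS I G))"
    by (intro mult_left_mono) auto
  with 1 show ?thesis by (simp add: mult_ac)
qed

lemma high_frequency_x:
  assumes g: "\<And>i. i \<le> s \<Longrightarrow> g i \<in> L2" "\<And>i. i < s \<Longrightarrow> XD (g i) (g (Suc i))"
    and I: "finite I" "\<And>i. i \<in> I \<Longrightarrow> fst i \<ge> N" and N: "N \<ge> 1" "s \<le> 1 \<or> N \<ge> 2 * s"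
  shows "cmod (l2_inner (g 0) (PS I G)) \<le> (2 / real N) ^ s * l2_norm (g s) * l2_norm (PS I G)"
proof -
  have "cmod (l2_inner (swp (g 0)) (PS (prod.swap ` I) (G \<circ> prod.swap)))
     \<le> (2 / real N) ^ s * l2_norm (swp (g s)) * l2_norm (PS (prod.swap ` I) (G \<circ> prod.swap))"
    by (rule high_frequency_y[where g = "\<lambda>i. swp (g i)"]) (use assms in \<open>auto simp: swp_derivs\<close>)
  then show ?thesis
    using g(1)[of 0] g(1)[of s] by (simp add: l2_inner_swp l2_norm_swp flip: swp_PS)
qed

section \<open>Approximating the gradient of a function with zero trace\<close>

lemma l2_inner_PS_disjoint:
  assumes "I \<inter> I' = {}"
  shows "l2_inner (PS I G) (PS I' H) = 0"
proof -
  have "l2_inner (LL i) (PS I' H) = 0" if "i \<in> I" for i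
    using assms that by (auto simp: l2_inner_PS_right l2_inner_LL intro!: sum.neutral)
  then show ?thesis by (simp add: l2_inner_PS_left)
qed

text \<open>No end condition is imposed on \<open>p\<close> or \<open>q\<close>, so this says that
  the x-derivative of \<open>u\<close> has zero trace on the horizontal sides. For \<open>p\<close>
  vanishing at the ends it is a chain of three integrations by parts; the general case is a limit of
  these, because neither side involves a derivative of \<open>p\<close>.\<close>

lemma mixed_derivative:
  assumes "u \<in> L2" "ux \<in> L2" "uy \<in> L2" "uxy \<in> L2" "XD0 u ux" "YD0 u uy" "XD uy uxy"
  shows "l2_inner uxy (tp p q) = - l2_inner ux (tp p (pderiv q))"
proof -
  have V: "l2_inner uxy (tp p q) = - l2_inner ux (tp p (pderiv q))" if "poly p 1 = 0" "poly p (-1) = 0" for p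
  proof -
    have "l2_inner uxy (tp p q) = - l2_inner uy (tp (pderiv p) q)"
      using assms(7) that unfolding XD_def by simp
    also have "\<dots> = l2_inner u (tp (pderiv p) (pderiv q))"
      using assms(6) unfolding YD0_def by simp
    also have "\<dots> = - l2_inner ux (tp p (pderiv q))"
      using assms(5) unfolding XD0_def by simp
    finally show ?thesis .
  qed
  \<comment> \<open>The factor \<open>1 - x^(2n+2)\<close> vanishes at both ends, is bounded by 2,
    and tends to 1 in the open interval. It turns any polynomial into an admissible one at no cost
    in the limit.\<close>
  define r where "r n = p * (1 - X ^ (2 * Suc n))" for n :: nat
  have rz: "poly (r n) 1 = 0" "poly (r n) (-1) = 0" for n by (simp_all add: r_def)
  have lim: "(\<lambda>n. l2_norm (\<lambda>z. tp (r n) q z - tp p q z)) \<longlonglongrightarrow> 0" for q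
  proof (rule l2_dominated_convergence[where w = "\<lambda>z. 2 * tp p q z"])
    show "AE z in MS. (\<lambda>n. tp (r n) q z) \<longlonglongrightarrow> tp p q z"
    proof (rule AE_I2)
      fix z :: "real \<times> real" assume "z \<in> space MS"
      then have z: "\<bar>fst z\<bar> < 1" by (auto simp: Sq_def)
      define s where "s = complex_of_real ((fst z)\<^sup>2)"
      have "(fst z)\<^sup>2 < 1" using z by (simp add: abs_square_less_1)
      moreover have "cmod s = (fst z)\<^sup>2" unfolding s_def norm_of_real by simp
      ultimately have "(\<lambda>n. s ^ n) \<longlonglongrightarrow> 0" by (intro LIMSEQ_power_zero) simp
      then have "(\<lambda>n. tp p q z * (1 - s * s ^ n)) \<longlonglongrightarrow> tp p q z * (1 - s * 0)"
        by (intro tendsto_mult tendsto_diff tendsto_const)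
      moreover have "tp (r n) q z = tp p q z * (1 - s * s ^ n)" for n
        by (simp add: tp_eq r_def s_def power_mult power2_eq_square)
      ultimately show "(\<lambda>n. tp (r n) q z) \<longlonglongrightarrow> tp p q z" by simp
    qed
    show "AE z in MS. cmod (tp (r n) q z) \<le> cmod (2 * tp p q z)" for n
    proof (rule AE_I2)
      fix z :: "real \<times> real" assume "z \<in> space MS"
      then have z: "\<bar>fst z\<bar> \<le> 1" by (auto simp: Sq_def)
      define a where "a = 1 - complex_of_real (fst z) ^ (2 * Suc n)"
      have "cmod a \<le> cmod 1 + cmod (complex_of_real (fst z) ^ (2 * Suc n))"
        unfolding a_def by (rule norm_triangle_ineq4)
      also have "\<dots> = 1 + \<bar>fst z\<bar> ^ (2 * Suc n)" by (simp only: norm_power norm_of_real norm_one)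
      also have "\<dots> \<le> 2" using power_le_one[OF _ z, of "2 * Suc n"] by simp
      finally have a: "cmod a \<le> 2" .
      have "tp (r n) q z = a * tp p q z" by (simp add: tp_eq r_def a_def)
      then show "cmod (tp (r n) q z) \<le> cmod (2 * tp p q z)"
        using mult_right_mono[OF a, of "cmod (tp p q z)"] by (simp add: norm_mult)
    qed
  qed auto
  have "(\<lambda>n. l2_inner uxy (tp (r n) q)) \<longlonglongrightarrow> l2_inner uxy (tp p q)"
    by (rule l2_inner_tendsto_right[OF lim]) (use assms in auto)
  moreover have "(\<lambda>n. - l2_inner ux (tp (r n) (pderiv q))) \<longlonglongrightarrow> - l2_inner ux (tp p (pderiv q))"
    by (intro tendsto_minus l2_inner_tendsto_right[OF lim]) (use assms in auto)
  ultimately show ?thesis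
    using V[OF rz] LIMSEQ_unique by fastforce
qed

text \<open>Frequencies start at 1, since the antiderivative of \<open>L_0\<close> does not vanish
  at the right end, and stop at \<open>N - 1\<close>, since integration raises the degree by one.
  The coefficients are those of the Legendre expansion of \<open>w\<close>.\<close>

definition Vap :: "nat \<Rightarrow> sfun \<Rightarrow> sfun" where
  "Vap N w = (\<lambda>z. \<Sum>i\<in>{1..<N} \<times> {1..<N}. (l2_inner w (LL i) / of_real (hw i))
      * tp (ap (legendre (fst i))) (ap (legendre (snd i))) z)"

lemma ap_legendre_VN: "0 < j \<Longrightarrow> j < N \<Longrightarrow> ap (legendre j) \<in> VN N"
  using degree_ap[of "legendre j"] by (simp add: VN_iff degree_legendre)

lemma Vap_VN2: "Vap N w \<in> VN2 N"
  unfolding Vap_def by (intro VN2_lin VN2_tp ap_legendre_VN) auto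

lemma swp_Vap:
  assumes "w \<in> L2"
  shows "swp (Vap N w) = Vap N (swp w)"
proof
  fix z
  have *: "l2_inner (swp w) (LL (prod.swap i)) = l2_inner w (LL i)" for i
    using l2_inner_swp[OF assms LL_L2] by (simp add: swp_LL)
  have "swp (Vap N w) z = (\<Sum>i\<in>{1..<N} \<times> {1..<N}. (l2_inner w (LL i) / of_real (hw i))
      * tp (ap (legendre (snd i))) (ap (legendre (fst i))) z)"
    unfolding swp_def Vap_def by (intro sum.cong) (auto simp: tp_eq)
  also have "\<dots> = (\<Sum>i\<in>prod.swap ` ({1..<N} \<times> {1..<N}). (l2_inner (swp w) (LL i) / of_real (hw i))
      * tp (ap (legendre (fst i))) (ap (legendre (snd i))) z)"
    by (subst sum.reindex) (auto simp: inj_on_def * hw_def mult.commute)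
  also have "prod.swap ` ({1..<N} \<times> {1..<N}) = {1..<N} \<times> {1..<N}" by (simp add: product_swap)
  finally show "swp (Vap N w) z = Vap N (swp w) z" by (simp add: Vap_def)
qed

text \<open>The test polynomial is split by its x-frequency. On the part with x-frequency at least
  \<open>N\<close> the discrete function drops out, and \<open>s + 1\<close> x-derivatives beyond
  \<open>ux\<close> give the rate. The other part is integrated in y, so that the mixed derivative
  is tested. Its truncation error sees only y-frequencies of at least \<open>N\<close>, where
  \<open>s\<close> y-derivatives of \<open>uxy\<close> give \<open>s\<close> factors and the
  integration in y gives one more.\<close>

lemma approx_gradient_x:
  assumes L2: "u \<in> L2" "ux \<in> L2" "uy \<in> L2" "uxy \<in> L2"
    and D: "XD0 u ux" "YD0 u uy" "XD uy uxy"
    and a: "a 0 = ux" "\<And>i. i \<le> Suc s \<Longrightarrow> a i \<in> L2" "\<And>i. i < Suc s \<Longrightarrow> XD (a i) (a (Suc i))"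
    and b: "b 0 = uxy" "\<And>i. i \<le> s \<Longrightarrow> b i \<in> L2" "\<And>i. i < s \<Longrightarrow> YD (b i) (b (Suc i))"
    and N: "N \<ge> 1" "s = 0 \<or> N \<ge> 2 * Suc s"
    and g: "g \<in> Pol"
  shows "cmod (l2_inner (\<lambda>z. ux z - pd_x (Vap N uxy) z) g)
     \<le> (2 / real N) ^ Suc s * (l2_norm (a (Suc s)) + l2_norm (b s)) * l2_norm g"
proof -
  define I0 where "I0 = {1..<N} \<times> {1..<N}"
  define c where "c i = l2_inner uxy (LL i) / of_real (hw i)" for i
  define v where "v = Vap N uxy"
  define vx where "vx = pd_x v"
  define vxy where "vxy = PS I0 c"
  have vx: "vx = (\<lambda>z. \<Sum>i\<in>I0. c i * tp (legendre (fst i)) (ap (legendre (snd i))) z)"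
    unfolding vx_def v_def Vap_def c_def I0_def
    by (subst lin_Pol) (simp_all add: pd_tp)
  have vxP: "vx \<in> Pol" unfolding vx by (intro Pol_lin) simp
  have vxyP: "vxy \<in> Pol" by (simp add: vxy_def)
  note L2 = L2 Pol_L2[OF vxP] Pol_L2[OF vxyP]
  \<comment> \<open>Because of the zero traces all coefficients of \<open>uxy\<close> with a zero
    frequency vanish, so starting the truncation at frequency 1 loses nothing.\<close>
  have zero_left: "l2_inner uxy (tp (legendre 0) q) = 0" for q
  proof -
    have "l2_inner uxy (tp 1 q) = - l2_inner ux (tp 1 (pderiv q))"
      by (rule mixed_derivative[OF L2(1-4) D])
    also have "\<dots> = l2_inner u (tp (pderiv 1) (pderiv q))"
      using D(1)[unfolded XD0_def, rule_format, of 1 "pderiv q"] by simp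
    finally show ?thesis by simp
  qed
  have zero_right: "l2_inner uxy (tp p (legendre 0)) = 0" for p
    using mixed_derivative[OF L2(1-4) D, of p 1] by simp
  have mixv: "l2_inner vxy (tp p q) = - l2_inner vx (tp p (pderiv q))" for p q
  proof -
    have "l2_inner (tp (legendre (fst i)) (ap (legendre (snd i)))) (tp p (pderiv q))
        = - l2_inner (LL i) (tp p q)" if "i \<in> I0" for i
      unfolding LL_def using that
      by (subst l2_inner_tp_parts(2)) (auto simp: I0_def)
    then show ?thesis
      unfolding vx vxy_def PS_def
      by (subst (1 2) l2_inner_lin_left) (auto simp: sum_negf)
  qed
  have mix: "l2_inner (\<lambda>z. uxy z - vxy z) f = - l2_inner (\<lambda>z. ux z - vx z) (pd_y f)" if "f \<in> Pol" for f
    using that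
  proof (induction f rule: Pol_induct)
    case (add f p q)
    have "l2_inner (\<lambda>z. uxy z - vxy z) (tp p q) = - l2_inner (\<lambda>z. ux z - vx z) (tp p (pderiv q))"
      using mixv[of p q] mixed_derivative[OF L2(1-4) D, of p q] L2
      by (simp add: l2_inner_diff_left)
    then show ?case using add L2
      by (simp add: pd_add pd_tp l2_inner_add_right L2_diff Pol_has_vector_derivative)
  qed simp
  \<comment> \<open>The truncation error is orthogonal to every product with both frequencies below
    \<open>N\<close>: inside the truncation range by construction, for a zero frequency by the
    previous two facts.\<close>
  have low: "l2_inner (\<lambda>z. uxy z - vxy z) (LL i) = 0" if "fst i < N" "snd i < N" for i
  proof (cases "i \<in> I0")
    case True
    have "l2_inner vxy (LL i) = (\<Sum>j\<in>I0. c j * l2_inner (LL j) (LL i))"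
      unfolding vxy_def by (rule l2_inner_PS_left) simp
    also have "\<dots> = (\<Sum>j\<in>I0. if j = i then c i * of_real (hw i) else 0)"
      by (intro sum.cong) (auto simp: l2_inner_LL)
    also have "\<dots> = l2_inner uxy (LL i)"
      using True hw_pos[of i] by (simp add: I0_def c_def)
    finally show ?thesis using L2 by (simp add: l2_inner_diff_left)
  next
    case False
    then have z: "fst i = 0 \<or> snd i = 0" using that by (cases i) (auto simp: I0_def)
    have "l2_inner uxy (LL i) = 0"
      using z zero_left zero_right unfolding LL_def by auto
    moreover have "l2_inner vxy (LL i) = 0"
      unfolding vxy_def using False by (auto simp: l2_inner_PS_left l2_inner_LL intro!: sum.neutral)
    ultimately show ?thesis using L2 by (simp add: l2_inner_diff_left)
  qed
  obtain M G where g: "g = PS ({..M} \<times> {..M}) G" using Pol_PS[OF g] by blast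
  define I where "I = {..M} \<times> {..M}"
  define I1 where "I1 = {i\<in>I. fst i < N}"
  define I2 where "I2 = {i\<in>I. \<not> fst i < N}"
  have fin: "finite I" "finite I1" "finite I2" by (auto simp: I_def I1_def I2_def)
  have split: "g = (\<lambda>z. PS I1 G z + PS I2 G z)"
    unfolding g I1_def I2_def I_def[symmetric] by (rule PS_split) (rule fin)
  have n1: "l2_norm (PS I1 G) \<le> l2_norm g" and n2: "l2_norm (PS I2 G) \<le> l2_norm g"
    unfolding g I_def[symmetric] by (auto intro!: l2_norm_PS_mono simp: I1_def I2_def fin)
  \<comment> \<open>The x-derivative of the discrete function is a combination of products with
    x-frequency below \<open>N\<close>, hence orthogonal to the high part.\<close>
  have "l2_inner vx (PS I2 G) = 0"
  proof -
    have "l2_inner (tp (legendre (fst j)) (ap (legendre (snd j)))) (LL i) = 0" if "j \<in> I0" "i \<in> I2" for i j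
      using that by (auto simp: LL_def l2_inner_tp pint_legendre I0_def I2_def)
    then have "l2_inner vx (LL i) = 0" if "i \<in> I2" for i
      unfolding vx using that by (subst l2_inner_lin_left) auto
    then show ?thesis using L2 by (simp add: l2_inner_PS_right)
  qed
  then have "l2_inner (\<lambda>z. ux z - vx z) (PS I2 G) = l2_inner (a 0) (PS I2 G)"
    using L2 by (simp add: l2_inner_diff_left a(1))
  also have "cmod \<dots> \<le> (2 / real N) ^ Suc s * l2_norm (a (Suc s)) * l2_norm (PS I2 G)"
    using N by (intro high_frequency_x a fin) (auto simp: I2_def)
  also have "\<dots> \<le> (2 / real N) ^ Suc s * l2_norm (a (Suc s)) * l2_norm g"
    using n2 by (intro mult_left_mono) auto
  finally have H: "cmod (l2_inner (\<lambda>z. ux z - vx z) (PS I2 G)) \<le> (2 / real N) ^ Suc s * l2_norm (a (Suc s)) * l2_norm g" .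
  \<comment> \<open>A y-antiderivative of the low part, with the same x-frequencies. Its values on
    the boundary are irrelevant, since the trace of the x-derivative removes the boundary
    terms.\<close>
  define Q where "Q = (\<lambda>z. \<Sum>i\<in>I1. G i * tp (legendre (fst i)) (ap (legendre (snd i))) z)"
  have QP: "Q \<in> Pol" unfolding Q_def by (intro Pol_lin) simp
  have Qy: "pd_y Q = PS I1 G"
    unfolding Q_def PS_def by (subst lin_Pol) (simp_all add: pd_tp LL_def)
  have "\<exists>G'. Q = PS ({..N - 1} \<times> {..Suc M}) G'"
    unfolding Q_def
  proof (rule lin_tp_PS)
    fix i assume "i \<in> I1"
    then show "degree (legendre (fst i)) \<le> N - 1" "degree (ap (legendre (snd i))) \<le> Suc M"
      using degree_ap[of "legendre (snd i)"] by (auto simp: I1_def I_def degree_legendre)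
  qed (rule fin)
  then obtain G' where G': "Q = PS ({..N - 1} \<times> {..Suc M}) G'" by blast
  define K1 where "K1 = {i\<in>{..N - 1} \<times> {..Suc M}. snd i < N}"
  define K2 where "K2 = {i\<in>{..N - 1} \<times> {..Suc M}. \<not> snd i < N}"
  define R where "R = PS K2 G'"
  have finK: "finite K1" "finite K2" by (auto simp: K1_def K2_def)
  have Qs: "Q = (\<lambda>z. PS K1 G' z + R z)"
    unfolding G' K1_def K2_def R_def by (rule PS_split) simp
  have RP: "R \<in> Pol" by (simp add: R_def)
  \<comment> \<open>As \<open>R\<close> is the orthogonal projection of \<open>Q\<close> on high
    y-frequencies, \<open>|R|^2\<close> equals the pairing of \<open>Q\<close> with
    \<open>R\<close>. One application of the decay estimate, with the chain consisting of
    \<open>Q\<close> and its y-derivative, gains the factor \<open>2 / N\<close>.\<close>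
  have Rn: "l2_norm R \<le> (2 / real N) * l2_norm g"
  proof -
    have "l2_inner (PS K1 G') R = 0"
      unfolding R_def by (rule l2_inner_PS_disjoint) (auto simp: K1_def K2_def)
    then have QR: "l2_inner Q R = l2_inner R R"
      unfolding Qs using RP by (simp add: l2_inner_add_left)
    define h where "h i = (if i = 0 then Q else PS I1 G)" for i :: nat
    have "cmod (l2_inner (h 0) (PS K2 G')) \<le> (2 / real N) ^ 1 * l2_norm (h 1) * l2_norm (PS K2 G')"
      by (rule high_frequency_y) (use N QP Pol_XD(2)[OF QP] finK in \<open>auto simp: K2_def Qy h_def\<close>)
    then have "cmod (l2_inner Q R) \<le> (2 / real N) * l2_norm (PS I1 G) * l2_norm R"
      by (simp add: h_def R_def)
    moreover have "cmod (l2_inner R R) = (l2_norm R)\<^sup>2"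
      unfolding l2_norm_sq_complex norm_of_real by simp
    ultimately have "(l2_norm R)\<^sup>2 \<le> (2 / real N) * l2_norm (PS I1 G) * l2_norm R"
      unfolding QR by simp
    also have "\<dots> \<le> (2 / real N) * l2_norm g * l2_norm R"
      using n1 by (intro mult_right_mono mult_left_mono) auto
    finally have "l2_norm R * l2_norm R \<le> ((2 / real N) * l2_norm g) * l2_norm R"
      by (simp add: power2_eq_square)
    moreover have "0 \<le> l2_norm R" "0 \<le> (2 / real N) * l2_norm g"
      by (rule l2_norm_nonneg, intro mult_nonneg_nonneg) simp_all
    ultimately show ?thesis
      by (metis mult_le_cancel_right order_le_less not_less)
  qed
  have "l2_inner (\<lambda>z. ux z - vx z) (PS I1 G) = - l2_inner (\<lambda>z. uxy z - vxy z) Q"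
    using mix[OF QP] by (simp add: Qy)
  also have "l2_inner (\<lambda>z. uxy z - vxy z) Q = l2_inner (\<lambda>z. uxy z - vxy z) R"
  proof -
    have "l2_inner (\<lambda>z. uxy z - vxy z) (PS K1 G') = 0"
      using low N L2 by (subst l2_inner_PS_right) (auto simp: K1_def intro!: sum.neutral)
    then show ?thesis unfolding Qs using L2 RP by (simp add: l2_inner_add_right L2_diff)
  qed
  also have "l2_inner (\<lambda>z. uxy z - vxy z) R = l2_inner uxy R"
  proof -
    have "l2_inner vxy R = 0"
      unfolding R_def vxy_def by (rule l2_inner_PS_disjoint) (auto simp: I0_def K2_def)
    then show ?thesis using L2 RP by (simp add: l2_inner_diff_left)
  qed
  finally have "cmod (l2_inner (\<lambda>z. ux z - vx z) (PS I1 G)) = cmod (l2_inner (b 0) R)"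
    by (simp add: b(1))
  also have "\<dots> \<le> (2 / real N) ^ s * l2_norm (b s) * l2_norm R"
    unfolding R_def using N by (intro high_frequency_y b finK) (auto simp: K2_def)
  also have "\<dots> \<le> (2 / real N) ^ s * l2_norm (b s) * ((2 / real N) * l2_norm g)"
    using Rn by (intro mult_left_mono) auto
  finally have L: "cmod (l2_inner (\<lambda>z. ux z - vx z) (PS I1 G)) \<le> (2 / real N) ^ Suc s * l2_norm (b s) * l2_norm g"
    by (simp add: mult_ac)
  have "l2_inner (\<lambda>z. ux z - vx z) g = l2_inner (\<lambda>z. ux z - vx z) (PS I1 G) + l2_inner (\<lambda>z. ux z - vx z) (PS I2 G)"
    using L2 by (subst split, subst l2_inner_add_right) auto
  then have "cmod (l2_inner (\<lambda>z. ux z - vx z) g) \<le> cmod (l2_inner (\<lambda>z. ux z - vx z) (PS I1 G)) + cmod (l2_inner (\<lambda>z. ux z - vx z) (PS I2 G))"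
    by (metis norm_triangle_ineq)
  with H L show ?thesis
    unfolding vx_def v_def distrib_left distrib_right by linarith
qed

lemma Pol_swp: "f \<in> Pol \<Longrightarrow> swp f \<in> Pol"
proof (induction f rule: Pol_induct)
  case (add f p q)
  have "swp (\<lambda>z. f z + tp p q z) = (\<lambda>z. swp f z + swp (tp p q) z)" by (simp add: swp_def)
  then show ?case using add Pol_add_tp[of "swp f" q p] by simp
qed (simp add: swp_def)

lemma pd_swp: "pd_x (swp f) = swp (pd_y f)"
  by (auto simp: pd_x_def pd_y_def swp_def fun_eq_iff)

text \<open>The squared norm is a sum of squared Legendre coefficients with positive weights. This
  upgrades vanishing in norm to vanishing at every point, as needed for identities between discrete
  functions.\<close>

lemma Pol_null:
  assumes "f \<in> Pol" "l2_norm f = 0"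
  shows "f = (\<lambda>z. 0)"
proof -
  obtain M G where f: "f = PS ({..M} \<times> {..M}) G" using Pol_PS[OF assms(1)] by blast
  have "(\<Sum>i\<in>{..M} \<times> {..M}. (cmod (G i))\<^sup>2 * hw i) = 0"
    using l2_norm_PS[of "{..M} \<times> {..M}" G] assms(2) f by simp
  then have "\<forall>i\<in>{..M} \<times> {..M}. (cmod (G i))\<^sup>2 * hw i = 0"
    using hw_pos by (subst (asm) sum_nonneg_eq_0_iff) (auto simp: less_imp_le)
  then have "\<forall>i\<in>{..M} \<times> {..M}. G i = 0" using hw_pos by (metis less_irrefl mult_eq_0_iff norm_eq_zero zero_eq_power2)
  then show ?thesis unfolding f PS_def by (auto intro!: sum.neutral)
qed

text \<open>The gradient form with classical derivatives. It is linear on polynomials by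
  computation, while \<open>grad_inner\<close> is built from chosen representatives of weak
  derivatives.\<close>

definition ga :: "sfun \<Rightarrow> sfun \<Rightarrow> complex" where
  "ga u v = l2_inner (pd_x u) (pd_x v) + l2_inner (pd_y u) (pd_y v)"

lemma pd_L2 [simp]: "f \<in> Pol \<Longrightarrow> pd_x f \<in> L2" "f \<in> Pol \<Longrightarrow> pd_y f \<in> L2" "f \<in> Pol \<Longrightarrow> lap f \<in> L2"
  by (simp_all add: Pol_has_vector_derivative lap_Pol)

lemma ga_commute: "ga v u = cnj (ga u v)"
  unfolding ga_def using l2_inner_commute[of "pd_x v" "pd_x u"] l2_inner_commute[of "pd_y v" "pd_y u"] by simp

lemma ga_lin_left:
  assumes "\<And>i. i \<in> I \<Longrightarrow> f i \<in> Pol" "w \<in> Pol"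
  shows "ga (\<lambda>z. \<Sum>i\<in>I. a i * f i z) w = (\<Sum>i\<in>I. a i * ga (f i) w)"
  unfolding ga_def using assms
  by (simp add: lin_Pol l2_inner_lin_left sum.distrib distrib_left)

lemma ga_diff_left:
  assumes "u \<in> Pol" "v \<in> Pol" "w \<in> Pol"
  shows "ga (\<lambda>z. u z - v z) w = ga u w - ga v w"
  unfolding ga_def using assms by (simp add: diff_Pol l2_inner_diff_left)

lemma ga_scale_left: "u \<in> Pol \<Longrightarrow> ga (\<lambda>z. c * u z) w = c * ga u w"
  unfolding ga_def by (simp add: pd_scale l2_inner_scale_left distrib_left)

lemma ga_scale_right: "u \<in> Pol \<Longrightarrow> ga w (\<lambda>z. c * u z) = cnj c * ga w u"
  unfolding ga_def by (simp add: pd_scale l2_inner_scale_right distrib_left)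

lemma ga_self: "ga u u = of_real ((l2_norm (pd_x u))\<^sup>2 + (l2_norm (pd_y u))\<^sup>2)"
  by (simp add: ga_def l2_norm_sq_complex)

text \<open>Every polynomial is an x-derivative of a polynomial. By the zero boundary values of
  \<open>f\<close>, pairing \<open>f\<close> with it amounts to pairing the vanishing x-derivative
  of \<open>f\<close>, so \<open>f\<close> is orthogonal to all polynomials, itself
  included.\<close>

lemma ga_null:
  assumes "f \<in> VN2 N" "ga f f = 0"
  shows "f = (\<lambda>z. 0)"
proof (rule Pol_null)
  show P: "f \<in> Pol" using assms VN2_Pol by blast
  have "(l2_norm (pd_x f))\<^sup>2 + (l2_norm (pd_y f))\<^sup>2 = 0"
    using assms(2) unfolding ga_self of_real_eq_0_iff .
  then have x0: "l2_norm (pd_x f) = 0" by (simp add: sum_power2_eq_zero_iff)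
  have tp0: "l2_inner f (tp p q) = 0" for p q
  proof -
    have "l2_inner (pd_x f) (tp (ap p) q) = 0"
      using l2_cauchy_schwarz[of "pd_x f" "tp (ap p) q"] x0 P by simp
    then show ?thesis
      using VN2_XD0(1)[OF assms(1), unfolded XD0_def, rule_format, of "ap p" q] by simp
  qed
  have "l2_inner f g = 0" if "g \<in> Pol" for g
    using that
  proof (induction g rule: Pol_induct)
    case (add g p q)
    then show ?case using P tp0[of p q] l2_inner_add_right[of g "tp p q" f] by simp
  qed simp
  from this[OF P] show "l2_norm f = 0" by (simp add: l2_norm_sq_complex)
qed

lemma lap_eq_ga:
  assumes "XD0 u ux" "YD0 u uy" "u \<in> L2" "ux \<in> L2" "uy \<in> L2" "v \<in> Pol"
  shows "l2_inner u (lap v) = - (l2_inner ux (pd_x v) + l2_inner uy (pd_y v))"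
  unfolding lap_def using assms
  by (simp add: l2_inner_add_right Pol_has_vector_derivative XD0_Pol YD0_Pol)

lemma VN2_lap:
  assumes "f \<in> VN2 N" "v \<in> Pol"
  shows "l2_inner f (lap v) = - ga f v"
  unfolding ga_def using VN2_Pol[OF assms(1)] assms VN2_XD0[OF assms(1)]
  by (intro lap_eq_ga) auto

subsection \<open>Nodal values determine the elements of the discrete space\<close>

text \<open>Equidistant points from -1 to 1. The end nodes carry the boundary conditions, so
  elements of the one-dimensional space are determined by the \<open>N - 1\<close> interior
  values.\<close>

definition node :: "nat \<Rightarrow> nat \<Rightarrow> real" where "node N i = 2 * real i / real N - 1"

lemma node_inj: "N > 0 \<Longrightarrow> node N i = node N j \<longleftrightarrow> i = j"
  by (auto simp: node_def)

definition lagr :: "nat \<Rightarrow> nat \<Rightarrow> complex poly" where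
  "lagr N i = (\<Prod>j\<in>{..N} - {i}. smult (inverse (of_real (node N i - node N j))) [:- of_real (node N j), 1:])"

lemma poly_lagr:
  assumes "N > 0" "i \<le> N" "j \<le> N"
  shows "poly (lagr N i) (of_real (node N j)) = (if i = j then 1 else 0)"
proof (cases "i = j")
  case True
  have "complex_of_real (node N j) - of_real (node N k) \<noteq> 0" if "k \<noteq> j" for k
    using that node_inj[OF assms(1), of j k] by simp
  then have "inverse (complex_of_real (node N j) - of_real (node N k)) * (of_real (node N j) - of_real (node N k)) = 1"
    if "k \<noteq> j" for k using that by simp
  moreover have ps: "poly (smult b [:- a, 1:]) x = b * (x - a)" for a b x :: complex
    by (simp add: algebra_simps)
  ultimately have "poly (smult (inverse (complex_of_real (node N i - node N k))) [:- of_real (node N k), 1:]) (of_real (node N j)) = 1"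
    if "k \<in> {..N} - {i}" for k
    using that True unfolding ps of_real_diff by blast
  then show ?thesis using True unfolding lagr_def poly_prod by (simp only: prod.neutral) simp
next
  case False
  then have "j \<in> {..N} - {i}" using assms by auto
  then show ?thesis using False
    by (auto simp: lagr_def poly_prod intro!: prod_zero bexI[of _ j])
qed

lemma degree_lagr: "i \<le> N \<Longrightarrow> degree (lagr N i) \<le> N"
proof -
  assume i: "i \<le> N"
  have "degree (smult c [:a, 1:]) \<le> 1" for c a :: complex
    by (rule order_trans[OF degree_smult_le]) simp
  then have "degree (lagr N i) \<le> (\<Sum>j\<in>{..N} - {i}. 1)"
    unfolding lagr_def
    by (intro order_trans[OF degree_prod_sum_le] sum_mono) auto
  then show ?thesis using i by simp
qed

lemma lagr_VN: "0 < i \<Longrightarrow> i < N \<Longrightarrow> lagr N i \<in> VN N"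
  using poly_lagr[of N i N] poly_lagr[of N i 0] degree_lagr[of i N]
  by (simp add: VN_iff node_def)

lemma lagrange_VN:
  assumes "p \<in> VN N" "N > 0"
  shows "p = (\<Sum>i\<in>{1..<N}. smult (poly p (of_real (node N i))) (lagr N i))"
proof -
  define q where "q = p - (\<Sum>i\<in>{1..<N}. smult (poly p (of_real (node N i))) (lagr N i))"
  have dq: "degree q \<le> N"
    unfolding q_def using assms
    by (intro degree_diff_le degree_sum_le) (auto simp: VN_iff intro!: order_trans[OF degree_smult_le] degree_lagr)
  have ends: "node N 0 = -1" "node N N = 1" using assms by (simp_all add: node_def)
  have "poly q (of_real (node N j)) = 0" if j: "j \<le> N" for j
  proof -
    have "(\<Sum>i\<in>{1..<N}. poly p (of_real (node N i)) * poly (lagr N i) (of_real (node N j)))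
       = (\<Sum>i\<in>{1..<N}. if i = j then poly p (of_real (node N j)) else 0)"
      using assms j by (intro sum.cong) (auto simp: poly_lagr)
    also have "\<dots> = poly p (of_real (node N j))"
    proof (cases "j \<in> {1..<N}")
      case False
      then have "j = 0 \<or> j = N" using j by auto
      then show ?thesis using False assms ends by (auto simp: VN_iff)
    qed simp
    finally show ?thesis by (simp add: q_def poly_sum)
  qed
  then have sub: "(\<lambda>j. complex_of_real (node N j)) ` {..N} \<subseteq> {x. poly q x = 0}" by auto
  have "card ((\<lambda>j. complex_of_real (node N j)) ` {..N}) = Suc N"
    using assms by (subst card_image) (auto simp: inj_on_def node_inj)
  then have "q = 0"
    using sub card_poly_roots_bound[of q] dq card_mono[OF poly_roots_finite sub]
    by (metis Suc_n_not_le_n order_trans)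
  then show ?thesis by (simp add: q_def)
qed

definition lag2 :: "nat \<Rightarrow> nat \<times> nat \<Rightarrow> sfun" where
  "lag2 N i = tp (lagr N (fst i)) (lagr N (snd i))"

lemma lag2_VN2: "i \<in> {1..<N} \<times> {1..<N} \<Longrightarrow> lag2 N i \<in> VN2 N"
  unfolding lag2_def by (intro VN2_tp lagr_VN) auto

text \<open>This gives a finite spanning family for the Gram-Schmidt process, and expresses the
  coefficients of a discrete function through point values. Thereby pointwise regularity in time
  becomes regularity of finitely many coefficients.\<close>

lemma lagrange_VN2:
  assumes "f \<in> VN2 N" "N > 0"
  shows "f = (\<lambda>z. \<Sum>i\<in>{1..<N} \<times> {1..<N}. f (node N (fst i), node N (snd i)) * lag2 N i z)"
  using assms(1)
proof (induction f rule: VN2_induct)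
  case (add f p q)
  have "tp p q z = (\<Sum>i\<in>{1..<N} \<times> {1..<N}. tp p q (node N (fst i), node N (snd i)) * lag2 N i z)" for z
  proof -
    have "tp p q z = poly (\<Sum>i\<in>{1..<N}. smult (poly p (of_real (node N i))) (lagr N i)) (of_real (fst z))
       * poly (\<Sum>i\<in>{1..<N}. smult (poly q (of_real (node N i))) (lagr N i)) (of_real (snd z))"
      using lagrange_VN[OF add(2) assms(2)] lagrange_VN[OF add(3) assms(2)] by (simp add: tp_eq)
    also have "\<dots> = (\<Sum>i\<in>{1..<N} \<times> {1..<N}. tp p q (node N (fst i), node N (snd i)) * lag2 N i z)"
      unfolding poly_sum sum_product sum.cartesian_product
      by (intro sum.cong) (auto simp: lag2_def tp_eq)
    finally show ?thesis .
  qed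
  then show ?case
    unfolding distrib_right sum.distrib by (intro ext arg_cong2[where f = "(+)"] fun_cong[OF add(4)])
qed simp

subsection \<open>The elliptic projection\<close>

text \<open>The given functions may be dependent, so the number \<open>r\<close> of basis functions
  is produced along the way: if the remainder after projection is zero the family stays as it is,
  otherwise the normalised remainder is appended.\<close>

lemma gram_schmidt:
  fixes n :: nat
  assumes "\<And>k. k < n \<Longrightarrow> f k \<in> VN2 N"
  shows "\<exists>(r::nat) e. (\<forall>k<r. e k \<in> VN2 N) \<and> (\<forall>j<r. \<forall>k<r. ga (e j) (e k) = (if j = k then 1 else 0))
     \<and> (\<forall>i<n. f i = (\<lambda>z. \<Sum>k<r. ga (f i) (e k) * e k z))"
  using assms
proof (induction n)
  case 0
  show ?case by (intro exI[of _ 0]) auto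
next
  case (Suc n)
  from Suc.IH[OF Suc.prems[OF less_SucI]]
  obtain r :: nat and e where re: "\<forall>k<r. e k \<in> VN2 N"
    "\<forall>j<r. \<forall>k<r. ga (e j) (e k) = (if j = k then 1 else 0)"
    "\<forall>i<n. f i = (\<lambda>z. \<Sum>k<r. ga (f i) (e k) * e k z)" by blast
  have e: "e k \<in> VN2 N" if "k < r" for k using re(1) that by blast
  have o: "ga (e j) (e k) = (if j = k then 1 else 0)" if "j < r" "k < r" for j k using re(2) that by blast
  have s: "f i = (\<lambda>z. \<Sum>k<r. ga (f i) (e k) * e k z)" if "i < n" for i using re(3) that by blast
  have eP: "e k \<in> Pol" if "k < r" for k using e[OF that] VN2_Pol by blast
  have fn: "f n \<in> VN2 N" "f n \<in> Pol" using Suc.prems VN2_Pol by blast+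
  define S where "S = (\<lambda>z. \<Sum>k<r. ga (f n) (e k) * e k z)"
  define h where "h = (\<lambda>z. f n z - S z)"
  have SV: "S \<in> VN2 N" unfolding S_def by (intro VN2_lin e) simp
  have hV: "h \<in> VN2 N" unfolding h_def by (intro VN2_diff fn SV)
  note P = VN2_Pol[OF SV] VN2_Pol[OF hV]
  have he: "ga h (e j) = 0" if j: "j < r" for j
  proof -
    have "ga S (e j) = (\<Sum>k<r. ga (f n) (e k) * ga (e k) (e j))"
      unfolding S_def using eP j by (intro ga_lin_left) auto
    also have "\<dots> = (\<Sum>k<r. if k = j then ga (f n) (e j) else 0)"
      using j by (intro sum.cong) (auto simp: o)
    also have "\<dots> = ga (f n) (e j)" using j by simp
    finally show ?thesis unfolding h_def using fn P(1) eP[OF j] by (simp add: ga_diff_left)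
  qed
  have eh: "ga (e j) h = 0" if "j < r" for j using he[OF that] ga_commute[of "e j" h] by simp
  show ?case
  proof (cases "h = (\<lambda>z. 0)")
    case True
    then have "f n = S" by (auto simp: h_def fun_eq_iff)
    then show ?thesis using e o s unfolding S_def
      by (intro exI[of _ r] exI[of _ e]) (auto simp: less_Suc_eq)
  next
    case False
    define t where "t = sqrt ((l2_norm (pd_x h))\<^sup>2 + (l2_norm (pd_y h))\<^sup>2)"
    have hh: "ga h h = of_real (t * t)" unfolding ga_self t_def by simp
    have t: "complex_of_real t \<noteq> 0" using hh ga_null[OF hV] False by auto
    define e' where "e' = e(r := (\<lambda>z. inverse (of_real t) * h z))"
    have e'r: "e' r = (\<lambda>z. inverse (of_real t) * h z)" and e'k: "\<And>k. k < r \<Longrightarrow> e' k = e k"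
      by (auto simp: e'_def)
    have gr: "ga w (e' r) = inverse (of_real t) * ga w h" for w
      unfolding e'r using P(2) by (simp add: ga_scale_right)
    have gl: "ga (e' r) w = inverse (of_real t) * ga h w" for w
      unfolding e'r using P(2) by (simp add: ga_scale_left)
    have fh: "ga (f i) h = 0" if i: "i < n" for i
    proof -
      have "ga (f i) h = ga (\<lambda>z. \<Sum>k<r. ga (f i) (e k) * e k z) h" using s[OF i] by simp
      also have "\<dots> = (\<Sum>k<r. ga (f i) (e k) * ga (e k) h)"
        using eP P(2) by (intro ga_lin_left) auto
      finally show ?thesis using eh by simp
    qed
    have fnh: "ga (f n) h = of_real (t * t)"
    proof -
      have "ga S h = (\<Sum>k<r. ga (f n) (e k) * ga (e k) h)"
        unfolding S_def using eP P(2) by (intro ga_lin_left) auto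
      then have "ga S h = 0" using eh by simp
      moreover have "ga h h = ga (f n) h - ga S h"
      proof -
        have "ga (\<lambda>z. f n z - S z) h = ga (f n) h - ga S h"
          by (rule ga_diff_left[OF fn(2) P])
        then show ?thesis by (simp add: h_def)
      qed
      ultimately show ?thesis using hh by simp
    qed
    have 1: "\<forall>k<Suc r. e' k \<in> VN2 N" using e e'k e'r VN2_scale[OF hV] by (auto simp: less_Suc_eq)
    have 2: "\<forall>j<Suc r. \<forall>k<Suc r. ga (e' j) (e' k) = (if j = k then 1 else 0)"
    proof (intro allI impI)
      fix j k assume jk: "j < Suc r" "k < Suc r"
      show "ga (e' j) (e' k) = (if j = k then 1 else 0)"
      proof (cases "j = r"; cases "k = r")
        assume "j = r" "k = r"
        moreover have "ga (e' r) (e' r) = inverse (of_real t) * (inverse (of_real t) * ga h h)"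
          unfolding gr unfolding gl by (simp add: mult_ac)
        ultimately show ?thesis using t hh by (simp add: field_simps)
      next
        assume "j = r" "k \<noteq> r"
        then show ?thesis using jk he by (simp add: gl e'k)
      next
        assume "j \<noteq> r" "k = r"
        then show ?thesis using jk eh by (simp add: gr e'k)
      next
        assume "j \<noteq> r" "k \<noteq> r"
        then show ?thesis using jk o by (simp add: e'k)
      qed
    qed
    have 3: "f i = (\<lambda>z. \<Sum>k<Suc r. ga (f i) (e' k) * e' k z)" if i: "i < Suc n" for i
    proof (cases "i = n")
      case False
      then have "i < n" using i by simp
      then show ?thesis using fun_cong[OF s[OF \<open>i < n\<close>]] fh by (simp add: gr e'k fun_eq_iff)
    next
      case True
      have "f n z = S z + h z" for z by (simp add: h_def)
      then show ?thesis unfolding True using t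
        by (simp add: gr fnh e'k fun_eq_iff S_def) (simp add: e'r)
    qed
    show ?thesis using 1 2 3 by (intro exI[of _ "Suc r"] exI[of _ e']) auto
  qed
qed

text \<open>The expansion formula is linear in \<open>v\<close>, so it extends from the Lagrange
  functions, where Gram-Schmidt provides it, to the whole space.\<close>

lemma gradient_orthonormal_basis:
  assumes "N > 0"
  shows "\<exists>(r::nat) e. (\<forall>k<r. e k \<in> VN2 N) \<and> (\<forall>v\<in>VN2 N. v = (\<lambda>z. \<Sum>k<r. ga v (e k) * e k z))"
proof -
  define I where "I = {1..<N} \<times> {1..<N}"
  obtain b :: "nat \<Rightarrow> nat \<times> nat" and n :: nat where b: "bij_betw b {..<n} I"
    using ex_bij_betw_nat_finite[of I] by (auto simp: I_def atLeast0LessThan)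
  have bI: "b k \<in> I" if "k < n" for k using b that by (auto simp: bij_betw_def)
  have "lag2 N (b k) \<in> VN2 N" if "k < n" for k
    by (rule lag2_VN2) (use bI[OF that] in \<open>simp add: I_def\<close>)
  then have "\<exists>(r::nat) e. (\<forall>k<r. e k \<in> VN2 N) \<and> (\<forall>j<r. \<forall>k<r. ga (e j) (e k) = (if j = k then 1 else 0))
     \<and> (\<forall>i<n. lag2 N (b i) = (\<lambda>z. \<Sum>k<r. ga (lag2 N (b i)) (e k) * e k z))"
    by (rule gram_schmidt)
  then obtain r :: nat and e where re: "\<forall>k<r. e k \<in> VN2 N"
    "\<forall>i<n. lag2 N (b i) = (\<lambda>z. \<Sum>k<r. ga (lag2 N (b i)) (e k) * e k z)" by blast
  have e: "e k \<in> VN2 N" if "k < r" for k using re(1) that by blast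
  have s: "lag2 N (b i) = (\<lambda>z. \<Sum>k<r. ga (lag2 N (b i)) (e k) * e k z)" if "i < n" for i
    using re(2) that by blast
  have eP: "e k \<in> Pol" if "k < r" for k using e[OF that] VN2_Pol by blast
  have s': "lag2 N i z = (\<Sum>k<r. ga (lag2 N i) (e k) * e k z)" if "i \<in> I" for i z
  proof -
    obtain k where "k < n" "i = b k" using b \<open>i \<in> I\<close> by (auto simp: bij_betw_def)
    then show ?thesis using fun_cong[OF s[of k]] by simp
  qed
  have "v = (\<lambda>z. \<Sum>k<r. ga v (e k) * e k z)" if v: "v \<in> VN2 N" for v
  proof
    fix z
    define c where "c i = v (node N (fst i), node N (snd i))" for i
    have vc: "v = (\<lambda>z. \<Sum>i\<in>I. c i * lag2 N i z)"
      unfolding c_def I_def by (rule lagrange_VN2[OF v assms])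
    have g: "ga v (e k) = (\<Sum>i\<in>I. c i * ga (lag2 N i) (e k))" if "k < r" for k
      by (subst vc, rule ga_lin_left) (use eP that in \<open>auto simp: lag2_def\<close>)
    have "v z = (\<Sum>i\<in>I. c i * (\<Sum>k<r. ga (lag2 N i) (e k) * e k z))"
      using fun_cong[OF vc, of z] s' by simp
    also have "\<dots> = (\<Sum>k<r. \<Sum>i\<in>I. c i * (ga (lag2 N i) (e k) * e k z))"
      unfolding sum_distrib_left by (rule sum.swap)
    also have "\<dots> = (\<Sum>k<r. ga v (e k) * e k z)"
      by (intro sum.cong) (auto simp: g sum_distrib_right mult.assoc)
    finally show "v z = (\<Sum>k<r. ga v (e k) * e k z)" .
  qed
  then show ?thesis using e by blast
qed

lemma pd_commute: "f \<in> Pol \<Longrightarrow> pd_x (pd_y f) = pd_y (pd_x f)"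
proof (induction f rule: Pol_induct)
  case (add f p q)
  then show ?case by (simp add: pd_add pd_tp Pol_has_vector_derivative)
qed simp

text \<open>Derivatives tangential to a side inherit the zero boundary values: the second
  y-derivative vanishes on the vertical sides and the x-derivative on the horizontal ones.\<close>

lemma VN2_traces:
  assumes "f \<in> VN2 N"
  shows "XD0 (pd_y (pd_y f)) (pd_x (pd_y (pd_y f)))" "YD0 (pd_x f) (pd_y (pd_x f))"
proof -
  have "XD0 (pd_y (pd_y f)) (pd_x (pd_y (pd_y f))) \<and> YD0 (pd_x f) (pd_y (pd_x f))"
    using assms
  proof (induction f rule: VN2_induct)
    case (add f p q)
    have "l2_inner (tp p q') (tp (pderiv r) s) = - l2_inner (tp (pderiv p) q') (tp r s)"
      "l2_inner (tp p' q) (tp r (pderiv s)) = - l2_inner (tp p' (pderiv q)) (tp r s)" for p' q' r s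
      using add(2,3) by (auto intro!: l2_inner_tp_parts simp: VN_iff)
    then show ?case using add VN2_Pol[OF add(1)]
      by (simp add: XD0_def YD0_def pd_add pd_tp l2_inner_add_left Pol_has_vector_derivative)
  qed (simp_all add: XD0_def YD0_def)
  then show "XD0 (pd_y (pd_y f)) (pd_x (pd_y (pd_y f)))" "YD0 (pd_x f) (pd_y (pd_x f))" by auto
qed

text \<open>On the square \<open>(w\<^sub>x\<^sub>x, w\<^sub>y\<^sub>y) = \<parallel>w\<^sub>x\<^sub>y\<parallel>\<^sup>2\<close> for polynomials vanishing on the boundary, which gives
  the regularity estimate needed in the duality argument.\<close>

lemma hessian_le_lap:
  assumes w: "w \<in> VN2 N"
  shows "l2_norm (pd_x (pd_x w)) \<le> l2_norm (lap w)" "l2_norm (pd_x (pd_y w)) \<le> l2_norm (lap w)"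
    "l2_norm (pd_y (pd_y w)) \<le> l2_norm (lap w)"
proof -
  define xx where "xx = pd_x (pd_x w)"
  define yy where "yy = pd_y (pd_y w)"
  define xy where "xy = pd_x (pd_y w)"
  have P: "w \<in> Pol" using w VN2_Pol by blast
  have P2: "xx \<in> Pol" "yy \<in> Pol" "xy \<in> Pol"
    unfolding xx_def yy_def xy_def by (auto intro!: Pol_has_vector_derivative P)
  have xy: "xy = pd_y (pd_x w)" unfolding xy_def by (rule pd_commute[OF P])
  have "l2_inner yy xx = - l2_inner (pd_x yy) (pd_x w)"
    unfolding xx_def using VN2_traces(1)[OF w] P P2(2)
    by (intro XD0_Pol) (auto simp: yy_def Pol_has_vector_derivative)
  also have "pd_x yy = pd_y xy"
    unfolding yy_def xy_def by (rule pd_commute) (rule Pol_has_vector_derivative[OF P])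
  also have "l2_inner (pd_y xy) (pd_x w) = cnj (l2_inner (pd_x w) (pd_y xy))"
    by (rule l2_inner_commute)
  also have "l2_inner (pd_x w) (pd_y xy) = - l2_inner xy xy"
    using VN2_traces(2)[OF w] P P2(3) xy
    by (intro YD0_Pol) (auto simp: Pol_has_vector_derivative)
  finally have 1: "l2_inner yy xx = of_real ((l2_norm xy)\<^sup>2)" by (simp add: l2_norm_sq_complex)
  then have 2: "l2_inner xx yy = of_real ((l2_norm xy)\<^sup>2)"
    using l2_inner_commute[of xx yy] by simp
  have "l2_inner (lap w) (lap w) = l2_inner xx xx + l2_inner xx yy + (l2_inner yy xx + l2_inner yy yy)"
    unfolding lap_def xx_def[symmetric] yy_def[symmetric] using P2
    by (simp add: l2_inner_add_left l2_inner_add_right L2_add)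
  also have "\<dots> = of_real ((l2_norm xx)\<^sup>2 + 2 * (l2_norm xy)\<^sup>2 + (l2_norm yy)\<^sup>2)"
    unfolding 1 2 l2_norm_sq_complex[of xx] l2_norm_sq_complex[of yy] by simp
  finally have "(l2_norm (lap w))\<^sup>2 = (l2_norm xx)\<^sup>2 + 2 * (l2_norm xy)\<^sup>2 + (l2_norm yy)\<^sup>2"
    unfolding l2_norm_sq_complex of_real_eq_iff .
  then have "(l2_norm xx)\<^sup>2 \<le> (l2_norm (lap w))\<^sup>2" "(l2_norm xy)\<^sup>2 \<le> (l2_norm (lap w))\<^sup>2" "(l2_norm yy)\<^sup>2 \<le> (l2_norm (lap w))\<^sup>2"
    by simp_all
  then show "l2_norm (pd_x (pd_x w)) \<le> l2_norm (lap w)" "l2_norm (pd_x (pd_y w)) \<le> l2_norm (lap w)"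
    "l2_norm (pd_y (pd_y w)) \<le> l2_norm (lap w)"
    unfolding xx_def[symmetric] xy_def[symmetric] yy_def[symmetric] by (auto intro: power2_le_imp_le)
qed

text \<open>\<open>D a b\<close> stands for the derivative of order \<open>(a, b)\<close>. The
  derivatives are only tested against polynomials that vanish at the ends of the interval of
  differentiation, and boundary values are recorded for \<open>u\<close> alone. Sobolev functions
  and discrete polynomials both fit, and the duality argument applies the same estimate to
  both.\<close>

definition sob :: "nat \<Rightarrow> sfun \<Rightarrow> (nat \<Rightarrow> nat \<Rightarrow> sfun) \<Rightarrow> bool" where
  "sob m u D \<longleftrightarrow> D 0 0 = u \<and> (\<forall>a b. a + b \<le> m \<longrightarrow> D a b \<in> L2)
     \<and> (\<forall>a b. a + b < m \<longrightarrow> XD (D a b) (D (Suc a) b) \<and> YD (D a b) (D a (Suc b)))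
     \<and> XD0 u (D 1 0) \<and> YD0 u (D 0 1)"

lemma sob_poly:
  assumes w: "w \<in> VN2 N"
  shows "sob 2 w (\<lambda>a b. (pd_x ^^ a) ((pd_y ^^ b) w))"
proof -
  have P: "(pd_y ^^ b) w \<in> Pol" for b
    by (induction b) (auto simp: Pol_has_vector_derivative VN2_Pol[OF w])
  then have P2: "(pd_x ^^ a) ((pd_y ^^ b) w) \<in> Pol" for a b
    by (induction a) (auto simp: Pol_has_vector_derivative)
  have c: "(pd_x ^^ a) (pd_y ((pd_y ^^ b) w)) = pd_y ((pd_x ^^ a) ((pd_y ^^ b) w))" for a b
    by (induction a) (simp_all add: pd_commute[OF P2])
  show ?thesis unfolding sob_def
    using P2 Pol_XD VN2_XD0[OF w] by (auto simp: c)
qed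

text \<open>Of the \<open>m\<close> derivatives two are spent on forming the mixed derivative. The
  chains are the pure x-derivatives of the x-derivative, and the y-derivatives of the mixed
  derivative. The second bound is the first one after exchanging coordinates, under which the
  approximant is the same function.\<close>

lemma approx_gradient:
  assumes S: "sob m u D" and m: "m \<ge> 2" and N: "N \<ge> 1" "m = 2 \<or> N \<ge> 2 * m"
    and K: "\<And>a b. a + b = m \<Longrightarrow> l2_norm (D a b) \<le> K" and g: "g \<in> Pol"
  shows "cmod (l2_inner (\<lambda>z. D 1 0 z - pd_x (Vap N (D 1 1)) z) g) \<le> (2 / real N) ^ (m - 1) * (2 * K) * l2_norm g"
    and "cmod (l2_inner (\<lambda>z. D 0 1 z - pd_y (Vap N (D 1 1)) z) g) \<le> (2 / real N) ^ (m - 1) * (2 * K) * l2_norm g"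
proof -
  have DL: "D a b \<in> L2" if "a + b \<le> m" for a b using S that unfolding sob_def by blast
  have DX: "XD (D a b) (D (Suc a) b)" "YD (D a b) (D a (Suc b))" if "a + b < m" for a b
    using S that unfolding sob_def by blast+
  have D0: "XD0 u (D 1 0)" "YD0 u (D 0 1)" "u \<in> L2" using S DL[of 0 0] unfolding sob_def by auto
  define s where "s = m - 2"
  have s: "m = Suc (Suc s)" using m by (simp add: s_def)
  have Ns: "s = 0 \<or> N \<ge> 2 * Suc s" using N(2) s by auto
  have "cmod (l2_inner (\<lambda>z. D 1 0 z - pd_x (Vap N (D 1 1)) z) g)
     \<le> (2 / real N) ^ Suc s * (l2_norm (D (Suc (Suc s)) 0) + l2_norm (D 1 (Suc s))) * l2_norm g"
    by (rule approx_gradient_x[where a = "\<lambda>i. D (Suc i) 0" and b = "\<lambda>i. D 1 (Suc i)" and u = u and uy = "D 0 1"])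
       (use D0 DL DX Ns N(1) g in \<open>auto simp: s\<close>)
  also have "\<dots> \<le> (2 / real N) ^ Suc s * (K + K) * l2_norm g"
    using K[of "Suc (Suc s)" 0] K[of 1 "Suc s"] by (intro mult_right_mono mult_left_mono add_mono) (auto simp: s)
  finally show "cmod (l2_inner (\<lambda>z. D 1 0 z - pd_x (Vap N (D 1 1)) z) g) \<le> (2 / real N) ^ (m - 1) * (2 * K) * l2_norm g"
    by (simp add: s)
  have V: "Vap N (D 1 1) \<in> Pol" using Vap_VN2 VN2_Pol by blast
  have eq: "(\<lambda>z. swp (D 0 1) z - pd_x (Vap N (swp (D 1 1))) z) = swp (\<lambda>z. D 0 1 z - pd_y (Vap N (D 1 1)) z)"
  proof -
    have "pd_x (Vap N (swp (D 1 1))) = swp (pd_y (Vap N (D 1 1)))"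
      using DL[of 1 1] m by (subst swp_Vap[symmetric]) (auto simp: pd_swp)
    then show ?thesis by (simp add: swp_def)
  qed
  have L: "(\<lambda>z. D 0 1 z - pd_y (Vap N (D 1 1)) z) \<in> L2" using DL[of 0 1] m V by auto
  have "cmod (l2_inner (\<lambda>z. swp (D 0 1) z - pd_x (Vap N (swp (D 1 1))) z) (swp g))
     \<le> (2 / real N) ^ Suc s * (l2_norm (swp (D 0 (Suc (Suc s)))) + l2_norm (swp (D (Suc s) 1))) * l2_norm (swp g)"
    by (rule approx_gradient_x[where a = "\<lambda>i. swp (D 0 (Suc i))" and b = "\<lambda>i. swp (D (Suc i) 1)" and u = "swp u" and uy = "swp (D 1 0)"])
       (use D0 DL DX Ns N(1) g in \<open>auto simp: s swp_derivs Pol_swp\<close>)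
  also have "\<dots> = (2 / real N) ^ Suc s * (l2_norm (D 0 (Suc (Suc s))) + l2_norm (D (Suc s) 1)) * l2_norm g"
    using DL[of 0 "Suc (Suc s)"] DL[of "Suc s" 1] g by (simp add: s l2_norm_swp)
  also have "\<dots> \<le> (2 / real N) ^ Suc s * (K + K) * l2_norm g"
    using K[of 0 "Suc (Suc s)"] K[of "Suc s" 1] by (intro mult_right_mono mult_left_mono add_mono) (auto simp: s)
  finally show "cmod (l2_inner (\<lambda>z. D 0 1 z - pd_y (Vap N (D 1 1)) z) g) \<le> (2 / real N) ^ (m - 1) * (2 * K) * l2_norm g"
    unfolding eq using l2_inner_swp[OF L, of g] g by (simp add: s)
qed

definition grad_basis :: "nat \<Rightarrow> nat \<Rightarrow> (nat \<Rightarrow> sfun) \<Rightarrow> bool" where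
  "grad_basis N r e \<longleftrightarrow> (\<forall>k<r. e k \<in> VN2 N) \<and> (\<forall>v\<in>VN2 N. v = (\<lambda>z. \<Sum>k<r. ga v (e k) * e k z))"

text \<open>The elliptic projection, extended to \<open>L\<^sup>2\<close> by moving the gradient onto the test function.\<close>

definition Pr :: "nat \<Rightarrow> (nat \<Rightarrow> sfun) \<Rightarrow> sfun \<Rightarrow> sfun" where
  "Pr r e g = (\<lambda>z. \<Sum>k<r. (- l2_inner g (lap (e k))) * e k z)"

lemma grad_basis_Pol: "grad_basis N r e \<Longrightarrow> k < r \<Longrightarrow> e k \<in> Pol"
  using VN2_Pol unfolding grad_basis_def by blast

lemma Pr_VN2: "grad_basis N r e \<Longrightarrow> Pr r e g \<in> VN2 N"
  unfolding Pr_def grad_basis_def by (intro VN2_lin) auto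

lemma Pr_Pol: "grad_basis N r e \<Longrightarrow> Pr r e g \<in> Pol"
  using Pr_VN2 VN2_Pol by blast

lemma grad_basis_lap:
  assumes B: "grad_basis N r e" and v: "v \<in> VN2 N"
  shows "lap v = (\<lambda>z. \<Sum>k<r. ga v (e k) * lap (e k) z)"
proof -
  have "v = (\<lambda>z. \<Sum>k<r. ga v (e k) * e k z)" using B v unfolding grad_basis_def by blast
  then have "lap v = lap (\<lambda>z. \<Sum>k<r. ga v (e k) * e k z)" by (rule arg_cong)
  also have "\<dots> = (\<lambda>z. \<Sum>k<r. ga v (e k) * lap (e k) z)"
    using grad_basis_Pol[OF B] by (subst lin_Pol(3)) auto
  finally show ?thesis .
qed

text \<open>Galerkin orthogonality with both derivatives moved to the test function; in this form it
  makes sense and holds for every square integrable \<open>g\<close>.\<close>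

lemma Pr_lap:
  assumes B: "grad_basis N r e" and g: "g \<in> L2" and v: "v \<in> VN2 N"
  shows "l2_inner (Pr r e g) (lap v) = l2_inner g (lap v)"
proof -
  have P: "e k \<in> Pol" if "k \<in> {..<r}" for k using grad_basis_Pol[OF B] that by simp
  have "l2_inner (Pr r e g) (lap v) = - ga (Pr r e g) v"
    by (rule VN2_lap[OF Pr_VN2[OF B] VN2_Pol[OF v]])
  also have "ga (Pr r e g) v = (\<Sum>k<r. (- l2_inner g (lap (e k))) * ga (e k) v)"
    unfolding Pr_def by (rule ga_lin_left[OF P VN2_Pol[OF v]])
  also have "- \<dots> = (\<Sum>k<r. cnj (ga v (e k)) * l2_inner g (lap (e k)))"
    by (simp add: sum_negf mult.commute flip: ga_commute)
  also have "\<dots> = l2_inner g (lap v)"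
    unfolding grad_basis_lap[OF B v]
    using P g by (subst l2_inner_lin_right) auto
  finally show ?thesis .
qed

text \<open>An Aubin-Nitsche argument in which \<open>w\<close> is itself the dual solution for the
  right-hand side \<open>lap w\<close>. In the regular range the constant is
  \<open>2^(m-1) * 2 * 8 = 2^(m+3)\<close>: the approximation of the gradient gives the first two
  factors, the error of \<open>w\<close> the third. The other summand covers \<open>m = 1\<close>
  and small \<open>N\<close>.\<close>

lemma elliptic_projection_dual:
  assumes S: "sob m u D" and m: "m \<ge> 1" and N: "N \<ge> 1" and B: "grad_basis N r e"
    and K: "\<And>a b. a + b \<le> m \<Longrightarrow> l2_norm (D a b) \<le> K" and w: "w \<in> VN2 M"
  shows "cmod (l2_inner (\<lambda>z. u z - Pr r e u z) (lap w))
     \<le> (2 ^ (m + 3) + 8 * (2 * real m) ^ (m - 1)) * K * (1 / real N) ^ m * l2_norm (lap w)"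
proof -
  have DL: "D a b \<in> L2" if "a + b \<le> m" for a b using S that unfolding sob_def by blast
  have D0: "XD0 u (D 1 0)" "YD0 u (D 0 1)" "u \<in> L2" "D 1 0 \<in> L2" "D 0 1 \<in> L2"
    using S DL[of 0 0] DL[of 1 0] DL[of 0 1] m unfolding sob_def by auto
  have K0: "K \<ge> 0" using order_trans[OF l2_norm_nonneg K[of 0 0]] by simp
  define P where "P = Pr r e"
  have PV: "P g \<in> VN2 N" "P g \<in> Pol" for g using Pr_VN2[OF B] Pr_Pol[OF B] by (auto simp: P_def)
  have wP: "w \<in> Pol" using w VN2_Pol by blast
  define H where "H = l2_norm (lap w)"
  \<comment> \<open>The projection error of the dual solution. It is orthogonal, in the gradient
    form, to every discrete function of degree \<open>N\<close>, so an arbitrary such function can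
    be subtracted in the other argument.\<close>
  define z where "z = (\<lambda>x. w x - P w x)"
  have zV: "z \<in> VN2 (max M N)"
    unfolding z_def using VN2_mono[OF w, of "max M N"] VN2_mono[OF PV(1), of "max M N" w] by (intro VN2_diff) auto
  have zP: "z \<in> Pol" using zV VN2_Pol by blast
  have orth: "ga z v = 0" "ga v z = 0" if v: "v \<in> VN2 N" for v
  proof -
    have "l2_inner z (lap v) = l2_inner w (lap v) - l2_inner (P w) (lap v)"
      unfolding z_def using wP PV v VN2_Pol[OF v] by (intro l2_inner_diff_left) auto
    also have "\<dots> = 0" using Pr_lap[OF B _ v, of w] wP by (simp add: P_def)
    finally show "ga z v = 0" using VN2_lap[OF zV VN2_Pol[OF v]] by simp
    then show "ga v z = 0" using ga_commute[of v z] by simp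
  qed
  define S where "S = l2_norm (pd_x z) + l2_norm (pd_y z)"
  have S0: "S \<ge> 0" by (simp add: S_def)
  have pair: "cmod (l2_inner a (pd_x z) + l2_inner b (pd_y z)) \<le> c * S"
    if "cmod (l2_inner a (pd_x z)) \<le> c * l2_norm (pd_x z)" "cmod (l2_inner b (pd_y z)) \<le> c * l2_norm (pd_y z)" for a b c
    using that norm_triangle_ineq[of "l2_inner a (pd_x z)" "l2_inner b (pd_y z)"] by (simp add: S_def distrib_left)
  have approx: "cmod (l2_inner (D' 1 0) (pd_x z) + l2_inner (D' 0 1) (pd_y z)) \<le> (2 / real N) ^ (k - 1) * (2 * K') * S"
    if S': "sob k u' D'" "k \<ge> 2" "k = 2 \<or> N \<ge> 2 * k" "\<And>a b. a + b = k \<Longrightarrow> l2_norm (D' a b) \<le> K'" for k u' D' K'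
  proof -
    have DL': "D' 1 0 \<in> L2" "D' 0 1 \<in> L2" using S'(1,2) unfolding sob_def by auto
    define v where "v = Vap N (D' 1 1)"
    have v: "v \<in> VN2 N" "v \<in> Pol" unfolding v_def using Vap_VN2 VN2_Pol by blast+
    have "l2_inner (D' 1 0) (pd_x z) + l2_inner (D' 0 1) (pd_y z)
       = l2_inner (D' 1 0) (pd_x z) + l2_inner (D' 0 1) (pd_y z) - ga v z"
      using orth v by simp
    also have "\<dots> = l2_inner (\<lambda>x. D' 1 0 x - pd_x v x) (pd_x z) + l2_inner (\<lambda>x. D' 0 1 x - pd_y v x) (pd_y z)"
      unfolding ga_def using DL' v zP by (simp add: l2_inner_diff_left)
    also have "cmod \<dots> \<le> (2 / real N) ^ (k - 1) * (2 * K') * S"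
      unfolding v_def
      by (intro pair approx_gradient[OF S'(1,2) N S'(3)] S'(4) Pol_has_vector_derivative zP)
    finally show ?thesis .
  qed
  \<comment> \<open>The gradient estimate is applied to \<open>w\<close> itself with order 2, the
    derivatives of that order being bounded by the Laplacian. From
    \<open>ga z z = ga w z \<le> (2/N) (2 H) S\<close> and \<open>S^2 \<le> 2 ga z z\<close> follows
    \<open>S \<le> 8 H / N\<close>.\<close>
  have Sb: "S \<le> 8 * H / real N"
  proof -
    let ?D = "\<lambda>a b. (pd_x ^^ a) ((pd_y ^^ b) w)"
    have "l2_norm (?D a b) \<le> H" if "a + b = 2" for a b
    proof -
      have "(a = 2 \<and> b = 0) \<or> (a = 1 \<and> b = 1) \<or> (a = 0 \<and> b = 2)" using that by auto
      then show ?thesis using hessian_le_lap[OF w] by (auto simp: H_def numeral_2_eq_2)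
    qed
    from approx[OF sob_poly[OF w] order_refl _ this]
    have "cmod (ga w z) \<le> (2 / real N) * (2 * H) * S" by (simp add: ga_def)
    moreover have "ga w z = ga z z"
    proof -
      have "ga (\<lambda>x. w x - P w x) z = ga w z - ga (P w) z"
        by (rule ga_diff_left[OF wP PV(2) zP])
      then have "ga (\<lambda>x. w x - P w x) z = ga w z" using orth PV by simp
      then show ?thesis unfolding z_def[symmetric] by simp
    qed
    moreover have "cmod (ga z z) = (l2_norm (pd_x z))\<^sup>2 + (l2_norm (pd_y z))\<^sup>2"
      unfolding ga_self norm_of_real by simp
    moreover have "S\<^sup>2 \<le> 2 * ((l2_norm (pd_x z))\<^sup>2 + (l2_norm (pd_y z))\<^sup>2)"
      unfolding S_def using sum_squares_bound[of "l2_norm (pd_x z)" "l2_norm (pd_y z)"] by (simp add: power2_sum)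
    ultimately have "S * S \<le> (8 * H / real N) * S" by (simp add: power2_eq_square)
    moreover have "8 * H / real N \<ge> 0" by (simp add: H_def)
    ultimately show ?thesis using S0 by (metis mult_le_cancel_right order_le_less not_less)
  qed
  \<comment> \<open>The Laplacian of the discrete part \<open>P w\<close> sees no error of
    \<open>u\<close>, and \<open>P u\<close> does not see the Laplacian of \<open>z\<close>. Only
    the gradient of \<open>u\<close> against the gradient of \<open>z\<close> remains.\<close>
  have "l2_inner (\<lambda>z. u z - P u z) (lap w) = l2_inner (\<lambda>z. u z - P u z) (lap z) + l2_inner (\<lambda>z. u z - P u z) (lap (P w))"
  proof -
    have "lap w = (\<lambda>x. lap z x + lap (P w) x)"
      using lap_add[OF zP PV(2)[of w]] by (simp add: z_def)
    then show ?thesis using D0 PV zP by (simp only:) (intro l2_inner_add_right, auto)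
  qed
  also have "l2_inner (\<lambda>z. u z - P u z) (lap (P w)) = 0"
    using Pr_lap[OF B D0(3) PV(1)] D0 PV by (simp add: l2_inner_diff_left P_def)
  also have "l2_inner (\<lambda>z. u z - P u z) (lap z) = l2_inner u (lap z)"
    using VN2_lap[OF PV(1) zP] orth PV D0 zP by (simp add: l2_inner_diff_left)
  also have "l2_inner u (lap z) = - (l2_inner (D 1 0) (pd_x z) + l2_inner (D 0 1) (pd_y z))"
    by (rule lap_eq_ga[OF D0 zP])
  finally have "l2_inner (\<lambda>z. u z - P u z) (lap w) = - (l2_inner (D 1 0) (pd_x z) + l2_inner (D 0 1) (pd_y z))"
    by simp
  then have E: "cmod (l2_inner (\<lambda>z. u z - P u z) (lap w)) = cmod (l2_inner (D 1 0) (pd_x z) + l2_inner (D 0 1) (pd_y z))"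
    by (simp only: norm_minus_cancel)
  have NK: "0 \<le> K * (1 / real N) ^ m * H" using K0 by (simp add: H_def)
  have one: "(1 / real N) ^ m = (1 / real N) * (1 / real N) ^ (m - 1)" using m by (metis power_eq_if not_one_le_zero)
  show ?thesis
  proof (cases "m \<ge> 2 \<and> (m = 2 \<or> N \<ge> 2 * m)")
    case True
    have "cmod (l2_inner (\<lambda>z. u z - P u z) (lap w)) \<le> (2 / real N) ^ (m - 1) * (2 * K) * S"
      unfolding E by (rule approx[OF S]) (use True K in auto)
    also have "\<dots> \<le> (2 / real N) ^ (m - 1) * (2 * K) * (8 * H / real N)"
      using Sb K0 by (intro mult_left_mono) auto
    also have "\<dots> = 2 ^ (m + 3) * (K * (1 / real N) ^ m * H)"
    proof -
      have "(2::real) ^ (m + 3) = 16 * 2 ^ (m - 1)" using m by (cases m) (auto simp: power_add)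
      moreover have "(2 / real N) ^ (m - 1) = 2 ^ (m - 1) * (1 / real N) ^ (m - 1)" by (simp add: power_divide)
      ultimately show ?thesis unfolding one by simp
    qed
    also have "\<dots> \<le> (2 ^ (m + 3) + 8 * (2 * real m) ^ (m - 1)) * (K * (1 / real N) ^ m * H)"
      using NK by (intro mult_right_mono) auto
    finally show ?thesis by (simp add: P_def H_def mult.assoc)
  next
    case False
    \<comment> \<open>When \<open>N < 2 m\<close> this product is at least 1, so it may be inserted
      to give the first-order bound the form of order \<open>m\<close>; for \<open>m = 1\<close> it
      equals 1.\<close>
    have p: "1 \<le> (2 * real m) ^ (m - 1) * (1 / real N) ^ (m - 1)"
    proof (cases "m = 1")
      case False
      then have "N \<le> 2 * m" using \<open>\<not> (m \<ge> 2 \<and> (m = 2 \<or> N \<ge> 2 * m))\<close> m by auto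
      then have "real N \<le> 2 * real m" by linarith
      then have "1 \<le> 2 * real m * (1 / real N)" using N by simp
      then show ?thesis unfolding power_mult_distrib[symmetric] by (rule one_le_power)
    qed simp
    have "cmod (l2_inner (\<lambda>z. u z - P u z) (lap w)) \<le> K * S"
      unfolding E
    proof (rule pair)
      show "cmod (l2_inner (D 1 0) (pd_x z)) \<le> K * l2_norm (pd_x z)"
        using zP m by (intro order_trans[OF l2_cauchy_schwarz[OF D0(4)]] mult_right_mono K) auto
      show "cmod (l2_inner (D 0 1) (pd_y z)) \<le> K * l2_norm (pd_y z)"
        using zP m by (intro order_trans[OF l2_cauchy_schwarz[OF D0(5)]] mult_right_mono K) auto
    qed
    also have "\<dots> \<le> K * (8 * H / real N)" using Sb K0 by (intro mult_left_mono)
    also have "\<dots> = (8 * K * H * (1 / real N)) * 1" by simp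
    also have "\<dots> \<le> (8 * K * H * (1 / real N)) * ((2 * real m) ^ (m - 1) * (1 / real N) ^ (m - 1))"
      using p K0 by (intro mult_left_mono) (auto simp: H_def)
    also have "\<dots> = 8 * (2 * real m) ^ (m - 1) * (K * (1 / real N) ^ m * H)" unfolding one by simp
    also have "\<dots> \<le> (2 ^ (m + 3) + 8 * (2 * real m) ^ (m - 1)) * (K * (1 / real N) ^ m * H)"
      using NK by (intro mult_right_mono) auto
    finally show ?thesis by (simp add: P_def H_def mult.assoc)
  qed
qed

section \<open>Laplacians of polynomials vanishing on the boundary are dense\<close>

definition lap_closure :: "sfun set" where
  "lap_closure = {g \<in> L2. \<forall>\<epsilon>>0. \<exists>M. \<exists>w\<in>VN2 M. l2_norm (\<lambda>z. g z - lap w z) < \<epsilon>}"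

lemma lap_closure_L2: "g \<in> lap_closure \<Longrightarrow> g \<in> L2"
  by (simp add: lap_closure_def)

lemma lap_closure_limit:
  assumes "(\<lambda>n. l2_norm (\<lambda>z. u n z - v z)) \<longlonglongrightarrow> 0" "\<And>n::nat. u n \<in> lap_closure" "v \<in> L2"
  shows "v \<in> lap_closure"
  unfolding lap_closure_def
proof (intro CollectI conjI allI impI assms)
  fix \<epsilon> :: real assume "\<epsilon> > 0"
  then have "\<epsilon> / 2 > 0" by simp
  from order_tendstoD(2)[OF assms(1) this]
  obtain n where n: "l2_norm (\<lambda>z. u n z - v z) < \<epsilon> / 2" by (auto simp: eventually_sequentially)
  obtain M w where w: "w \<in> VN2 M" "l2_norm (\<lambda>z. u n z - lap w z) < \<epsilon> / 2"
    using assms(2)[of n] \<open>\<epsilon> / 2 > 0\<close> unfolding lap_closure_def by blast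
  have L: "u n \<in> L2" "lap w \<in> L2" using lap_closure_L2[OF assms(2)] lap_Pol[OF VN2_Pol[OF w(1)]] by auto
  have "l2_norm (\<lambda>z. v z - lap w z) = l2_norm (\<lambda>z. (v z - u n z) + (u n z - lap w z))" by simp
  also have "\<dots> \<le> l2_norm (\<lambda>z. v z - u n z) + l2_norm (\<lambda>z. u n z - lap w z)"
    by (intro l2_norm_triangle L2_diff L assms)
  also have "\<dots> < \<epsilon>" using n w l2_norm_minus_commute[of "u n" v] by simp
  finally show "\<exists>M. \<exists>w\<in>VN2 M. l2_norm (\<lambda>z. v z - lap w z) < \<epsilon>" using w by blast
qed

lemma lap_closure_lap: "w \<in> VN2 M \<Longrightarrow> lap w \<in> lap_closure"
  unfolding lap_closure_def using lap_Pol[OF VN2_Pol[of w M]]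
  by (intro CollectI conjI allI impI exI[of _ M] bexI[of _ w]) auto

lemma lap_closure_zero [simp]: "(\<lambda>z. 0) \<in> lap_closure"
  using lap_closure_lap[OF VN2_zero[of 0]] by simp

lemma lap_closure_add:
  assumes "g \<in> lap_closure" "h \<in> lap_closure"
  shows "(\<lambda>z. g z + h z) \<in> lap_closure"
  unfolding lap_closure_def
proof (intro CollectI conjI allI impI)
  note L = lap_closure_L2[OF assms(1)] lap_closure_L2[OF assms(2)]
  show "(\<lambda>z. g z + h z) \<in> L2" using L by auto
  fix \<epsilon> :: real assume "\<epsilon> > 0"
  then have \<epsilon>: "\<epsilon> / 2 > 0" by simp
  obtain M v where v: "v \<in> VN2 M" "l2_norm (\<lambda>z. g z - lap v z) < \<epsilon> / 2"
    using assms(1) \<epsilon> unfolding lap_closure_def by blast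
  obtain N w where w: "w \<in> VN2 N" "l2_norm (\<lambda>z. h z - lap w z) < \<epsilon> / 2"
    using assms(2) \<epsilon> unfolding lap_closure_def by blast
  have P: "v \<in> Pol" "w \<in> Pol" using v w VN2_Pol by blast+
  have L': "lap v \<in> L2" "lap w \<in> L2" using P lap_Pol by auto
  have "l2_norm (\<lambda>z. g z + h z - lap (\<lambda>z. v z + w z) z) = l2_norm (\<lambda>z. (g z - lap v z) + (h z - lap w z))"
    unfolding lap_add[OF P] by (simp add: algebra_simps)
  also have "\<dots> \<le> l2_norm (\<lambda>z. g z - lap v z) + l2_norm (\<lambda>z. h z - lap w z)"
    by (intro l2_norm_triangle L2_diff L L')
  also have "\<dots> < \<epsilon>" using v w by simp
  finally show "\<exists>M. \<exists>w\<in>VN2 M. l2_norm (\<lambda>z. g z + h z - lap w z) < \<epsilon>"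
    using VN2_add[OF VN2_mono[OF v(1), of "max M N"] VN2_mono[OF w(1), of "max M N"]] by auto
qed

lemma lap_closure_scale:
  assumes "g \<in> lap_closure"
  shows "(\<lambda>z. c * g z) \<in> lap_closure"
proof (cases "c = 0")
  case False
  show ?thesis unfolding lap_closure_def
  proof (intro CollectI conjI allI impI)
    show "(\<lambda>z. c * g z) \<in> L2" using lap_closure_L2[OF assms] by auto
    fix \<epsilon> :: real assume "\<epsilon> > 0"
    then have \<epsilon>: "\<epsilon> / cmod c > 0" using False by simp
    obtain M v where v: "v \<in> VN2 M" "l2_norm (\<lambda>z. g z - lap v z) < \<epsilon> / cmod c"
      using assms \<epsilon> unfolding lap_closure_def by blast
    have "l2_norm (\<lambda>z. c * g z - lap (\<lambda>z. c * v z) z) = l2_norm (\<lambda>z. c * (g z - lap v z))"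
      unfolding lap_scale[OF VN2_Pol[OF v(1)]] by (simp add: algebra_simps)
    also have "\<dots> < \<epsilon>" using v False unfolding l2_norm_scale by (simp add: field_simps)
    finally show "\<exists>M. \<exists>w\<in>VN2 M. l2_norm (\<lambda>z. c * g z - lap w z) < \<epsilon>"
      using VN2_scale[OF v(1)] by auto
  qed
qed simp

subsection \<open>Eigenfunctions\<close>

text \<open>The Taylor polynomial of \<open>sin (k (x + 1))\<close> about the point -1, with terms
  of degree below \<open>n\<close>. Expanding at the left end makes it vanish there whenever
  \<open>n\<close> is positive.\<close>

definition sin_poly :: "real \<Rightarrow> nat \<Rightarrow> complex poly" where
  "sin_poly k n = (\<Sum>i<n. smult (of_real (sin_coeff i * k ^ i)) ([:1, 1:] ^ i))"

lemma poly_sin_poly: "poly (sin_poly k n) (of_real x) = of_real (\<Sum>i<n. sin_coeff i * (k * (x + 1)) ^ i)"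
  by (simp add: sin_poly_def poly_sum power_mult_distrib mult_ac add.commute)

lemma sin_poly_tendsto: "(\<lambda>n. poly (sin_poly k n) (of_real x)) \<longlonglongrightarrow> of_real (sin (k * (x + 1)))"
proof -
  have "(\<lambda>n. \<Sum>i<n. sin_coeff i * (k * (x + 1)) ^ i) \<longlonglongrightarrow> sin (k * (x + 1))"
    using sin_converges[of "k * (x + 1)"] unfolding sums_def by simp
  then show ?thesis unfolding poly_sin_poly by (rule tendsto_of_real)
qed

text \<open>The bound is uniform in the degree: the coefficients are dominated by those of the
  exponential series, and \<open>x + 1\<close> is at most 2.\<close>

lemma sin_poly_bounded:
  assumes "k \<ge> 0" "x \<in> {-1..1}"
  shows "cmod (poly (sin_poly k n) (of_real x)) \<le> exp (2 * k)"
proof -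
  define y where "y = k * (x + 1)"
  have y: "0 \<le> y" "y \<le> 2 * k" using assms by (auto simp: y_def mult_left_mono mult.commute[of 2])
  have "cmod (poly (sin_poly k n) (of_real x)) = \<bar>\<Sum>i<n. sin_coeff i * y ^ i\<bar>"
    unfolding poly_sin_poly norm_of_real y_def ..
  also have "\<dots> \<le> (\<Sum>i<n. \<bar>sin_coeff i * y ^ i\<bar>)" by (rule sum_abs)
  also have "\<dots> \<le> (\<Sum>i<n. y ^ i /\<^sub>R fact i)"
    using y by (intro sum_mono) (auto simp: sin_coeff_def abs_mult field_simps)
  also have "\<dots> \<le> exp y"
    using y by (auto simp: exp_def intro!: sum_le_suminf summable_exp)
  also have "\<dots> \<le> exp (2 * k)" using y by simp
  finally show ?thesis .
qed

text \<open>Taylor truncations inherit the eigenvalue equation exactly, with the truncation order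
  shifted by two. Hence Laplacians of the approximants converge although differentiation is not
  continuous.\<close>

lemma pderiv2_sin_poly: "pderiv (pderiv (sin_poly k (Suc (Suc n)))) = smult (- of_real (k\<^sup>2)) (sin_poly k n)"
proof (induction n)
  case 0
  then show ?case by (simp add: sin_poly_def lessThan_Suc pderiv_add pderiv_smult pderiv_pCons)
next
  case (Suc n)
  have st: "sin_poly k (Suc i) = sin_poly k i + smult (of_real (sin_coeff i * k ^ i)) ([:1, 1:] ^ i)" for i
    by (simp add: sin_poly_def)
  have d: "pderiv ([:1, 1:] ^ Suc i) = smult (of_nat (Suc i)) ([:1, 1:] ^ i :: complex poly)" for i
    unfolding pderiv_power_Suc by (simp add: pderiv_pCons)
  have c: "sin_coeff (Suc (Suc n)) * (real (Suc (Suc n)) * real (Suc n)) = - sin_coeff n"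
    unfolding sin_coeff_Suc cos_coeff_Suc by simp
  have "pderiv (pderiv (smult (of_real (sin_coeff (Suc (Suc n)) * k ^ Suc (Suc n))) ([:1, 1:] ^ Suc (Suc n) :: complex poly)))
     = smult (of_real ((sin_coeff (Suc (Suc n)) * (real (Suc (Suc n)) * real (Suc n))) * k ^ Suc (Suc n))) ([:1, 1:] ^ n)"
    unfolding pderiv_smult d smult_smult by (simp add: mult_ac)
  also have "\<dots> = smult (- of_real (k\<^sup>2)) (smult (of_real (sin_coeff n * k ^ n)) ([:1, 1:] ^ n))"
    unfolding c by (simp add: power2_eq_square mult_ac)
  finally show ?case
    using Suc unfolding st[of "Suc (Suc n)"] st[of n] pderiv_add smult_add_right by simp
qed

definition sj :: "nat \<Rightarrow> real \<Rightarrow> real" where "sj j x = sin (real j * (pi / 2 * (x + 1)))"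

text \<open>The Taylor polynomial is corrected by a linear function so as to vanish at both ends.\<close>

definition sj_poly :: "nat \<Rightarrow> nat \<Rightarrow> complex poly" where
  "sj_poly j n = sin_poly (real j * pi / 2) (Suc (Suc n))
     - smult (poly (sin_poly (real j * pi / 2) (Suc (Suc n))) 1 / 2) [:1, 1:]"

lemma sj_poly_VN: "sj_poly j n \<in> VN (Suc (Suc n))"
proof -
  have "poly (sin_poly k (Suc m)) (-1) = 0" for k m
    using poly_sin_poly[of k "Suc m" "-1"] by (simp add: sum.lessThan_Suc_shift del: sum.lessThan_Suc)
  moreover have "degree (sj_poly j n) \<le> Suc (Suc n)"
    unfolding sj_poly_def sin_poly_def
  proof (intro degree_diff_le degree_sum_le)
    fix i assume "i \<in> {..<Suc (Suc n)}"
    then show "degree (smult (of_real (sin_coeff i * (real j * pi / 2) ^ i)) ([:1, 1:] ^ i :: complex poly)) \<le> Suc (Suc n)"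
      using degree_power_le[of "[:1, 1:] :: complex poly" i] by (intro order_trans[OF degree_smult_le]) simp
  qed (auto intro: order_trans[OF degree_smult_le])
  ultimately show ?thesis by (simp add: VN_iff sj_poly_def)
qed

lemma sj_poly_tendsto: "(\<lambda>n. poly (sj_poly j n) (of_real x)) \<longlonglongrightarrow> of_real (sj j x)"
proof -
  have 1: "(\<lambda>n. poly (sin_poly (real j * pi / 2) (Suc (Suc n))) (of_real x)) \<longlonglongrightarrow> of_real (sj j x)" for x
    using sin_poly_tendsto[of "real j * pi / 2" x] unfolding sj_def
    by (intro LIMSEQ_Suc) (simp add: mult_ac)
  have "sj j 1 = 0" by (simp add: sj_def)
  with 1[of 1] have 2: "(\<lambda>n. poly (sin_poly (real j * pi / 2) (Suc (Suc n))) 1) \<longlonglongrightarrow> 0" by simp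
  have "(\<lambda>n. poly (sj_poly j n) (of_real x)) \<longlonglongrightarrow> of_real (sj j x) - 0 / 2 * (1 + of_real x)"
    unfolding sj_poly_def poly_diff poly_smult
    by (intro tendsto_diff tendsto_mult tendsto_divide 1 2) auto
  then show ?thesis by simp
qed

lemma sj_poly_bounded:
  assumes "x \<in> {-1..1}"
  shows "cmod (poly (sj_poly j n) (of_real x)) \<le> 2 * exp (real j * pi)"
proof -
  let ?k = "real j * pi / 2"
  have "poly [:1, 1:] (complex_of_real x) = 1 + of_real x" by simp
  then have "cmod (poly (sj_poly j n) (of_real x)) \<le> cmod (poly (sin_poly ?k (Suc (Suc n))) (of_real x))
     + cmod (poly (sin_poly ?k (Suc (Suc n))) (of_real 1) / 2 * (1 + of_real x))"
    unfolding sj_poly_def poly_diff poly_smult of_real_1 by (simp only: norm_triangle_ineq4)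
  also have "cmod (poly (sin_poly ?k (Suc (Suc n))) (of_real x)) \<le> exp (real j * pi)"
    using sin_poly_bounded[of ?k x "Suc (Suc n)"] assms by simp
  also have "cmod (poly (sin_poly ?k (Suc (Suc n))) (of_real 1) / 2 * (1 + of_real x)) \<le> exp (real j * pi) / 2 * 2"
  proof -
    have "cmod (1 + complex_of_real x) \<le> 2" using norm_triangle_ineq[of 1 "complex_of_real x"] assms by auto
    moreover have "cmod (poly (sin_poly ?k (Suc (Suc n))) (of_real 1)) \<le> exp (real j * pi)"
      using sin_poly_bounded[of ?k 1 "Suc (Suc n)"] by simp
    ultimately show ?thesis unfolding norm_mult norm_divide by (intro mult_mono divide_right_mono) auto
  qed
  finally show ?thesis by simp
qed

lemma sj_poly2:
  "pderiv (pderiv (sj_poly j n)) = smult (- of_real ((real j * pi / 2)\<^sup>2)) (sin_poly (real j * pi / 2) n)"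
  unfolding sj_poly_def pderiv_diff pderiv2_sin_poly pderiv_smult by (simp add: pderiv_pCons)

definition ss :: "nat \<Rightarrow> nat \<Rightarrow> sfun" where
  "ss j k = (\<lambda>z. of_real (sj j (fst z) * sj k (snd z)))"

lemma sj_continuous [continuous_intros]:
  fixes f :: "real \<times> real \<Rightarrow> real"
  shows "continuous_on S f \<Longrightarrow> continuous_on S (\<lambda>x. sj j (f x))"
  unfolding sj_def
  by (intro continuous_on_sin continuous_on_mult continuous_on_add continuous_on_const)

lemma ss_L2 [simp]: "ss j k \<in> L2"
  unfolding ss_def by (intro L2_continuous continuous_intros)

text \<open>The product of sines is an eigenfunction with eigenvalue \<open>- (a + b)\<close>. The
  corrected Taylor polynomials are discrete functions whose Laplacians converge to that multiple of
  it, and a nonzero eigenvalue can be divided out. If an index is zero, the product itself is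
  zero.\<close>

lemma ss_lap_closure: "ss j k \<in> lap_closure"
proof (cases "j = 0 \<or> k = 0")
  case True
  then have "ss j k = (\<lambda>z. 0)" by (auto simp: ss_def sj_def)
  then show ?thesis by simp
next
  case False
  define a where "a = (real j * pi / 2)\<^sup>2"
  define b where "b = (real k * pi / 2)\<^sup>2"
  define l where "l = - complex_of_real (a + b)"
  have "a > 0" "b > 0" using False by (auto simp: a_def b_def)
  then have l: "l \<noteq> 0" unfolding l_def by (metis add_pos_pos less_irrefl neg_equal_0_iff_equal of_real_eq_0_iff)
  define w where "w n = tp (sj_poly j n) (sj_poly k n)" for n
  have w: "w n \<in> VN2 (Suc (Suc n))" for n unfolding w_def by (intro VN2_tp sj_poly_VN)
  have lw: "lap (w n) z = - of_real a * tp (sin_poly (real j * pi / 2) n) (sj_poly k n) z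
      - of_real b * tp (sj_poly j n) (sin_poly (real k * pi / 2) n) z" for n z
    unfolding w_def lap_tp sj_poly2 tp_smult_left tp_smult_right a_def b_def by simp
  \<comment> \<open>The product of the uniform bounds for a Taylor polynomial in one variable and a
    corrected one in the other, where the correction doubles the bound.\<close>
  define E where "E = exp (real j * pi) * (2 * exp (real k * pi))"
  have "(\<lambda>n. l2_norm (\<lambda>z. lap (w n) z - l * ss j k z)) \<longlonglongrightarrow> 0"
  proof (rule l2_dominated_convergence[where w = "\<lambda>z. of_real ((a + b) * E)"])
    show "lap (w n) \<in> L2" for n using lap_Pol[OF VN2_Pol[OF w]] by simp
    show "(\<lambda>z. l * ss j k z) \<in> L2" by (intro L2_scale) simp
    show "AE z in MS. (\<lambda>n. lap (w n) z) \<longlonglongrightarrow> l * ss j k z"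
    proof (rule AE_I2)
      fix z
      have "(\<lambda>n. lap (w n) z) \<longlonglongrightarrow> - of_real a * (of_real (sj j (fst z)) * of_real (sj k (snd z)))
         - of_real b * (of_real (sj j (fst z)) * of_real (sj k (snd z)))"
        unfolding lw tp_eq
        using sin_poly_tendsto[of "real j * pi / 2" "fst z"] sin_poly_tendsto[of "real k * pi / 2" "snd z"]
        by (intro tendsto_diff tendsto_mult tendsto_const sj_poly_tendsto) (simp_all add: sj_def mult_ac)
      then show "(\<lambda>n. lap (w n) z) \<longlonglongrightarrow> l * ss j k z"
        by (simp add: ss_def l_def algebra_simps)
    qed
    show "AE z in MS. cmod (lap (w n) z) \<le> cmod (of_real ((a + b) * E))" for n
    proof (rule AE_I2)
      fix z assume "z \<in> space MS"
      then have z: "fst z \<in> {-1..1}" "snd z \<in> {-1..1}" by (auto simp: Sq_def)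
      have "cmod (tp (sin_poly (real j * pi / 2) n) (sj_poly k n) z) \<le> E"
        unfolding E_def tp_eq norm_mult
        using sin_poly_bounded[of "real j * pi / 2" "fst z" n] z sj_poly_bounded[OF z(2)]
        by (intro mult_mono) auto
      moreover have "cmod (tp (sj_poly j n) (sin_poly (real k * pi / 2) n) z) \<le> (2 * exp (real j * pi)) * exp (real k * pi)"
        unfolding tp_eq norm_mult
        using sin_poly_bounded[of "real k * pi / 2" "snd z" n] z sj_poly_bounded[OF z(1)]
        by (intro mult_mono) auto
      ultimately have "a * cmod (tp (sin_poly (real j * pi / 2) n) (sj_poly k n) z)
          + b * cmod (tp (sj_poly j n) (sin_poly (real k * pi / 2) n) z) \<le> a * E + b * E"
        using \<open>a > 0\<close> \<open>b > 0\<close> by (intro add_mono mult_left_mono) (auto simp: E_def)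
      moreover have "cmod (lap (w n) z) \<le> a * cmod (tp (sin_poly (real j * pi / 2) n) (sj_poly k n) z)
          + b * cmod (tp (sj_poly j n) (sin_poly (real k * pi / 2) n) z)"
        unfolding lw using \<open>a > 0\<close> \<open>b > 0\<close>
        by (intro order_trans[OF norm_triangle_ineq4]) (simp add: norm_mult)
      moreover have "cmod (of_real ((a + b) * E)) = a * E + b * E"
        unfolding norm_of_real using \<open>a > 0\<close> \<open>b > 0\<close> by (simp add: E_def distrib_right)
      ultimately show "cmod (lap (w n) z) \<le> cmod (of_real ((a + b) * E))" by linarith
    qed
    show "(\<lambda>z. of_real ((a + b) * E)) \<in> L2" by (intro L2_continuous continuous_intros)
  qed
  from lap_closure_limit[OF this lap_closure_lap[OF w] L2_scale[OF ss_L2]]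
  have "(\<lambda>z. inverse l * (l * ss j k z)) \<in> lap_closure" by (rule lap_closure_scale)
  then show ?thesis using l by (simp add: mult.assoc[symmetric])
qed

subsection \<open>Approximation of square integrable functions\<close>

text \<open>The cosine maps the closed interval one-to-one onto itself. It serves as a new variable,
  in which polynomials are trigonometric.\<close>

definition cj :: "real \<Rightarrow> real" where "cj x = cos (pi / 2 * (x + 1))"

text \<open>Multipliers that keep every product of sines inside the closure. Quantifying over all
  frequencies makes the set stable under multiplication by cosines.\<close>

definition sin_mult :: "(real \<times> real \<Rightarrow> real) set" where
  "sin_mult = {f. \<forall>j k. (\<lambda>z. of_real (f z) * ss j k z) \<in> lap_closure}"

text \<open>A cosine times a sine of frequency \<open>j\<close> is the mean of the sines of
  frequencies \<open>j + 1\<close> and \<open>j - 1\<close>. Frequency zero is treated apart, as the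
  sine then vanishes.\<close>

lemma sin_mult_cos:
  assumes "f \<in> sin_mult"
  shows "(\<lambda>z. cj (fst z) * f z) \<in> sin_mult" "(\<lambda>z. cj (snd z) * f z) \<in> sin_mult"
proof -
  have c: "cj x * sj (Suc j) x = (sj (Suc (Suc j)) x + sj j x) / 2" for j x
  proof -
    define t where "t = pi / 2 * (x + 1)"
    have e: "real (Suc (Suc j)) * t = real (Suc j) * t + t" "real j * t = real (Suc j) * t - t"
      by (simp_all add: algebra_simps)
    show ?thesis unfolding cj_def sj_def t_def[symmetric] e sin_add sin_diff by simp
  qed
  have s0: "sj 0 x = 0" for x by (simp add: sj_def)
  have F: "(\<lambda>z. of_real (f z) * ss j k z) \<in> lap_closure" for j k using assms by (simp add: sin_mult_def)
  have G: "(\<lambda>z. (1/2) * (of_real (f z) * ss j k z + of_real (f z) * ss j' k' z)) \<in> lap_closure" for j k j' k'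
    by (intro lap_closure_scale lap_closure_add F)
  show "(\<lambda>z. cj (fst z) * f z) \<in> sin_mult"
    unfolding sin_mult_def
  proof (intro CollectI allI)
    fix j k
    show "(\<lambda>z. of_real (cj (fst z) * f z) * ss j k z) \<in> lap_closure"
    proof (cases j)
      case 0
      then show ?thesis by (simp add: ss_def s0)
    next
      case (Suc i)
      have "of_real (cj (fst z) * f z) * ss j k z
          = (1/2) * (of_real (f z) * ss (Suc (Suc i)) k z + of_real (f z) * ss i k z)" for z
      proof -
        have "of_real (cj (fst z) * f z) * ss j k z = complex_of_real ((cj (fst z) * sj j (fst z)) * f z * sj k (snd z))"
          by (simp add: ss_def)
        also have "\<dots> = (1/2) * (of_real (f z) * ss (Suc (Suc i)) k z + of_real (f z) * ss i k z)"
          unfolding Suc c by (simp add: ss_def field_simps)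
        finally show ?thesis .
      qed
      then show ?thesis using G[of "Suc (Suc i)" k i k] by (simp only:)
    qed
  qed
  show "(\<lambda>z. cj (snd z) * f z) \<in> sin_mult"
    unfolding sin_mult_def
  proof (intro CollectI allI)
    fix j k
    show "(\<lambda>z. of_real (cj (snd z) * f z) * ss j k z) \<in> lap_closure"
    proof (cases k)
      case 0
      then show ?thesis by (simp add: ss_def s0)
    next
      case (Suc i)
      have "of_real (cj (snd z) * f z) * ss j k z
          = (1/2) * (of_real (f z) * ss j (Suc (Suc i)) z + of_real (f z) * ss j i z)" for z
      proof -
        have "of_real (cj (snd z) * f z) * ss j k z = complex_of_real ((cj (snd z) * sj k (snd z)) * f z * sj j (fst z))"
          by (simp add: ss_def)
        also have "\<dots> = (1/2) * (of_real (f z) * ss j (Suc (Suc i)) z + of_real (f z) * ss j i z)"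
          unfolding Suc c by (simp add: ss_def field_simps)
        finally show ?thesis .
      qed
      then show ?thesis using G[of j "Suc (Suc i)" j i] by (simp only:)
    qed
  qed
qed

lemma sin_mult_add: "f \<in> sin_mult \<Longrightarrow> g \<in> sin_mult \<Longrightarrow> (\<lambda>z. f z + g z) \<in> sin_mult"
  using lap_closure_add by (fastforce simp: sin_mult_def distrib_right)

lemma sin_mult_scale: "f \<in> sin_mult \<Longrightarrow> (\<lambda>z. c * f z) \<in> sin_mult"
  using lap_closure_scale[of _ "of_real c"] by (fastforce simp: sin_mult_def mult.assoc)

text \<open>The induction leaves the multiplier \<open>f\<close> arbitrary, so that a product of
  polynomials is handled by multiplying first with one and then with the other.\<close>

lemma sin_mult_polynomial:
  assumes "real_polynomial_function p" "f \<in> sin_mult"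
  shows "(\<lambda>z. p (cj (fst z), cj (snd z)) * f z) \<in> sin_mult"
  using assms
proof (induction p arbitrary: f rule: real_polynomial_function.induct)
  case (linear p)
  interpret p: bounded_linear p by (rule linear)
  define \<alpha> where "\<alpha> = p (1, 0)"
  define \<beta> where "\<beta> = p (0, 1)"
  have "p (a, b) = a * \<alpha> + b * \<beta>" for a b
    using p.add[of "(a, 0)" "(0, b)"] p.scaleR[of a "(1, 0)"] p.scaleR[of b "(0, 1)"]
    by (simp add: \<alpha>_def \<beta>_def)
  then have "p (cj (fst z), cj (snd z)) * f z = \<alpha> * (cj (fst z) * f z) + \<beta> * (cj (snd z) * f z)" for z
    by (simp add: algebra_simps)
  then show ?case
    using sin_mult_add[OF sin_mult_scale[OF sin_mult_cos(1)[OF linear(2)]] sin_mult_scale[OF sin_mult_cos(2)[OF linear(2)]], of \<alpha> \<beta>]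
    by (simp only:)
next
  case (const c)
  then show ?case by (rule sin_mult_scale)
next
  case (add p q)
  then show ?case using sin_mult_add[OF add.IH] by (simp add: distrib_right)
next
  case (mult p q)
  then show ?case using mult.IH(1)[OF mult.IH(2)[OF mult.prems]] by (simp add: mult.assoc)
qed

lemma lap_closure_uniform:
  assumes "g \<in> borel_measurable MS"
    and "\<And>\<epsilon>. \<epsilon> > 0 \<Longrightarrow> \<exists>h\<in>lap_closure. \<forall>z\<in>Sq. cmod (h z - g z) \<le> \<epsilon>"
  shows "g \<in> lap_closure"
proof -
  have "\<forall>n::nat. \<exists>h\<in>lap_closure. \<forall>z\<in>Sq. cmod (h z - g z) \<le> 1 / real (Suc n)"
    by (intro allI assms(2)) simp
  then obtain h where h: "\<And>n::nat. h n \<in> lap_closure" "\<And>n z. z \<in> Sq \<Longrightarrow> cmod (h n z - g z) \<le> 1 / real (Suc n)"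
    by metis
  note hL = lap_closure_L2[OF h(1)]
  note [measurable] = assms(1) L2_measurable[OF hL]
  have dL: "(\<lambda>z. h 0 z - g z) \<in> L2"
    by (rule L2_bounded[where B = 1]) (use h(2)[of _ 0] in auto)
  have gL: "g \<in> L2" using L2_diff[OF hL[of 0] dL] by simp
  have "(\<lambda>n. l2_norm (\<lambda>z. h n z - g z)) \<longlonglongrightarrow> 0"
  proof (rule tendsto_sandwich[of "\<lambda>_. 0" _ _ "\<lambda>n. sqrt (measure MS Sq) * (1 / real (Suc n))"])
    show "\<forall>\<^sub>F n in sequentially. l2_norm (\<lambda>z. h n z - g z) \<le> sqrt (measure MS Sq) * (1 / real (Suc n))"
      using h(2) by (intro always_eventually allI l2_norm_le_sup) auto
    show "(\<lambda>n. sqrt (measure MS Sq) * (1 / real (Suc n))) \<longlonglongrightarrow> 0"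
      using tendsto_mult_right[OF LIMSEQ_inverse_real_of_nat, of "sqrt (measure MS Sq)"]
      by (simp add: inverse_eq_divide)
  qed auto
  from lap_closure_limit[OF this h(1) gL] show ?thesis .
qed

lemma cj_inverse:
  assumes "x \<in> {-1..1}"
  shows "2 * arccos (cj x) / pi - 1 = x" "cj x \<in> {-1..1}"
proof -
  have "0 \<le> pi / 2 * (x + 1)" "pi / 2 * (x + 1) \<le> pi"
    using assms mult_left_mono[of "x + 1" 2 "pi / 2"] by auto
  then have "arccos (cj x) = pi / 2 * (x + 1)" unfolding cj_def by (rule arccos_cos)
  then show "2 * arccos (cj x) / pi - 1 = x" by (simp add: field_simps)
  show "cj x \<in> {-1..1}" by (simp add: cj_def)
qed

lemma sj1_pos: "x \<in> {-1<..<1} \<Longrightarrow> sj 1 x > 0"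
  unfolding sj_def using mult_strict_left_mono[of "x + 1" 2 "pi / 2"] by (intro sin_gt_zero) auto

lemma sj1_nonneg: "x \<in> {-1..1} \<Longrightarrow> sj 1 x \<ge> 0"
  unfolding sj_def using mult_left_mono[of "x + 1" 2 "pi / 2"] by (intro sin_ge_zero) auto

lemma continuous_measurable_MS:
  fixes f :: "real \<times> real \<Rightarrow> 'a::euclidean_space"
  shows "continuous_on cSq f \<Longrightarrow> f \<in> borel_measurable MS"
  using Sq_subset_cSq
  by (intro continuous_imp_measurable_on_sets_lebesgue) (auto intro: continuous_on_subset)

text \<open>Written in the cosine variables, \<open>k\<close> is again continuous on the closed
  square and is approximated uniformly by polynomials. Polynomials in cosines times the lowest
  product of sines belong to the closure.\<close>

lemma lap_closure_continuous_sin: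
  fixes k :: "real \<times> real \<Rightarrow> real"
  assumes k: "continuous_on cSq k"
  shows "(\<lambda>z. of_real (k z) * ss 1 1 z) \<in> lap_closure"
proof (rule lap_closure_uniform)
  show "(\<lambda>z. of_real (k z) * ss 1 1 z) \<in> borel_measurable MS"
    unfolding ss_def by (intro continuous_measurable_MS continuous_intros k)
  fix \<epsilon> :: real assume \<epsilon>: "\<epsilon> > 0"
  \<comment> \<open>This is \<open>k\<close> pulled back by the inverse of the cosine substitution
    in each coordinate.\<close>
  define h where "h = (\<lambda>z :: real \<times> real. k (2 * arccos (fst z) / pi - 1, 2 * arccos (snd z) / pi - 1))"
  have ar: "2 * arccos a / pi - 1 \<in> {-1..1}" if "a \<in> {-1..1}" for a
    using arccos_lbound[of a] arccos_ubound[of a] that by (auto simp: field_simps)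
  have "continuous_on cSq h"
    unfolding h_def
    by (rule continuous_on_compose2[OF k])
       (auto intro!: continuous_intros simp: cSq_def dest: ar)
  from Stone_Weierstrass_real_polynomial_function[OF compact_cSq this \<epsilon>]
  obtain p where p: "real_polynomial_function p" "\<And>z. z \<in> cSq \<Longrightarrow> \<bar>h z - p z\<bar> < \<epsilon>" by blast
  have one: "(\<lambda>z. 1) \<in> sin_mult" using ss_lap_closure by (simp add: sin_mult_def)
  have h1: "(\<lambda>z. of_real (p (cj (fst z), cj (snd z))) * ss 1 1 z) \<in> lap_closure"
    using sin_mult_polynomial[OF p(1) one] unfolding sin_mult_def by auto
  have h2: "cmod (of_real (p (cj (fst z), cj (snd z))) * ss 1 1 z - of_real (k z) * ss 1 1 z) \<le> \<epsilon>" if "z \<in> Sq" for z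
  proof -
    have z: "fst z \<in> {-1..1}" "snd z \<in> {-1..1}" using that by (auto simp: Sq_def)
    have "(cj (fst z), cj (snd z)) \<in> cSq" using cj_inverse(2)[OF z(1)] cj_inverse(2)[OF z(2)] by (simp add: cSq_def)
    from p(2)[OF this] have "\<bar>k z - p (cj (fst z), cj (snd z))\<bar> < \<epsilon>"
      using cj_inverse(1)[OF z(1)] cj_inverse(1)[OF z(2)] by (simp add: h_def)
    then have le: "\<bar>p (cj (fst z), cj (snd z)) - k z\<bar> \<le> \<epsilon>" by simp
    have "of_real (p (cj (fst z), cj (snd z))) * ss 1 1 z - of_real (k z) * ss 1 1 z
        = complex_of_real ((p (cj (fst z), cj (snd z)) - k z) * (sj 1 (fst z) * sj 1 (snd z)))"
      by (simp add: ss_def algebra_simps)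
    then have "cmod (of_real (p (cj (fst z), cj (snd z))) * ss 1 1 z - of_real (k z) * ss 1 1 z)
        = \<bar>p (cj (fst z), cj (snd z)) - k z\<bar> * (\<bar>sj 1 (fst z)\<bar> * \<bar>sj 1 (snd z)\<bar>)"
      by (simp only: norm_of_real abs_mult)
    also have "\<dots> \<le> \<epsilon> * (1 * 1)"
      using le \<epsilon> by (intro mult_mono) (auto simp: sj_def)
    finally show ?thesis by simp
  qed
  show "\<exists>h\<in>lap_closure. \<forall>z\<in>Sq. cmod (h z - of_real (k z) * ss 1 1 z) \<le> \<epsilon>"
    by (intro bexI[OF _ h1] ballI h2)
qed

text \<open>The factor of sines is divided out, with its denominator kept away from zero near the
  boundary. The quotient of the sines by the modified denominator lies in the unit interval and is
  eventually 1 at every inner point.\<close>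

lemma lap_closure_continuous_real:
  fixes g :: "real \<times> real \<Rightarrow> real"
  assumes g: "continuous_on cSq g"
  shows "(\<lambda>z. of_real (g z)) \<in> lap_closure"
proof -
  define s where "s z = sj 1 (fst z) * sj 1 (snd z)" for z
  have sc: "continuous_on cSq s" unfolding s_def by (intro continuous_intros)
  define k where "k n z = g z / max (s z) (1 / real (Suc n))" for n z
  have mx: "max (s z) (1 / real (Suc n)) > 0" for n z by (simp add: less_max_iff_disj)
  have kc: "continuous_on cSq (k n)" for n
    unfolding k_def using mx[of _ n] by (intro continuous_intros g sc) (metis less_irrefl)
  have L: "(\<lambda>z. complex_of_real (g z)) \<in> L2" by (intro L2_continuous continuous_intros g)
  have "(\<lambda>n. l2_norm (\<lambda>z. of_real (k n z) * ss 1 1 z - of_real (g z))) \<longlonglongrightarrow> 0"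
  proof (rule l2_dominated_convergence[OF _ L L])
    show "(\<lambda>z. of_real (k n z) * ss 1 1 z) \<in> L2" for n
      by (rule lap_closure_L2[OF lap_closure_continuous_sin[OF kc]])
    have kz: "of_real (k n z) * ss 1 1 z = of_real (g z) * of_real (s z / max (s z) (1 / real (Suc n)))" for n z
      by (simp add: k_def ss_def s_def)
    show "AE z in MS. (\<lambda>n. of_real (k n z) * ss 1 1 z) \<longlonglongrightarrow> of_real (g z)"
    proof (rule AE_I2)
      fix z assume "z \<in> space MS"
      then have "fst z \<in> {-1<..<1}" "snd z \<in> {-1<..<1}" by (auto simp: Sq_def)
      then have sz: "s z > 0" unfolding s_def by (intro mult_pos_pos sj1_pos)
      have "\<forall>\<^sub>F n in sequentially. 1 / real (Suc n) < s z"
        using order_tendstoD(2)[OF LIMSEQ_inverse_real_of_nat sz] by (simp add: inverse_eq_divide)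
      then have "\<forall>\<^sub>F n in sequentially. of_real (k n z) * ss 1 1 z = complex_of_real (g z)"
        by eventually_elim (subst kz, use sz in \<open>simp add: max_def\<close>)
      then show "(\<lambda>n. of_real (k n z) * ss 1 1 z) \<longlonglongrightarrow> of_real (g z)" by (rule tendsto_eventually)
    qed
    show "AE z in MS. cmod (of_real (k n z) * ss 1 1 z) \<le> cmod (of_real (g z))" for n
    proof (rule AE_I2)
      fix z assume "z \<in> space MS"
      then have "fst z \<in> {-1..1}" "snd z \<in> {-1..1}" by (auto simp: Sq_def)
      then have sz: "s z \<ge> 0" unfolding s_def by (intro mult_nonneg_nonneg sj1_nonneg)
      have "s z / max (s z) (1 / real (Suc n)) \<le> 1" "0 \<le> s z / max (s z) (1 / real (Suc n))"
        using mx[of z n] sz by (simp_all add: divide_le_eq)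
      then have "\<bar>s z / max (s z) (1 / real (Suc n))\<bar> \<le> 1" by linarith
      then have "\<bar>g z\<bar> * \<bar>s z / max (s z) (1 / real (Suc n))\<bar> \<le> \<bar>g z\<bar> * 1"
        by (intro mult_left_mono) auto
      then show "cmod (of_real (k n z) * ss 1 1 z) \<le> cmod (of_real (g z))"
        unfolding kz norm_mult norm_of_real by simp
    qed
  qed
  from lap_closure_limit[OF this lap_closure_continuous_sin[OF kc] L] show ?thesis .
qed

lemma lap_closure_continuous:
  assumes g: "continuous_on cSq g"
  shows "g \<in> lap_closure"
proof -
  have "(\<lambda>z. of_real (Re (g z)) + \<i> * of_real (Im (g z))) \<in> lap_closure"
    by (intro lap_closure_add lap_closure_scale lap_closure_continuous_real continuous_intros g)
  then show ?thesis by (simp add: complex_eq[symmetric])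
qed

text \<open>Radial truncation at modulus \<open>K\<close>. Being continuous and bounded, it provides
  a constant majorant while preserving pointwise limits.\<close>

definition clip :: "real \<Rightarrow> complex \<Rightarrow> complex" where
  "clip K w = w / of_real (max 1 (cmod w / K))"

lemma clip_bounds:
  assumes "K > 0"
  shows "cmod (clip K w) \<le> K" "cmod (clip K w) \<le> cmod w" "cmod w \<le> K \<Longrightarrow> clip K w = w"
proof -
  have "cmod (clip K w) = cmod w / max 1 (cmod w / K)"
    by (simp add: clip_def norm_divide)
  moreover have m: "max 1 (cmod w / K) > 0" by (simp add: less_max_iff_disj)
  moreover have "cmod w \<le> K * max 1 (cmod w / K)"
    using assms by (metis max.cobounded2 mult_left_mono less_imp_le nonzero_mult_div_cancel_left times_divide_eq_right less_irrefl)
  moreover have "cmod w * 1 \<le> cmod w * max 1 (cmod w / K)" by (intro mult_left_mono) auto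
  ultimately show "cmod (clip K w) \<le> K" "cmod (clip K w) \<le> cmod w"
    by (simp_all add: divide_le_eq)
  assume "cmod w \<le> K"
  then show "clip K w = w" using assms by (simp add: clip_def max_def)
qed

lemma clip_continuous:
  assumes "K > 0"
  shows "continuous_on S (clip K)"
proof -
  have "max 1 (cmod w / K) \<noteq> 0" for w by (metis less_max_iff_disj less_irrefl zero_less_one)
  then have "complex_of_real (max 1 (cmod w / K)) \<noteq> 0" for w by (simp only: of_real_eq_0_iff not_False_eq_True)
  then show ?thesis unfolding clip_def using assms by (intro continuous_intros) auto
qed

text \<open>A measurable function is an almost everywhere limit of continuous ones. Clipping these
  makes dominated convergence applicable and covers bounded functions; letting the clipping level
  grow, with \<open>e\<close> as its own majorant, covers the rest.\<close>

theorem lap_dense: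
  assumes e: "e \<in> L2"
  shows "e \<in> lap_closure"
proof -
  have "e measurable_on Sq" using L2_measurable[OF e] by (simp add: measurable_on_iff_borel_measurable)
  then obtain N g where N: "negligible N" and g: "\<And>n::nat. continuous_on UNIV (g n)"
    and lim: "\<And>z. z \<notin> N \<Longrightarrow> (\<lambda>n. g n z) \<longlonglongrightarrow> (if z \<in> Sq then e z else 0)"
    unfolding measurable_on_def by blast
  have AE: "AE z in MS. (\<lambda>n. g n z) \<longlonglongrightarrow> e z"
  proof -
    have "AE z in lebesgue. z \<notin> N" using N by (simp add: negligible_iff_null_sets AE_not_in)
    then have "AE z in lebesgue. z \<in> Sq \<longrightarrow> (\<lambda>n. g n z) \<longlonglongrightarrow> e z"
    proof eventually_elim
      case (elim z)
      then show ?case using lim[OF elim] by (auto split: if_splits)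
    qed
    then show ?thesis by (simp add: AE_restrict_space_iff)
  qed
  have cK: "(\<lambda>z. clip K (e z)) \<in> lap_closure" if K: "K > 0" for K
  proof -
    have L: "(\<lambda>z. clip K (e z)) \<in> L2"
    proof (rule L2_bounded[where B = K])
      show "(\<lambda>z. clip K (e z)) \<in> borel_measurable MS"
        by (rule measurable_compose[OF L2_measurable[OF e]])
           (intro borel_measurable_continuous_onI clip_continuous K)
    qed (rule clip_bounds(1)[OF K])
    have gc: "continuous_on cSq (\<lambda>z. clip K (g n z))" for n
      by (rule continuous_on_compose2[OF clip_continuous[OF K, of UNIV] continuous_on_subset[OF g]]) auto
    have "(\<lambda>n. l2_norm (\<lambda>z. clip K (g n z) - clip K (e z))) \<longlonglongrightarrow> 0"
    proof (rule l2_dominated_convergence[where w = "\<lambda>z. of_real K"])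
      show "AE z in MS. (\<lambda>n. clip K (g n z)) \<longlonglongrightarrow> clip K (e z)"
        using AE
      proof eventually_elim
        case (elim z)
        have "isCont (clip K) (e z)" using clip_continuous[OF K, of UNIV] by (simp add: continuous_on_eq_continuous_at)
        then show ?case by (rule isCont_tendsto_compose) (rule elim)
      qed
      show "AE z in MS. cmod (clip K (g n z)) \<le> cmod (of_real K)" for n
        by (rule AE_I2) (use clip_bounds(1)[OF K] K in simp)
      show "(\<lambda>z. of_real K) \<in> L2" by (intro L2_continuous continuous_intros)
    qed (use L lap_closure_L2[OF lap_closure_continuous[OF gc]] in auto)
    from lap_closure_limit[OF this lap_closure_continuous[OF gc] L] show ?thesis .
  qed
  have "(\<lambda>n. l2_norm (\<lambda>z. clip (real (Suc n)) (e z) - e z)) \<longlonglongrightarrow> 0"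
  proof (rule l2_dominated_convergence[OF _ e e])
    show "(\<lambda>z. clip (real (Suc n)) (e z)) \<in> L2" for n by (rule lap_closure_L2[OF cK]) simp
    show "AE z in MS. (\<lambda>n. clip (real (Suc n)) (e z)) \<longlonglongrightarrow> e z"
    proof (rule AE_I2)
      fix z
      obtain n0 where n0: "cmod (e z) < real n0" using reals_Archimedean2 by blast
      have "\<forall>\<^sub>F n in sequentially. clip (real (Suc n)) (e z) = e z"
        using eventually_ge_at_top[of n0]
        by eventually_elim (use n0 in \<open>auto intro!: clip_bounds(3)\<close>)
      then show "(\<lambda>n. clip (real (Suc n)) (e z)) \<longlonglongrightarrow> e z" by (rule tendsto_eventually)
    qed
    show "AE z in MS. cmod (clip (real (Suc n)) (e z)) \<le> cmod (e z)" for n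
      by (rule AE_I2) (rule clip_bounds(2), simp)
  qed
  from lap_closure_limit[OF this cK e] show ?thesis by simp
qed

section \<open>Smooth cutoff functions\<close>

text \<open>One-variable counterpart of \<open>Ck_on\<close> on the whole line. Each derivative is
  given existentially, so closure under sums, products and reciprocals follows by induction on the
  order.\<close>

primrec Dk :: "nat \<Rightarrow> (real \<Rightarrow> 'a::real_normed_algebra) \<Rightarrow> bool" where
  "Dk 0 f \<longleftrightarrow> continuous_on UNIV f"
| "Dk (Suc k) f \<longleftrightarrow> (\<exists>f'. (\<forall>x. (f has_vector_derivative f' x) (at x)) \<and> Dk k f')"

lemma DkI: "(\<And>x. (f has_vector_derivative f' x) (at x)) \<Longrightarrow> Dk k f' \<Longrightarrow> Dk (Suc k) f"
  by auto

lemma Dk_continuous: "Dk k f \<Longrightarrow> continuous_on UNIV f"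
proof (cases k)
  case (Suc n)
  assume "Dk k f"
  then obtain f' where "\<And>x. (f has_vector_derivative f' x) (at x)" using Suc by auto
  then show ?thesis using has_vector_derivative_continuous by (blast intro: continuous_at_imp_continuous_on)
qed simp

lemma Dk_SucD: "Dk (Suc k) f \<Longrightarrow> Dk k f"
proof (induction k arbitrary: f)
  case 0
  then show ?case using Dk_continuous[of "Suc 0" f] by simp
next
  case (Suc k)
  then obtain f' where "\<forall>x. (f has_vector_derivative f' x) (at x)" "Dk (Suc k) f'"
    unfolding Dk.simps(2)[of "Suc k"] by blast
  then show ?case using Suc.IH[of f'] by (intro DkI[of f f']) auto
qed

lemma Dk_const: "Dk k (\<lambda>x. c)"
  by (induction k arbitrary: c) (auto intro!: exI[of _ "\<lambda>x. 0"])

lemma Dk_add: "Dk k f \<Longrightarrow> Dk k g \<Longrightarrow> Dk k (\<lambda>x. f x + g x)"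
proof (induction k arbitrary: f g)
  case (Suc k)
  then obtain f' g' where "\<forall>x. (f has_vector_derivative f' x) (at x)" "Dk k f'"
    "\<forall>x. (g has_vector_derivative g' x) (at x)" "Dk k g'" by auto
  then show ?case using Suc.IH[of f' g']
    by (auto intro!: exI[of _ "\<lambda>x. f' x + g' x"] has_vector_derivative_add)
qed (auto intro: continuous_intros)

lemma Dk_mult:
  fixes f g :: "real \<Rightarrow> 'a::real_normed_algebra"
  shows "Dk k f \<Longrightarrow> Dk k g \<Longrightarrow> Dk k (\<lambda>x. f x * g x)"
proof (induction k arbitrary: f g)
  case (Suc k)
  then obtain f' g' where d: "\<forall>x. (f has_vector_derivative f' x) (at x)" "Dk k f'"
    "\<forall>x. (g has_vector_derivative g' x) (at x)" "Dk k g'" by auto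
  have "Dk k (\<lambda>x. f x * g' x + f' x * g x)"
    using Suc d by (intro Dk_add Suc.IH) (auto dest: Dk_SucD simp del: Dk.simps)
  then show ?case using d has_vector_derivative_mult by (intro DkI) blast+
qed (auto intro: continuous_intros)

lemma Dk_affine: "Dk k f \<Longrightarrow> Dk k (\<lambda>x. f (a * x + b))"
proof (induction k arbitrary: f)
  case 0
  then show ?case by (auto intro!: continuous_intros continuous_on_compose2[of UNIV f])
next
  case (Suc k)
  then obtain f' where f': "\<And>x. (f has_vector_derivative f' x) (at x)" "Dk k f'" by auto
  have "((\<lambda>x. f (a * x + b)) has_vector_derivative a *\<^sub>R f' (a * x + b)) (at x)" for x
  proof -
    have "((\<lambda>x. a * x + b) has_real_derivative a) (at x)" by (auto intro!: derivative_eq_intros)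
    then have "((\<lambda>x. a * x + b) has_vector_derivative a) (at x)"
      by (simp add: has_real_derivative_iff_has_vector_derivative)
    from vector_diff_chain_at[OF this f'(1)] show ?thesis by (simp add: o_def)
  qed
  moreover have "Dk k (\<lambda>x. a *\<^sub>R f' (a * x + b))"
  proof -
    have sc: "Dk j h \<Longrightarrow> Dk j (\<lambda>x. a *\<^sub>R h x)" for j and h :: "real \<Rightarrow> 'a"
    proof (induction j arbitrary: h)
      case (Suc j)
      then obtain h' where "\<forall>x. (h has_vector_derivative h' x) (at x)" "Dk j h'" by auto
      then show ?case using Suc.IH[of h']
        by (auto intro!: exI[of _ "\<lambda>x. a *\<^sub>R h' x"] bounded_linear.has_vector_derivative[OF bounded_linear_scaleR_right])
    qed (auto intro: continuous_intros)
    show ?thesis by (rule sc) (rule Suc.IH[OF f'(2)])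
  qed
  ultimately show ?case by (rule DkI)
qed

lemma Dk_inverse:
  fixes f :: "real \<Rightarrow> real"
  assumes "\<And>x. f x \<noteq> 0"
  shows "Dk k f \<Longrightarrow> Dk k (\<lambda>x. inverse (f x))"
proof (induction k)
  case 0
  then show ?case using assms by (auto intro: continuous_intros)
next
  case (Suc k)
  then obtain f' where f': "\<And>x. (f has_vector_derivative f' x) (at x)" "Dk k f'" by auto
  have "((\<lambda>x. inverse (f x)) has_vector_derivative ((-1) * f' x) * (inverse (f x) * inverse (f x))) (at x)" for x
    using f'(1)[of x] assms[of x] unfolding has_real_derivative_iff_has_vector_derivative[symmetric]
    by (auto intro!: derivative_eq_intros)
  moreover have "Dk k (\<lambda>x. ((-1) * f' x) * (inverse (f x) * inverse (f x)))"
    using Suc.IH[OF Dk_SucD[OF Suc.prems]] by (intro Dk_mult Dk_const f')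
  ultimately show ?case by (rule DkI)
qed

lemma Dk_of_real: "Dk k f \<Longrightarrow> Dk k (\<lambda>x. complex_of_real (f x))"
proof (induction k arbitrary: f)
  case (Suc k)
  then obtain f' where "\<forall>x. (f has_vector_derivative f' x) (at x)" "Dk k f'" by auto
  then show ?case using Suc.IH[of f'] has_vector_derivative_of_real
    by (intro DkI[of _ "\<lambda>x. of_real (f' x)"]) (auto simp: has_real_derivative_iff_has_vector_derivative)
qed (auto intro: continuous_intros)

lemma Dk_poly: "Dk k (\<lambda>x. poly p (complex_of_real x))"
proof (induction k arbitrary: p)
  case (Suc k)
  have "((\<lambda>x. poly p (complex_of_real x)) has_vector_derivative poly (pderiv p) (of_real x)) (at x)" for x
    by (intro has_vector_derivative_real_field) (rule poly_DERIV)
  then show ?case using Suc by (rule DkI)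
qed (auto intro: continuous_intros)

text \<open>The functions \<open>P(1/x) exp(-1/x)\<close>, continued by zero to the left. The class
  is closed under differentiation, which replaces \<open>P\<close> by \<open>X^2 (P - P')\<close>,
  and thus all derivatives are treated at once.\<close>

definition flat_exp :: "real poly \<Rightarrow> real \<Rightarrow> real" where
  "flat_exp P x = (if x > 0 then poly P (1 / x) * exp (- (1 / x)) else 0)"

lemma poly_exp_tendsto_0: "((\<lambda>x. poly P x * exp (- x)) \<longlongrightarrow> 0) at_top" for P :: "real poly"
proof -
  have "((\<lambda>x. \<Sum>i\<le>degree P. coeff P i * (x ^ i / exp x)) \<longlongrightarrow> (\<Sum>i\<le>degree P. coeff P i * 0)) at_top"
    by (intro tendsto_sum tendsto_mult tendsto_const tendsto_power_div_exp_0)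
  moreover have "(\<Sum>i\<le>degree P. coeff P i * (x ^ i / exp x)) = poly P x * exp (- x)" for x
    by (simp add: poly_altdef sum_distrib_right exp_minus divide_inverse mult.assoc)
  ultimately show ?thesis by simp
qed

lemma flat_exp_deriv: "(flat_exp P has_vector_derivative flat_exp ([:0, 1:]\<^sup>2 * (P - pderiv P)) x) (at x)"
proof -
  consider "x > 0" | "x < 0" | "x = 0" by linarith
  then have "(flat_exp P has_real_derivative flat_exp ([:0, 1:]\<^sup>2 * (P - pderiv P)) x) (at x)"
  proof cases
    case 1
    have "((\<lambda>x. poly P (1 / x) * exp (- (1 / x))) has_real_derivative flat_exp ([:0, 1:]\<^sup>2 * (P - pderiv P)) x) (at x)"
      using 1 by (auto intro!: derivative_eq_intros poly_DERIV[THEN DERIV_chain2] simp: flat_exp_def power2_eq_square field_simps)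
    moreover have "\<forall>\<^sub>F y in nhds x. flat_exp P y = poly P (1 / y) * exp (- (1 / y))"
      using eventually_nhds_in_open[of "{0<..}" x] 1 by (auto simp: flat_exp_def elim!: eventually_mono)
    ultimately show ?thesis by (subst DERIV_cong_ev[OF refl _ refl])
  next
    case 2
    have "((\<lambda>x. 0) has_real_derivative flat_exp ([:0, 1:]\<^sup>2 * (P - pderiv P)) x) (at x)"
      using 2 by (simp add: flat_exp_def)
    moreover have "\<forall>\<^sub>F y in nhds x. flat_exp P y = 0"
      using eventually_nhds_in_open[of "{..<0}" x] 2 by (auto simp: flat_exp_def elim!: eventually_mono)
    ultimately show ?thesis by (subst DERIV_cong_ev[OF refl _ refl])
  next
    case 3
    \<comment> \<open>At the origin the difference quotient on the right is again of this type, with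
      \<open>P\<close> multiplied by the variable, and the exponential decay dominates any
      polynomial in \<open>1/h\<close>.\<close>
    have "((\<lambda>h. flat_exp P h / h) \<longlongrightarrow> 0) (at 0)"
    proof (rule filterlim_split_at)
      have "((\<lambda>h. flat_exp P h / h) \<longlongrightarrow> 0) (at_left 0) \<longleftrightarrow> ((\<lambda>h. 0 :: real) \<longlongrightarrow> 0) (at_left (0::real))"
        by (rule filterlim_cong) (auto simp: eventually_at_filter flat_exp_def intro!: always_eventually)
      then show "((\<lambda>h. flat_exp P h / h) \<longlongrightarrow> 0) (at_left 0)" by simp
      have "((\<lambda>h. poly (pCons 0 P) (inverse h) * exp (- inverse h)) \<longlongrightarrow> 0) (at_right 0)"
        by (rule filterlim_compose[OF poly_exp_tendsto_0 filterlim_inverse_at_top_right])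
      moreover have "((\<lambda>h. flat_exp P h / h) \<longlongrightarrow> 0) (at_right 0) \<longleftrightarrow> ((\<lambda>h. poly (pCons 0 P) (inverse h) * exp (- inverse h)) \<longlongrightarrow> 0) (at_right (0::real))"
        by (rule filterlim_cong) (auto simp: eventually_at_filter flat_exp_def divide_inverse intro!: always_eventually)
      ultimately show "((\<lambda>h. flat_exp P h / h) \<longlongrightarrow> 0) (at_right 0)" by simp
    qed
    then show ?thesis using 3 by (simp add: DERIV_def flat_exp_def)
  qed
  then show ?thesis by (simp add: has_real_derivative_iff_has_vector_derivative)
qed

lemma Dk_flat_exp: "Dk k (flat_exp P)"
proof (induction k arbitrary: P)
  case 0
  then show ?case using flat_exp_deriv by (auto intro!: continuous_at_imp_continuous_on has_vector_derivative_continuous)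
next
  case (Suc k)
  then show ?case using flat_exp_deriv[of P] by auto
qed

text \<open>The standard smooth transition from 0 on the left of 0 to 1 on the right of 1; the
  denominator is positive since at least one of its two terms is.\<close>

definition Hs :: "real \<Rightarrow> real" where "Hs x = flat_exp 1 x * inverse (flat_exp 1 x + flat_exp 1 (1 - x))"

lemma flat_exp_1: "flat_exp 1 x \<ge> 0" "x > 0 \<Longrightarrow> flat_exp 1 x > 0" "x \<le> 0 \<Longrightarrow> flat_exp 1 x = 0"
  by (simp_all add: flat_exp_def)

lemma Hs_denominator: "flat_exp 1 x + flat_exp 1 (1 - x) > 0"
  using flat_exp_1(1)[of x] flat_exp_1(1)[of "1 - x"] flat_exp_1(2)[of x] flat_exp_1(2)[of "1 - x"] by (cases "x > 0") auto

lemma Dk_Hs: "Dk k Hs"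
proof -
  have "Dk k (\<lambda>x. flat_exp 1 ((-1) * x + 1))" by (rule Dk_affine[OF Dk_flat_exp])
  then show ?thesis unfolding Hs_def
    using Hs_denominator by (intro Dk_mult Dk_inverse Dk_add Dk_flat_exp) (auto simp: less_le)
qed

lemma Hs_0: "x \<le> 0 \<Longrightarrow> Hs x = 0"
  by (simp add: Hs_def flat_exp_1)

lemma Hs_1: "x \<ge> 1 \<Longrightarrow> Hs x = 1"
  using flat_exp_1(2)[of x] by (simp add: Hs_def flat_exp_1(3))

lemma Hs_bounds: "0 \<le> Hs x" "Hs x \<le> 1"
proof -
  have "Hs x = flat_exp 1 x / (flat_exp 1 x + flat_exp 1 (1 - x))" by (simp add: Hs_def divide_inverse)
  then show "0 \<le> Hs x" "Hs x \<le> 1"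
    using Hs_denominator[of x] flat_exp_1(1)[of x] flat_exp_1(1)[of "1 - x"] by (simp_all add: divide_le_eq)
qed

lemma Hs_derivative:
  "\<exists>h B. continuous_on UNIV h \<and> (\<forall>x. (Hs has_real_derivative h x) (at x))
     \<and> (\<forall>x. x < 0 \<or> x > 1 \<longrightarrow> h x = 0) \<and> (\<forall>x. \<bar>h x\<bar> \<le> B)"
proof -
  obtain h where h: "\<And>x. (Hs has_vector_derivative h x) (at x)" "Dk 0 h"
    using Dk_Hs[of "Suc 0"] by auto
  have hd: "(Hs has_real_derivative h x) (at x)" for x
    using h(1) by (simp add: has_real_derivative_iff_has_vector_derivative)
  have z: "h x = 0" if "x < 0 \<or> x > 1" for x
  proof -
    have "\<forall>\<^sub>F y in nhds x. Hs y = (if x < 0 then 0 else 1)"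
    proof (cases "x < 0")
      case True
      then show ?thesis using eventually_nhds_in_open[of "{..<0}" x] by (auto simp: Hs_0 elim!: eventually_mono)
    next
      case False
      then show ?thesis using that eventually_nhds_in_open[of "{1<..}" x] by (auto simp: Hs_1 elim!: eventually_mono)
    qed
    then have "(Hs has_real_derivative 0) (at x)" by (subst DERIV_cong_ev[OF refl _ refl]) auto
    then show ?thesis using hd DERIV_unique by blast
  qed
  have c: "continuous_on UNIV h" using h(2) by simp
  have "compact (h ` {0..1})" by (intro compact_continuous_image continuous_on_subset[OF c]) auto
  then obtain B where B: "\<And>x. x \<in> {0..1} \<Longrightarrow> \<bar>h x\<bar> \<le> B"
    using compact_imp_bounded[of "h ` {0..1}"] unfolding bounded_iff by fastforce
  have "\<bar>h x\<bar> \<le> max B 0" for x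
    using z[of x] B[of x] by (cases "x \<in> {0..1}") auto
  then show ?thesis using c hd z by blast
qed

definition hs :: "real \<Rightarrow> real" where "hs = (SOME h. \<exists>B. continuous_on UNIV h \<and> (\<forall>x. (Hs has_real_derivative h x) (at x))
     \<and> (\<forall>x. x < 0 \<or> x > 1 \<longrightarrow> h x = 0) \<and> (\<forall>x. \<bar>h x\<bar> \<le> B))"

lemma hs:
  "continuous_on UNIV hs" "(Hs has_real_derivative hs x) (at x)" "x < 0 \<or> x > 1 \<Longrightarrow> hs x = 0"
  and hs_bound: "\<exists>B\<ge>0. \<forall>x. \<bar>hs x\<bar> \<le> B"
proof -
  have *: "\<exists>B. continuous_on UNIV hs \<and> (\<forall>x. (Hs has_real_derivative hs x) (at x))
     \<and> (\<forall>x. x < 0 \<or> x > 1 \<longrightarrow> hs x = 0) \<and> (\<forall>x. \<bar>hs x\<bar> \<le> B)"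
    using Hs_derivative unfolding hs_def by (rule someI_ex)
  then show "continuous_on UNIV hs" "(Hs has_real_derivative hs x) (at x)" "x < 0 \<or> x > 1 \<Longrightarrow> hs x = 0"
    by blast+
  show "\<exists>B\<ge>0. \<forall>x. \<bar>hs x\<bar> \<le> B" using * abs_ge_zero order_trans by blast
qed

section \<open>Test functions\<close>

text \<open>Products of one-variable functions are the test functions actually employed: their
  iterated derivatives factor, and cut-off polynomials in two variables are built from them.\<close>

definition tt :: "(real \<Rightarrow> complex) \<Rightarrow> (real \<Rightarrow> complex) \<Rightarrow> sfun" where
  "tt f g = (\<lambda>(x, y). f x * g y)"

lemma tt_apply [simp]: "tt f g (x, y) = f x * g y"
  by (simp add: tt_def)

lemma Ck_on_tt: "Dk k f \<Longrightarrow> Dk k g \<Longrightarrow> Ck_on k S (tt f g)"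
proof (induction k arbitrary: f g)
  case 0
  then have "continuous_on UNIV f" "continuous_on UNIV g" by auto
  then show ?case unfolding tt_def case_prod_unfold
    by (auto intro!: continuous_intros continuous_on_compose2[of UNIV f] continuous_on_compose2[of UNIV g])
next
  case (Suc k)
  then obtain f' g' where d: "\<And>x. (f has_vector_derivative f' x) (at x)" "Dk k f'"
    "\<And>x. (g has_vector_derivative g' x) (at x)" "Dk k g'" by auto
  have "(tt f g has_derivative (\<lambda>h. fst h *\<^sub>R tt f' g z + snd h *\<^sub>R tt f g' z)) (at z within S)" for z
  proof -
    have 1: "((\<lambda>z. f (fst z)) has_derivative (\<lambda>h. fst h *\<^sub>R f' (fst z))) (at z within S)"
      by (rule has_derivative_compose[OF has_derivative_fst[OF has_derivative_ident] d(1)[unfolded has_vector_derivative_def]])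
    have 2: "((\<lambda>z. g (snd z)) has_derivative (\<lambda>h. snd h *\<^sub>R g' (snd z))) (at z within S)"
      by (rule has_derivative_compose[OF has_derivative_snd[OF has_derivative_ident] d(3)[unfolded has_vector_derivative_def]])
    show ?thesis
      using has_derivative_mult[OF 1 2] by (simp add: tt_def case_prod_unfold mult_ac add.commute)
  qed
  moreover have "Ck_on k S (tt f' g)" "Ck_on k S (tt f g')"
    using Suc d Dk_SucD by blast+
  ultimately show ?case unfolding Ck_on.simps by blast
qed

text \<open>A strict bound below 1 on the support keeps it compactly inside the open
  interval.\<close>

definition tests1 :: "(real \<Rightarrow> complex) set" where
  "tests1 = {f. (\<forall>k. Dk k f) \<and> (\<exists>a<1. \<forall>x. \<bar>x\<bar> > a \<longrightarrow> f x = 0)}"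

lemma tt_test: "f \<in> tests1 \<Longrightarrow> g \<in> tests1 \<Longrightarrow> tt f g \<in> test_functions"
proof -
  assume f: "f \<in> tests1" and g: "g \<in> tests1"
  then obtain a b where a: "a < 1" "\<And>x. \<bar>x\<bar> > a \<Longrightarrow> f x = 0" and b: "b < 1" "\<And>x. \<bar>x\<bar> > b \<Longrightarrow> g x = 0"
    unfolding tests1_def by blast
  have "{z. tt f g z \<noteq> 0} \<subseteq> {-a..a} \<times> {-b..b}"
    using a(2) b(2) by (force simp: not_less)
  then have "closure {z. tt f g z \<noteq> 0} \<subseteq> {-a..a} \<times> {-b..b}"
    by (intro closure_minimal closed_Times) auto
  also have "\<dots> \<subseteq> Sq" using a(1) b(1) by (auto simp: Sq_def)
  finally show ?thesis using f g by (auto simp: test_functions_def smooth_on_def tests1_def intro: Ck_on_tt)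
qed

definition vd :: "(real \<Rightarrow> complex) \<Rightarrow> real \<Rightarrow> complex" where
  "vd f = (\<lambda>x. vector_derivative f (at x))"

lemma vd: "Dk (Suc k) f \<Longrightarrow> (f has_vector_derivative vd f x) (at x)" "Dk (Suc k) f \<Longrightarrow> Dk k (vd f)"
proof -
  assume "Dk (Suc k) f"
  then obtain f' where f': "\<And>x. (f has_vector_derivative f' x) (at x)" "Dk k f'" by auto
  then have "vd f = f'" unfolding vd_def using vector_derivative_at by blast
  then show "(f has_vector_derivative vd f x) (at x)" "Dk k (vd f)" using f' by auto
qed

lemma vd_tests1: "f \<in> tests1 \<Longrightarrow> vd f \<in> tests1"
proof -
  assume f: "f \<in> tests1"
  then obtain a where a: "a < 1" "\<And>x. \<bar>x\<bar> > a \<Longrightarrow> f x = 0" unfolding tests1_def by blast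
  have "vd f x = 0" if "\<bar>x\<bar> > a" for x
  proof -
    have "open {x. \<bar>x\<bar> > a}" by (intro open_Collect_less continuous_intros)
    then have "\<forall>\<^sub>F y in nhds x. f y = 0"
      using eventually_nhds_in_open[of "{x. \<bar>x\<bar> > a}" x] that a(2) by (auto elim!: eventually_mono)
    then have "(f has_vector_derivative 0) (at x)"
      using has_derivative_transform_eventually[of "\<lambda>_. 0" "\<lambda>_. 0" x UNIV f] that a(2)[OF that]
      unfolding has_vector_derivative_def
      by (auto simp: eventually_nhds_conv_at elim!: eventually_mono)
    then show ?thesis unfolding vd_def by (rule vector_derivative_at)
  qed
  moreover have "Dk k (vd f)" for k using f vd(2)[of k f] unfolding tests1_def by blast
  ultimately show ?thesis using a unfolding tests1_def by blast
qed

lemma pd_tt: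
  assumes "f \<in> tests1" "g \<in> tests1"
  shows "pd_x (tt f g) = tt (vd f) g" "pd_y (tt f g) = tt f (vd g)"
proof -
  have d: "(f has_vector_derivative vd f x) (at x)" "(g has_vector_derivative vd g x) (at x)" for x
    using assms vd(1)[of 0] unfolding tests1_def by blast+
  show "pd_x (tt f g) = tt (vd f) g" "pd_y (tt f g) = tt f (vd g)"
    using vector_derivative_at[OF has_vector_derivative_mult_left[OF d(1)]]
      vector_derivative_at[OF has_vector_derivative_mult_right[OF d(2)]]
    by (auto simp: pd_x_def pd_y_def fun_eq_iff)
qed

lemma pd_iterated_tt:
  assumes "f \<in> tests1" "g \<in> tests1"
  shows "(pd_x ^^ a) ((pd_y ^^ b) (tt f g)) = tt ((vd ^^ a) f) ((vd ^^ b) g)"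
proof -
  have t: "(vd ^^ i) h \<in> tests1" if "h \<in> tests1" for h i
    using that by (induction i) (auto intro: vd_tests1)
  have "(pd_y ^^ b) (tt f g) = tt f ((vd ^^ b) g)"
    by (induction b) (simp_all add: pd_tt assms t)
  moreover have "(pd_x ^^ a) (tt f h) = tt ((vd ^^ a) f) h" if "h \<in> tests1" for h
    by (induction a) (simp_all add: pd_tt assms t that)
  ultimately show ?thesis by (simp add: t assms)
qed

text \<open>A smooth cutoff equal to 1 for \<open>|x| \<le> (n-1)/(n+1)\<close> and to 0 for
  \<open>|x| \<ge> n/(n+1)\<close>.\<close>

definition chi :: "nat \<Rightarrow> real \<Rightarrow> real" where
  "chi n x = Hs (real (Suc n) * x + real n) * Hs (- real (Suc n) * x + real n)"

definition dchi :: "nat \<Rightarrow> real \<Rightarrow> real" where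
  "dchi n x = (hs (real (Suc n) * x + real n) * real (Suc n)) * Hs (- real (Suc n) * x + real n)
      + Hs (real (Suc n) * x + real n) * (hs (- real (Suc n) * x + real n) * - real (Suc n))"

lemma chi_deriv: "(chi n has_real_derivative dchi n x) (at x)"
  unfolding chi_def dchi_def
  by (auto intro!: derivative_eq_intros DERIV_chain2[OF hs(2)])

lemma Dk_chi: "Dk k (chi n)"
  unfolding chi_def by (intro Dk_mult Dk_affine Dk_Hs)

lemma chi_bounds: "0 \<le> chi n x" "chi n x \<le> 1"
  unfolding chi_def using Hs_bounds by (auto intro: mult_nonneg_nonneg mult_le_one)

lemma chi_eventually:
  assumes "x \<in> {-1<..<1}"
  shows "\<forall>\<^sub>F n in sequentially. chi n x = 1 \<and> dchi n x = 0"
proof -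
  obtain n0 :: nat where n0: "2 / (1 + x) < real n0" using reals_Archimedean2 by blast
  obtain n1 :: nat where n1: "2 / (1 - x) < real n1" using reals_Archimedean2 by blast
  show ?thesis
    using eventually_ge_at_top[of "max n0 n1"]
  proof eventually_elim
    case (elim n)
    have "2 / (1 + x) < real (Suc n)" "2 / (1 - x) < real (Suc n)" using elim n0 n1 by linarith+
    then have "2 < real (Suc n) * (1 + x)" "2 < real (Suc n) * (1 - x)"
      using assms by (simp_all add: divide_less_eq mult.commute)
    then have "real (Suc n) * x + real n > 1" "- real (Suc n) * x + real n > 1"
      by (simp_all add: algebra_simps)
    then show ?case by (simp add: chi_def dchi_def Hs_1 hs(3))
  qed
qed

definition cut :: "nat \<Rightarrow> complex poly \<Rightarrow> real \<Rightarrow> complex" where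
  "cut n p x = of_real (chi n x) * poly p (of_real x)"

lemma cut_tests1: "cut n p \<in> tests1"
proof -
  have "Dk k (cut n p)" for k
    unfolding cut_def by (intro Dk_mult Dk_of_real Dk_poly Dk_chi)
  moreover have "cut n p x = 0" if x: "\<bar>x\<bar> > 1 - 1 / real (Suc n)" for x
  proof -
    have "1 - 1 / real (Suc n) = real n / real (Suc n)" by (simp add: field_simps)
    then have "real n < \<bar>x\<bar> * real (Suc n)" using x by (simp add: divide_less_eq)
    then have "real (Suc n) * x + real n \<le> 0 \<or> - real (Suc n) * x + real n \<le> 0"
      by (cases "x \<ge> 0") (auto simp: algebra_simps)
    then show ?thesis by (auto simp: cut_def chi_def Hs_0)
  qed
  moreover have "1 - 1 / real (Suc n) < 1" by simp
  ultimately show ?thesis unfolding tests1_def by blast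
qed

lemma vd_cut: "vd (cut n p) x = of_real (dchi n x) * poly p (of_real x) + of_real (chi n x) * poly (pderiv p) (of_real x)"
proof -
  have 1: "((\<lambda>x. complex_of_real (chi n x)) has_vector_derivative of_real (dchi n x)) (at x)"
    using chi_deriv by (intro has_vector_derivative_of_real) (simp add: has_real_derivative_iff_has_vector_derivative)
  have 2: "((\<lambda>x. poly p (complex_of_real x)) has_vector_derivative poly (pderiv p) (of_real x)) (at x)"
    by (intro has_vector_derivative_real_field) (rule poly_DERIV)
  show ?thesis
    unfolding vd_def cut_def
    using vector_derivative_at[OF has_vector_derivative_mult[OF 1 2]] by (simp add: add.commute)
qed

lemma cut_le: "cmod (cut n p x) \<le> cmod (poly p (of_real x))"
  unfolding cut_def norm_mult norm_of_real using chi_bounds[of n x]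
  by (simp add: mult_left_le_one_le)

lemma cut_tendsto:
  assumes "x \<in> {-1<..<1}"
  shows "(\<lambda>n. cut n p x) \<longlonglongrightarrow> poly p (of_real x)"
    and "(\<lambda>n. vd (cut n p) x) \<longlonglongrightarrow> poly (pderiv p) (of_real x)"
proof -
  have "\<forall>\<^sub>F n in sequentially. cut n p x = poly p (of_real x)"
    using chi_eventually[OF assms] by eventually_elim (simp add: cut_def)
  then show "(\<lambda>n. cut n p x) \<longlonglongrightarrow> poly p (of_real x)" by (rule tendsto_eventually)
  have "\<forall>\<^sub>F n in sequentially. vd (cut n p) x = poly (pderiv p) (of_real x)"
    using chi_eventually[OF assms] by eventually_elim (simp add: vd_cut)
  then show "(\<lambda>n. vd (cut n p) x) \<longlonglongrightarrow> poly (pderiv p) (of_real x)" by (rule tendsto_eventually)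
qed

lemma poly_bounded_interval: "\<exists>C\<ge>0. \<forall>x\<in>{-1..1}. cmod (poly p (of_real x)) \<le> C"
proof -
  have "compact ((\<lambda>x. poly p (complex_of_real x)) ` {-1..1})"
    by (intro compact_continuous_image continuous_intros) simp
  then obtain C where C: "\<And>x. x \<in> {-1..1} \<Longrightarrow> cmod (poly p (of_real x)) \<le> C"
    using compact_imp_bounded[of "(\<lambda>x. poly p (complex_of_real x)) ` {-1..1}"] unfolding bounded_iff by fastforce
  have "C \<ge> 0" using order_trans[OF norm_ge_zero C[of 0]] by simp
  then show ?thesis using C by blast
qed

lemma poly_root_bound:
  assumes "poly p (of_real a) = 0"
  shows "\<exists>C\<ge>0. \<forall>x\<in>{-1..1}. cmod (poly p (of_real x)) \<le> C * \<bar>x - a\<bar>"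
proof -
  obtain r where r: "p = [:- of_real a, 1:] * r" using assms by (auto simp: poly_eq_0_iff_dvd dvd_def)
  obtain C where C: "C \<ge> 0" "\<And>x. x \<in> {-1..1} \<Longrightarrow> cmod (poly r (of_real x)) \<le> C"
    using poly_bounded_interval[of r] by blast
  have "cmod (poly p (of_real x)) \<le> C * \<bar>x - a\<bar>" if "x \<in> {-1..1}" for x
  proof -
    have "poly p (of_real x) = of_real (x - a) * poly r (of_real x)" unfolding r by (simp add: algebra_simps)
    then have "cmod (poly p (of_real x)) = \<bar>x - a\<bar> * cmod (poly r (of_real x))" by (simp only: norm_mult norm_of_real)
    also have "\<dots> \<le> \<bar>x - a\<bar> * C" using C that by (intro mult_left_mono) auto
    finally show ?thesis by (simp add: mult.commute)
  qed
  then show ?thesis using C by blast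
qed

text \<open>Near an endpoint the derivative of the cutoff is of order \<open>n\<close>, but only where \<open>p\<close> is of order \<open>1/n\<close>.\<close>

lemma vd_cut_bounded:
  assumes "poly p 1 = 0" "poly p (-1) = 0"
  shows "\<exists>C. \<forall>n. \<forall>x\<in>{-1..1}. cmod (vd (cut n p) x) \<le> C"
proof -
  obtain B where B: "B \<ge> 0" "\<And>x. \<bar>hs x\<bar> \<le> B" using hs_bound by blast
  obtain C1 where C1: "C1 \<ge> 0" "\<And>x. x \<in> {-1..1} \<Longrightarrow> cmod (poly p (of_real x)) \<le> C1 * \<bar>x - (-1)\<bar>"
    using poly_root_bound[of p "-1"] assms by auto
  obtain C2 where C2: "C2 \<ge> 0" "\<And>x. x \<in> {-1..1} \<Longrightarrow> cmod (poly p (of_real x)) \<le> C2 * \<bar>x - 1\<bar>"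
    using poly_root_bound[of p 1] assms by auto
  obtain C3 where C3: "\<And>x. x \<in> {-1..1} \<Longrightarrow> cmod (poly (pderiv p) (of_real x)) \<le> C3"
    using poly_bounded_interval[of "pderiv p"] by blast
  have "cmod (vd (cut n p) x) \<le> 2 * B * C1 + 2 * B * C2 + C3" if x: "x \<in> {-1..1}" for n x
  proof -
    define r where "r = real (Suc n)"
    have r: "r > 0" "real n = r - 1" by (auto simp: r_def)
    define P where "P = cmod (poly p (of_real x))"
    have P0: "P \<ge> 0" by (simp add: P_def)
    have a: "\<bar>hs (r * x + real n)\<bar> * r * P \<le> 2 * B * C1"
    proof (cases "r * x + real n > 1")
      case True
      then show ?thesis using hs(3)[of "r * x + real n"] B C1 by simp
    next
      case False
      \<comment> \<open>The derivative of the transition can be nonzero here only at distance at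
        most \<open>2 / r\<close> from the left end. The linear vanishing of \<open>p\<close> there
        compensates the factor \<open>r\<close>.\<close>
      then have le: "r * (x + 1) \<le> 2" using r by (simp add: algebra_simps)
      have "P \<le> C1 * (x + 1)" using C1(2)[OF x] x by (simp add: P_def)
      then have "r * P \<le> r * (C1 * (x + 1))" using r by (intro mult_left_mono) auto
      also have "\<dots> = C1 * (r * (x + 1))" by simp
      also have "\<dots> \<le> C1 * 2" using le C1 by (intro mult_left_mono) auto
      finally have rP: "r * P \<le> C1 * 2" .
      have "\<bar>hs (r * x + real n)\<bar> * (r * P) \<le> B * (C1 * 2)"
        by (rule mult_mono[OF B(2) rP]) (use B r P0 in auto)
      then show ?thesis by (simp add: mult_ac)
    qed
    have b: "\<bar>hs (- r * x + real n)\<bar> * r * P \<le> 2 * B * C2"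
    proof (cases "- r * x + real n > 1")
      case True
      then show ?thesis using hs(3)[of "- r * x + real n"] B C2 by simp
    next
      case False
      then have le: "r * (1 - x) \<le> 2" using r by (simp add: algebra_simps)
      have "P \<le> C2 * (1 - x)" using C2(2)[OF x] x by (simp add: P_def)
      then have "r * P \<le> r * (C2 * (1 - x))" using r by (intro mult_left_mono) auto
      also have "\<dots> = C2 * (r * (1 - x))" by simp
      also have "\<dots> \<le> C2 * 2" using le C2 by (intro mult_left_mono) auto
      finally have rP: "r * P \<le> C2 * 2" .
      have "\<bar>hs (- r * x + real n)\<bar> * (r * P) \<le> B * (C2 * 2)"
        by (rule mult_mono[OF B(2) rP]) (use B r P0 in auto)
      then show ?thesis by (simp add: mult_ac)
    qed
    have H: "\<bar>Hs t\<bar> \<le> 1" for t using Hs_bounds[of t] by simp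
    have "\<bar>dchi n x\<bar> \<le> \<bar>hs (r * x + real n)\<bar> * r + \<bar>hs (- r * x + real n)\<bar> * r"
    proof -
      have "\<bar>dchi n x\<bar> \<le> \<bar>(hs (r * x + real n) * r) * Hs (- r * x + real n)\<bar> + \<bar>Hs (r * x + real n) * (hs (- r * x + real n) * - r)\<bar>"
        unfolding dchi_def r_def by (rule abs_triangle_ineq)
      also have "\<bar>(hs (r * x + real n) * r) * Hs (- r * x + real n)\<bar> \<le> (\<bar>hs (r * x + real n)\<bar> * r) * 1"
        unfolding abs_mult using r H by (intro mult_mono) auto
      also have "\<bar>Hs (r * x + real n) * (hs (- r * x + real n) * - r)\<bar> \<le> 1 * (\<bar>hs (- r * x + real n)\<bar> * r)"
        unfolding abs_mult using r H by (intro mult_mono) auto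
      finally show ?thesis by simp
    qed
    then have "\<bar>dchi n x\<bar> * P \<le> (\<bar>hs (r * x + real n)\<bar> * r + \<bar>hs (- r * x + real n)\<bar> * r) * P"
      using P0 by (rule mult_right_mono)
    also have "\<dots> \<le> 2 * B * C1 + 2 * B * C2" using a b by (simp add: distrib_right)
    finally have 1: "\<bar>dchi n x\<bar> * P \<le> 2 * B * C1 + 2 * B * C2" .
    have "cmod (vd (cut n p) x) \<le> \<bar>dchi n x\<bar> * P + \<bar>chi n x\<bar> * cmod (poly (pderiv p) (of_real x))"
      unfolding vd_cut P_def by (intro order_trans[OF norm_triangle_ineq]) (simp add: norm_mult)
    also have "\<bar>chi n x\<bar> * cmod (poly (pderiv p) (of_real x)) \<le> 1 * C3"
      using chi_bounds[of n x] C3[OF x] by (intro mult_mono) auto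
    finally show ?thesis using 1 by simp
  qed
  then show ?thesis by blast
qed

section \<open>Weak derivatives\<close>

lemma Dk_L2:
  assumes "Dk k f" "Dk l g"
  shows "(\<lambda>z. cnj (tt f g z)) \<in> L2"
proof -
  have "continuous_on UNIV f" "continuous_on UNIV g" using assms Dk_continuous by blast+
  then show ?thesis unfolding tt_def case_prod_unfold
    by (auto intro!: L2_continuous continuous_intros continuous_on_compose2[of UNIV f] continuous_on_compose2[of UNIV g])
qed

lemma tests1_L2: "f \<in> tests1 \<Longrightarrow> g \<in> tests1 \<Longrightarrow> (\<lambda>z. cnj (tt f g z)) \<in> L2"
  unfolding tests1_def using Dk_L2 by blast

lemma l2_inner_tt: "l2_inner w (\<lambda>z. cnj (tt f g z)) = (LINT z|MS. w z * tt f g z)"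
  by (simp add: l2_inner_def)

lemma has_weak_deriv_tt:
  assumes "has_weak_deriv a b u w" "f \<in> tests1" "g \<in> tests1"
  shows "(LINT z|MS. u z * tt ((vd ^^ a) f) ((vd ^^ b) g) z) = (-1) ^ (a + b) * (LINT z|MS. w z * tt f g z)"
  using assms tt_test[OF assms(2,3)] unfolding has_weak_deriv_def
  by (auto simp: pd_iterated_tt)

text \<open>The conjugate polynomials are cut off because \<open>l2_inner\<close> conjugates its
  second argument whereas weak derivatives are defined by unconjugated integrals. Convergence of the
  differentiated cutoffs needs the zeros at the ends, which keep them uniformly bounded.\<close>

lemma cut_tt_tendsto:
  shows "(\<lambda>n. l2_norm (\<lambda>z. cnj (tt (cut n (cnjp p)) (cut n (cnjp q)) z) - tp p q z)) \<longlonglongrightarrow> 0"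
    and "poly p 1 = 0 \<Longrightarrow> poly p (-1) = 0 \<Longrightarrow>
      (\<lambda>n. l2_norm (\<lambda>z. cnj (tt (vd (cut n (cnjp p))) (cut n (cnjp q)) z) - tp (pderiv p) q z)) \<longlonglongrightarrow> 0"
    and "poly q 1 = 0 \<Longrightarrow> poly q (-1) = 0 \<Longrightarrow>
      (\<lambda>n. l2_norm (\<lambda>z. cnj (tt (cut n (cnjp p)) (vd (cut n (cnjp q))) z) - tp p (pderiv q) z)) \<longlonglongrightarrow> 0"
proof -
  have gen: "(\<lambda>n. l2_norm (\<lambda>z. cnj (tt (f n) (g n) z) - tp P Q z)) \<longlonglongrightarrow> 0"
    if fg: "\<And>n. f n \<in> tests1" "\<And>n. g n \<in> tests1"
      and lim: "\<And>x. x \<in> {-1<..<1} \<Longrightarrow> (\<lambda>n. f n x) \<longlonglongrightarrow> cnj (poly P (of_real x))"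
        "\<And>x. x \<in> {-1<..<1} \<Longrightarrow> (\<lambda>n. g n x) \<longlonglongrightarrow> cnj (poly Q (of_real x))"
      and bd: "\<exists>C. \<forall>n. \<forall>x\<in>{-1..1}. cmod (f n x) \<le> C" "\<exists>C. \<forall>n. \<forall>x\<in>{-1..1}. cmod (g n x) \<le> C"
    for f g :: "nat \<Rightarrow> real \<Rightarrow> complex" and P Q
  proof -
    obtain C where C: "\<And>n x. x \<in> {-1..1} \<Longrightarrow> cmod (f n x) \<le> C" using bd(1) by blast
    obtain D where D: "\<And>n x. x \<in> {-1..1} \<Longrightarrow> cmod (g n x) \<le> D" using bd(2) by blast
    have C0: "0 \<le> C" using order_trans[OF norm_ge_zero C[of 0 0]] by simp
    show ?thesis
    proof (rule l2_dominated_convergence[where w = "\<lambda>z. of_real (C * D)"])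
      show "AE z in MS. (\<lambda>n. cnj (tt (f n) (g n) z)) \<longlonglongrightarrow> tp P Q z"
      proof (rule AE_I2)
        fix z assume "z \<in> space MS"
        then have z: "fst z \<in> {-1<..<1}" "snd z \<in> {-1<..<1}" by (auto simp: Sq_def)
        have "(\<lambda>n. cnj (f n (fst z) * g n (snd z))) \<longlonglongrightarrow> cnj (cnj (poly P (of_real (fst z))) * cnj (poly Q (of_real (snd z))))"
          by (intro tendsto_cnj tendsto_mult lim z)
        then show "(\<lambda>n. cnj (tt (f n) (g n) z)) \<longlonglongrightarrow> tp P Q z" by (simp add: tt_def case_prod_unfold tp_eq)
      qed
      show "AE z in MS. cmod (cnj (tt (f n) (g n) z)) \<le> cmod (of_real (C * D))" for n
      proof (rule AE_I2)
        fix z assume "z \<in> space MS"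
        then have z: "fst z \<in> {-1..1}" "snd z \<in> {-1..1}" by (auto simp: Sq_def)
        have "cmod (f n (fst z)) * cmod (g n (snd z)) \<le> C * D"
          using C[OF z(1)] D[OF z(2)] C0 by (intro mult_mono) auto
        also have "\<dots> \<le> \<bar>C * D\<bar>" by simp
        finally show "cmod (cnj (tt (f n) (g n) z)) \<le> cmod (of_real (C * D))"
          unfolding norm_of_real by (simp add: tt_def case_prod_unfold norm_mult)
      qed
      show "(\<lambda>z. of_real (C * D)) \<in> L2" by (intro L2_continuous continuous_intros)
    qed (use fg in \<open>auto intro: tests1_L2\<close>)
  qed
  have bc: "\<exists>C. \<forall>n. \<forall>x\<in>{-1..1}. cmod (cut n p x) \<le> C" for p
    using poly_bounded_interval[of p] cut_le order_trans by blast
  have c: "(\<lambda>n. cut n (cnjp p) x) \<longlonglongrightarrow> cnj (poly p (of_real x))" if "x \<in> {-1<..<1}" for p x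
    using cut_tendsto(1)[OF that, of "cnjp p"] by (simp add: poly_cnjp)
  have d: "(\<lambda>n. vd (cut n (cnjp p)) x) \<longlonglongrightarrow> cnj (poly (pderiv p) (of_real x))" if "x \<in> {-1<..<1}" for p x
    using cut_tendsto(2)[OF that, of "cnjp p"] by (simp add: poly_cnjp flip: cnjp_pderiv)
  show "(\<lambda>n. l2_norm (\<lambda>z. cnj (tt (cut n (cnjp p)) (cut n (cnjp q)) z) - tp p q z)) \<longlonglongrightarrow> 0"
    by (intro gen cut_tests1 c bc)
  show "(\<lambda>n. l2_norm (\<lambda>z. cnj (tt (vd (cut n (cnjp p))) (cut n (cnjp q)) z) - tp (pderiv p) q z)) \<longlonglongrightarrow> 0"
    if "poly p 1 = 0" "poly p (-1) = 0"
    by (intro gen cut_tests1 vd_tests1 c d bc vd_cut_bounded) (use that in \<open>simp_all add: poly_cnjp_pm1\<close>)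
  show "(\<lambda>n. l2_norm (\<lambda>z. cnj (tt (cut n (cnjp p)) (vd (cut n (cnjp q))) z) - tp p (pderiv q) z)) \<longlonglongrightarrow> 0"
    if "poly q 1 = 0" "poly q (-1) = 0"
    by (intro gen cut_tests1 vd_tests1 c d bc vd_cut_bounded) (use that in \<open>simp_all add: poly_cnjp_pm1\<close>)
qed

lemma sign_cancel: "(-1) ^ k * A = - ((-1) ^ k * B) \<Longrightarrow> A = - (B :: complex)"
  by (cases "even k") auto

text \<open>Moving one derivative between test function and weak derivative gives the identity for
  compactly supported products, up to a common sign; removing the cutoff extends it to polynomials.
  Only the factor that is differentiated must vanish at its ends.\<close>

lemma has_weak_deriv_XD:
  assumes "has_weak_deriv a b u w" "has_weak_deriv (Suc a) b u w'"
  shows "XD w w'"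
  unfolding XD_def
proof (intro allI impI)
  fix p q :: "complex poly" assume p: "poly p 1 = 0" "poly p (-1) = 0"
  have L: "w \<in> L2" "w' \<in> L2" using assms by (auto simp: has_weak_deriv_def)
  have eq: "l2_inner w (\<lambda>z. cnj (tt (vd (cut n (cnjp p))) (cut n (cnjp q)) z))
      = - l2_inner w' (\<lambda>z. cnj (tt (cut n (cnjp p)) (cut n (cnjp q)) z))" for n
    unfolding l2_inner_tt
  proof (rule sign_cancel[of "a + b"])
    let ?f = "cut n (cnjp p)" and ?g = "cut n (cnjp q)"
    have "(-1) ^ (a + b) * (LINT z|MS. w z * tt (vd ?f) ?g z) = (LINT z|MS. u z * tt ((vd ^^ Suc a) ?f) ((vd ^^ b) ?g) z)"
      unfolding funpow_Suc_right o_apply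
      by (rule has_weak_deriv_tt[OF assms(1) vd_tests1[OF cut_tests1] cut_tests1, symmetric])
    also have "\<dots> = (-1) ^ (Suc a + b) * (LINT z|MS. w' z * tt ?f ?g z)"
      by (rule has_weak_deriv_tt[OF assms(2) cut_tests1 cut_tests1])
    also have "\<dots> = - ((-1) ^ (a + b) * (LINT z|MS. w' z * tt ?f ?g z))" by simp
    finally show "(-1) ^ (a + b) * (LINT z|MS. w z * tt (vd ?f) ?g z) = - ((-1) ^ (a + b) * (LINT z|MS. w' z * tt ?f ?g z))" .
  qed
  have "(\<lambda>n. l2_inner w (\<lambda>z. cnj (tt (vd (cut n (cnjp p))) (cut n (cnjp q)) z))) \<longlonglongrightarrow> l2_inner w (tp (pderiv p) q)"
    by (intro l2_inner_tendsto_right cut_tt_tendsto p tests1_L2 vd_tests1 cut_tests1 L) simp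
  moreover have "(\<lambda>n. - l2_inner w' (\<lambda>z. cnj (tt (cut n (cnjp p)) (cut n (cnjp q)) z))) \<longlonglongrightarrow> - l2_inner w' (tp p q)"
    by (intro tendsto_minus l2_inner_tendsto_right cut_tt_tendsto tests1_L2 cut_tests1 L) simp
  ultimately show "l2_inner w (tp (pderiv p) q) = - l2_inner w' (tp p q)"
    unfolding eq by (rule LIMSEQ_unique)
qed

lemma has_weak_deriv_YD:
  assumes "has_weak_deriv a b u w" "has_weak_deriv a (Suc b) u w'"
  shows "YD w w'"
  unfolding YD_def
proof (intro allI impI)
  fix p q :: "complex poly" assume q: "poly q 1 = 0" "poly q (-1) = 0"
  have L: "w \<in> L2" "w' \<in> L2" using assms by (auto simp: has_weak_deriv_def)
  have eq: "l2_inner w (\<lambda>z. cnj (tt (cut n (cnjp p)) (vd (cut n (cnjp q))) z))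
      = - l2_inner w' (\<lambda>z. cnj (tt (cut n (cnjp p)) (cut n (cnjp q)) z))" for n
    unfolding l2_inner_tt
  proof (rule sign_cancel[of "a + b"])
    let ?f = "cut n (cnjp p)" and ?g = "cut n (cnjp q)"
    have "(-1) ^ (a + b) * (LINT z|MS. w z * tt ?f (vd ?g) z) = (LINT z|MS. u z * tt ((vd ^^ a) ?f) ((vd ^^ Suc b) ?g) z)"
      unfolding funpow_Suc_right o_apply
      by (rule has_weak_deriv_tt[OF assms(1) cut_tests1 vd_tests1[OF cut_tests1], symmetric])
    also have "\<dots> = (-1) ^ (a + Suc b) * (LINT z|MS. w' z * tt ?f ?g z)"
      by (rule has_weak_deriv_tt[OF assms(2) cut_tests1 cut_tests1])
    also have "\<dots> = - ((-1) ^ (a + b) * (LINT z|MS. w' z * tt ?f ?g z))" by simp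
    finally show "(-1) ^ (a + b) * (LINT z|MS. w z * tt ?f (vd ?g) z) = - ((-1) ^ (a + b) * (LINT z|MS. w' z * tt ?f ?g z))" .
  qed
  have "(\<lambda>n. l2_inner w (\<lambda>z. cnj (tt (cut n (cnjp p)) (vd (cut n (cnjp q))) z))) \<longlonglongrightarrow> l2_inner w (tp p (pderiv q))"
    by (intro l2_inner_tendsto_right cut_tt_tendsto q tests1_L2 vd_tests1 cut_tests1 L) simp
  moreover have "(\<lambda>n. - l2_inner w' (\<lambda>z. cnj (tt (cut n (cnjp p)) (cut n (cnjp q)) z))) \<longlonglongrightarrow> - l2_inner w' (tp p q)"
    by (intro tendsto_minus l2_inner_tendsto_right cut_tt_tendsto tests1_L2 cut_tests1 L) simp
  ultimately show "l2_inner w (tp p (pderiv q)) = - l2_inner w' (tp p q)"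
    unfolding eq by (rule LIMSEQ_unique)
qed

text \<open>Density allows \<open>lap w\<close> to approach \<open>e\<close> itself, so that testing
  with Laplacians determines the norm.\<close>

lemma l2_norm_le_dual:
  assumes e: "e \<in> L2" and B: "B \<ge> 0" "\<And>M w. w \<in> VN2 M \<Longrightarrow> cmod (l2_inner e (lap w)) \<le> B * l2_norm (lap w)"
  shows "l2_norm e \<le> B"
proof (cases "l2_norm e = 0")
  case False
  define a where "a = l2_norm e"
  have a: "a > 0" using False l2_norm_nonneg[of e] unfolding a_def by linarith
  \<comment> \<open>With \<open>lap w\<close> within \<epsilon> of \<open>e\<close>, the squared
    norm is at most \<open>a \<epsilon> + B (a + \<epsilon>)\<close>; dividing by \<open>a\<close>
    gives this bound.\<close>
  have "a \<le> B + \<epsilon> * (1 + B / a)" if \<epsilon>: "\<epsilon> > 0" for \<epsilon>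
  proof -
    obtain M w where w: "w \<in> VN2 M" "l2_norm (\<lambda>z. e z - lap w z) < \<epsilon>"
      using lap_dense[OF e] \<epsilon> unfolding lap_closure_def by blast
    have L: "lap w \<in> L2" using lap_Pol[OF VN2_Pol[OF w(1)]] by simp
    have lw: "l2_norm (lap w) \<le> a + \<epsilon>"
      using l2_norm_triangle_sub[OF L e] w(2) l2_norm_minus_commute[of e "lap w"] by (simp add: a_def)
    have "a\<^sup>2 = cmod (l2_inner e e)" unfolding l2_norm_sq_complex norm_of_real by (simp add: a_def)
    also have "l2_inner e e = l2_inner e (\<lambda>z. e z - lap w z) + l2_inner e (lap w)"
      using l2_inner_diff_right[OF e L e] by simp
    also have "cmod \<dots> \<le> a * \<epsilon> + B * (a + \<epsilon>)"
    proof (rule order_trans[OF norm_triangle_ineq add_mono])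
      have "cmod (l2_inner e (\<lambda>z. e z - lap w z)) \<le> a * l2_norm (\<lambda>z. e z - lap w z)"
        unfolding a_def by (rule l2_cauchy_schwarz[OF e L2_diff[OF e L]])
      also have "\<dots> \<le> a * \<epsilon>" using w(2) a by (intro mult_left_mono) auto
      finally show "cmod (l2_inner e (\<lambda>z. e z - lap w z)) \<le> a * \<epsilon>" .
      show "cmod (l2_inner e (lap w)) \<le> B * (a + \<epsilon>)"
        using B(2)[OF w(1)] mult_left_mono[OF lw B(1)] by linarith
    qed
    finally have "a * a \<le> (B + \<epsilon> * (1 + B / a)) * a"
      using a by (simp add: power2_eq_square algebra_simps)
    then show ?thesis using a by simp
  qed
  then have *: "a \<le> B + \<epsilon>" if "\<epsilon> > 0" for \<epsilon>
  proof -
    have c: "1 + B / a > 0" using B(1) a by (simp add: add_pos_nonneg)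
    then have "\<epsilon> / (1 + B / a) > 0" using that by simp
    from \<open>\<And>\<epsilon>. \<epsilon> > 0 \<Longrightarrow> a \<le> B + \<epsilon> * (1 + B / a)\<close>[OF this] show ?thesis using c by simp
  qed
  show ?thesis unfolding a_def[symmetric] by (rule field_le_epsilon) (rule *)
qed (use B in simp)

text \<open>The difference is orthogonal to all polynomials by removal of the cutoff, hence to all
  Laplacians of discrete functions, and the duality bound with constant 0 applies.\<close>

lemma has_weak_deriv_unique:
  assumes "has_weak_deriv a b u w" "has_weak_deriv a b u w'"
  shows "AE z in MS. w z = w' z"
proof -
  have L: "w \<in> L2" "w' \<in> L2" using assms by (auto simp: has_weak_deriv_def)
  define d where "d = (\<lambda>z. w z - w' z)"
  have dL: "d \<in> L2" using L unfolding d_def by auto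
  have eq: "l2_inner w (\<lambda>z. cnj (tt f g z)) = l2_inner w' (\<lambda>z. cnj (tt f g z))" if "f \<in> tests1" "g \<in> tests1" for f g
    using has_weak_deriv_tt[OF assms(1) that] has_weak_deriv_tt[OF assms(2) that] unfolding l2_inner_tt by simp
  have tp: "l2_inner d (tp p q) = 0" for p q
  proof -
    have "(\<lambda>n. l2_inner d (\<lambda>z. cnj (tt (cut n (cnjp p)) (cut n (cnjp q)) z))) \<longlonglongrightarrow> l2_inner d (tp p q)"
      by (intro l2_inner_tendsto_right cut_tt_tendsto tests1_L2 cut_tests1 dL) simp
    moreover have "l2_inner d (\<lambda>z. cnj (tt (cut n (cnjp p)) (cut n (cnjp q)) z)) = 0" for n
      unfolding d_def using eq[OF cut_tests1 cut_tests1] L by (simp add: l2_inner_diff_left tests1_L2 cut_tests1)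
    ultimately have "(\<lambda>n. 0) \<longlonglongrightarrow> l2_inner d (tp p q)" by simp
    from LIMSEQ_unique[OF tendsto_const this] show ?thesis by simp
  qed
  have Pol: "l2_inner d f = 0" if "f \<in> Pol" for f
    using that
  proof (induction f rule: Pol_induct)
    case (add f p q)
    then show ?case using tp[of p q] l2_inner_add_right[of f "tp p q" d] dL by simp
  qed simp
  have "l2_norm d \<le> 0"
    by (rule l2_norm_le_dual[OF dL]) (use Pol lap_Pol VN2_Pol in auto)
  then have "l2_norm d = 0" using l2_norm_nonneg[of d] by linarith
  then have "AE z in MS. d z = 0" using l2_norm_eq_0_iff[OF dL] by simp
  then show ?thesis by eventually_elim (simp add: d_def)
qed

section \<open>Integration by parts and traces\<close>

text \<open>The partial derivatives are explicit arguments and are one-sided on the boundary. This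
  is what smoothness up to the boundary provides and what the divergence theorem consumes.\<close>

definition C1 :: "sfun \<Rightarrow> sfun \<Rightarrow> sfun \<Rightarrow> bool" where
  "C1 f fx fy \<longleftrightarrow> continuous_on cSq f \<and> continuous_on cSq fx \<and> continuous_on cSq fy
    \<and> (\<forall>x\<in>{-1..1}. \<forall>y\<in>{-1..1}. ((\<lambda>s. f (s, y)) has_vector_derivative fx (x, y)) (at x within {-1..1})
         \<and> ((\<lambda>s. f (x, s)) has_vector_derivative fy (x, y)) (at y within {-1..1}))"

lemma C1_L2: "C1 f fx fy \<Longrightarrow> f \<in> L2" "C1 f fx fy \<Longrightarrow> fx \<in> L2" "C1 f fx fy \<Longrightarrow> fy \<in> L2"
  unfolding C1_def by (auto intro: L2_continuous)

lemma integral_C1: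
  assumes "C1 f fx fy"
  shows "(LINT z|MS. fx z) = integral {-1..1} (\<lambda>y. f (1, y) - f (-1, y))"
    and "(LINT z|MS. fy z) = integral {-1..1} (\<lambda>x. f (x, 1) - f (x, -1))"
proof -
  have "integral {-1..1} (\<lambda>x. fx (x, y)) = f (1, y) - f (-1, y)" if "y \<in> {-1..1}" for y
    using assms that unfolding C1_def by (intro integral_unique fundamental_theorem_of_calculus) auto
  then show "(LINT z|MS. fx z) = integral {-1..1} (\<lambda>y. f (1, y) - f (-1, y))"
    using assms unfolding C1_def by (subst integral_MS_iterated(2)) (auto intro: integral_cong)
  have "integral {-1..1} (\<lambda>y. fy (x, y)) = f (x, 1) - f (x, -1)" if "x \<in> {-1..1}" for x
    using assms that unfolding C1_def by (intro integral_unique fundamental_theorem_of_calculus) auto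
  then show "(LINT z|MS. fy z) = integral {-1..1} (\<lambda>x. f (x, 1) - f (x, -1))"
    using assms unfolding C1_def by (subst integral_MS_iterated(1)) (auto intro: integral_cong)
qed

lemma C1_mult:
  assumes "C1 f fx fy" "C1 g gx gy"
  shows "C1 (\<lambda>z. f z * g z) (\<lambda>z. f z * gx z + fx z * g z) (\<lambda>z. f z * gy z + fy z * g z)"
  using assms unfolding C1_def
  by (auto intro!: continuous_intros has_vector_derivative_mult)

lemma C1_cnj:
  assumes "C1 f fx fy"
  shows "C1 (\<lambda>z. cnj (f z)) (\<lambda>z. cnj (fx z)) (\<lambda>z. cnj (fy z))"
  using assms unfolding C1_def
  by (auto intro!: continuous_intros has_vector_derivative_cnj)

lemma Ck_on_C1:
  assumes "Ck_on (Suc 0) S f" "cSq \<subseteq> S"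
  shows "\<exists>fx fy. C1 f fx fy"
proof -
  obtain fx fy where d: "\<And>z. z \<in> S \<Longrightarrow> (f has_derivative (\<lambda>h. fst h *\<^sub>R fx z + snd h *\<^sub>R fy z)) (at z within S)"
    and c: "continuous_on S fx" "continuous_on S fy"
    using assms(1) by auto
  have "continuous_on S f"
    unfolding continuous_on_eq_continuous_within using has_derivative_continuous[OF d] by blast
  moreover have "((\<lambda>s. f (s, y)) has_vector_derivative fx (x, y)) (at x within {-1..1})"
    "((\<lambda>s. f (x, s)) has_vector_derivative fy (x, y)) (at y within {-1..1})"
    if xy: "x \<in> {-1..1}" "y \<in> {-1..1}" for x y
  proof -
    have z: "(x, y) \<in> S" and sub: "(\<lambda>s. (s, y)) ` {-1..1} \<subseteq> S" "(\<lambda>s. (x, s)) ` {-1..1} \<subseteq> S"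
      using xy assms(2) by (auto simp: cSq_def)
    have 1: "((\<lambda>s. (s, y)) has_derivative (\<lambda>h. (h, 0))) (at x within {-1..1})"
      by (intro derivative_intros)
    have 2: "((\<lambda>s. (x, s)) has_derivative (\<lambda>h. (0, h))) (at y within {-1..1})"
      by (intro derivative_intros)
    show "((\<lambda>s. f (s, y)) has_vector_derivative fx (x, y)) (at x within {-1..1})"
      using has_derivative_in_compose[OF 1 has_derivative_subset[OF d[OF z] sub(1)]]
      by (simp add: has_vector_derivative_def)
    show "((\<lambda>s. f (x, s)) has_vector_derivative fy (x, y)) (at y within {-1..1})"
      using has_derivative_in_compose[OF 2 has_derivative_subset[OF d[OF z] sub(2)]]
      by (simp add: has_vector_derivative_def)
  qed
  ultimately have "C1 f fx fy"
    unfolding C1_def using c assms(2) continuous_on_subset by blast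
  then show ?thesis by blast
qed

lemma Pol_Ck_on: "f \<in> Pol \<Longrightarrow> Ck_on k S f"
proof (induction k arbitrary: f)
  case 0
  then show ?case by (simp add: Pol_continuous)
next
  case (Suc k)
  have "(f has_derivative (\<lambda>h. fst h *\<^sub>R pd_x f z + snd h *\<^sub>R pd_y f z)) (at z within S)" for z
    using Suc.prems
  proof (induction f rule: Pol_induct)
    case (add f p q)
    have 0: "((\<lambda>x. poly p (complex_of_real x)) has_derivative (\<lambda>h. h *\<^sub>R poly (pderiv p) (of_real x))) (at x)" for p x
      using has_vector_derivative_real_field[OF poly_DERIV, of p x UNIV] by (simp add: has_vector_derivative_def)
    have 1: "((\<lambda>z. poly p (complex_of_real (fst z))) has_derivative (\<lambda>h. fst h *\<^sub>R poly (pderiv p) (of_real (fst z)))) (at z within S)"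
      by (rule has_derivative_compose[OF has_derivative_fst[OF has_derivative_ident] 0])
    have 2: "((\<lambda>z. poly q (complex_of_real (snd z))) has_derivative (\<lambda>h. snd h *\<^sub>R poly (pderiv q) (of_real (snd z)))) (at z within S)"
      by (rule has_derivative_compose[OF has_derivative_snd[OF has_derivative_ident] 0])
    have "(tp p q has_derivative (\<lambda>h. fst h *\<^sub>R tp (pderiv p) q z + snd h *\<^sub>R tp p (pderiv q) z)) (at z within S)"
      using has_derivative_mult[OF 1 2] by (simp add: tp_eq[abs_def] add.commute)
    from has_derivative_add[OF add.IH this] show ?case
      using add by (simp add: pd_add pd_tp algebra_simps)
  qed simp
  then show ?case using Suc.IH Pol_has_vector_derivative(1,2)[OF Suc.prems] unfolding Ck_on.simps by blast
qed

lemma Pol_C1: "f \<in> Pol \<Longrightarrow> C1 f (pd_x f) (pd_y f)"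
  unfolding C1_def by (auto intro: Pol_continuous Pol_has_vector_derivative)

lemma test_function_C1:
  assumes "\<phi> \<in> test_functions"
  shows "C1 \<phi> (pd_x \<phi>) (pd_y \<phi>)" "\<And>z. z \<notin> Sq \<Longrightarrow> \<phi> z = 0"
proof -
  have "Ck_on (Suc 0) UNIV \<phi>" using assms by (simp add: test_functions_def smooth_on_def del: Ck_on.simps)
  then obtain fx fy where d: "\<And>z. (\<phi> has_derivative (\<lambda>h. fst h *\<^sub>R fx z + snd h *\<^sub>R fy z)) (at z)"
    and c: "continuous_on UNIV fx" "continuous_on UNIV fy" by auto
  have x: "((\<lambda>s. \<phi> (s, y)) has_vector_derivative fx (x, y)) (at x)" for x y
  proof -
    have "((\<lambda>s. (s, y)) has_derivative (\<lambda>h. (h, 0))) (at x)" by (intro derivative_intros)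
    from has_derivative_compose[OF this d] show ?thesis by (simp add: has_vector_derivative_def)
  qed
  have y: "((\<lambda>s. \<phi> (x, s)) has_vector_derivative fy (x, y)) (at y)" for x y
  proof -
    have "((\<lambda>s. (x, s)) has_derivative (\<lambda>h. (0, h))) (at y)" by (intro derivative_intros)
    from has_derivative_compose[OF this d] show ?thesis by (simp add: has_vector_derivative_def)
  qed
  have eq: "pd_x \<phi> = fx" "pd_y \<phi> = fy"
    using vector_derivative_at[OF x] vector_derivative_at[OF y] by (auto simp: pd_x_def pd_y_def fun_eq_iff)
  have "continuous_on UNIV \<phi>"
    using d by (intro continuous_at_imp_continuous_on ballI has_derivative_continuous)
  then show "C1 \<phi> (pd_x \<phi>) (pd_y \<phi>)"
    unfolding C1_def eq using c x y by (auto intro: continuous_on_subset has_vector_derivative_at_within)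
  show "\<phi> z = 0" if "z \<notin> Sq" for z
    using assms that closure_subset[of "{z. \<phi> z \<noteq> 0}"] unfolding test_functions_def by blast
qed

lemma C1_has_weak_deriv:
  assumes "C1 f fx fy"
  shows "has_weak_deriv 0 0 f f" "has_weak_deriv 1 0 f fx" "has_weak_deriv 0 1 f fy"
proof -
  show "has_weak_deriv 0 0 f f" using C1_L2[OF assms] by (simp add: has_weak_deriv_def)
  have parts: "(LINT z|MS. f z * pd_x \<phi> z) = - (LINT z|MS. fx z * \<phi> z)"
    "(LINT z|MS. f z * pd_y \<phi> z) = - (LINT z|MS. fy z * \<phi> z)" if \<phi>: "\<phi> \<in> test_functions" for \<phi>
  proof -
    note t = test_function_C1[OF \<phi>]
    note p = C1_mult[OF assms t(1)]
    have i: "integrable MS (\<lambda>z. a z * b z)" if "a \<in> L2" "continuous_on cSq b" for a b :: sfun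
      using L2_mult_integrable[OF that(1) L2_continuous[of "\<lambda>z. cnj (b z)"]] that(2)
      by (simp add: continuous_on_cnj)
    have c: "continuous_on cSq \<phi>" "continuous_on cSq (pd_x \<phi>)" "continuous_on cSq (pd_y \<phi>)"
      using t(1) by (auto simp: C1_def)
    have b: "\<phi> (1, y) = 0" "\<phi> (-1, y) = 0" "\<phi> (y, 1) = 0" "\<phi> (y, -1) = 0" for y
      using t(2) by (auto simp: Sq_def)
    have "(LINT z|MS. f z * pd_x \<phi> z + fx z * \<phi> z) = 0"
      using integral_C1(1)[OF p] by (simp add: b)
    then show "(LINT z|MS. f z * pd_x \<phi> z) = - (LINT z|MS. fx z * \<phi> z)"
      using i[OF C1_L2(1)[OF assms] c(2)] i[OF C1_L2(2)[OF assms] c(1)] by (simp add: eq_neg_iff_add_eq_0)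
    have "(LINT z|MS. f z * pd_y \<phi> z + fy z * \<phi> z) = 0"
      using integral_C1(2)[OF p] by (simp add: b)
    then show "(LINT z|MS. f z * pd_y \<phi> z) = - (LINT z|MS. fy z * \<phi> z)"
      using i[OF C1_L2(1)[OF assms] c(3)] i[OF C1_L2(3)[OF assms] c(1)] by (simp add: eq_neg_iff_add_eq_0)
  qed
  show "has_weak_deriv 1 0 f fx" "has_weak_deriv 0 1 f fy"
    using parts C1_L2[OF assms] by (auto simp: has_weak_deriv_def)
qed

lemma test_C1_L2: "\<phi> \<in> test_functions \<Longrightarrow> (\<lambda>z. cnj (\<phi> z)) \<in> L2"
  using C1_L2(1)[OF C1_cnj[OF test_function_C1(1)]] .

lemma has_weak_deriv_zero: "has_weak_deriv a b (\<lambda>z. 0) (\<lambda>z. 0)"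
  by (simp add: has_weak_deriv_def)

lemma weak_deriv_AE:
  assumes "has_weak_deriv a b u w"
  shows "AE z in MS. weak_deriv a b u z = w z"
proof (rule has_weak_deriv_unique)
  show "has_weak_deriv a b u (weak_deriv a b u)"
    unfolding weak_deriv_def by (rule someI[of "has_weak_deriv a b u"]) (rule assms)
qed (rule assms)

lemma Hm_weak_deriv:
  assumes "u \<in> Hm m" "a + b \<le> m"
  shows "has_weak_deriv a b u (weak_deriv a b u)" "weak_deriv a b u \<in> L2"
proof -
  show h: "has_weak_deriv a b u (weak_deriv a b u)"
  proof -
    have "\<exists>w. has_weak_deriv a b u w" using assms by (auto simp: Hm_def)
    then show ?thesis unfolding weak_deriv_def by (rule someI_ex[of "has_weak_deriv a b u"])
  qed
  then show "weak_deriv a b u \<in> L2" by (simp add: has_weak_deriv_def)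
qed

lemma l2_norm_weak_deriv_le:
  assumes "a + b \<le> m"
  shows "l2_norm (weak_deriv a b u) \<le> Hm_norm m u"
proof -
  have "(l2_norm (weak_deriv a b u))\<^sup>2 = (l2_norm (weak_deriv a (a + b - a) u))\<^sup>2" by simp
  also have "\<dots> \<le> (\<Sum>a'\<le>a + b. (l2_norm (weak_deriv a' (a + b - a') u))\<^sup>2)"
    by (rule member_le_sum[of a "{..a + b}" "\<lambda>a'. (l2_norm (weak_deriv a' (a + b - a') u))\<^sup>2"]) auto
  also have "\<dots> \<le> (\<Sum>k\<le>m. \<Sum>a\<le>k. (l2_norm (weak_deriv a (k - a) u))\<^sup>2)"
    using assms by (intro member_le_sum[of "a + b" "{..m}" "\<lambda>k. \<Sum>a\<le>k. (l2_norm (weak_deriv a (k - a) u))\<^sup>2"] sum_nonneg) auto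
  finally have "sqrt ((l2_norm (weak_deriv a b u))\<^sup>2) \<le> Hm_norm m u"
    unfolding Hm_norm_def by (rule real_sqrt_le_mono)
  then show ?thesis by simp
qed

lemma weak_deriv_0_AE: "u \<in> L2 \<Longrightarrow> AE z in MS. weak_deriv 0 0 u z = u z"
  by (rule weak_deriv_AE) (simp add: has_weak_deriv_def)

lemma l2_norm_le_Hm_norm: "u \<in> L2 \<Longrightarrow> l2_norm u \<le> Hm_norm m u"
  using l2_norm_weak_deriv_le[of 0 0 m u] l2_norm_cong_AE[OF weak_deriv_0_AE, of u] by simp

lemma Hm_norm_nonneg: "0 \<le> Hm_norm m u"
  using order_trans[OF l2_norm_nonneg l2_norm_weak_deriv_le[of 0 0 m u]] by simp

text \<open>The premise on test functions provides the integrability needed to split the integrals;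
  for first derivatives it follows from their continuity on the closed square.\<close>

lemma has_weak_deriv_diff:
  assumes "has_weak_deriv a b u w" "has_weak_deriv a b u' w'" "u \<in> L2" "u' \<in> L2"
    and test: "\<And>\<phi>. \<phi> \<in> test_functions \<Longrightarrow> (\<lambda>z. cnj ((pd_x ^^ a) ((pd_y ^^ b) \<phi>) z)) \<in> L2"
  shows "has_weak_deriv a b (\<lambda>z. u z - u' z) (\<lambda>z. w z - w' z)"
proof -
  have L: "w \<in> L2" "w' \<in> L2" using assms by (auto simp: has_weak_deriv_def)
  have "(LINT z|MS. (u z - u' z) * (pd_x ^^ a) ((pd_y ^^ b) \<phi>) z) = (-1) ^ (a + b) * (LINT z|MS. (w z - w' z) * \<phi> z)"
    if \<phi>: "\<phi> \<in> test_functions" for \<phi>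
  proof -
    define D where "D = (pd_x ^^ a) ((pd_y ^^ b) \<phi>)"
    have i: "integrable MS (\<lambda>z. u z * D z)" "integrable MS (\<lambda>z. u' z * D z)"
      using L2_mult_integrable[OF assms(3) test[OF \<phi>]] L2_mult_integrable[OF assms(4) test[OF \<phi>]] by (simp_all add: D_def)
    have j: "integrable MS (\<lambda>z. w z * \<phi> z)" "integrable MS (\<lambda>z. w' z * \<phi> z)"
      using L2_mult_integrable[OF L(1) test_C1_L2[OF \<phi>]] L2_mult_integrable[OF L(2) test_C1_L2[OF \<phi>]] by simp_all
    have "(LINT z|MS. (u z - u' z) * D z) = (LINT z|MS. u z * D z) - (LINT z|MS. u' z * D z)"
      using i by (simp add: left_diff_distrib)
    also have "\<dots> = (-1) ^ (a + b) * (LINT z|MS. w z * \<phi> z) - (-1) ^ (a + b) * (LINT z|MS. w' z * \<phi> z)"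
      using assms(1,2) \<phi> unfolding has_weak_deriv_def D_def by auto
    also have "\<dots> = (-1) ^ (a + b) * (LINT z|MS. (w z - w' z) * \<phi> z)"
      using j by (simp add: left_diff_distrib right_diff_distrib)
    finally show ?thesis by (simp add: D_def)
  qed
  then show ?thesis using L by (auto simp: has_weak_deriv_def)
qed

lemma has_weak_deriv_diff_1:
  assumes "u \<in> L2" "u' \<in> L2"
  shows "has_weak_deriv 1 0 u w \<Longrightarrow> has_weak_deriv 1 0 u' w' \<Longrightarrow> has_weak_deriv 1 0 (\<lambda>z. u z - u' z) (\<lambda>z. w z - w' z)"
    and "has_weak_deriv 0 1 u w \<Longrightarrow> has_weak_deriv 0 1 u' w' \<Longrightarrow> has_weak_deriv 0 1 (\<lambda>z. u z - u' z) (\<lambda>z. w z - w' z)"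
  by (rule has_weak_deriv_diff; use assms C1_L2[OF C1_cnj[OF test_function_C1(1)]] in simp)+

text \<open>Pointwise \<open>h \<le> d/2 + h^2/(2d)\<close>, so the integral is at most
  \<open>d + B^2/(2d)\<close>. The choice \<open>d = B\<close> gives \<open>3B/2\<close>, and
  \<open>B = 0\<close> is reached by letting \<open>d\<close> tend to zero.\<close>

lemma integral_le_of_square:
  fixes h :: "real \<Rightarrow> real"
  assumes h: "continuous_on {-1..1} h" and B: "B \<ge> 0" "integral {-1..1} (\<lambda>s. (h s)\<^sup>2) \<le> B\<^sup>2"
  shows "integral {-1..1} h \<le> 2 * B"
proof -
  have *: "integral {-1..1} h \<le> d + B\<^sup>2 / (2 * d)" if d: "d > 0" for d
  proof -
    have pt: "h s \<le> d / 2 + (h s)\<^sup>2 * (1 / (2 * d))" for s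
    proof -
      have "0 \<le> (h s - d)\<^sup>2 / (2 * d)" using d by simp
      also have "\<dots> = (h s)\<^sup>2 * (1 / (2 * d)) - h s + d / 2"
        using d by (simp add: power2_eq_square field_simps)
      finally show ?thesis by simp
    qed
    have i: "(\<lambda>s. d / 2 + (h s)\<^sup>2 * (1 / (2 * d))) integrable_on {-1..1}" "(\<lambda>s. (h s)\<^sup>2 * (1 / (2 * d))) integrable_on {-1..1}"
      using d by (auto intro!: integrable_continuous_interval continuous_intros h)
    have "integral {-1..1} h \<le> integral {-1..1} (\<lambda>s. d / 2 + (h s)\<^sup>2 * (1 / (2 * d)))"
      by (intro integral_le integrable_continuous_interval h i) (rule pt)
    also have "\<dots> = integral {-1..1} (\<lambda>s::real. d / 2) + integral {-1..1} (\<lambda>s. (h s)\<^sup>2 * (1 / (2 * d)))"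
      using i by (intro Henstock_Kurzweil_Integration.integral_add) auto
    also have "\<dots> = d + integral {-1..1} (\<lambda>s. (h s)\<^sup>2) * (1 / (2 * d))"
      by simp
    also have "\<dots> \<le> d + B\<^sup>2 * (1 / (2 * d))" using B d by (intro add_left_mono mult_right_mono) auto
    finally show ?thesis by simp
  qed
  show ?thesis
  proof (cases "B = 0")
    case True
    have "integral {-1..1} h \<le> 0 + d" if "d > 0" for d using *[OF that] True by simp
    then show ?thesis unfolding True by (simp add: field_le_epsilon)
  next
    case False
    then show ?thesis using *[of B] B by (simp add: power2_eq_square)
  qed
qed

lemma bdry_norm_nonneg: "bdry_norm w \<ge> 0"
  unfolding bdry_norm_def by (simp add: integral_nonneg_AE)

lemma bdry_norm_ge:
  assumes w: "continuous_on cSq w"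
  shows "integral {-1..1} (\<lambda>y. cmod (w (1, y)) + cmod (w (-1, y))) \<le> 4 * bdry_norm w"
    and "integral {-1..1} (\<lambda>x. cmod (w (x, 1)) + cmod (w (x, -1))) \<le> 4 * bdry_norm w"
proof -
  have c: "continuous_on {-1..1} (\<lambda>y. w (1, y))" "continuous_on {-1..1} (\<lambda>y. w (-1, y))"
    "continuous_on {-1..1} (\<lambda>x. w (x, 1))" "continuous_on {-1..1} (\<lambda>x. w (x, -1))"
    by (auto intro!: continuous_on_compose2[OF w] continuous_intros simp: cSq_def)
  let ?F = "\<lambda>s. (cmod (w (-1, s)))\<^sup>2 + (cmod (w (1, s)))\<^sup>2 + (cmod (w (s, -1)))\<^sup>2 + (cmod (w (s, 1)))\<^sup>2"
  have Fc: "continuous_on {-1..1} ?F" by (intro continuous_intros c)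
  have Fi: "integrable (lebesgue_on {-1..1}) ?F"
    using absolutely_integrable_continuous_real[OF Fc] by (simp add: integrable_restrict_space set_integrable_def)
  have "(bdry_norm w)\<^sup>2 = (LINT s|lebesgue_on {-1..1}. ?F s)"
    unfolding bdry_norm_def by (intro real_sqrt_pow2 integral_nonneg_AE AE_I2) simp
  also have "\<dots> = integral {-1..1} ?F" using Fi by (intro lebesgue_integral_eq_integral) auto
  finally have B: "integral {-1..1} ?F = (bdry_norm w)\<^sup>2" ..
  have le: "integral {-1..1} (\<lambda>s. cmod (f s)) \<le> 2 * bdry_norm w"
    if "continuous_on {-1..1} f" "\<And>s. (cmod (f s))\<^sup>2 \<le> ?F s" for f :: "real \<Rightarrow> complex"
  proof (rule integral_le_of_square)
    show "integral {-1..1} (\<lambda>s. (cmod (f s))\<^sup>2) \<le> (bdry_norm w)\<^sup>2"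
      unfolding B[symmetric] by (intro integral_le integrable_continuous_interval Fc continuous_intros that)
  qed (auto intro!: continuous_intros that bdry_norm_nonneg)
  have i: "(\<lambda>s. cmod (f s)) integrable_on {-1..1}" if "continuous_on {-1..1} f" for f :: "real \<Rightarrow> complex"
    by (intro integrable_continuous_interval continuous_intros that)
  show "integral {-1..1} (\<lambda>y. cmod (w (1, y)) + cmod (w (-1, y))) \<le> 4 * bdry_norm w"
    using le[OF c(1)] le[OF c(2)] by (simp add: integral_add i c)
  show "integral {-1..1} (\<lambda>x. cmod (w (x, 1)) + cmod (w (x, -1))) \<le> 4 * bdry_norm w"
    using le[OF c(3)] le[OF c(4)] by (simp add: integral_add i c)
qed

text \<open>By the divergence theorem each expression is a boundary integral of \<open>w\<close>
  times the conjugate of \<open>f\<close>. The constant is four times the maximum of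
  \<open>|f|\<close> and is independent of \<open>w\<close>, so that it survives a limit over a
  sequence.\<close>

lemma C1_boundary_bound:
  assumes w: "C1 w wx wy" and f: "f \<in> Pol"
  shows "\<exists>C. \<forall>w wx wy. C1 w wx wy \<longrightarrow> cmod (l2_inner w (pd_x f) + l2_inner wx f) \<le> C * bdry_norm w
     \<and> cmod (l2_inner w (pd_y f) + l2_inner wy f) \<le> C * bdry_norm w"
proof -
  obtain K where K: "\<And>z. z \<in> cSq \<Longrightarrow> cmod (f z) \<le> K"
    using compact_imp_bounded[OF compact_continuous_image[OF Pol_continuous[OF f] compact_cSq]]
    unfolding bounded_iff by blast
  have K0: "0 \<le> K" using order_trans[OF norm_ge_zero K[of "(0,0)"]] by (simp add: cSq_def)
  have "cmod (l2_inner w (pd_x f) + l2_inner wx f) \<le> (K * 4) * bdry_norm w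
     \<and> cmod (l2_inner w (pd_y f) + l2_inner wy f) \<le> (K * 4) * bdry_norm w" if w: "C1 w wx wy" for w wx wy
  proof -
    have wc: "continuous_on cSq w" using w by (simp add: C1_def)
    have c': "continuous_on {-1..1} (\<lambda>y. w (1, y))" "continuous_on {-1..1} (\<lambda>y. w (-1, y))"
      "continuous_on {-1..1} (\<lambda>x. w (x, 1))" "continuous_on {-1..1} (\<lambda>x. w (x, -1))"
      by (auto intro!: continuous_on_compose2[OF wc] continuous_intros simp: cSq_def)
    have cf: "continuous_on {-1..1} (\<lambda>y. f (1, y))" "continuous_on {-1..1} (\<lambda>y. f (-1, y))"
      "continuous_on {-1..1} (\<lambda>x. f (x, 1))" "continuous_on {-1..1} (\<lambda>x. f (x, -1))"
      by (auto intro!: continuous_on_compose2[OF Pol_continuous[OF f, of UNIV]] continuous_intros)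
    note p = C1_mult[OF w C1_cnj[OF Pol_C1[OF f]]]
    have L: "w \<in> L2" "wx \<in> L2" "wy \<in> L2" "f \<in> L2" using C1_L2[OF w] f by auto
    have pt: "cmod (a * cnj b - a' * cnj b') \<le> K * (cmod a + cmod a')" if "cmod b \<le> K" "cmod b' \<le> K" for a b a' b'
    proof -
      have "cmod (a * cnj b - a' * cnj b') \<le> cmod a * cmod b + cmod a' * cmod b'"
        using norm_triangle_ineq4[of "a * cnj b" "a' * cnj b'"] by (simp add: norm_mult)
      also have "\<dots> \<le> cmod a * K + cmod a' * K" using that by (intro add_mono mult_left_mono) auto
      finally show ?thesis by (simp add: algebra_simps)
    qed
    have "l2_inner w (pd_x f) + l2_inner wx f = (LINT z|MS. w z * cnj (pd_x f z) + wx z * cnj (f z))"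
      unfolding l2_inner_def using L f by (simp add: L2_mult_integrable)
    also have "\<dots> = integral {-1..1} (\<lambda>y. w (1, y) * cnj (f (1, y)) - w (-1, y) * cnj (f (-1, y)))"
      by (rule integral_C1(1)[OF p])
    also have "cmod \<dots> \<le> integral {-1..1} (\<lambda>y. K * (cmod (w (1, y)) + cmod (w (-1, y))))"
    proof (rule integral_norm_bound_integral)
      fix y :: real assume y: "y \<in> {-1..1}"
      show "cmod (w (1, y) * cnj (f (1, y)) - w (-1, y) * cnj (f (-1, y))) \<le> K * (cmod (w (1, y)) + cmod (w (-1, y)))"
        using y by (intro pt K) (auto simp: cSq_def)
    qed (intro integrable_continuous_interval continuous_intros cf c')+
    also have "\<dots> = K * integral {-1..1} (\<lambda>y. cmod (w (1, y)) + cmod (w (-1, y)))" by simp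
    also have "\<dots> \<le> K * (4 * bdry_norm w)" using bdry_norm_ge(1)[OF wc] K0 by (intro mult_left_mono)
    finally have x: "cmod (l2_inner w (pd_x f) + l2_inner wx f) \<le> (K * 4) * bdry_norm w" by (simp only: mult.assoc)
    have "l2_inner w (pd_y f) + l2_inner wy f = (LINT z|MS. w z * cnj (pd_y f z) + wy z * cnj (f z))"
      unfolding l2_inner_def using L f by (simp add: L2_mult_integrable)
    also have "\<dots> = integral {-1..1} (\<lambda>x. w (x, 1) * cnj (f (x, 1)) - w (x, -1) * cnj (f (x, -1)))"
      by (rule integral_C1(2)[OF p])
    also have "cmod \<dots> \<le> integral {-1..1} (\<lambda>x. K * (cmod (w (x, 1)) + cmod (w (x, -1))))"
    proof (rule integral_norm_bound_integral)
      fix x :: real assume x: "x \<in> {-1..1}"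
      show "cmod (w (x, 1) * cnj (f (x, 1)) - w (x, -1) * cnj (f (x, -1))) \<le> K * (cmod (w (x, 1)) + cmod (w (x, -1)))"
        using x by (intro pt K) (auto simp: cSq_def)
    qed (intro integrable_continuous_interval continuous_intros cf c')+
    also have "\<dots> = K * integral {-1..1} (\<lambda>x. cmod (w (x, 1)) + cmod (w (x, -1)))" by simp
    also have "\<dots> \<le> K * (4 * bdry_norm w)" using bdry_norm_ge(2)[OF wc] K0 by (intro mult_left_mono)
    finally have y: "cmod (l2_inner w (pd_y f) + l2_inner wy f) \<le> (K * 4) * bdry_norm w" by (simp only: mult.assoc)
    show ?thesis using x y by blast
  qed
  then show ?thesis by blast
qed

text \<open>The identities hold for the smooth approximants up to a multiple of their boundary norm,
  which tends to zero, while all other terms converge. Hence no end condition on the test polynomial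
  is left.\<close>

lemma H10_derivs:
  assumes v: "v \<in> H10"
  shows "v \<in> L2" "weak_deriv 1 0 v \<in> L2" "weak_deriv 0 1 v \<in> L2"
    "XD0 v (weak_deriv 1 0 v)" "YD0 v (weak_deriv 0 1 v)"
proof -
  have H: "v \<in> Hm 1" using v by (simp add: H10_def)
  show L: "v \<in> L2" "weak_deriv 1 0 v \<in> L2" "weak_deriv 0 1 v \<in> L2"
    using H Hm_weak_deriv(2)[OF H, of 1 0] Hm_weak_deriv(2)[OF H, of 0 1] by (auto simp: Hm_def)
  obtain w where w: "\<And>n::nat. smooth_on cSq (w n)" "(\<lambda>n. Hm_norm 1 (\<lambda>z. w n z - v z)) \<longlonglongrightarrow> 0"
    "(\<lambda>n. bdry_norm (w n)) \<longlonglongrightarrow> 0"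
    using v unfolding H10_def zero_trace_def by blast
  have "\<exists>fx fy. C1 (w n) fx fy" for n
    by (rule Ck_on_C1[of cSq]) (use w(1)[of n] in \<open>auto simp: smooth_on_def simp del: Ck_on.simps\<close>)
  then obtain wx wy where C: "\<And>n. C1 (w n) (wx n) (wy n)" by metis
  note wL = C1_L2[OF C]
  \<comment> \<open>Uniqueness of weak derivatives identifies the representative chosen inside
    \<open>Hm_norm\<close> with the explicit derivative \<open>d\<close>.\<close>
  have le: "l2_norm d \<le> Hm_norm 1 (\<lambda>z. w n z - v z)"
    if "has_weak_deriv a b (\<lambda>z. w n z - v z) d" "a + b \<le> 1" for a b d n
    using l2_norm_weak_deriv_le[OF that(2), of "\<lambda>z. w n z - v z"] l2_norm_cong_AE[OF weak_deriv_AE[OF that(1)]] that(1)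
    by (simp add: has_weak_deriv_def)
  have lim: "(\<lambda>n. l2_norm (\<lambda>z. d n z - d' z)) \<longlonglongrightarrow> 0"
    if "\<And>n. has_weak_deriv a b (\<lambda>z. w n z - v z) (\<lambda>z. d n z - d' z)" "a + b \<le> 1" for a b d d'
    by (rule tendsto_sandwich[OF _ _ tendsto_const w(2)]) (use le[OF that] in auto)
  have 0: "(\<lambda>n. l2_norm (\<lambda>z. w n z - v z)) \<longlonglongrightarrow> 0"
    by (rule lim[of 0 0]) (use wL L in \<open>auto simp: has_weak_deriv_def\<close>)
  have x: "(\<lambda>n. l2_norm (\<lambda>z. wx n z - weak_deriv 1 0 v z)) \<longlonglongrightarrow> 0"
    by (rule lim[of 1 0]) (use has_weak_deriv_diff_1(1)[OF wL(1) L(1) C1_has_weak_deriv(2)[OF C] Hm_weak_deriv(1)[OF H]] in auto)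
  have y: "(\<lambda>n. l2_norm (\<lambda>z. wy n z - weak_deriv 0 1 v z)) \<longlonglongrightarrow> 0"
    by (rule lim[of 0 1]) (use has_weak_deriv_diff_1(2)[OF wL(1) L(1) C1_has_weak_deriv(3)[OF C] Hm_weak_deriv(1)[OF H]] in auto)
  have fin: "l2_inner v (pd_x f) + l2_inner (weak_deriv 1 0 v) f = 0 \<and> l2_inner v (pd_y f) + l2_inner (weak_deriv 0 1 v) f = 0"
    if f: "f \<in> Pol" for f
  proof -
    obtain K where K: "\<And>n. cmod (l2_inner (w n) (pd_x f) + l2_inner (wx n) f) \<le> K * bdry_norm (w n)"
      "\<And>n. cmod (l2_inner (w n) (pd_y f) + l2_inner (wy n) f) \<le> K * bdry_norm (w n)"
      using C1_boundary_bound[OF C f] C by blast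
    have b0: "(\<lambda>n. K * bdry_norm (w n)) \<longlonglongrightarrow> 0" using tendsto_mult_left[OF w(3), of K] by simp
    have "(\<lambda>n. l2_inner (w n) (pd_x f) + l2_inner (wx n) f) \<longlonglongrightarrow> l2_inner v (pd_x f) + l2_inner (weak_deriv 1 0 v) f"
      by (intro tendsto_add l2_inner_tendsto 0 x wL L) (use f in auto)
    moreover have "(\<lambda>n. l2_inner (w n) (pd_x f) + l2_inner (wx n) f) \<longlonglongrightarrow> 0"
      by (rule Lim_null_comparison[OF _ b0]) (use K in auto)
    moreover have "(\<lambda>n. l2_inner (w n) (pd_y f) + l2_inner (wy n) f) \<longlonglongrightarrow> l2_inner v (pd_y f) + l2_inner (weak_deriv 0 1 v) f"
      by (intro tendsto_add l2_inner_tendsto 0 y wL L) (use f in auto)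
    moreover have "(\<lambda>n. l2_inner (w n) (pd_y f) + l2_inner (wy n) f) \<longlonglongrightarrow> 0"
      by (rule Lim_null_comparison[OF _ b0]) (use K in auto)
    ultimately show ?thesis using LIMSEQ_unique by blast
  qed
  show "XD0 v (weak_deriv 1 0 v)" "YD0 v (weak_deriv 0 1 v)"
    unfolding XD0_def YD0_def using fin[OF Pol_tp] by (simp_all add: pd_tp eq_neg_iff_add_eq_0)
qed

lemma VN2_boundary:
  assumes "v \<in> VN2 N"
  shows "v (1, y) = 0" "v (-1, y) = 0" "v (y, 1) = 0" "v (y, -1) = 0"
proof -
  have "v (1, y) = 0 \<and> v (-1, y) = 0 \<and> v (y, 1) = 0 \<and> v (y, -1) = 0"
    using assms by (induction v rule: VN2_induct) (auto simp: VN_iff)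
  then show "v (1, y) = 0" "v (-1, y) = 0" "v (y, 1) = 0" "v (y, -1) = 0" by auto
qed

text \<open>A discrete function is smooth up to the boundary and vanishes there, so the constant
  sequence witnesses its zero trace.\<close>

lemma VN2_H10:
  assumes v: "v \<in> VN2 N"
  shows "v \<in> H10"
proof -
  have P: "v \<in> Pol" using v VN2_Pol by blast
  note d = C1_has_weak_deriv[OF Pol_C1[OF P]]
  have "v \<in> Hm 1"
  proof -
    have "\<exists>w. has_weak_deriv a b v w" if "a + b \<le> 1" for a b
    proof -
      have "(a = 0 \<and> b = 0) \<or> (a = 1 \<and> b = 0) \<or> (a = 0 \<and> b = 1)" using that by auto
      then show ?thesis using d by blast
    qed
    then show ?thesis using P by (simp add: Hm_def)
  qed
  moreover have "zero_trace v"
    unfolding zero_trace_def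
  proof (intro exI[of _ "\<lambda>_. v"] conjI allI)
    show "smooth_on cSq v" unfolding smooth_on_def using Pol_Ck_on[OF P] by blast
    have "l2_norm (weak_deriv a b (\<lambda>z. 0)) = 0" for a b
      using l2_norm_cong_AE[OF weak_deriv_AE[OF has_weak_deriv_zero]] by simp
    then have "Hm_norm 1 (\<lambda>z. v z - v z) = 0" by (simp add: Hm_norm_def)
    then show "(\<lambda>n. Hm_norm 1 (\<lambda>z. v z - v z)) \<longlonglongrightarrow> 0" by simp
    have "bdry_norm v = 0" unfolding bdry_norm_def by (simp add: VN2_boundary[OF v])
    then show "(\<lambda>n. bdry_norm v) \<longlonglongrightarrow> 0" by simp
  qed
  ultimately show ?thesis by (simp add: H10_def)
qed

lemma grad_inner_lap:
  assumes u: "u \<in> H10" and v: "v \<in> VN2 N"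
  shows "grad_inner u v = - l2_inner u (lap v)"
proof -
  have P: "v \<in> Pol" using v VN2_Pol by blast
  note d = C1_has_weak_deriv[OF Pol_C1[OF P]]
  have "grad_inner u v = l2_inner (weak_deriv 1 0 u) (pd_x v) + l2_inner (weak_deriv 0 1 u) (pd_y v)"
    unfolding grad_inner_def
    using weak_deriv_AE[OF d(2)] weak_deriv_AE[OF d(3)] H10_derivs[OF u] P
    by (intro arg_cong2[where f = "(+)"] l2_inner_cong_AE) auto
  also have "\<dots> = - l2_inner u (lap v)"
    using lap_eq_ga[OF H10_derivs(4,5,1,2,3)[OF u] P] by simp
  finally show ?thesis .
qed

text \<open>The case distinction replaces the chosen representative of order zero, which agrees with
  \<open>u\<close> only almost everywhere, by \<open>u\<close> itself as \<open>sob\<close>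
  demands.\<close>

lemma Hm_sob:
  assumes "u \<in> Hm m" "u \<in> H10" "m \<ge> 1"
  shows "sob m u (\<lambda>a b. if a + b = 0 then u else weak_deriv a b u)"
    and "a + b \<le> m \<Longrightarrow> l2_norm (if a + b = 0 then u else weak_deriv a b u) \<le> Hm_norm m u"
proof -
  let ?D = "\<lambda>a b. if a + b = 0 then u else weak_deriv a b u"
  note h = H10_derivs[OF assms(2)]
  have hw: "has_weak_deriv a b u (?D a b)" if "a + b \<le> m" for a b
    using Hm_weak_deriv(1)[OF assms(1) that] h(1) by (auto simp: has_weak_deriv_def)
  have "XD (?D a b) (?D (Suc a) b)" "YD (?D a b) (?D a (Suc b))" if "a + b < m" for a b
  proof -
    have "a + b \<le> m" "Suc a + b \<le> m" "a + Suc b \<le> m" using that by auto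
    then show "XD (?D a b) (?D (Suc a) b)" "YD (?D a b) (?D a (Suc b))"
      by (intro has_weak_deriv_XD[OF hw hw] has_weak_deriv_YD[OF hw hw]; simp)+
  qed
  moreover have "?D a b \<in> L2" if "a + b \<le> m" for a b using hw[OF that] by (simp add: has_weak_deriv_def)
  ultimately show "sob m u ?D" unfolding sob_def using h by auto
  show "l2_norm (?D a b) \<le> Hm_norm m u" if "a + b \<le> m" for a b
    using l2_norm_weak_deriv_le[OF that, of u] l2_norm_le_Hm_norm[OF h(1), of m] by simp
qed

theorem elliptic_projection_error:
  assumes "u \<in> Hm m" "u \<in> H10" "m \<ge> 1" "N \<ge> 1" "grad_basis N r e"
  shows "l2_norm (\<lambda>z. u z - Pr r e u z)
     \<le> (2 ^ (m + 3) + 8 * (2 * real m) ^ (m - 1)) * (1 / real N) ^ m * Hm_norm m u"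
proof (rule l2_norm_le_dual)
  show "(\<lambda>z. u z - Pr r e u z) \<in> L2"
    using H10_derivs(1)[OF assms(2)] Pr_Pol[OF assms(5)] by auto
  show "0 \<le> (2 ^ (m + 3) + 8 * (2 * real m) ^ (m - 1)) * (1 / real N) ^ m * Hm_norm m u"
    using Hm_norm_nonneg by simp
  show "cmod (l2_inner (\<lambda>z. u z - Pr r e u z) (lap w))
     \<le> (2 ^ (m + 3) + 8 * (2 * real m) ^ (m - 1)) * (1 / real N) ^ m * Hm_norm m u * l2_norm (lap w)"
    if "w \<in> VN2 M" for M w
    using elliptic_projection_dual[OF Hm_sob(1)[OF assms(1-3)] assms(3-5) Hm_sob(2)[OF assms(1-3)] that]
    by (simp add: mult_ac)
qed

section \<open>Absolutely continuous functions of time\<close>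

lemma borel_measurable_lebesgue_on_AE:
  fixes u v :: "'a::euclidean_space \<Rightarrow> 'b::euclidean_space"
  assumes S: "S \<in> sets lebesgue" and v: "v \<in> borel_measurable (lebesgue_on S)"
    and eq: "AE x in lebesgue_on S. u x = v x"
  shows "u \<in> borel_measurable (lebesgue_on S)"
proof -
  have v: "(\<lambda>x. if x \<in> S then v x else 0) \<in> borel_measurable lebesgue"
    using v S by (simp add: borel_measurable_if)
  have "AE x in lebesgue. x \<in> S \<longrightarrow> u x = v x"
    using eq S by (simp add: AE_restrict_space_iff)
  then have "AE x in lebesgue. (if x \<in> S then v x else 0) = (if x \<in> S then u x else 0)"
    by eventually_elim simp
  from borel_measurable_AE[OF v this] show ?thesis
    using S by (simp add: borel_measurable_if)
qed

text \<open>The set where a continuous function exceeds the bound is open in the open interval;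
  being null, it is empty, and the end points follow by continuity.\<close>

lemma AE_interval_le:
  fixes h :: "real \<Rightarrow> real"
  assumes "a < b" and h: "continuous_on {a..b} h" and AE: "AE x in lebesgue_on {a<..<b}. h x \<le> K" and x: "x \<in> {a..b}"
  shows "h x \<le> K"
proof -
  have "open ({a<..<b} \<inter> h -` {K<..})"
    by (rule continuous_open_preimage[OF continuous_on_subset[OF h]]) auto
  moreover have "negligible ({a<..<b} \<inter> h -` {K<..})"
  proof -
    have "AE x in lebesgue. x \<notin> {a<..<b} \<inter> h -` {K<..}"
      using AE by (auto simp: AE_restrict_space_iff elim!: eventually_mono)
    then have "{a<..<b} \<inter> h -` {K<..} \<in> null_sets lebesgue"
      by (subst completion.null_sets_iff_AE) auto
    then show ?thesis by (simp add: negligible_iff_null_sets)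
  qed
  ultimately have "{a<..<b} \<inter> h -` {K<..} = {}"
    using open_not_negligible by blast
  then have "h y \<le> K" if "y \<in> {a<..<b}" for y using that by force
  then show ?thesis
    using continuous_le_on_closure[of "{a<..<b}" h x K] h x \<open>a < b\<close> by simp
qed

lemma Dk_deriv_differentiable:
  assumes "\<And>k. Dk k (f :: real \<Rightarrow> real)"
  shows "(deriv ^^ k) f differentiable (at t)"
proof -
  have "Dk j ((deriv ^^ k) f)" for j
  proof (induction k arbitrary: j)
    case (Suc k)
    then have "Dk (Suc j) ((deriv ^^ k) f)" .
    then obtain f' where f': "\<And>x. ((deriv ^^ k) f has_vector_derivative f' x) (at x)" "Dk j f'" by auto
    then have "deriv ((deriv ^^ k) f) = f'"
      by (intro ext DERIV_imp_deriv) (simp add: has_real_derivative_iff_has_vector_derivative)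
    then show ?case using f'(2) by simp
  qed (use assms in simp)
  from this[of "Suc 0"] obtain f' where "\<And>x. ((deriv ^^ k) f has_vector_derivative f' x) (at x)" by auto
  then show ?thesis using differentiableI_vector by blast
qed

text \<open>A smooth transition from 0 to 1 on \<open>[a, a + 1/(n+1)]\<close>, tending to the
  indicator of the points strictly to the right of \<open>a\<close>.\<close>

definition step :: "real \<Rightarrow> nat \<Rightarrow> real \<Rightarrow> real" where
  "step a n t = Hs (real (Suc n) * t + - (real (Suc n) * a))"

lemma step_eq: "step a n t = Hs (real (Suc n) * (t - a))"
  by (simp add: step_def algebra_simps)

lemma Dk_step: "Dk k (step a n)"
  unfolding step_def by (rule Dk_affine[OF Dk_Hs])

lemma step_deriv: "(step a n has_real_derivative hs (real (Suc n) * (t - a)) * real (Suc n)) (at t)"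
  unfolding step_eq[abs_def] by (auto intro!: derivative_eq_intros DERIV_chain2[OF hs(2)])

lemma step_bounds: "0 \<le> step a n t" "step a n t \<le> 1"
  by (simp_all add: step_eq Hs_bounds)

lemma step_0: "t \<le> a \<Longrightarrow> step a n t = 0"
  unfolding step_eq by (rule Hs_0) (simp add: mult_nonneg_nonpos)

lemma step_1: "t \<ge> a + 1 / real (Suc n) \<Longrightarrow> step a n t = 1"
proof -
  assume "t \<ge> a + 1 / real (Suc n)"
  then have "1 / real (Suc n) \<le> t - a" by simp
  then have "1 \<le> real (Suc n) * (t - a)" by (simp add: divide_le_eq mult.commute)
  then show ?thesis unfolding step_eq by (rule Hs_1)
qed

lemma step_tendsto: "(\<lambda>n. step a n t) \<longlonglongrightarrow> (if a < t then 1 else 0)"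
proof (cases "a < t")
  case True
  then have "\<forall>\<^sub>F n in sequentially. 1 / real (Suc n) < t - a"
    using order_tendstoD(2)[OF LIMSEQ_inverse_real_of_nat, of "t - a"] by (simp add: inverse_eq_divide)
  then have "\<forall>\<^sub>F n in sequentially. step a n t = 1"
    by eventually_elim (auto intro!: step_1)
  then show ?thesis using True by (simp add: tendsto_eventually)
qed (simp add: step_0)

text \<open>The derivative of \<open>step\<close>: an approximate unit mass concentrated to the
  right of \<open>a\<close>.\<close>

definition bump :: "real \<Rightarrow> nat \<Rightarrow> real \<Rightarrow> real" where
  "bump a n t = hs (real (Suc n) * (t - a)) * real (Suc n)"

lemma bump_continuous: "continuous_on S (bump a n)"
  unfolding bump_def by (intro continuous_intros continuous_on_compose2[OF hs(1)]) auto

lemma bump_0: "t < a \<or> t > a + 1 / real (Suc n) \<Longrightarrow> bump a n t = 0"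
proof -
  assume t: "t < a \<or> t > a + 1 / real (Suc n)"
  have "real (Suc n) * (t - a) < 0 \<or> real (Suc n) * (t - a) > 1"
  proof (cases "t < a")
    case True then show ?thesis by (simp add: mult_pos_neg)
  next
    case False
    then have "1 / real (Suc n) < t - a" using t by simp
    then have "1 < real (Suc n) * (t - a)" by (simp add: divide_less_eq mult.commute)
    then show ?thesis ..
  qed
  then show ?thesis unfolding bump_def using hs(3) by simp
qed

lemma bump_integral: "(bump a n has_integral 1) {a..a + 1 / real (Suc n)}"
proof -
  have "(bump a n has_integral (step a n (a + 1 / real (Suc n)) - step a n a)) {a..a + 1 / real (Suc n)}"
  proof (rule fundamental_theorem_of_calculus)
    fix x
    show "(step a n has_vector_derivative bump a n x) (at x within {a..a + 1 / real (Suc n)})"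
      using step_deriv[of a n x] unfolding bump_def has_real_derivative_iff_has_vector_derivative
      by (rule has_vector_derivative_at_within)
  qed simp
  then show ?thesis by (simp add: step_0 step_1)
qed

text \<open>The height \<open>B / r\<close> of the bump cancels the length \<open>r\<close> of its
  support, so the error is at most \<open>B\<close> times the oscillation of \<sigma>. Choosing the
  oscillation below \<open>\<epsilon> / (B + 1)\<close> makes it smaller than \<epsilon>.\<close>

lemma bump_mollifies:
  fixes \<sigma> :: "real \<Rightarrow> complex"
  assumes \<sigma>: "continuous_on {t0..T} \<sigma>" and a: "t0 < a" "a < T"
  shows "(\<lambda>n. LINT t|lebesgue_on {t0<..<T}. of_real (bump a n t) * \<sigma> t) \<longlonglongrightarrow> \<sigma> a"
proof (rule metric_LIMSEQ_I)
  fix \<epsilon> :: real assume \<epsilon>: "\<epsilon> > 0"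
  obtain B where B: "B \<ge> 0" "\<And>x. \<bar>hs x\<bar> \<le> B" using hs_bound by blast
  have "\<epsilon> / (B + 1) > 0" using \<epsilon> B by simp
  then obtain d where d: "d > 0" "\<And>t. t \<in> {t0..T} \<Longrightarrow> dist t a < d \<Longrightarrow> dist (\<sigma> t) (\<sigma> a) < \<epsilon> / (B + 1)"
    using \<sigma> a unfolding continuous_on_iff by (metis atLeastAtMost_iff less_imp_le)
  have "\<forall>\<^sub>F n in sequentially. 1 / real (Suc n) < min d (T - a)"
    using order_tendstoD(2)[OF LIMSEQ_inverse_real_of_nat, of "min d (T - a)"] d(1) a by (simp add: inverse_eq_divide)
  then obtain n0 where n0: "\<And>n. n \<ge> n0 \<Longrightarrow> 1 / real (Suc n) < min d (T - a)" by (auto simp: eventually_sequentially)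
  have "dist (LINT t|lebesgue_on {t0<..<T}. of_real (bump a n t) * \<sigma> t) (\<sigma> a) < \<epsilon>" if n: "n \<ge> n0" for n
  proof -
    define r where "r = 1 / real (Suc n)"
    have r: "r > 0" "r < d" "a + r < T" using n0[OF n] by (auto simp: r_def)
    let ?F = "\<lambda>t. of_real (bump a n t) * \<sigma> t"
    have Fc: "continuous_on {t0..T} ?F" by (intro continuous_intros bump_continuous \<sigma>)
    have "integrable (lebesgue_on {t0..T}) ?F"
      using absolutely_integrable_continuous_real[OF Fc] by (simp add: integrable_restrict_space set_integrable_def)
    then have "set_integrable lebesgue {t0..T} ?F" by (simp add: integrable_restrict_space set_integrable_def)
    then have "set_integrable lebesgue {t0<..<T} ?F" by (rule set_integrable_subset) auto
    then have Fi: "integrable (lebesgue_on {t0<..<T}) ?F" by (simp add: integrable_restrict_space set_integrable_def)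
    have sub: "{a..a + r} \<subseteq> {t0<..<T}" using a r by auto
    have F1: "(?F has_integral integral {a..a + r} ?F) {a..a + r}"
      using a r by (intro integrable_integral integrable_continuous_interval continuous_on_subset[OF Fc]) auto
    have "(?F has_integral integral {a..a + r} ?F) {t0<..<T}"
      by (rule has_integral_on_superset[OF F1 _ sub]) (auto simp: r_def intro!: bump_0)
    then have eq: "(LINT t|lebesgue_on {t0<..<T}. ?F t) = integral {a..a + r} ?F"
      using lebesgue_integral_eq_integral[OF Fi] integral_unique by simp
    have "((\<lambda>t. of_real (bump a n t) * \<sigma> a) has_integral of_real 1 * \<sigma> a) {a..a + r}"
      using has_integral_mult_left[OF has_integral_of_real[OF bump_integral[of a n]], of "\<sigma> a"] by (simp add: r_def)
    from has_integral_diff[OF F1 this]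
    have D: "((\<lambda>t. of_real (bump a n t) * (\<sigma> t - \<sigma> a)) has_integral (integral {a..a + r} ?F - \<sigma> a)) {a..a + r}"
      by (simp add: right_diff_distrib)
    have "cmod (integral {a..a + r} ?F - \<sigma> a) \<le> (B / r * (\<epsilon> / (B + 1))) * Henstock_Kurzweil_Integration.content {a..a + r}"
    proof (rule has_integral_bound_real[OF _ finite.emptyI D])
      show "0 \<le> B / r * (\<epsilon> / (B + 1))" using B \<epsilon> r by simp
      fix t assume "t \<in> {a..a + r} - {}"
      then have t: "t \<in> {a..a + r}" by simp
      have "\<bar>bump a n t\<bar> \<le> B / r"
        unfolding bump_def r_def abs_mult using B(2) by (simp add: mult_right_mono)
      moreover have "cmod (\<sigma> t - \<sigma> a) \<le> \<epsilon> / (B + 1)"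
        using d(2)[of t] t r a by (auto simp: dist_norm dist_real_def)
      ultimately show "cmod (of_real (bump a n t) * (\<sigma> t - \<sigma> a)) \<le> B / r * (\<epsilon> / (B + 1))"
        unfolding norm_mult norm_of_real using B r by (intro mult_mono) auto
    qed
    also have "\<dots> = B * \<epsilon> / (B + 1)" using r by simp
    also have "\<dots> < \<epsilon>" using B \<epsilon> by (simp add: divide_less_eq algebra_simps)
    finally show ?thesis unfolding eq by (simp add: dist_norm)
  qed
  then show "\<exists>n0. \<forall>n\<ge>n0. dist (LINT t|lebesgue_on {t0<..<T}. of_real (bump a n t) * \<sigma> t) (\<sigma> a) < \<epsilon>" by blast
qed

text \<open>The test function is the difference of two smooth steps at \<open>s\<close> and
  \<open>t\<close>. Its derivative evaluates \<sigma> at both points in the limit, and the function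
  itself tends to the indicator between them.\<close>

lemma weak_fundamental_theorem:
  fixes \<sigma> g :: "real \<Rightarrow> complex"
  assumes \<sigma>: "continuous_on {t0..T} \<sigma>" and st: "t0 < s" "s < t" "t < T"
    and g: "g \<in> borel_measurable (lebesgue_on {t0<..<T})" "AE \<tau> in lebesgue_on {t0<..<T}. cmod (g \<tau>) \<le> G"
    and weak: "\<And>\<eta>. \<eta> \<in> time_test_functions {t0<..<T} \<Longrightarrow>
       (LINT t|lebesgue_on {t0<..<T}. of_real (deriv \<eta> t) * \<sigma> t) = - (LINT t|lebesgue_on {t0<..<T}. of_real (\<eta> t) * g t)"
  shows "(g has_integral (\<sigma> t - \<sigma> s)) {s..t}"
proof -
  define M where "M = lebesgue_on {t0<..<T}"
  define \<eta> where "\<eta> n \<tau> = step s n \<tau> - step t n \<tau>" for n \<tau>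
  have \<eta>d: "deriv (\<eta> n) \<tau> = bump s n \<tau> - bump t n \<tau>" for n \<tau>
    unfolding \<eta>_def bump_def by (intro DERIV_imp_deriv DERIV_diff step_deriv)
  have fm: "finite_measure M"
  proof
    have "emeasure lborel {t0<..<T} < \<infinity>" using st by (simp add: emeasure_lborel_Ioo)
    then show "emeasure M (space M) \<noteq> \<infinity>" by (simp add: M_def emeasure_restrict_space)
  qed
  have int: "integrable M (\<lambda>\<tau>. of_real (bump a n \<tau>) * \<sigma> \<tau>)" for a n
  proof -
    have Fc: "continuous_on {t0..T} (\<lambda>\<tau>. of_real (bump a n \<tau>) * \<sigma> \<tau>)" by (intro continuous_intros bump_continuous \<sigma>)
    have "set_integrable lebesgue {t0<..<T} (\<lambda>\<tau>. of_real (bump a n \<tau>) * \<sigma> \<tau>)"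
      using absolutely_integrable_continuous_real[OF Fc] by (rule set_integrable_subset) auto
    then show ?thesis by (simp add: M_def integrable_restrict_space set_integrable_def)
  qed
  have "(\<lambda>n. (LINT \<tau>|M. of_real (bump s n \<tau>) * \<sigma> \<tau>) - (LINT \<tau>|M. of_real (bump t n \<tau>) * \<sigma> \<tau>)) \<longlonglongrightarrow> \<sigma> s - \<sigma> t"
    unfolding M_def using st by (intro tendsto_diff bump_mollifies[OF \<sigma>]) auto
  also have "(\<lambda>n. (LINT \<tau>|M. of_real (bump s n \<tau>) * \<sigma> \<tau>) - (LINT \<tau>|M. of_real (bump t n \<tau>) * \<sigma> \<tau>))
      = (\<lambda>n. LINT \<tau>|M. of_real (deriv (\<eta> n) \<tau>) * \<sigma> \<tau>)"
    using int by (simp add: \<eta>d left_diff_distrib)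
  finally have 1: "(\<lambda>n. LINT \<tau>|M. of_real (deriv (\<eta> n) \<tau>) * \<sigma> \<tau>) \<longlonglongrightarrow> \<sigma> s - \<sigma> t" .
  have test: "\<forall>\<^sub>F n in sequentially. \<eta> n \<in> time_test_functions {t0<..<T}"
  proof -
    have "\<forall>\<^sub>F n in sequentially. 1 / real (Suc n) < T - t"
      using order_tendstoD(2)[OF LIMSEQ_inverse_real_of_nat, of "T - t"] st by (simp add: inverse_eq_divide)
    then show ?thesis
    proof eventually_elim
      case (elim n)
      have "\<eta> n = (\<lambda>\<tau>. step s n \<tau> + (-1) * step t n \<tau>)" by (auto simp: \<eta>_def)
      moreover have "Dk k (\<lambda>\<tau>. step s n \<tau> + (-1) * step t n \<tau>)" for k
        by (intro Dk_add Dk_mult Dk_const Dk_step)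
      ultimately have D: "Dk k (\<eta> n)" for k by (simp only:)
      have "\<eta> n \<tau> = 0" if "\<tau> \<notin> {s..t + 1 / real (Suc n)}" for \<tau>
        using that st by (cases "\<tau> < s") (auto simp: \<eta>_def step_0 step_1)
      then have cl: "closure {\<tau>. \<eta> n \<tau> \<noteq> 0} \<subseteq> {s..t + 1 / real (Suc n)}"
        by (intro closure_minimal subsetI) (blast, simp)
      moreover have "{s..t + 1 / real (Suc n)} \<subseteq> {t0<..<T}" using elim st by auto
      moreover have "compact (closure {\<tau>. \<eta> n \<tau> \<noteq> 0})"
        using cl bounded_subset[of "{s..t + 1 / real (Suc n)}"] by (auto simp: compact_eq_bounded_closed)
      ultimately show ?case
        using Dk_deriv_differentiable[OF D] unfolding time_test_functions_def by blast
    qed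
  qed
  have "\<forall>\<^sub>F n in sequentially. - (LINT \<tau>|M. of_real (deriv (\<eta> n) \<tau>) * \<sigma> \<tau>) = (LINT \<tau>|M. of_real (\<eta> n \<tau>) * g \<tau>)"
    using test by eventually_elim (simp add: weak M_def)
  from Lim_transform_eventually[OF tendsto_minus[OF 1] this]
  have 2: "(\<lambda>n. LINT \<tau>|M. of_real (\<eta> n \<tau>) * g \<tau>) \<longlonglongrightarrow> \<sigma> t - \<sigma> s" by simp
  \<comment> \<open>The interval is half-open because the limit of a step is 0 at its own starting
    point and 1 strictly to the right.\<close>
  let ?F = "\<lambda>\<tau>. if \<tau> \<in> {s<..t} then g \<tau> else 0"
  have Fm: "?F \<in> borel_measurable M"
    unfolding M_def using g(1) by (intro measurable_If_set) (auto simp: sets_restrict_space)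
  have \<eta>m: "(\<lambda>\<tau>. of_real (\<eta> n \<tau>) * g \<tau>) \<in> borel_measurable M" for n
  proof -
    have "continuous_on {t0<..<T} (\<eta> n)"
      unfolding \<eta>_def using Dk_continuous[OF Dk_step[of 0]] by (intro continuous_intros) (auto intro: continuous_on_subset)
    then have [measurable]: "\<eta> n \<in> borel_measurable M"
      unfolding M_def by (intro continuous_imp_measurable_on_sets_lebesgue) auto
    have [measurable]: "g \<in> borel_measurable M" using g(1) by (simp add: M_def)
    show ?thesis by measurable
  qed
  have G0: "AE \<tau> in M. cmod (g \<tau>) \<le> \<bar>G\<bar>" using g(2) unfolding M_def by eventually_elim simp
  have 3: "(\<lambda>n. LINT \<tau>|M. of_real (\<eta> n \<tau>) * g \<tau>) \<longlonglongrightarrow> (LINT \<tau>|M. ?F \<tau>)"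
  proof (rule integral_dominated_convergence[where w = "\<lambda>_. \<bar>G\<bar>"])
    show "integrable M (\<lambda>_. \<bar>G\<bar>)" using finite_measure.integrable_const[OF fm] .
    show "AE \<tau> in M. (\<lambda>n. of_real (\<eta> n \<tau>) * g \<tau>) \<longlonglongrightarrow> ?F \<tau>"
    proof (rule AE_I2)
      fix \<tau>
      have "(\<lambda>n. of_real (\<eta> n \<tau>) * g \<tau>) \<longlonglongrightarrow> of_real ((if s < \<tau> then 1 else 0) - (if t < \<tau> then 1 else 0)) * g \<tau>"
        unfolding \<eta>_def by (intro tendsto_intros step_tendsto)
      then show "(\<lambda>n. of_real (\<eta> n \<tau>) * g \<tau>) \<longlonglongrightarrow> ?F \<tau>" using st by (auto split: if_splits)
    qed
    show "AE \<tau> in M. norm (of_real (\<eta> n \<tau>) * g \<tau>) \<le> \<bar>G\<bar>" for n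
      using G0
    proof eventually_elim
      case (elim \<tau>)
      have "\<bar>\<eta> n \<tau>\<bar> \<le> 1" unfolding \<eta>_def using step_bounds[of s n \<tau>] step_bounds[of t n \<tau>] by linarith
      from mult_mono[OF this elim] show ?case by (simp add: norm_mult)
    qed
  qed (use Fm \<eta>m in auto)
  have eq: "(LINT \<tau>|M. ?F \<tau>) = \<sigma> t - \<sigma> s" using LIMSEQ_unique[OF 3 2] .
  have Fi: "integrable M ?F"
  proof (rule finite_measure.integrable_const_bound[OF fm _ Fm])
    show "AE \<tau> in M. norm (?F \<tau>) \<le> \<bar>G\<bar>" using G0 by eventually_elim auto
  qed
  have "(?F has_integral (\<sigma> t - \<sigma> s)) {t0<..<T}"
    using lebesgue_integral_eq_integral[OF Fi[unfolded M_def]] integrable_on_lebesgue_on[OF Fi[unfolded M_def]] eq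
    by (auto simp: has_integral_iff M_def)
  then have "(g has_integral (\<sigma> t - \<sigma> s)) {s<..t}"
    using st by (subst (asm) has_integral_restrict) auto
  moreover have "negligible ({s<..t} - {s..t} \<union> ({s..t} - {s<..t}))"
    by (rule negligible_subset[of "{s}"]) auto
  ultimately show ?thesis
    by (subst has_integral_spike_set_eq[of "{s..t}" "{s<..t}"]) (auto intro: negligible_subset[of "{s}"])
qed

lemma has_integral_bound_AE:
  fixes g :: "real \<Rightarrow> complex"
  assumes g: "(g has_integral L) {s..t}" and sub: "{s..t} \<subseteq> {t0<..<T}" and st: "s \<le> t"
    and AE: "AE \<tau> in lebesgue_on {t0<..<T}. cmod (g \<tau>) \<le> G" and G: "0 \<le> G"
  shows "cmod L \<le> G * (t - s)"
proof -
  define N where "N = {\<tau>\<in>{t0<..<T}. \<not> cmod (g \<tau>) \<le> G}"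
  have "AE \<tau> in lebesgue. \<tau> \<notin> N"
    using AE by (auto simp: AE_restrict_space_iff N_def elim!: eventually_mono)
  then have "negligible N"
    by (subst negligible_iff_null_sets, subst completion.null_sets_iff_AE) auto
  then have i: "((\<lambda>\<tau>. if \<tau> \<in> N then 0 else g \<tau>) has_integral L) {s..t}"
    by (rule has_integral_spike[OF _ _ g]) auto
  have "cmod (if \<tau> \<in> N then 0 else g \<tau>) \<le> G" if "\<tau> \<in> {s..t} - {}" for \<tau>
    using that sub G by (auto simp: N_def)
  from has_integral_bound_real[OF G finite.emptyI i this] show ?thesis
    using st by simp
qed

text \<open>A discrete Gronwall argument: the quadratic term disappears when the partition is refined.\<close>

lemma sqrt_growth:
  fixes E :: "real \<Rightarrow> real"
  assumes E0: "\<And>\<tau>. \<tau> \<in> {a..b} \<Longrightarrow> E \<tau> \<ge> 0" and ab: "a \<le> b" and K: "K \<ge> 0" "L \<ge> 0"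
    and step: "\<And>s t. a \<le> s \<Longrightarrow> s \<le> t \<Longrightarrow> t \<le> b \<Longrightarrow> E t - E s \<le> 2 * K * sqrt (E s) * (t - s) + L * (t - s)\<^sup>2"
  shows "sqrt (E b) \<le> sqrt (E a) + K * (b - a)"
proof -
  \<comment> \<open>The square root is not Lipschitz at zero; the shift by \<delta> bounds it below
    by \<open>q\<close> and is removed at the end.\<close>
  have main: "sqrt (E b + \<delta>) \<le> sqrt (E a + \<delta>) + K * (b - a)" if \<delta>: "\<delta> > 0" for \<delta>
  proof -
    define q where "q = sqrt \<delta>"
    have q: "q > 0" using \<delta> by (simp add: q_def)
    define c where "c = L / (2 * q)"
    have c: "c \<ge> 0" "L = 2 * q * c" using q K by (simp_all add: c_def)
    have one: "sqrt (E t + \<delta>) \<le> sqrt (E s + \<delta>) + K * (t - s) + c * (t - s)\<^sup>2"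
      if st: "a \<le> s" "s \<le> t" "t \<le> b" for s t
    proof -
      define x where "x = sqrt (E s + \<delta>)"
      have es: "E s \<ge> 0" "E t \<ge> 0" using E0[of s] E0[of t] st by auto
      have x: "x \<ge> q" "x > 0" "x\<^sup>2 = E s + \<delta>" "sqrt (E s) \<le> x" using es \<delta> by (auto simp: x_def q_def)
      define y where "y = K * (t - s) + c * (t - s)\<^sup>2"
      have y: "y \<ge> 0" using K c st by (simp add: y_def)
      have "2 * K * sqrt (E s) * (t - s) \<le> 2 * K * x * (t - s)"
        using x K st by (intro mult_right_mono mult_left_mono) auto
      moreover have "L * (t - s)\<^sup>2 \<le> 2 * x * (c * (t - s)\<^sup>2)"
      proof -
        have "L * (t - s)\<^sup>2 = 2 * q * (c * (t - s)\<^sup>2)" using c by simp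
        also have "\<dots> \<le> 2 * x * (c * (t - s)\<^sup>2)"
          using x c by (intro mult_right_mono) auto
        finally show ?thesis .
      qed
      ultimately have "E t + \<delta> \<le> x\<^sup>2 + 2 * x * y"
        using step[OF st] x by (simp add: y_def algebra_simps)
      also have "\<dots> \<le> (x + y)\<^sup>2" by (simp add: power2_sum)
      finally have "sqrt (E t + \<delta>) \<le> x + y" using x y by (intro real_le_lsqrt) auto
      then show ?thesis by (simp add: x_def y_def)
    qed
    \<comment> \<open>With \<open>n + 1\<close> equal pieces the linear terms add up to
      \<open>K (b - a)\<close>, whereas the quadratic ones leave only
      \<open>c (b - a)^2 / (n + 1)\<close>.\<close>
    have part: "sqrt (E b + \<delta>) \<le> sqrt (E a + \<delta>) + K * (b - a) + c * (b - a)\<^sup>2 / real (Suc n)" for n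
    proof -
      define h where "h = (b - a) / real (Suc n)"
      have h: "h \<ge> 0" "real (Suc n) * h = b - a" using ab by (auto simp: h_def)
      have ind: "sqrt (E (a + real i * h) + \<delta>) \<le> sqrt (E a + \<delta>) + real i * (K * h + c * h\<^sup>2)" if "i \<le> Suc n" for i
        using that
      proof (induction i)
        case (Suc i)
        have le: "real (Suc i) * h \<le> real (Suc n) * h" using Suc.prems h by (intro mult_right_mono) auto
        have "sqrt (E (a + real (Suc i) * h) + \<delta>) \<le> sqrt (E (a + real i * h) + \<delta>)
           + K * (a + real (Suc i) * h - (a + real i * h)) + c * (a + real (Suc i) * h - (a + real i * h))\<^sup>2"
          using h le by (intro one) (auto simp: algebra_simps)
        also have "a + real (Suc i) * h - (a + real i * h) = h" by (simp add: algebra_simps)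
        finally show ?case using Suc by (simp add: algebra_simps)
      qed simp
      have "real (Suc n) * (K * h + c * h\<^sup>2) = K * (real (Suc n) * h) + c * ((real (Suc n) * h) * h)"
        by (simp only: power2_eq_square algebra_simps)
      also have "\<dots> = K * (b - a) + c * (b - a)\<^sup>2 / real (Suc n)"
        unfolding h(2) by (simp add: h_def power2_eq_square)
      finally show ?thesis using ind[of "Suc n"] unfolding h(2) by simp
    qed
    have "(\<lambda>n. sqrt (E a + \<delta>) + K * (b - a) + c * (b - a)\<^sup>2 * inverse (real (Suc n)))
        \<longlonglongrightarrow> sqrt (E a + \<delta>) + K * (b - a) + c * (b - a)\<^sup>2 * 0"
      by (intro tendsto_intros LIMSEQ_inverse_real_of_nat)
    then show ?thesis
      using part by (intro LIMSEQ_le_const[of _ "sqrt (E a + \<delta>) + K * (b - a)" "sqrt (E b + \<delta>)"])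
        (auto simp: divide_inverse)
  qed
  have "((\<lambda>\<delta>. sqrt (E b + \<delta>)) \<longlongrightarrow> sqrt (E b + 0)) (at_right 0)"
    by (intro tendsto_intros)
  moreover have "((\<lambda>\<delta>. sqrt (E a + \<delta>) + K * (b - a)) \<longlongrightarrow> sqrt (E a + 0) + K * (b - a)) (at_right 0)"
    by (intro tendsto_intros)
  moreover have "\<forall>\<^sub>F \<delta> in at_right 0. sqrt (E b + \<delta>) \<le> sqrt (E a + \<delta>) + K * (b - a)"
    using eventually_at_right_less[of 0] by eventually_elim (rule main)
  ultimately have "sqrt (E b + 0) \<le> sqrt (E a + 0) + K * (b - a)"
    by (intro tendsto_le[OF trivial_limit_at_right_real])
  then show ?thesis by simp
qed

section \<open>Continuity with values in \<open>L\<^sup>2\<close>\<close>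

lemma l2_norm_lin:
  assumes "\<And>i. i \<in> I \<Longrightarrow> f i \<in> L2"
  shows "l2_norm (\<lambda>z. \<Sum>i\<in>I. a i * f i z) \<le> (\<Sum>i\<in>I. cmod (a i) * l2_norm (f i))"
  using assms
proof (induction I rule: infinite_finite_induct)
  case (insert i I)
  have "l2_norm (\<lambda>z. a i * f i z + (\<Sum>i\<in>I. a i * f i z)) \<le> l2_norm (\<lambda>z. a i * f i z) + l2_norm (\<lambda>z. \<Sum>i\<in>I. a i * f i z)"
    using insert.prems by (intro l2_norm_triangle L2_scale L2_sum) auto
  then show ?case using insert by (simp add: l2_norm_scale)
qed auto

lemma continuous_L2_lin:
  assumes "finite I" "\<And>i. i \<in> I \<Longrightarrow> f i \<in> L2" "\<And>i. i \<in> I \<Longrightarrow> continuous_on S (a i)"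
  shows "continuous_L2 S (\<lambda>t z. \<Sum>i\<in>I. a i t * f i z)"
  unfolding continuous_L2_def
proof (intro conjI ballI)
  show "(\<lambda>z. \<Sum>i\<in>I. a i t * f i z) \<in> L2" for t by (intro L2_sum L2_scale assms)
  fix t assume t: "t \<in> S"
  have "((\<lambda>s. \<Sum>i\<in>I. cmod (a i s - a i t) * l2_norm (f i)) \<longlongrightarrow> (\<Sum>i\<in>I. cmod (a i t - a i t) * l2_norm (f i))) (at t within S)"
    using assms(3) t by (intro tendsto_intros) (auto simp: continuous_on_def)
  then have lim: "((\<lambda>s. \<Sum>i\<in>I. cmod (a i s - a i t) * l2_norm (f i)) \<longlongrightarrow> 0) (at t within S)" by simp
  show "((\<lambda>s. l2_norm (\<lambda>z. (\<Sum>i\<in>I. a i s * f i z) - (\<Sum>i\<in>I. a i t * f i z))) \<longlongrightarrow> 0) (at t within S)"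
  proof (rule tendsto_sandwich[OF _ _ tendsto_const lim])
    have "l2_norm (\<lambda>z. (\<Sum>i\<in>I. a i s * f i z) - (\<Sum>i\<in>I. a i t * f i z)) \<le> (\<Sum>i\<in>I. cmod (a i s - a i t) * l2_norm (f i))" for s
      using l2_norm_lin[of I f "\<lambda>i. a i s - a i t"] assms(2) by (simp add: left_diff_distrib sum_subtractf)
    then show "\<forall>\<^sub>F s in at t within S. l2_norm (\<lambda>z. (\<Sum>i\<in>I. a i s * f i z) - (\<Sum>i\<in>I. a i t * f i z))
       \<le> (\<Sum>i\<in>I. cmod (a i s - a i t) * l2_norm (f i))" by (intro always_eventually allI)
  qed simp
qed

lemma continuous_L2_cong:
  assumes "\<And>t. t \<in> S \<Longrightarrow> u t = w t" "continuous_L2 S w"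
  shows "continuous_L2 S u"
  unfolding continuous_L2_def
proof (intro conjI ballI)
  fix t assume t: "t \<in> S"
  show "u t \<in> L2" using assms t by (simp add: continuous_L2_def)
  have "\<forall>\<^sub>F s in at t within S. l2_norm (\<lambda>z. w s z - w t z) = l2_norm (\<lambda>z. u s z - u t z)"
    unfolding eventually_at_filter using assms(1) t by (intro always_eventually) auto
  moreover have "((\<lambda>s. l2_norm (\<lambda>z. w s z - w t z)) \<longlongrightarrow> 0) (at t within S)"
    using assms(2) t by (simp add: continuous_L2_def)
  ultimately show "((\<lambda>s. l2_norm (\<lambda>z. u s z - u t z)) \<longlongrightarrow> 0) (at t within S)"
    by (rule Lim_transform_eventually[rotated])
qed

lemma continuous_L2_diff:
  assumes "continuous_L2 S u" "continuous_L2 S w"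
  shows "continuous_L2 S (\<lambda>t z. u t z - w t z)"
  unfolding continuous_L2_def
proof (intro conjI ballI)
  fix t assume t: "t \<in> S"
  have L: "u s \<in> L2" "w s \<in> L2" if "s \<in> S" for s using assms that by (auto simp: continuous_L2_def)
  show "(\<lambda>z. u t z - w t z) \<in> L2" using L[OF t] by auto
  have lim: "((\<lambda>s. l2_norm (\<lambda>z. u s z - u t z) + l2_norm (\<lambda>z. w s z - w t z)) \<longlongrightarrow> 0 + 0) (at t within S)"
    using assms t unfolding continuous_L2_def by (intro tendsto_add) auto
  show "((\<lambda>s. l2_norm (\<lambda>z. (u s z - w s z) - (u t z - w t z))) \<longlongrightarrow> 0) (at t within S)"
  proof (rule tendsto_sandwich[OF _ _ tendsto_const])
    show "\<forall>\<^sub>F s in at t within S. l2_norm (\<lambda>z. (u s z - w s z) - (u t z - w t z)) \<le> l2_norm (\<lambda>z. u s z - u t z) + l2_norm (\<lambda>z. w s z - w t z)"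
      unfolding eventually_at_filter
    proof (intro always_eventually allI impI)
      fix s assume s: "s \<in> S"
      have "l2_norm (\<lambda>z. (u s z - u t z) - (w s z - w t z)) \<le> l2_norm (\<lambda>z. u s z - u t z) + l2_norm (\<lambda>z. w s z - w t z)"
        by (intro l2_norm_triangle_diff L2_diff L s t)
      then show "l2_norm (\<lambda>z. (u s z - w s z) - (u t z - w t z)) \<le> l2_norm (\<lambda>z. u s z - u t z) + l2_norm (\<lambda>z. w s z - w t z)"
        by (simp add: algebra_simps)
    qed
    show "((\<lambda>s. l2_norm (\<lambda>z. u s z - u t z) + l2_norm (\<lambda>z. w s z - w t z)) \<longlongrightarrow> 0) (at t within S)"
      using lim by simp
  qed simp
qed

lemma continuous_L2_inner:
  assumes u: "continuous_L2 S u" and v: "v \<in> L2"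
  shows "continuous_on S (\<lambda>t. l2_inner (u t) v)"
  unfolding continuous_on_def
proof
  fix t assume t: "t \<in> S"
  have lim: "((\<lambda>s. l2_norm (\<lambda>z. u s z - u t z) * l2_norm v) \<longlongrightarrow> 0) (at t within S)"
    using u t tendsto_mult_right[of "\<lambda>s. l2_norm (\<lambda>z. u s z - u t z)" 0 _ "l2_norm v"] unfolding continuous_L2_def by simp
  have "((\<lambda>s. l2_inner (u s) v - l2_inner (u t) v) \<longlongrightarrow> 0) (at t within S)"
  proof (rule Lim_null_comparison[OF _ lim])
    show "\<forall>\<^sub>F s in at t within S. cmod (l2_inner (u s) v - l2_inner (u t) v) \<le> l2_norm (\<lambda>z. u s z - u t z) * l2_norm v"
      unfolding eventually_at_filter
    proof (intro always_eventually allI impI)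
      fix s assume "s \<in> S"
      then have L: "u s \<in> L2" "u t \<in> L2" using u t by (auto simp: continuous_L2_def)
      show "cmod (l2_inner (u s) v - l2_inner (u t) v) \<le> l2_norm (\<lambda>z. u s z - u t z) * l2_norm v"
        using l2_cauchy_schwarz[OF L2_diff[OF L] v] by (simp add: l2_inner_diff_left L v)
    qed
  qed
  then show "((\<lambda>s. l2_inner (u s) v) \<longlongrightarrow> l2_inner (u t) v) (at t within S)" by (rule LIM_zero_cancel)
qed

lemma continuous_L2_norm:
  assumes u: "continuous_L2 S u"
  shows "continuous_on S (\<lambda>t. l2_norm (u t))"
  unfolding continuous_on_def
proof
  fix t assume t: "t \<in> S"
  have lim: "((\<lambda>s. l2_norm (\<lambda>z. u s z - u t z)) \<longlongrightarrow> 0) (at t within S)"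
    using u t unfolding continuous_L2_def by simp
  have "((\<lambda>s. l2_norm (u s) - l2_norm (u t)) \<longlongrightarrow> 0) (at t within S)"
  proof (rule Lim_null_comparison[OF _ lim])
    show "\<forall>\<^sub>F s in at t within S. norm (l2_norm (u s) - l2_norm (u t)) \<le> l2_norm (\<lambda>z. u s z - u t z)"
      unfolding eventually_at_filter
    proof (intro always_eventually allI impI)
      fix s assume "s \<in> S"
      then have L: "u s \<in> L2" "u t \<in> L2" using u t by (auto simp: continuous_L2_def)
      show "norm (l2_norm (u s) - l2_norm (u t)) \<le> l2_norm (\<lambda>z. u s z - u t z)"
        using l2_norm_triangle_sub[OF L] l2_norm_triangle_sub[OF L(2,1)] l2_norm_minus_commute[of "u s" "u t"] by simp
    qed
  qed
  then show "((\<lambda>s. l2_norm (u s)) \<longlongrightarrow> l2_norm (u t)) (at t within S)" by (rule LIM_zero_cancel)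
qed

section \<open>Bounded potentials and essentially bounded functions of time\<close>

definition pot_bound :: "(real \<times> real \<Rightarrow> real) \<Rightarrow> real \<Rightarrow> bool" where
  "pot_bound \<psi> \<Psi> \<longleftrightarrow> \<psi> \<in> borel_measurable MS \<and> 0 \<le> \<Psi> \<and> (AE z in MS. \<bar>\<psi> z\<bar> \<le> \<Psi>)"

lemma Linf_Sq_pot_bound:
  assumes "\<psi> \<in> Linf_Sq"
  shows "\<exists>\<Psi>. pot_bound \<psi> \<Psi>"
proof -
  define E where "E = esssup MS (\<lambda>z. ereal \<bar>\<psi> z\<bar>)"
  have E: "E < \<infinity>" "AE z in MS. ereal \<bar>\<psi> z\<bar> \<le> E" and m: "\<psi> \<in> borel_measurable MS"
    using assms esssup_AE[of "\<lambda>z. ereal \<bar>\<psi> z\<bar>" MS] by (auto simp: Linf_Sq_def E_def)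
  have "AE z in MS. \<bar>\<psi> z\<bar> \<le> max 0 (real_of_ereal E)"
    using E(2)
  proof eventually_elim
    case (elim z)
    then show ?case using E(1) by (cases E) auto
  qed
  then show ?thesis using m unfolding pot_bound_def by (intro exI[of _ "max 0 (real_of_ereal E)"]) auto
qed

lemma pot_L2:
  assumes \<psi>: "pot_bound \<psi> \<Psi>" and w: "w \<in> L2"
  shows "(\<lambda>z. of_real (\<psi> z) * w z) \<in> L2" "l2_norm (\<lambda>z. of_real (\<psi> z) * w z) \<le> \<Psi> * l2_norm w"
proof -
  have [measurable]: "\<psi> \<in> borel_measurable MS" using \<psi> by (simp add: pot_bound_def)
  note [measurable] = L2_measurable[OF w]
  have b: "AE z in MS. (cmod (of_real (\<psi> z) * w z))\<^sup>2 \<le> \<Psi>\<^sup>2 * (cmod (w z))\<^sup>2"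
  proof -
    have "AE z in MS. \<bar>\<psi> z\<bar> \<le> \<Psi>" using \<psi> by (simp add: pot_bound_def)
    then show ?thesis
    proof eventually_elim
      case (elim z)
      have "\<bar>\<psi> z\<bar>\<^sup>2 \<le> \<Psi>\<^sup>2" using elim by (intro power_mono) auto
      then show ?case by (simp add: norm_mult power_mult_distrib mult_right_mono)
    qed
  qed
  have i: "integrable MS (\<lambda>z. \<Psi>\<^sup>2 * (cmod (w z))\<^sup>2)" using L2_integrable_sq[OF w] by simp
  have j: "integrable MS (\<lambda>z. (cmod (of_real (\<psi> z) * w z))\<^sup>2)"
    by (rule Bochner_Integration.integrable_bound[OF i]) (use b in \<open>auto elim!: eventually_mono\<close>)
  show "(\<lambda>z. of_real (\<psi> z) * w z) \<in> L2" unfolding L2_def using j by simp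
  have "(l2_norm (\<lambda>z. of_real (\<psi> z) * w z))\<^sup>2 \<le> (LINT z|MS. \<Psi>\<^sup>2 * (cmod (w z))\<^sup>2)"
    unfolding l2_norm_sq by (rule integral_mono_AE[OF j i b])
  also have "\<dots> = (\<Psi> * l2_norm w)\<^sup>2" by (simp add: l2_norm_sq power_mult_distrib)
  finally show "l2_norm (\<lambda>z. of_real (\<psi> z) * w z) \<le> \<Psi> * l2_norm w"
    by (rule power2_le_imp_le) (use \<psi> in \<open>simp add: pot_bound_def\<close>)
qed

lemma pot_real: "Im (l2_inner (\<lambda>z. of_real (\<psi> z) * w z) w) = 0"
proof -
  have "l2_inner (\<lambda>z. of_real (\<psi> z) * w z) w = (LINT z|MS. complex_of_real (\<psi> z * (cmod (w z))\<^sup>2))"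
    unfolding l2_inner_def by (simp add: complex_norm_square mult.assoc del: of_real_power)
  then show ?thesis by (simp only: integral_complex_of_real Im_complex_of_real)
qed

lemma AE_interval_not_False:
  assumes "(t0::real) < T"
  shows "\<not> (AE t in lebesgue_on {t0<..<T}. False)"
proof
  assume "AE t in lebesgue_on {t0<..<T}. False"
  then have "AE t in lebesgue. t \<notin> {t0<..<T}" by (simp add: AE_restrict_space_iff)
  then have "{t0<..<T} \<in> null_sets lebesgue" by (subst completion.null_sets_iff_AE) auto
  then have "negligible {t0<..<T}" by (simp add: negligible_iff_null_sets)
  then show False using open_not_negligible[of "{t0<..<T}"] assms by auto
qed

lemma Linf_bound:
  assumes "u \<in> Linf I Y nrm"
  shows "AE t in lebesgue_on I. nrm (u t) \<le> Linf_norm I nrm u"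
proof -
  have E: "Linf_esssup I nrm u < \<infinity>" using assms by (simp add: Linf_def)
  have "AE t in lebesgue_on I. ereal (nrm (u t)) \<le> Linf_esssup I nrm u"
    unfolding Linf_esssup_def by (rule esssup_AE)
  then show ?thesis
  proof eventually_elim
    case (elim t)
    then show ?case using E unfolding Linf_norm_def by (cases "Linf_esssup I nrm u") auto
  qed
qed

text \<open>A negative essential supremum would force a negative norm at almost every time,
  impossible on an interval of positive length.\<close>

lemma Linf_norm_nonneg:
  assumes "u \<in> Linf {t0<..<T} Y nrm" "\<And>w. nrm w \<ge> 0" "t0 < T"
  shows "0 \<le> Linf_norm {t0<..<T} nrm u"
proof (rule ccontr)
  assume neg: "\<not> ?thesis"
  have "AE t in lebesgue_on {t0<..<T}. False"
    using Linf_bound[OF assms(1)]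
  proof eventually_elim
    case (elim t)
    then show ?case using neg assms(2)[of "u t"] by linarith
  qed
  then show False using AE_interval_not_False[OF assms(3)] by blast
qed

text \<open>Strong measurability implies weak measurability: pairings of the simple approximants are
  simple, and they converge almost everywhere since the Sobolev norm dominates the plain
  one.\<close>

lemma Linf_inner_measurable:
  assumes u: "u \<in> Linf I (Hm m \<inter> H10) (Hm_norm m)" and I: "I \<in> sets lebesgue" and v: "v \<in> L2"
  shows "(\<lambda>t. l2_inner (u t) v) \<in> borel_measurable (lebesgue_on I)"
proof -
  let ?M = "lebesgue_on I"
  obtain s where s: "\<And>n::nat. simple_function ?M (s n)" "\<And>n. s n ` I \<subseteq> Hm m \<inter> H10"
    "AE t in ?M. (\<lambda>n. Hm_norm m (\<lambda>z. s n t z - u t z)) \<longlonglongrightarrow> 0"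
    using u unfolding Linf_def strongly_measurable_def by blast
  have XX: "AE t in ?M. u t \<in> Hm m \<inter> H10" using u by (simp add: Linf_def)
  have h [measurable]: "(\<lambda>t. l2_inner (s n t) v) \<in> borel_measurable ?M" for n
    using simple_function_compose[OF s(1)[of n], of "\<lambda>x. l2_inner x v"]
    by (intro borel_measurable_simple_function) (simp add: o_def)
  have lim: "AE t in ?M. (\<lambda>n. l2_inner (s n t) v) \<longlonglongrightarrow> l2_inner (u t) v"
  proof -
    have "AE t in ?M. t \<in> I" using I by (intro AE_I2) simp
    then show ?thesis using s(3) XX
    proof eventually_elim
      case (elim t)
      have L: "s n t \<in> L2" "u t \<in> L2" for n using elim s(2)[of n] by (auto simp: Hm_def)
      have "(\<lambda>n. l2_norm (\<lambda>z. s n t z - u t z)) \<longlonglongrightarrow> 0"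
        by (rule tendsto_sandwich[OF _ _ tendsto_const elim(2)])
           (use l2_norm_le_Hm_norm[OF L2_diff[OF L]] in auto)
      then show ?case by (intro l2_inner_tendsto L v)
    qed
  qed
  have "(\<lambda>t. lim (\<lambda>n. l2_inner (s n t) v)) \<in> borel_measurable ?M" by measurable
  moreover have "AE t in ?M. l2_inner (u t) v = lim (\<lambda>n. l2_inner (s n t) v)"
    using lim by eventually_elim (simp add: limI)
  ultimately show ?thesis by (rule borel_measurable_lebesgue_on_AE[OF I])
qed

section \<open>The energy estimate\<close>

text \<open>On the finite-dimensional space the Laplacian is bounded. The constant depends on the
  basis and hence on \<open>N\<close> without control, which is acceptable because it reaches only
  terms of second order in the time step.\<close>

lemma grad_basis_inverse_inequality:
  assumes B: "grad_basis N r e" and v: "v \<in> VN2 N"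
  shows "l2_norm (lap v) \<le> (\<Sum>k<r. (l2_norm (lap (e k)))\<^sup>2) * l2_norm v"
proof -
  have P: "e k \<in> Pol" if "k < r" for k using grad_basis_Pol[OF B that] .
  have vP: "v \<in> Pol" using v VN2_Pol by blast
  have "l2_norm (lap v) \<le> (\<Sum>k<r. cmod (ga v (e k)) * l2_norm (lap (e k)))"
    unfolding grad_basis_lap[OF B v] using P by (intro l2_norm_lin) auto
  also have "\<dots> \<le> (\<Sum>k<r. (l2_norm (lap (e k)))\<^sup>2 * l2_norm v)"
  proof (rule sum_mono)
    fix k assume "k \<in> {..<r}"
    then have k: "e k \<in> Pol" using P by simp
    have "cmod (ga v (e k)) = cmod (l2_inner v (lap (e k)))" using VN2_lap[OF v k] by simp
    also have "\<dots> \<le> l2_norm v * l2_norm (lap (e k))" using k vP by (intro l2_cauchy_schwarz) auto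
    finally have "cmod (ga v (e k)) * l2_norm (lap (e k)) \<le> (l2_norm v * l2_norm (lap (e k))) * l2_norm (lap (e k))"
      by (intro mult_right_mono) auto
    then show "cmod (ga v (e k)) * l2_norm (lap (e k)) \<le> (l2_norm (lap (e k)))\<^sup>2 * l2_norm v"
      by (simp add: power2_eq_square mult_ac)
  qed
  finally show ?thesis by (simp add: sum_distrib_right)
qed

text \<open>The error is split as \<theta> - \<rho> with \<rho> the projection error. The equation
  is given in integrated form, so the growth of the squared norm of \<theta> is estimated over a
  short interval with the test function frozen at its left end. The first-order term carries
  \<open>K1 + \<Psi> K2\<close>, and the rest is quadratic in the length, as
  \<open>sqrt_growth\<close> requires.\<close>

lemma energy_estimate:
  assumes B: "grad_basis N r e" and \<psi>: "pot_bound \<psi> \<Psi>" and \<gamma>: "\<gamma> \<ge> 0" and T: "t0 < T"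
    and uN: "\<And>t. t \<in> {t0..T} \<Longrightarrow> uN t \<in> VN2 N" "continuous_L2 {t0..T} uN"
    and u: "continuous_L2 {t0..T} u"
    and eq: "\<And>v s t. v \<in> VN2 N \<Longrightarrow> t0 < s \<Longrightarrow> s < t \<Longrightarrow> t < T \<Longrightarrow>
       ((\<lambda>\<tau>. \<i> * (of_real \<gamma> * l2_inner (\<lambda>z. uN \<tau> z - u \<tau> z) (lap v) + l2_inner (\<lambda>z. of_real (\<psi> z) * (uN \<tau> z - u \<tau> z)) v))
         has_integral (l2_inner (\<lambda>z. uN t z - u t z) v - l2_inner (\<lambda>z. uN s z - u s z) v)) {s..t}"
    and K1: "K1 \<ge> 0" "\<And>v s t. v \<in> VN2 N \<Longrightarrow> t0 < s \<Longrightarrow> s < t \<Longrightarrow> t < T \<Longrightarrow>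
       cmod (l2_inner (\<lambda>z. u t z - Pr r e (u t) z) v - l2_inner (\<lambda>z. u s z - Pr r e (u s) z) v) \<le> K1 * (t - s) * l2_norm v"
    and K2: "\<And>t. t \<in> {t0..T} \<Longrightarrow> l2_norm (\<lambda>z. u t z - Pr r e (u t) z) \<le> K2"
    and init: "\<And>v. v \<in> VN2 N \<Longrightarrow> l2_inner (uN t0) v = l2_inner (u t0) v"
    and t: "t \<in> {t0<..<T}"
  shows "l2_norm (\<lambda>z. uN t z - u t z) \<le> 2 * K2 + (K1 + \<Psi> * K2) * (T - t0)"
proof -
  define P where "P \<tau> = Pr r e (u \<tau>)" for \<tau>
  define \<rho> where "\<rho> \<tau> = (\<lambda>z. u \<tau> z - P \<tau> z)" for \<tau>
  define \<theta> where "\<theta> \<tau> = (\<lambda>z. uN \<tau> z - P \<tau> z)" for \<tau>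
  define e' where "e' \<tau> = (\<lambda>z. uN \<tau> z - u \<tau> z)" for \<tau>
  have \<Psi>: "\<Psi> \<ge> 0" using \<psi> by (simp add: pot_bound_def)
  have uL: "u \<tau> \<in> L2" if "\<tau> \<in> {t0..T}" for \<tau> using u that by (auto simp: continuous_L2_def)
  have PV: "P \<tau> \<in> VN2 N" "P \<tau> \<in> L2" for \<tau> unfolding P_def using Pr_VN2[OF B] Pr_Pol[OF B] by auto
  have \<theta>V: "\<theta> \<tau> \<in> VN2 N" "\<theta> \<tau> \<in> Pol" "\<theta> \<tau> \<in> L2" if "\<tau> \<in> {t0..T}" for \<tau>
  proof -
    show 1: "\<theta> \<tau> \<in> VN2 N" unfolding \<theta>_def using uN(1)[OF that] PV by (intro VN2_diff)
    then show "\<theta> \<tau> \<in> Pol" "\<theta> \<tau> \<in> L2" using VN2_Pol by auto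
  qed
  have uNL: "uN \<tau> \<in> L2" if "\<tau> \<in> {t0..T}" for \<tau> using VN2_Pol[OF uN(1)[OF that]] by simp
  have \<rho>L: "\<rho> \<tau> \<in> L2" if "\<tau> \<in> {t0..T}" for \<tau> unfolding \<rho>_def using uL[OF that] PV by auto
  have eL: "e' \<tau> \<in> L2" if "\<tau> \<in> {t0..T}" for \<tau> unfolding e'_def using uL[OF that] uNL[OF that] by auto
  have K20: "K2 \<ge> 0" using order_trans[OF l2_norm_nonneg K2[of t0]] T by simp
  have \<rho>K: "l2_norm (\<rho> \<tau>) \<le> K2" if "\<tau> \<in> {t0..T}" for \<tau> using K2[OF that] by (simp add: \<rho>_def P_def)
  have \<theta>e: "\<theta> \<tau> = (\<lambda>z. e' \<tau> z + \<rho> \<tau> z)" and e\<theta>: "e' \<tau> = (\<lambda>z. \<theta> \<tau> z - \<rho> \<tau> z)" for \<tau>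
    by (auto simp: \<theta>_def e'_def \<rho>_def)
  define CN where "CN = (\<Sum>k<r. (l2_norm (lap (e k)))\<^sup>2)"
  have CN: "CN \<ge> 0" "l2_norm (lap v) \<le> CN * l2_norm v" if "v \<in> VN2 N" for v
    unfolding CN_def by (auto intro!: sum_nonneg grad_basis_inverse_inequality[OF B that])
  have CN0: "CN \<ge> 0" by (rule CN(1)[OF VN2_zero])
  have P_cont: "continuous_L2 {t0..T} P"
    unfolding P_def Pr_def
    using grad_basis_Pol[OF B] by (intro continuous_L2_lin continuous_intros continuous_L2_inner u) auto
  have \<theta>_cont: "continuous_on {t0..T} (\<lambda>\<tau>. l2_norm (\<theta> \<tau>))"
    unfolding \<theta>_def by (intro continuous_L2_norm continuous_L2_diff uN(2) P_cont)
  obtain B0 where B0: "\<And>\<tau>. \<tau> \<in> {t0..T} \<Longrightarrow> l2_norm (\<theta> \<tau>) \<le> B0"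
  proof -
    have "bounded ((\<lambda>\<tau>. l2_norm (\<theta> \<tau>)) ` {t0..T})"
      by (intro compact_imp_bounded compact_continuous_image \<theta>_cont) simp
    then show ?thesis using that unfolding bounded_iff by force
  qed
  have B00: "B0 \<ge> 0" using order_trans[OF l2_norm_nonneg B0[of t0]] T by simp
  define k where "k v \<tau> = \<i> * (of_real \<gamma> * l2_inner (e' \<tau>) (lap v) + l2_inner (\<lambda>z. of_real (\<psi> z) * e' \<tau> z) v)" for v \<tau>
  \<comment> \<open>The elliptic projection is chosen exactly so that \<rho> disappears from the
    Laplacian term; it survives only next to the potential.\<close>
  have k_eq: "k v \<tau> = \<i> * (of_real \<gamma> * l2_inner (\<theta> \<tau>) (lap v)
      + (l2_inner (\<lambda>z. of_real (\<psi> z) * \<theta> \<tau> z) v - l2_inner (\<lambda>z. of_real (\<psi> z) * \<rho> \<tau> z) v))"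
    if v: "v \<in> VN2 N" and \<tau>: "\<tau> \<in> {t0..T}" for v \<tau>
  proof -
    have vL: "v \<in> L2" "lap v \<in> L2" using VN2_Pol[OF v] by auto
    have "l2_inner (\<rho> \<tau>) (lap v) = 0"
      unfolding \<rho>_def using Pr_lap[OF B uL[OF \<tau>] v] uL[OF \<tau>] PV vL by (simp add: l2_inner_diff_left P_def)
    then have "l2_inner (e' \<tau>) (lap v) = l2_inner (\<theta> \<tau>) (lap v)"
      unfolding e\<theta> using \<theta>V[OF \<tau>] \<rho>L[OF \<tau>] vL by (simp add: l2_inner_diff_left)
    moreover have "l2_inner (\<lambda>z. of_real (\<psi> z) * e' \<tau> z) v
        = l2_inner (\<lambda>z. of_real (\<psi> z) * \<theta> \<tau> z) v - l2_inner (\<lambda>z. of_real (\<psi> z) * \<rho> \<tau> z) v"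
      unfolding e\<theta> right_diff_distrib
      by (rule l2_inner_diff_left[OF pot_L2(1)[OF \<psi> \<theta>V(3)[OF \<tau>]] pot_L2(1)[OF \<psi> \<rho>L[OF \<tau>]] vL(1)])
    ultimately show ?thesis by (simp add: k_def)
  qed
  have pot_le: "cmod (l2_inner (\<lambda>z. of_real (\<psi> z) * w z) v) \<le> \<Psi> * l2_norm w * l2_norm v" if "w \<in> L2" "v \<in> L2" for w v
    using l2_cauchy_schwarz[OF pot_L2(1)[OF \<psi> that(1)] that(2)] mult_right_mono[OF pot_L2(2)[OF \<psi> that(1)] l2_norm_nonneg[of v]]
    by linarith
  have k_int: "(k v has_integral (l2_inner (e' t) v - l2_inner (e' s) v)) {s..t}"
    if "v \<in> VN2 N" "t0 < s" "s < t" "t < T" for v s t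
    unfolding k_def e'_def by (rule eq[OF that])
  have \<theta>_diff: "l2_inner (\<theta> t) v - l2_inner (\<theta> s) v = (l2_inner (e' t) v - l2_inner (e' s) v) + (l2_inner (\<rho> t) v - l2_inner (\<rho> s) v)"
    if "v \<in> VN2 N" "s \<in> {t0..T}" "t \<in> {t0..T}" for v s t
    unfolding \<theta>e using VN2_Pol[OF that(1)] eL[OF that(2)] eL[OF that(3)] \<rho>L[OF that(2)] \<rho>L[OF that(3)]
    by (simp add: l2_inner_add_left)
  have \<rho>_diff: "cmod (l2_inner (\<rho> t) v - l2_inner (\<rho> s) v) \<le> K1 * (t - s) * l2_norm v"
    if "v \<in> VN2 N" "t0 < s" "s < t" "t < T" for v s t
    unfolding \<rho>_def P_def by (rule K1(2)[OF that])
  \<comment> \<open>A Lipschitz constant in time for \<theta>, dependent on \<open>N\<close> through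
    \<open>CN\<close> and on the solution through \<open>B0\<close>.\<close>
  define L where "L = \<gamma> * CN * B0 + \<Psi> * B0 + \<Psi> * K2 + K1"
  have L0: "L \<ge> 0" unfolding L_def using \<gamma> CN0 B00 \<Psi> K20 K1(1) by simp
  have k_le: "cmod (k v \<tau>) \<le> (L - K1) * l2_norm v" if v: "v \<in> VN2 N" and \<tau>: "\<tau> \<in> {t0..T}" for v \<tau>
  proof -
    have vL: "v \<in> L2" "lap v \<in> L2" using VN2_Pol[OF v] by auto
    have "cmod (l2_inner (\<theta> \<tau>) (lap v)) \<le> l2_norm (\<theta> \<tau>) * l2_norm (lap v)"
      by (rule l2_cauchy_schwarz[OF \<theta>V(3)[OF \<tau>] vL(2)])
    also have "\<dots> \<le> B0 * (CN * l2_norm v)" using B0[OF \<tau>] B00 CN(2)[OF v] by (intro mult_mono) auto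
    finally have 1: "\<gamma> * cmod (l2_inner (\<theta> \<tau>) (lap v)) \<le> \<gamma> * (B0 * (CN * l2_norm v))" using \<gamma> by (rule mult_left_mono)
    have "\<Psi> * l2_norm (\<theta> \<tau>) * l2_norm v \<le> \<Psi> * B0 * l2_norm v"
      using B0[OF \<tau>] \<Psi> by (intro mult_right_mono mult_left_mono) auto
    then have 2: "cmod (l2_inner (\<lambda>z. of_real (\<psi> z) * \<theta> \<tau> z) v) \<le> \<Psi> * B0 * l2_norm v"
      using pot_le[OF \<theta>V(3)[OF \<tau>] vL(1)] by linarith
    have "\<Psi> * l2_norm (\<rho> \<tau>) * l2_norm v \<le> \<Psi> * K2 * l2_norm v"
      using \<rho>K[OF \<tau>] \<Psi> by (intro mult_right_mono mult_left_mono) auto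
    then have 3: "cmod (l2_inner (\<lambda>z. of_real (\<psi> z) * \<rho> \<tau> z) v) \<le> \<Psi> * K2 * l2_norm v"
      using pot_le[OF \<rho>L[OF \<tau>] vL(1)] by linarith
    have "cmod (k v \<tau>) \<le> cmod (of_real \<gamma> * l2_inner (\<theta> \<tau>) (lap v))
        + cmod (l2_inner (\<lambda>z. of_real (\<psi> z) * \<theta> \<tau> z) v - l2_inner (\<lambda>z. of_real (\<psi> z) * \<rho> \<tau> z) v)"
      unfolding k_eq[OF v \<tau>]
      by (rule order_trans[OF eq_refl norm_triangle_ineq]) (simp only: norm_mult norm_ii mult_1)
    also have "cmod (of_real \<gamma> * l2_inner (\<theta> \<tau>) (lap v)) = \<gamma> * cmod (l2_inner (\<theta> \<tau>) (lap v))"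
      using \<gamma> by (simp add: norm_mult)
    also have "cmod (l2_inner (\<lambda>z. of_real (\<psi> z) * \<theta> \<tau> z) v - l2_inner (\<lambda>z. of_real (\<psi> z) * \<rho> \<tau> z) v)
       \<le> cmod (l2_inner (\<lambda>z. of_real (\<psi> z) * \<theta> \<tau> z) v) + cmod (l2_inner (\<lambda>z. of_real (\<psi> z) * \<rho> \<tau> z) v)"
      by (rule norm_triangle_ineq4)
    finally show ?thesis using 1 2 3 by (simp add: L_def algebra_simps)
  qed
  have LK: "L - K1 \<ge> 0" unfolding L_def using \<gamma> CN0 B00 \<Psi> K20 by simp
  have lip: "l2_norm (\<lambda>z. \<theta> t z - \<theta> s z) \<le> L * (t - s)" if st: "t0 < s" "s < t" "t < T" for s t
  proof -
    have I: "s \<in> {t0..T}" "t \<in> {t0..T}" using st by auto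
    define v where "v = (\<lambda>z. \<theta> t z - \<theta> s z)"
    have v: "v \<in> VN2 N" unfolding v_def using \<theta>V I by (intro VN2_diff) auto
    have vL: "v \<in> L2" using VN2_Pol[OF v] by simp
    have "cmod (l2_inner (e' t) v - l2_inner (e' s) v) \<le> ((L - K1) * l2_norm v) * Henstock_Kurzweil_Integration.content {s..t}"
      using st LK by (intro has_integral_bound_real[OF _ finite.emptyI k_int[OF v st]] k_le[OF v]) auto
    then have 1: "cmod (l2_inner (e' t) v - l2_inner (e' s) v) \<le> ((L - K1) * l2_norm v) * (t - s)" using st by simp
    have "(l2_norm v)\<^sup>2 = cmod (l2_inner v v)" unfolding l2_norm_sq_complex norm_of_real by simp
    also have "l2_inner v v = l2_inner (\<theta> t) v - l2_inner (\<theta> s) v"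
    proof -
      have "l2_inner (\<lambda>z. \<theta> t z - \<theta> s z) v = l2_inner (\<theta> t) v - l2_inner (\<theta> s) v"
        by (rule l2_inner_diff_left[OF \<theta>V(3)[OF I(2)] \<theta>V(3)[OF I(1)] vL])
      then show ?thesis by (simp add: v_def)
    qed
    also have "cmod \<dots> \<le> ((L - K1) * l2_norm v) * (t - s) + K1 * (t - s) * l2_norm v"
      unfolding \<theta>_diff[OF v I]
      by (intro order_trans[OF norm_triangle_ineq] add_mono 1 \<rho>_diff v st)
    also have "\<dots> = (L * (t - s)) * l2_norm v" by (simp add: algebra_simps)
    finally have "l2_norm v * l2_norm v \<le> (L * (t - s)) * l2_norm v" by (simp add: power2_eq_square)
    moreover have "0 \<le> L * (t - s)" using L0 st by simp
    ultimately show ?thesis unfolding v_def[symmetric] using l2_norm_nonneg[of v]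
      by (metis mult_le_cancel_right order_le_less not_less)
  qed
  define K where "K = K1 + \<Psi> * K2"
  define L1 where "L1 = (\<gamma> * CN + \<Psi>) * L * B0"
  have L10: "L1 \<ge> 0" unfolding L1_def using \<gamma> CN0 \<Psi> L0 B00 by simp
  have K0: "K \<ge> 0" unfolding K_def using K1(1) \<Psi> K20 by simp
  have energy: "(l2_norm (\<theta> t))\<^sup>2 - (l2_norm (\<theta> s))\<^sup>2 \<le> 2 * K * sqrt ((l2_norm (\<theta> s))\<^sup>2) * (t - s) + (2 * L1 + L\<^sup>2) * (t - s)\<^sup>2"
    if st: "t0 < s" "s < t" "t < T" for s t
  proof -
    have I: "s \<in> {t0..T}" "t \<in> {t0..T}" using st by auto
    \<comment> \<open>The test function is fixed at the left end of the interval; replacing it by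
      the current value costs a factor \<open>t - s\<close> by the Lipschitz bound.\<close>
    define v where "v = \<theta> s"
    have v: "v \<in> VN2 N" "v \<in> L2" "v \<in> Pol" unfolding v_def using \<theta>V[OF I(1)] by auto
    define n where "n = l2_norm v"
    have n: "n \<ge> 0" "n \<le> B0" unfolding n_def v_def using B0[OF I(1)] by auto
    have Rek: "Re (k v \<tau>) \<le> \<Psi> * K2 * n + L1 * (t - s)" if \<tau>: "\<tau> \<in> {s..t}" for \<tau>
    proof -
      have \<tau>I: "\<tau> \<in> {t0..T}" using \<tau> st by auto
      define d where "d = (\<lambda>z. \<theta> \<tau> z - v z)"
      have dL: "d \<in> L2" unfolding d_def using \<theta>V[OF \<tau>I] v by auto
      have dn: "l2_norm d \<le> L * (t - s)"
      proof (cases "\<tau> = s")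
        case True
        then show ?thesis using L0 st by (simp add: d_def v_def)
      next
        case False
        then have "l2_norm d \<le> L * (\<tau> - s)" unfolding d_def v_def using lip[of s \<tau>] \<tau> st by auto
        also have "\<dots> \<le> L * (t - s)" using L0 \<tau> by (intro mult_left_mono) auto
        finally show ?thesis .
      qed
      have \<theta>d: "\<theta> \<tau> = (\<lambda>z. v z + d z)" by (simp add: d_def)
      define A where "A = of_real \<gamma> * l2_inner d (lap v)"
      define D where "D = l2_inner (\<lambda>z. of_real (\<psi> z) * d z) v"
      define R where "R = l2_inner (\<lambda>z. of_real (\<psi> z) * \<rho> \<tau> z) v"
      define V where "V = of_real \<gamma> * l2_inner v (lap v) + l2_inner (\<lambda>z. of_real (\<psi> z) * v z) v"
      have "k v \<tau> = \<i> * (V + (A + D - R))"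
      proof -
        have "l2_inner (\<theta> \<tau>) (lap v) = l2_inner v (lap v) + l2_inner d (lap v)"
          unfolding \<theta>d using v dL by (simp add: l2_inner_add_left)
        moreover have "l2_inner (\<lambda>z. of_real (\<psi> z) * \<theta> \<tau> z) v = l2_inner (\<lambda>z. of_real (\<psi> z) * v z) v + D"
          unfolding \<theta>d D_def distrib_left
          by (rule l2_inner_add_left[OF pot_L2(1)[OF \<psi> v(2)] pot_L2(1)[OF \<psi> dL] v(2)])
        ultimately show ?thesis unfolding k_eq[OF v(1) \<tau>I] by (simp add: A_def R_def V_def algebra_simps)
      qed
      \<comment> \<open>Both the gradient term and the term of the real potential are real for equal
        arguments. After multiplication by the imaginary unit they leave the real part, so no
        exponential growth factor appears.\<close>
      moreover have "Im V = 0"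
        unfolding V_def VN2_lap[OF v(1,3)] ga_self by (simp add: pot_real)
      ultimately have "Re (k v \<tau>) = - Im (A + D - R)" by simp
      also have "\<dots> \<le> cmod (A + D - R)" using abs_Im_le_cmod[of "A + D - R"] by linarith
      also have "\<dots> \<le> cmod A + cmod D + cmod R"
        using norm_triangle_ineq4[of "A + D" R] norm_triangle_ineq[of A D] by linarith
      also have "cmod A \<le> \<gamma> * ((L * (t - s)) * (CN * B0))"
      proof -
        have "cmod (l2_inner d (lap v)) \<le> l2_norm d * l2_norm (lap v)" using v by (intro l2_cauchy_schwarz dL) auto
        also have "\<dots> \<le> (L * (t - s)) * (CN * B0)"
        proof (rule mult_mono[OF dn])
          have "CN * l2_norm v \<le> CN * B0" using n CN0 unfolding n_def by (intro mult_left_mono)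
          then show "l2_norm (lap v) \<le> CN * B0" using CN(2)[OF v(1)] by linarith
        qed (use L0 st in auto)
        finally show ?thesis unfolding A_def norm_mult norm_of_real using \<gamma> by (simp add: mult_left_mono)
      qed
      also have "cmod D \<le> \<Psi> * (L * (t - s)) * B0"
      proof -
        have "cmod D \<le> \<Psi> * l2_norm d * l2_norm v" unfolding D_def by (rule pot_le[OF dL v(2)])
        also have "\<dots> \<le> \<Psi> * (L * (t - s)) * B0"
          using dn n \<Psi> L0 st unfolding n_def by (intro mult_mono mult_left_mono) auto
        finally show ?thesis .
      qed
      also have "cmod R \<le> \<Psi> * K2 * n"
      proof -
        have "cmod R \<le> \<Psi> * l2_norm (\<rho> \<tau>) * l2_norm v" unfolding R_def by (rule pot_le[OF \<rho>L[OF \<tau>I] v(2)])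
        also have "\<dots> \<le> \<Psi> * K2 * n"
          using \<rho>K[OF \<tau>I] n \<Psi> unfolding n_def by (intro mult_right_mono mult_left_mono) auto
        finally show ?thesis .
      qed
      finally show ?thesis by (simp add: L1_def algebra_simps)
    qed
    have re: "((\<lambda>\<tau>. Re (k v \<tau>)) has_integral Re (l2_inner (e' t) v - l2_inner (e' s) v)) {s..t}"
      using has_integral_linear[OF k_int[OF v(1) st] bounded_linear_Re] by (simp add: o_def)
    have co: "((\<lambda>_. \<Psi> * K2 * n + L1 * (t - s)) has_integral (\<Psi> * K2 * n + L1 * (t - s)) * (t - s)) {s..t}"
      using has_integral_const_real[of "\<Psi> * K2 * n + L1 * (t - s)" s t] st by (simp add: mult.commute)
    have "Re (l2_inner (e' t) v - l2_inner (e' s) v) \<le> (\<Psi> * K2 * n + L1 * (t - s)) * (t - s)"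
      by (rule has_integral_le[OF re co Rek])
    moreover have "Re (l2_inner (\<rho> t) v - l2_inner (\<rho> s) v) \<le> K1 * (t - s) * n"
      using \<rho>_diff[OF v(1) st] complex_Re_le_cmod order_trans unfolding n_def by blast
    ultimately have 1: "Re (l2_inner (\<theta> t) v - l2_inner (\<theta> s) v) \<le> (K * n + L1 * (t - s)) * (t - s)"
      unfolding \<theta>_diff[OF v(1) I] by (simp add: K_def algebra_simps)
    define w where "w = (\<lambda>z. \<theta> t z - v z)"
    have wL: "w \<in> L2" unfolding w_def using \<theta>V[OF I(2)] v by auto
    have "l2_inner (\<theta> t) (\<theta> t) = l2_inner v v + l2_inner v w + (l2_inner w v + l2_inner w w)"
    proof -
      have "\<theta> t = (\<lambda>z. v z + w z)" by (simp add: w_def)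
      then show ?thesis using v(2) wL by (simp add: l2_inner_add_left l2_inner_add_right L2_add)
    qed
    then have "complex_of_real ((l2_norm (\<theta> t))\<^sup>2) = of_real (n\<^sup>2) + cnj (l2_inner w v) + (l2_inner w v + of_real ((l2_norm w)\<^sup>2))"
      unfolding l2_norm_sq_complex n_def using l2_inner_commute[of v w] by simp
    from arg_cong[OF this, of Re]
    have "(l2_norm (\<theta> t))\<^sup>2 = n\<^sup>2 + 2 * Re (l2_inner w v) + (l2_norm w)\<^sup>2"
      by (simp del: of_real_power)
    moreover have "l2_inner w v = l2_inner (\<theta> t) v - l2_inner (\<theta> s) v"
      unfolding w_def using l2_inner_diff_left[OF \<theta>V(3)[OF I(2)] v(2) v(2)] by (simp add: v_def)
    moreover have "(l2_norm w)\<^sup>2 \<le> (L * (t - s))\<^sup>2"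
      unfolding w_def v_def by (intro power_mono lip st) simp
    ultimately have "(l2_norm (\<theta> t))\<^sup>2 - n\<^sup>2 \<le> 2 * ((K * n + L1 * (t - s)) * (t - s)) + (L * (t - s))\<^sup>2"
      using 1 by simp
    then show ?thesis using n unfolding v_def[symmetric] n_def[symmetric]
      by (simp add: power2_eq_square algebra_simps)
  qed
  have mono: "l2_norm (\<theta> t) \<le> l2_norm (\<theta> s) + K * (t - s)" if st: "t0 < s" "s \<le> t" "t < T" for s t
  proof -
    have "sqrt ((l2_norm (\<theta> t))\<^sup>2) \<le> sqrt ((l2_norm (\<theta> s))\<^sup>2) + K * (t - s)"
    proof (rule sqrt_growth[where L = "2 * L1 + L\<^sup>2"])
      fix s' t' assume "s \<le> s'" "s' \<le> t'" "t' \<le> t"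
      then show "(l2_norm (\<theta> t'))\<^sup>2 - (l2_norm (\<theta> s'))\<^sup>2 \<le> 2 * K * sqrt ((l2_norm (\<theta> s'))\<^sup>2) * (t' - s') + (2 * L1 + L\<^sup>2) * (t' - s')\<^sup>2"
        using energy[of s' t'] st by (cases "s' = t'") auto
    qed (use st K0 L10 in auto)
    then show ?thesis by simp
  qed
  \<comment> \<open>The integrated equation is available strictly after the initial time, so the
    estimate is carried to \<open>t0\<close> by right continuity of the norm of \<theta>.\<close>
  have \<theta>t: "l2_norm (\<theta> t) \<le> l2_norm (\<theta> t0) + K * (T - t0)"
  proof -
    have "continuous (at t0 within {t0..T}) (\<lambda>\<tau>. l2_norm (\<theta> \<tau>))"
      using \<theta>_cont T by (simp add: continuous_on_eq_continuous_within)
    then have "((\<lambda>\<tau>. l2_norm (\<theta> \<tau>)) \<longlongrightarrow> l2_norm (\<theta> t0)) (at_right t0)"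
      unfolding continuous_within at_within_Icc_at_right[OF T] .
    then have lim: "((\<lambda>\<tau>. l2_norm (\<theta> \<tau>) + K * (T - t0)) \<longlongrightarrow> l2_norm (\<theta> t0) + K * (T - t0)) (at_right t0)"
      by (intro tendsto_intros)
    have "\<forall>\<^sub>F \<tau> in at_right t0. l2_norm (\<theta> t) \<le> l2_norm (\<theta> \<tau>) + K * (T - t0)"
    proof -
      have "\<forall>\<^sub>F \<tau> in at_right t0. \<tau> \<in> {t0<..<t}"
        using t by (intro eventually_at_right_real) auto
      then show ?thesis
      proof eventually_elim
        case (elim \<tau>)
        have "K * (t - \<tau>) \<le> K * (T - t0)" using K0 elim t by (intro mult_left_mono) auto
        then show ?case using mono[of \<tau> t] elim t by auto
      qed
    qed
    then show ?thesis by (intro tendsto_lowerbound[OF lim]) auto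
  qed
  have I0: "t0 \<in> {t0..T}" and It: "t \<in> {t0..T}" using T t by auto
  \<comment> \<open>At the initial time \<open>uN\<close> is the orthogonal projection of
    \<open>u\<close>, hence testing \<theta> with itself leaves the pairing of \<rho> with
    \<theta>.\<close>
  have \<theta>0: "l2_norm (\<theta> t0) \<le> K2"
  proof -
    have "l2_inner (\<theta> t0) (\<theta> t0) = l2_inner (uN t0) (\<theta> t0) - l2_inner (P t0) (\<theta> t0)"
      using l2_inner_diff_left[OF uNL[OF I0] PV(2) \<theta>V(3)[OF I0]] by (simp add: \<theta>_def)
    also have "\<dots> = l2_inner (\<rho> t0) (\<theta> t0)"
      using l2_inner_diff_left[OF uL[OF I0] PV(2) \<theta>V(3)[OF I0]] init[OF \<theta>V(1)[OF I0]] by (simp add: \<rho>_def)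
    finally have "(l2_norm (\<theta> t0))\<^sup>2 = cmod (l2_inner (\<rho> t0) (\<theta> t0))"
      unfolding l2_norm_sq_complex by (metis norm_of_real abs_power2)
    also have "\<dots> \<le> l2_norm (\<rho> t0) * l2_norm (\<theta> t0)" by (rule l2_cauchy_schwarz[OF \<rho>L[OF I0] \<theta>V(3)[OF I0]])
    also have "\<dots> \<le> K2 * l2_norm (\<theta> t0)" using \<rho>K[OF I0] by (intro mult_right_mono) auto
    finally have "l2_norm (\<theta> t0) * l2_norm (\<theta> t0) \<le> K2 * l2_norm (\<theta> t0)" by (simp add: power2_eq_square)
    then show ?thesis using K20 l2_norm_nonneg[of "\<theta> t0"]
      by (metis mult_le_cancel_right order_le_less not_less)
  qed
  have "l2_norm (e' t) \<le> l2_norm (\<theta> t) + l2_norm (\<rho> t)"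
    unfolding e\<theta> by (rule l2_norm_triangle_diff[OF \<theta>V(3)[OF It] \<rho>L[OF It]])
  then show ?thesis using \<theta>t \<theta>0 \<rho>K[OF It] by (simp add: e'_def K_def)
qed

section \<open>The semidiscrete and the exact solution\<close>

text \<open>Regularity of \<open>uN\<close> is assumed point by point in space. The nodal
  representation expresses the whole path through finitely many point values, which yields
  continuity in norm and differentiation under the inner product.\<close>

lemma VN2_path:
  assumes V: "\<And>t. t \<in> {t0..T} \<Longrightarrow> uN t \<in> VN2 N" and N: "N > 0"
    and cont: "\<And>z. continuous_on {t0..T} (\<lambda>t. uN t z)"
    and diff: "\<And>t z. t \<in> {t0<..<T} \<Longrightarrow> (\<lambda>s. uN s z) differentiable (at t)"
  shows "continuous_L2 {t0..T} uN"
    and "t \<in> {t0<..<T} \<Longrightarrow> d_t uN t \<in> VN2 N"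
    and "t \<in> {t0<..<T} \<Longrightarrow> v \<in> L2 \<Longrightarrow> ((\<lambda>\<tau>. l2_inner (uN \<tau>) v) has_vector_derivative l2_inner (d_t uN t) v) (at t)"
proof -
  define I where "I = {1..<N} \<times> {1..<N}"
  define x where "x i = (node N (fst i), node N (snd i))" for i
  have lV: "lag2 N i \<in> VN2 N" if "i \<in> I" for i using lag2_VN2 that by (simp add: I_def)
  have lL: "lag2 N i \<in> L2" if "i \<in> I" for i using VN2_Pol[OF lV[OF that]] by simp
  have rep: "uN t = (\<lambda>z. \<Sum>i\<in>I. uN t (x i) * lag2 N i z)" if "t \<in> {t0..T}" for t
    unfolding I_def x_def by (rule lagrange_VN2[OF V[OF that] N])
  show "continuous_L2 {t0..T} uN"
  proof (rule continuous_L2_cong[OF rep])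
    show "continuous_L2 {t0..T} (\<lambda>t z. \<Sum>i\<in>I. uN t (x i) * lag2 N i z)"
      by (intro continuous_L2_lin cont lL) (auto simp: I_def)
  qed
  have d: "((\<lambda>s. uN s z) has_vector_derivative d_t uN t z) (at t)" if "t \<in> {t0<..<T}" for t z
    unfolding d_t_def using diff[OF that] by (simp add: vector_derivative_works)
  have drep: "d_t uN t = (\<lambda>z. \<Sum>i\<in>I. d_t uN t (x i) * lag2 N i z)" if t: "t \<in> {t0<..<T}" for t
  proof
    fix z
    have "((\<lambda>s. \<Sum>i\<in>I. uN s (x i) * lag2 N i z) has_vector_derivative (\<Sum>i\<in>I. d_t uN t (x i) * lag2 N i z)) (at t)"
      by (intro has_vector_derivative_sum has_vector_derivative_mult_left d t)
    then have "((\<lambda>s. uN s z) has_vector_derivative (\<Sum>i\<in>I. d_t uN t (x i) * lag2 N i z)) (at t)"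
      by (rule has_vector_derivative_transform_within_open[of _ _ _ "{t0<..<T}"])
         (use t in \<open>auto intro: fun_cong[OF rep, symmetric]\<close>)
    from vector_derivative_unique_at[OF d[OF t] this]
    show "d_t uN t z = (\<Sum>i\<in>I. d_t uN t (x i) * lag2 N i z)" .
  qed
  show "d_t uN t \<in> VN2 N" if "t \<in> {t0<..<T}" for t
    by (subst drep[OF that]) (intro VN2_lin lV)
  show "((\<lambda>\<tau>. l2_inner (uN \<tau>) v) has_vector_derivative l2_inner (d_t uN t) v) (at t)"
    if t: "t \<in> {t0<..<T}" and v: "v \<in> L2" for t v
  proof -
    have 1: "l2_inner (\<lambda>z. \<Sum>i\<in>I. a i * lag2 N i z) v = (\<Sum>i\<in>I. a i * l2_inner (lag2 N i) v)" for a
      by (rule l2_inner_lin_left) (auto simp: lL v)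
    have "((\<lambda>s. \<Sum>i\<in>I. uN s (x i) * l2_inner (lag2 N i) v) has_vector_derivative (\<Sum>i\<in>I. d_t uN t (x i) * l2_inner (lag2 N i) v)) (at t)"
      by (intro has_vector_derivative_sum has_vector_derivative_mult_left d t)
    moreover have "(\<Sum>i\<in>I. d_t uN t (x i) * l2_inner (lag2 N i) v) = l2_inner (d_t uN t) v"
      unfolding 1[symmetric] drep[OF t, symmetric] ..
    moreover have "(\<Sum>i\<in>I. uN s (x i) * l2_inner (lag2 N i) v) = l2_inner (uN s) v" if "s \<in> {t0<..<T}" for s
    proof -
      have "s \<in> {t0..T}" using that by auto
      from rep[OF this, symmetric] show ?thesis unfolding 1[symmetric] by (rule arg_cong)
    qed
    ultimately show ?thesis
      using has_vector_derivative_transform_within_open[of _ _ t "{t0<..<T}" "\<lambda>s. l2_inner (uN s) v"] t by auto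
  qed
qed

text \<open>For \<open>m = 1\<close> the weak equation is tested with \<open>v\<close>. Otherwise
  the pointwise equation is paired with \<open>v\<close> and integrated by parts; there it also
  shows that \<open>f\<close> agrees almost everywhere with a square integrable function.\<close>

lemma exact_weak_form:
  assumes m: "m \<ge> 1" and \<psi>: "pot_bound \<psi> \<Psi>" and u: "u \<in> Hm m" "u \<in> H10" and u': "u' \<in> L2"
    and eq: "if m = 1 then \<forall>v\<in>H10. weak_eq \<gamma> \<psi> f u u' v else strong_eq \<gamma> \<psi> f u u'"
    and v: "v \<in> VN2 N"
  shows "- \<i> * l2_inner u' v - of_real \<gamma> * l2_inner u (lap v) - l2_inner (\<lambda>z. of_real (\<psi> z) * u z) v - l2_inner f v = 0"
proof (cases "m = 1")
  case True
  then have "weak_eq \<gamma> \<psi> f u u' v" using eq VN2_H10[OF v] by auto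
  then show ?thesis unfolding weak_eq_def grad_inner_lap[OF u(2) v] by simp
next
  case False
  then have m2: "2 \<le> m" using m by simp
  define xx where "xx = weak_deriv 2 0 u"
  define yy where "yy = weak_deriv 0 2 u"
  note h = H10_derivs[OF u(2)]
  have vP: "v \<in> Pol" using VN2_Pol[OF v] .
  have L: "xx \<in> L2" "yy \<in> L2" unfolding xx_def yy_def using Hm_weak_deriv(2)[OF u(1)] m2 by auto
  have p: "(\<lambda>z. of_real (\<psi> z) * u z) \<in> L2" by (rule pot_L2(1)[OF \<psi> h(1)])
  have XD: "XD (weak_deriv 1 0 u) xx" "YD (weak_deriv 0 1 u) yy"
    unfolding xx_def yy_def using Hm_weak_deriv(1)[OF u(1)] m2
    by (auto intro!: has_weak_deriv_XD[of 1 0 u _ _] has_weak_deriv_YD[of 0 1 u _ _] simp: numeral_2_eq_2)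
  have ibp: "l2_inner xx v + l2_inner yy v = l2_inner u (lap v)"
    using XD_VN2[OF XD(1) h(2) L(1) v] YD_VN2[OF XD(2) h(3) L(2) v] lap_eq_ga[OF h(4,5,1,2,3) vP] by simp
  define F where "F = (\<lambda>z. (- \<i> * u' z - of_real \<gamma> * (xx z + yy z)) - of_real (\<psi> z) * u z)"
  have FL: "F \<in> L2" unfolding F_def using u' L p by (intro L2_diff L2_scale L2_add)
  have "AE z in MS. f z = F z"
    using eq False unfolding strong_eq_def F_def xx_def yy_def
    by (auto elim!: eventually_mono simp: algebra_simps)
  then have "l2_inner f v = l2_inner F v" using FL vP by (intro l2_inner_cong_AE) auto
  also have "\<dots> = (- \<i> * l2_inner u' v - of_real \<gamma> * (l2_inner xx v + l2_inner yy v)) - l2_inner (\<lambda>z. of_real (\<psi> z) * u z) v"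
  proof -
    have vL: "v \<in> L2" using vP by simp
    have "l2_inner (\<lambda>z. - \<i> * u' z) v = - \<i> * l2_inner u' v"
      "l2_inner (\<lambda>z. of_real \<gamma> * (xx z + yy z)) v = of_real \<gamma> * (l2_inner xx v + l2_inner yy v)"
      by (simp_all only: l2_inner_scale_left l2_inner_add_left[OF L vL])
    then show ?thesis
      unfolding F_def l2_inner_diff_left[OF L2_diff[OF L2_scale[OF u'] L2_scale[OF L2_add[OF L]]] p vL]
        l2_inner_diff_left[OF L2_scale[OF u'] L2_scale[OF L2_add[OF L]] vL] by (simp only:)
  qed
  finally show ?thesis by (simp add: ibp)
qed

text \<open>The new function is the adjoint of the projection error operator applied to
  \<open>v\<close>. With it, testing the projection error of \<open>u\<close> becomes testing
  \<open>u\<close> with a fixed function, which is how the projection commutes with the weak time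
  derivative.\<close>

lemma Pr_adjoint:
  assumes B: "grad_basis N r e" and v: "v \<in> L2"
  shows "(\<lambda>z. v z + (\<Sum>k<r. cnj (l2_inner (e k) v) * lap (e k) z)) \<in> L2"
    and "w \<in> L2 \<Longrightarrow> l2_inner w (\<lambda>z. v z + (\<Sum>k<r. cnj (l2_inner (e k) v) * lap (e k) z))
       = l2_inner (\<lambda>z. w z - Pr r e w z) v"
proof -
  have e: "e k \<in> L2" "lap (e k) \<in> L2" if "k \<in> {..<r}" for k using grad_basis_Pol[OF B] that by auto
  have S: "(\<lambda>z. \<Sum>k<r. cnj (l2_inner (e k) v) * lap (e k) z) \<in> L2"
    using e by (intro L2_sum L2_scale) auto
  then show "(\<lambda>z. v z + (\<Sum>k<r. cnj (l2_inner (e k) v) * lap (e k) z)) \<in> L2" using v by auto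
  assume w: "w \<in> L2"
  have "l2_inner w (\<lambda>z. v z + (\<Sum>k<r. cnj (l2_inner (e k) v) * lap (e k) z))
     = l2_inner w v + (\<Sum>k<r. l2_inner (e k) v * l2_inner w (lap (e k)))"
    using l2_inner_lin_right[of "{..<r}" "\<lambda>k. lap (e k)" w "\<lambda>k. cnj (l2_inner (e k) v)"] e
    by (simp add: l2_inner_add_right[OF v S w] w)
  also have "(\<Sum>k<r. l2_inner (e k) v * l2_inner w (lap (e k))) = - l2_inner (Pr r e w) v"
    unfolding Pr_def using e v by (subst l2_inner_lin_left) (auto simp: sum_negf mult.commute)
  finally show "l2_inner w (\<lambda>z. v z + (\<Sum>k<r. cnj (l2_inner (e k) v) * lap (e k) z)) = l2_inner (\<lambda>z. w z - Pr r e w z) v"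
    using Pr_Pol[OF B] v w by (simp add: l2_inner_diff_left)
qed

lemma semidiscrete_error:
  assumes m: "m \<ge> 1" and T: "t0 < T" and \<gamma>: "\<gamma> \<ge> 0" and \<psi>: "pot_bound \<psi> \<Psi>"
    and sol: "homogenized_solution m t0 T \<gamma> \<psi> f \<phi> u u'"
    and u: "u \<in> Linf {t0<..<T} (Hm m \<inter> H10) (Hm_norm m)"
    and u': "u' \<in> Linf {t0<..<T} (Hm m \<inter> H10) (Hm_norm m)"
    and N: "N \<ge> 2" and semi: "semidiscrete_solution N t0 T \<gamma> \<psi> f \<phi> uN"
    and t: "t \<in> {t0<..<T}"
  defines "U \<equiv> Linf_norm {t0<..<T} (Hm_norm m) u" and "U' \<equiv> Linf_norm {t0<..<T} (Hm_norm m) u'"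
    and "A \<equiv> (2 ^ (m + 3) + 8 * (2 * real m) ^ (m - 1)) * (1 / real N) ^ m"
  shows "l2_norm (\<lambda>z. uN t z - u t z) \<le> 2 * (A * U) + (A * U' + \<Psi> * (A * U)) * (T - t0)"
proof -
  let ?I = "{t0<..<T}"
  have N0: "N > 0" "N \<ge> 1" using N by auto
  have A0: "A \<ge> 0" by (simp add: A_def)
  have U0: "U \<ge> 0" "U' \<ge> 0"
    unfolding U_def U'_def using u u' T by (auto intro!: Linf_norm_nonneg Hm_norm_nonneg)
  obtain r :: nat and e where B: "grad_basis N r e"
    using gradient_orthonormal_basis[OF N0(1)] unfolding grad_basis_def by blast
  have uc: "continuous_L2 {t0..T} u" and td: "has_time_deriv ?I u u'"
    and u0: "AE z in MS. u t0 z = \<phi> z"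
    using sol by (auto simp: homogenized_solution_def)
  have uL: "u \<tau> \<in> L2" if "\<tau> \<in> {t0..T}" for \<tau> using uc that by (auto simp: continuous_L2_def)
  have V: "\<And>t. t \<in> {t0..T} \<Longrightarrow> uN t \<in> VN2 N" and cont: "\<And>z. continuous_on {t0..T} (\<lambda>t. uN t z)"
    and diff: "\<And>t z. t \<in> ?I \<Longrightarrow> (\<lambda>s. uN s z) differentiable (at t)"
    and weakN: "\<And>t v. t \<in> ?I \<Longrightarrow> v \<in> VN2 N \<Longrightarrow> weak_eq \<gamma> \<psi> (f t) (uN t) (d_t uN t) v"
    and init: "\<And>v. v \<in> VN2 N \<Longrightarrow> l2_inner (\<lambda>z. uN t0 z - \<phi> z) v = 0"
    using semi by (auto simp: semidiscrete_solution_def)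
  have path: "continuous_L2 {t0..T} uN"
    "\<And>t v. t \<in> ?I \<Longrightarrow> v \<in> L2 \<Longrightarrow> ((\<lambda>\<tau>. l2_inner (uN \<tau>) v) has_vector_derivative l2_inner (d_t uN t) v) (at t)"
    by (rule VN2_path[of t0 T uN N]; use V N0(1) cont diff in simp)+
  have X: "AE \<tau> in lebesgue_on ?I. u \<tau> \<in> Hm m \<inter> H10" "AE \<tau> in lebesgue_on ?I. u' \<tau> \<in> Hm m \<inter> H10"
    using u u' by (auto simp: Linf_def)
  have bdU: "AE \<tau> in lebesgue_on ?I. Hm_norm m (u \<tau>) \<le> U" "AE \<tau> in lebesgue_on ?I. Hm_norm m (u' \<tau>) \<le> U'"
    unfolding U_def U'_def by (rule Linf_bound[OF u] Linf_bound[OF u'])+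
  have AEI: "AE \<tau> in lebesgue_on ?I. \<tau> \<in> ?I" by (rule AE_I2) simp
  have proj: "l2_norm (\<lambda>z. w z - Pr r e w z) \<le> A * Hm_norm m w" if "w \<in> Hm m \<inter> H10" for w
    unfolding A_def using elliptic_projection_error[of w m N r e] that m N0(2) B by simp
  have ex: "AE \<tau> in lebesgue_on ?I. \<forall>v\<in>VN2 N. - \<i> * l2_inner (u' \<tau>) v - of_real \<gamma> * l2_inner (u \<tau>) (lap v)
      - l2_inner (\<lambda>z. of_real (\<psi> z) * u \<tau> z) v - l2_inner (f \<tau>) v = 0"
  proof -
    have "AE \<tau> in lebesgue_on ?I. if m = 1 then \<forall>v\<in>H10. weak_eq \<gamma> \<psi> (f \<tau>) (u \<tau>) (u' \<tau>) v else strong_eq \<gamma> \<psi> (f \<tau>) (u \<tau>) (u' \<tau>)"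
      using sol by (auto simp: homogenized_solution_def split: if_splits)
    then show ?thesis using X
    proof eventually_elim
      case (elim \<tau>)
      then show ?case using exact_weak_form[OF m \<psi> _ _ _ elim(1)] by (auto simp: Hm_def)
    qed
  qed
  have meas: "(\<lambda>\<tau>. l2_inner (u' \<tau>) v) \<in> borel_measurable (lebesgue_on ?I)" if "v \<in> L2" for v
    by (rule Linf_inner_measurable[OF u' _ that]) simp
  have bd: "AE \<tau> in lebesgue_on ?I. cmod (l2_inner (u' \<tau>) v) \<le> U' * l2_norm v" if v: "v \<in> L2" for v
    using bdU(2) X(2)
  proof eventually_elim
    case (elim \<tau>)
    have L: "u' \<tau> \<in> L2" using elim by (simp add: Hm_def)
    have "cmod (l2_inner (u' \<tau>) v) \<le> l2_norm (u' \<tau>) * l2_norm v" by (rule l2_cauchy_schwarz[OF L v])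
    also have "\<dots> \<le> U' * l2_norm v"
      using l2_norm_le_Hm_norm[OF L, of m] elim by (intro mult_right_mono) auto
    finally show ?case .
  qed
  have ftc: "((\<lambda>\<tau>. l2_inner (u' \<tau>) v) has_integral (l2_inner (u t) v - l2_inner (u s) v)) {s..t}"
    if v: "v \<in> L2" and st: "t0 < s" "s < t" "t < T" for v s t
    by (rule weak_fundamental_theorem[OF continuous_L2_inner[OF uc v] st meas[OF v] bd[OF v]])
       (use td v in \<open>auto simp: has_time_deriv_def\<close>)
  have L2': "(\<lambda>z. u \<tau> z - Pr r e (u \<tau>) z) \<in> L2" if "\<tau> \<in> {t0..T}" for \<tau>
    using uL[OF that] Pr_Pol[OF B] by auto
  \<comment> \<open>The projection estimate holds for almost every time. Continuity of the error in
    norm extends it to every time, the initial one included.\<close>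
  have K2: "l2_norm (\<lambda>z. u \<tau> z - Pr r e (u \<tau>) z) \<le> A * U" if \<tau>: "\<tau> \<in> {t0..T}" for \<tau>
  proof (rule AE_interval_le[OF T _ _ \<tau>])
    have "continuous_L2 {t0..T} (\<lambda>\<tau>. Pr r e (u \<tau>))"
      unfolding Pr_def using grad_basis_Pol[OF B] by (intro continuous_L2_lin continuous_intros continuous_L2_inner uc) auto
    then show "continuous_on {t0..T} (\<lambda>\<tau>. l2_norm (\<lambda>z. u \<tau> z - Pr r e (u \<tau>) z))"
      by (intro continuous_L2_norm continuous_L2_diff uc)
    show "AE \<tau> in lebesgue_on ?I. l2_norm (\<lambda>z. u \<tau> z - Pr r e (u \<tau>) z) \<le> A * U"
      using X(1) bdU(1)
    proof eventually_elim
      case (elim \<tau>)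
      then show ?case using proj[OF elim(1)] mult_left_mono[OF elim(2) A0] by linarith
    qed
  qed
  have K1: "cmod (l2_inner (\<lambda>z. u t z - Pr r e (u t) z) v - l2_inner (\<lambda>z. u s z - Pr r e (u s) z) v) \<le> A * U' * (t - s) * l2_norm v"
    if v: "v \<in> VN2 N" and st: "t0 < s" "s < t" "t < T" for v s t
  proof -
    have vL: "v \<in> L2" using VN2_Pol[OF v] by simp
    \<comment> \<open>Testing with this function turns the increment of the projection error of
      \<open>u\<close> into the integral of the projection error of the time derivative against
      \<open>v\<close>.\<close>
    define v' where "v' = (\<lambda>z. v z + (\<Sum>k<r. cnj (l2_inner (e k) v) * lap (e k) z))"
    have v'L: "v' \<in> L2" unfolding v'_def by (rule Pr_adjoint(1)[OF B vL])
    have v': "l2_inner w v' = l2_inner (\<lambda>z. w z - Pr r e w z) v" if "w \<in> L2" for w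
      unfolding v'_def by (rule Pr_adjoint(2)[OF B vL that])
    have "AE \<tau> in lebesgue_on ?I. cmod (l2_inner (u' \<tau>) v') \<le> A * U' * l2_norm v"
      using X(2) bdU(2)
    proof eventually_elim
      case (elim \<tau>)
      have L: "u' \<tau> \<in> L2" using elim by (simp add: Hm_def)
      have "cmod (l2_inner (u' \<tau>) v') \<le> l2_norm (\<lambda>z. u' \<tau> z - Pr r e (u' \<tau>) z) * l2_norm v"
        unfolding v'[OF L] using L Pr_Pol[OF B] vL by (intro l2_cauchy_schwarz) auto
      also have "\<dots> \<le> A * U' * l2_norm v"
        using proj[OF elim(1)] mult_left_mono[OF elim(2) A0] by (intro mult_right_mono) auto
      finally show ?case .
    qed
    moreover have "{s..t} \<subseteq> ?I" using st by auto
    ultimately have "cmod (l2_inner (u t) v' - l2_inner (u s) v') \<le> A * U' * l2_norm v * (t - s)"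
      using st A0 U0 by (intro has_integral_bound_AE[OF ftc[OF v'L st]]) auto
    then show ?thesis using st by (simp add: v' uL mult_ac)
  qed
  have eq: "((\<lambda>\<tau>. \<i> * (of_real \<gamma> * l2_inner (\<lambda>z. uN \<tau> z - u \<tau> z) (lap v) + l2_inner (\<lambda>z. of_real (\<psi> z) * (uN \<tau> z - u \<tau> z)) v))
         has_integral (l2_inner (\<lambda>z. uN t z - u t z) v - l2_inner (\<lambda>z. uN s z - u s z) v)) {s..t}"
    if v: "v \<in> VN2 N" and st: "t0 < s" "s < t" "t < T" for v s t
  proof -
    have vL: "v \<in> L2" "lap v \<in> L2" using VN2_Pol[OF v] by auto
    have 1: "((\<lambda>\<tau>. l2_inner (d_t uN \<tau>) v) has_integral (l2_inner (uN t) v - l2_inner (uN s) v)) {s..t}"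
    proof (rule fundamental_theorem_of_calculus)
      show "((\<lambda>\<tau>. l2_inner (uN \<tau>) v) has_vector_derivative l2_inner (d_t uN \<tau>) v) (at \<tau> within {s..t})" if "\<tau> \<in> {s..t}" for \<tau>
        by (rule has_vector_derivative_at_within[OF path(2)[OF _ vL(1)]]) (use that st in auto)
    qed (use st in simp)
    have 2: "((\<lambda>\<tau>. l2_inner (d_t uN \<tau>) v - l2_inner (u' \<tau>) v) has_integral
        ((l2_inner (uN t) v - l2_inner (uN s) v) - (l2_inner (u t) v - l2_inner (u s) v))) {s..t}"
      by (rule has_integral_diff[OF 1 ftc[OF vL(1) st]])
    define G where "G \<tau> = \<i> * (of_real \<gamma> * l2_inner (\<lambda>z. uN \<tau> z - u \<tau> z) (lap v) + l2_inner (\<lambda>z. of_real (\<psi> z) * (uN \<tau> z - u \<tau> z)) v)" for \<tau>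
    \<comment> \<open>Subtracting the two weak equations cancels the source term. The exact equation
      holds only almost everywhere in time, which the integral does not notice.\<close>
    have G: "AE \<tau> in lebesgue_on ?I. l2_inner (d_t uN \<tau>) v - l2_inner (u' \<tau>) v = G \<tau>"
      using ex AEI
    proof eventually_elim
      case (elim \<tau>)
      then have \<tau>: "\<tau> \<in> {t0..T}" by auto
      have L: "uN \<tau> \<in> L2" "u \<tau> \<in> L2" using VN2_Pol[OF V[OF \<tau>]] uL[OF \<tau>] by auto
      have a: "- \<i> * l2_inner (d_t uN \<tau>) v - of_real \<gamma> * l2_inner (uN \<tau>) (lap v) - l2_inner (\<lambda>z. of_real (\<psi> z) * uN \<tau> z) v - l2_inner (f \<tau>) v = 0"
        using weakN[OF elim(2) v] unfolding weak_eq_def grad_inner_lap[OF VN2_H10[OF V[OF \<tau>]] v] by simp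
      have b: "- \<i> * l2_inner (u' \<tau>) v - of_real \<gamma> * l2_inner (u \<tau>) (lap v) - l2_inner (\<lambda>z. of_real (\<psi> z) * u \<tau> z) v - l2_inner (f \<tau>) v = 0"
        using elim(1) v by blast
      have c: "l2_inner (\<lambda>z. uN \<tau> z - u \<tau> z) (lap v) = l2_inner (uN \<tau>) (lap v) - l2_inner (u \<tau>) (lap v)"
        by (rule l2_inner_diff_left[OF L vL(2)])
      have d: "l2_inner (\<lambda>z. of_real (\<psi> z) * (uN \<tau> z - u \<tau> z)) v
          = l2_inner (\<lambda>z. of_real (\<psi> z) * uN \<tau> z) v - l2_inner (\<lambda>z. of_real (\<psi> z) * u \<tau> z) v"
        unfolding right_diff_distrib by (rule l2_inner_diff_left[OF pot_L2(1)[OF \<psi> L(1)] pot_L2(1)[OF \<psi> L(2)] vL(1)])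
      have "\<i> * (- \<i> * (l2_inner (d_t uN \<tau>) v - l2_inner (u' \<tau>) v)) = G \<tau>"
        unfolding G_def c d using a b by (intro arg_cong[where f = "(*) \<i>"]) (simp add: algebra_simps)
      then show ?case by simp
    qed
    have "negligible {\<tau>\<in>?I. \<not> l2_inner (d_t uN \<tau>) v - l2_inner (u' \<tau>) v = G \<tau>}"
    proof -
      have "AE \<tau> in lebesgue. \<tau> \<notin> {\<tau>\<in>?I. \<not> l2_inner (d_t uN \<tau>) v - l2_inner (u' \<tau>) v = G \<tau>}"
        using G by (auto simp: AE_restrict_space_iff elim!: eventually_mono)
      then show ?thesis by (subst negligible_iff_null_sets, subst completion.null_sets_iff_AE) auto
    qed
    then have "(G has_integral ((l2_inner (uN t) v - l2_inner (uN s) v) - (l2_inner (u t) v - l2_inner (u s) v))) {s..t}"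
      by (rule has_integral_spike[OF _ _ 2]) (use st in auto)
    moreover have sp: "l2_inner (\<lambda>z. uN \<tau> z - u \<tau> z) v = l2_inner (uN \<tau>) v - l2_inner (u \<tau>) v" if "\<tau> \<in> {t0..T}" for \<tau>
      using VN2_Pol[OF V[OF that]] uL[OF that] vL by (intro l2_inner_diff_left) auto
    moreover have "(l2_inner (uN t) v - l2_inner (uN s) v) - (l2_inner (u t) v - l2_inner (u s) v)
        = l2_inner (\<lambda>z. uN t z - u t z) v - l2_inner (\<lambda>z. uN s z - u s z) v"
      using st by (simp add: sp)
    ultimately show ?thesis unfolding G_def by (simp only:)
  qed
  have init': "l2_inner (uN t0) v = l2_inner (u t0) v" if v: "v \<in> VN2 N" for v
  proof -
    have I0: "t0 \<in> {t0..T}" using T by simp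
    have L: "uN t0 \<in> L2" "u t0 \<in> L2" "v \<in> L2" using VN2_Pol[OF V[OF I0]] uL[OF I0] VN2_Pol[OF v] by auto
    have "l2_inner (\<lambda>z. uN t0 z - \<phi> z) v = l2_inner (\<lambda>z. uN t0 z - u t0 z) v"
      using u0 L by (intro l2_inner_cong_AE) (auto elim!: eventually_mono)
    then show ?thesis using init[OF v] L by (simp add: l2_inner_diff_left)
  qed
  show ?thesis
    by (rule energy_estimate[OF B \<psi> \<gamma> T V path(1) uc eq _ K1 K2 init' t])
       (use A0 U0 in auto)
qed

theorem theorem4p1:
  fixes m :: nat and t0 T c d \<gamma> :: real and \<psi> :: "real \<times> real \<Rightarrow> real"
  assumes "m \<ge> 1" and "t0 < T" and "c < d" and "\<gamma> = (2 / (d - c))\<^sup>2"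
    and "\<psi> \<in> Linf_Sq"
  shows "\<exists>C::real. \<forall>(g1::sfun) (g2::sfun) (g3::sfun) (g4::sfun) (\<phi>::sfun)
           (u1::real \<Rightarrow> sfun) (u2::real \<Rightarrow> sfun) (f::real \<Rightarrow> sfun) (\<phi>hat::sfun)
           (u::real \<Rightarrow> sfun) (u'::real \<Rightarrow> sfun) (N::nat) (uN::real \<Rightarrow> sfun).
     smooth_on ({-1..1} \<times> {t0..T}) g1 \<longrightarrow>
     smooth_on ({-1..1} \<times> {t0..T}) g2 \<longrightarrow>
     smooth_on ({-1..1} \<times> {t0..T}) g3 \<longrightarrow>
     smooth_on ({-1..1} \<times> {t0..T}) g4 \<longrightarrow>
     smooth_on cSq \<phi> \<longrightarrow>
     u1 = lift1 g3 g4 \<longrightarrow>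
     u2 = lift2 g1 g2 g3 g4 \<longrightarrow>
     f = source \<gamma> \<psi> u1 u2 \<longrightarrow>
     \<phi>hat = initial_datum \<phi> t0 u1 u2 \<longrightarrow>
     homogenized_solution m t0 T \<gamma> \<psi> f \<phi>hat u u' \<longrightarrow>
     u \<in> Linf {t0<..<T} (Hm m \<inter> H10) (Hm_norm m) \<longrightarrow>
     u' \<in> Linf {t0<..<T} (Hm m \<inter> H10) (Hm_norm m) \<longrightarrow>
     N \<ge> 2 \<longrightarrow>
     semidiscrete_solution N t0 T \<gamma> \<psi> f \<phi>hat uN \<longrightarrow>
     (\<forall>t\<in>{t0<..<T}. l2_norm (\<lambda>z. uN t z - u t z)
        \<le> C * real N powi (- int m)
            * (Linf_norm {t0<..<T} (Hm_norm m) u + Linf_norm {t0<..<T} (Hm_norm m) u'))"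
proof -
  obtain \<Psi> where \<psi>: "pot_bound \<psi> \<Psi>" using Linf_Sq_pot_bound[OF assms(5)] by blast
  have \<Psi>: "\<Psi> \<ge> 0" using \<psi> by (simp add: pot_bound_def)
  have \<gamma>: "\<gamma> \<ge> 0" using assms(4) by simp
  define D where "D = 2 ^ (m + 3) + 8 * (2 * real m) ^ (m - 1)"
  have D: "D \<ge> 0" by (simp add: D_def)
  \<comment> \<open>The constant depends on \<open>m\<close> through \<open>D\<close>, on a bound of
    the potential and on the length of the time interval; it contains neither \<gamma> nor the
    data.\<close>
  define C where "C = D * (2 + (1 + \<Psi>) * (T - t0))"
  have "l2_norm (\<lambda>z. uN t z - u t z) \<le> C * real N powi (- int m)
      * (Linf_norm {t0<..<T} (Hm_norm m) u + Linf_norm {t0<..<T} (Hm_norm m) u')"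
    if sol: "homogenized_solution m t0 T \<gamma> \<psi> f \<phi>hat u u'"
      and u: "u \<in> Linf {t0<..<T} (Hm m \<inter> H10) (Hm_norm m)" "u' \<in> Linf {t0<..<T} (Hm m \<inter> H10) (Hm_norm m)"
      and N: "N \<ge> 2" and semi: "semidiscrete_solution N t0 T \<gamma> \<psi> f \<phi>hat uN" and t: "t \<in> {t0<..<T}"
    for f u u' uN :: "real \<Rightarrow> sfun" and \<phi>hat N t
  proof -
    define U where "U = Linf_norm {t0<..<T} (Hm_norm m) u"
    define U' where "U' = Linf_norm {t0<..<T} (Hm_norm m) u'"
    define q where "q = (1 / real N) ^ m"
    have U: "U \<ge> 0" "U' \<ge> 0"
      unfolding U_def U'_def using u assms(2) by (auto intro!: Linf_norm_nonneg Hm_norm_nonneg)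
    have q: "q \<ge> 0" "real N powi (- int m) = q"
      by (simp_all add: q_def power_int_minus power_one_over inverse_eq_divide)
    have "l2_norm (\<lambda>z. uN t z - u t z) \<le> 2 * (D * q * U) + (D * q * U' + \<Psi> * (D * q * U)) * (T - t0)"
      using semidiscrete_error[OF assms(1,2) \<gamma> \<psi> sol u N semi t] by (simp add: U_def U'_def q_def D_def)
    also have "\<dots> = D * q * (2 * U + (U' + \<Psi> * U) * (T - t0))" by (simp add: algebra_simps)
    also have "\<dots> \<le> D * q * ((2 + (1 + \<Psi>) * (T - t0)) * (U + U'))"
    proof (rule mult_left_mono)
      have "(2 + (1 + \<Psi>) * (T - t0)) * (U + U') - (2 * U + (U' + \<Psi> * U) * (T - t0))
          = 2 * U' + (U + \<Psi> * U') * (T - t0)" by (simp add: algebra_simps)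
      also have "\<dots> \<ge> 0" using U \<Psi> assms(2) by simp
      finally show "2 * U + (U' + \<Psi> * U) * (T - t0) \<le> (2 + (1 + \<Psi>) * (T - t0)) * (U + U')" by simp
    qed (use D q in simp)
    finally show ?thesis unfolding q(2) U_def[symmetric] U'_def[symmetric] C_def by (simp add: mult_ac)
  qed
  then show ?thesis by (intro exI[of _ C]) blast
qed

end
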